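(* Let $(C,\delta,\Delta)$ be a cocommutative (augmented and coaugmented) differential graded coalgebra over $\mathbb{Q}$ with augmentation $\varepsilon\colon C\to\mathbb{Q}$, let $\overline{C}=\ker\varepsilon$ with reduced comultiplication $\overline{\Delta}$, and let $\overline{H}\cong H(\overline{C},\delta)$. Choose a decomposition $\overline{C}=A\oplus\delta A\oplus\overline{H}$, where $\delta=0$ on $\overline{H}$ and $\delta\colon A\to\delta A$ is an isomorphism, and endow $\overline{H}$ with the $A_\infty$-coalgebra structure $\{\overline{\Delta}'_k\}_{k\ge 1}$ transferred from $\overline{C}$ along the homotopy retract induced by this decomposition (higher Massey coproducts). Then this transferred $A_\infty$-coalgebra structure on $\overline{H}$ is cocommutative, and $\mathcal{L}(\overline{H})$ is the Quillen minimal model of $\mathcal{L}(\overline{C})$.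
   Context: All objects are graded vector spaces over $\mathbb{Q}$. **$A_\infty$-coalgebras.** An $A_\infty$-coalgebra $C$ is a graded vector space with a differential graded algebra structure on the tensor algebra $T^+(s^{-1}C)$ on the desuspension of $C$; equivalently, a family of linear maps $\Delta_k\colon C\to C^{\otimes k}$ of degree $k-2$, $k\ge 1$, satisfying for each $i$ $$\sum_{k=1}^i\sum_{n=0}^{i-k}(-1)^{k+n+kn}(\mathrm{id}^{\otimes i-k-n}\otimes\Delta_k\otimes\mathrm{id}^{\otimes n})\Delta_{i-k+1}=0.$$ A differential graded coalgebra $(C,\delta,\Delta)$ is an $A_\infty$-coalgebra with $\Delta_1=\delta$, $\Delta_2=\Delta$, $\Delta_k=0$ for $k>2$. An $A_\infty$-coalgebra is cocommutative if $\tau\circ\Delta_k=0$ for every $k\ge1$, where $\tau\colon T(C)\to T(C)\otimes T(C)$ is the (reduced) unshuffle coproduct $$\tau(a_1\otimes\cdots\otimes a_n)=\sum_{i=1}^{n-1}\sum_{\sigma\in S(i,n-i)}\pm\,\epsilon_\sigma(a_{\sigma(1)}\otimes\cdots\otimes a_{\sigma(i)})\otimes(a_{\sigma(i+1)}\otimes\cdots\otimes a_{\sigma(n)}),$$ where $\epsilon_\sigma$ is the signature of $\sigma$, $\pm$ is the Koszul sign, and $S(i,n-i)$ is the set of $(i,n-i)$-shuffles. **Transferred structure.** The decomposition $\overline{C}=A\oplus\delta A\oplus\overline{H}$ gives maps $i\colon\overline{H}\to\overline{C}$ (the inclusion), $p\colon\overline{C}\to\overline{H}$ (the projection, zero on $A\oplus\delta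 A$) and $k\colon\overline{C}\to\overline{C}$ of degree $+1$ with $k|_{A}=0$, $k|_{\overline{H}}=0$, $k(\delta a)=a$ for $a\in A$. They satisfy $\mathrm{id}-ip=\delta k+k\delta$, and $i$ is a quasi-isomorphism, so that $(\overline{C},\overline{H},i,p,k)$ is a homotopy retract. The transferred structure is $$\overline{\Delta}'_1=0,\qquad \overline{\Delta}'_j=\sum_{T\in PT_j}\Delta_T\quad (j\ge2),$$ where $PT_j$ is the set of isomorphism classes of planar rooted trees with exactly $j$ leaves all of whose internal vertices have at least two inputs. For $T\in PT_j$, $\Delta_T\colon\overline{H}\to\overline{H}^{\otimes j}$ is the map obtained by labelling the root edge by $i$, each internal edge by $k$, each leaf by $p$, and each internal vertex with $r$ inputs by the $r$-ary comultiplication of $\overline{C}$ (which is $\overline{\Delta}$ if $r=2$ and $0$ if $r>2$), and composing from the root up to the leaves, with the standard signs of the homotopy transfer theorem for $A_\infty$-coalgebras. The operations $\overline{\Delta}'_j$ are called higher Massey coproducts. **The functor $\mathcal{L}$.** The generalized Quillen functor $\mathcal{L}$ assigns to a cocommutative $A_\infty$-coalgebra $(C,\{\Delta_k\})$ the differential graded Lie algebra $(\mathbb{L}(s^{-1}C),\partial)$, where $\mathbb{L}(s^{-1}C)$ is the free graded Lie algebra on $s^{-1}C$ and $\partial=\sum_{k\ge1}\partial_k$ with $\partial_k\colon s^{-1}C\to\mathbb{L}^k(s^{-1}C)$ (brackets of length $k$) determined by $\Delta_k$; that is, $\partial$ is the restriction to $\mathbb{L}(s^{-1}C)\subset T(s^{-1}C)$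 of the derivation corresponding to $\{\Delta_k\}$. On cocommutative differential graded coalgebras it coincides with the classical Quillen functor (with differential $\partial_1+\partial_2$). **Quillen minimal model.** A Quillen minimal model of a differential graded Lie algebra $M$ is a free differential graded Lie algebra $(\mathbb{L}(W),\partial)$ with decomposable differential ($\partial W\subset\mathbb{L}^{\ge2}(W)$) together with a quasi-isomorphism of differential graded Lie algebras $(\mathbb{L}(W),\partial)\to M$.
   Formalization: As stated it can fail (dual of cochains of the string Lie 2-algebra of sl₂: H̄=0 but L(C̄) is not acyclic); proved for all C with the free Lie algebra completed by bracket length, and with the ordinary free Lie algebra only when C̄ is in degrees ≥2 or ≤0. *)

theory Defs
  imports Complex_Main "HOL-Library.Function_Algebras" "HOL-Combinatorics.Permutations"
begin

section \<open>Rational vector spaces\<close>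

class rat_vector = ab_group_add +
  fixes qscale :: "rat \<Rightarrow> 'a \<Rightarrow> 'a"  (infixr "*\<^sub>Q" 75)
  assumes qscale_right_distrib: "a *\<^sub>Q (x + y) = a *\<^sub>Q x + a *\<^sub>Q y"
    and qscale_left_distrib: "(a + b) *\<^sub>Q x = a *\<^sub>Q x + b *\<^sub>Q x"
    and qscale_assoc: "a *\<^sub>Q (b *\<^sub>Q x) = (a * b) *\<^sub>Q x"
    and qscale_one: "1 *\<^sub>Q x = x"

instantiation rat :: rat_vector
begin
definition qscale_rat :: "rat \<Rightarrow> rat \<Rightarrow> rat" where "qscale_rat a x = a * x"
instance by standard (simp_all add: qscale_rat_def algebra_simps)
end

instantiation "fun" :: (type, rat_vector) rat_vector
begin
definition qscale_fun :: "rat \<Rightarrow> ('a \<Rightarrow> 'b) \<Rightarrow> 'a \<Rightarrow> 'b"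
  where "qscale_fun a f = (\<lambda>x. a *\<^sub>Q f x)"
instance
  by standard (simp_all add: qscale_fun_def fun_eq_iff qscale_right_distrib
      qscale_left_distrib qscale_assoc qscale_one)
end

abbreviation qlinear :: "('a::rat_vector \<Rightarrow> 'b::rat_vector) \<Rightarrow> bool" where
  "qlinear \<equiv> Vector_Spaces.linear (*\<^sub>Q) (*\<^sub>Q)"

abbreviation qsubspace :: "'a::rat_vector set \<Rightarrow> bool" where
  "qsubspace \<equiv> module.subspace (*\<^sub>Q)"

abbreviation qspan :: "'a::rat_vector set \<Rightarrow> 'a set" where
  "qspan \<equiv> module.span (*\<^sub>Q)"


section \<open>Gradings and Koszul signs\<close>

text \<open>A grading of the ambient space is a family of subspaces whose direct sum is everything.\<close>

definition hdecomp :: "(int \<Rightarrow> 'c::rat_vector set) \<Rightarrow> 'c \<Rightarrow> (int \<Rightarrow> 'c) \<Rightarrow> bool" where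
  "hdecomp C x f \<longleftrightarrow>
     finite {n. f n \<noteq> 0} \<and> (\<forall>n. f n \<in> C n) \<and> (\<Sum>n | f n \<noteq> 0. f n) = x"

definition is_grading :: "(int \<Rightarrow> 'c::rat_vector set) \<Rightarrow> bool" where
  "is_grading C \<longleftrightarrow> (\<forall>n. qsubspace (C n)) \<and> (\<forall>x. \<exists>!f. hdecomp C x f)"

definition hpart :: "(int \<Rightarrow> 'c::rat_vector set) \<Rightarrow> 'c \<Rightarrow> int \<Rightarrow> 'c" where
  "hpart C x = (THE f. hdecomp C x f)"

definition graded_subspace :: "(int \<Rightarrow> 'c::rat_vector set) \<Rightarrow> 'c set \<Rightarrow> bool" where
  "graded_subspace C V \<longleftrightarrow> qsubspace V \<and> (\<forall>x\<in>V. \<forall>n. hpart C x n \<in> V)"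

definition desusp :: "(int \<Rightarrow> 'c set) \<Rightarrow> int \<Rightarrow> 'c set" where
  "desusp C n = C (n + 1)"

definition ksgn :: "int \<Rightarrow> rat" where
  "ksgn m = (if even m then 1 else -1)"

text \<open>The linear map \<open>x \<mapsto> (-1)\<^bsup>m |x|\<^esup> x\<close>.\<close>

definition gsign :: "(int \<Rightarrow> 'c::rat_vector set) \<Rightarrow> int \<Rightarrow> 'c \<Rightarrow> 'c" where
  "gsign C m x = (\<Sum>n | hpart C x n \<noteq> 0. ksgn (m * n) *\<^sub>Q hpart C x n)"

definition parity_part :: "(int \<Rightarrow> 'c::rat_vector set) \<Rightarrow> int \<Rightarrow> 'c \<Rightarrow> 'c" where
  "parity_part C e x = (\<Sum>n | hpart C x n \<noteq> 0 \<and> n mod 2 = e. hpart C x n)"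


section \<open>Tensors\<close>

text \<open>
  A tensor is represented by its values on lists of linear functionals: \<open>a\<^sub>1 \<otimes> \<dots> \<otimes> a\<^sub>k\<close> is the
  function sending \<open>[\<phi>\<^sub>1, \<dots>, \<phi>\<^sub>k]\<close> to \<open>\<phi>\<^sub>1(a\<^sub>1) \<cdots> \<phi>\<^sub>k(a\<^sub>k)\<close>, and every other list to 0.
  Over a field the span of these functions is (canonically isomorphic to) the \<open>k\<close>-th tensor
  power, and for a subspace \<open>V\<close> the tensors with entries in \<open>V\<close> span the \<open>k\<close>-th tensor power of \<open>V\<close>.
  The values of \<open>t\<close> on lists of length \<open>k\<close> form its component of tensor length \<open>k\<close>; elements of
  the tensor algebra vanish on all lists that are long enough, elements of the completed tensor
  algebra (product over all lengths) need not.
\<close>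

type_synonym 'c tensor = "('c \<Rightarrow> rat) list \<Rightarrow> rat"

definition all_linear :: "('c::rat_vector \<Rightarrow> rat) list \<Rightarrow> bool" where
  "all_linear \<phi>s \<longleftrightarrow> (\<forall>\<phi>\<in>set \<phi>s. qlinear \<phi>)"

definition pure :: "'c::rat_vector list \<Rightarrow> 'c tensor" where
  "pure xs = (\<lambda>\<phi>s. if all_linear \<phi>s \<and> length \<phi>s = length xs
                   then \<Prod>i<length xs. (\<phi>s ! i) (xs ! i) else 0)"

definition len_part :: "nat \<Rightarrow> 'c tensor \<Rightarrow> 'c tensor" where
  "len_part k t = (\<lambda>\<phi>s. if length \<phi>s = k then t \<phi>s else 0)"

text \<open>The elements of degree \<open>m\<close> of the \<open>k\<close>-th tensor power of a graded subspace \<open>V\<close>.\<close>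

definition tensor_power ::
    "(int \<Rightarrow> 'c::rat_vector set) \<Rightarrow> 'c set \<Rightarrow> nat \<Rightarrow> int \<Rightarrow> 'c tensor set" where
  "tensor_power C V k m =
     qspan {pure xs | xs ds. length xs = k \<and> length ds = k \<and> sum_list ds = m \<and>
                             (\<forall>i<k. xs ! i \<in> V \<inter> C (ds ! i))}"

definition tmult :: "'c tensor \<Rightarrow> 'c tensor \<Rightarrow> 'c tensor" where
  "tmult s t = (\<lambda>\<phi>s. \<Sum>i\<le>length \<phi>s. s (take i \<phi>s) * t (drop i \<phi>s))"

text \<open>
  \<open>tensor_map C [(d\<^sub>1,k\<^sub>1,f\<^sub>1), \<dots>, (d\<^sub>r,k\<^sub>r,f\<^sub>r)]\<close> is \<open>f\<^sub>1 \<otimes> \<dots> \<otimes> f\<^sub>r\<close>, where \<open>f\<^sub>i\<close> is linear of degree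
  \<open>d\<^sub>i\<close> with values in the \<open>k\<^sub>i\<close>-th tensor power. On homogeneous elements it is
  \<open>x\<^sub>1 \<otimes> \<dots> \<otimes> x\<^sub>r \<mapsto> \<plusminus> f\<^sub>1 x\<^sub>1 \<otimes> \<dots> \<otimes> f\<^sub>r x\<^sub>r\<close> with the Koszul sign, whose exponent is the sum of
  \<open>d\<^sub>j |x\<^sub>i|\<close> over \<open>i < j\<close>.
\<close>

fun pullback :: "(int \<Rightarrow> 'c::rat_vector set) \<Rightarrow> (int \<times> nat \<times> ('c \<Rightarrow> 'c tensor)) list \<Rightarrow>
    ('c \<Rightarrow> rat) list \<Rightarrow> ('c \<Rightarrow> rat) list" where
  "pullback C [] \<phi>s = []"
| "pullback C ((d, k, f) # fs) \<phi>s =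
     (\<lambda>v. f (gsign C (sum_list (map fst fs)) v) (take k \<phi>s)) # pullback C fs (drop k \<phi>s)"

definition tensor_map :: "(int \<Rightarrow> 'c::rat_vector set) \<Rightarrow>
    (int \<times> nat \<times> ('c \<Rightarrow> 'c tensor)) list \<Rightarrow> 'c tensor \<Rightarrow> 'c tensor" where
  "tensor_map C fs t =
     (\<lambda>\<phi>s. if all_linear \<phi>s \<and> length \<phi>s = sum_list (map (\<lambda>(d, k, f). k) fs)
           then t (pullback C fs \<phi>s) else 0)"

definition ten1 :: "'c::rat_vector \<Rightarrow> 'c tensor" where
  "ten1 x = pure [x]"

definition id_factor :: "int \<times> nat \<times> ('c::rat_vector \<Rightarrow> 'c tensor)" where
  "id_factor = (0, 1, ten1)"


section \<open>Cocommutative \<open>A\<^sub>\<infinity>\<close>-coalgebras\<close>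

text \<open>
  The operations are indexed from 1; the value of the family at 0 is never used. They are linear
  maps on the whole ambient space, of which only the restrictions to \<open>V\<close> matter.
\<close>

definition ainf_coalgebra ::
    "(int \<Rightarrow> 'c::rat_vector set) \<Rightarrow> 'c set \<Rightarrow> (nat \<Rightarrow> 'c \<Rightarrow> 'c tensor) \<Rightarrow> bool" where
  "ainf_coalgebra C V \<Delta> \<longleftrightarrow>
     is_grading C \<and> graded_subspace C V \<and>
     (\<forall>k\<ge>1. qlinear (\<Delta> k) \<and>
        (\<forall>n. \<forall>x\<in>V \<inter> C n. \<Delta> k x \<in> tensor_power C V k (n + int k - 2))) \<and>
     (\<forall>i\<ge>1. \<forall>x\<in>V.
        (\<Sum>k=1..i. \<Sum>n=0..i-k. ksgn (int (k + n + k * n)) *\<^sub>Q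
           tensor_map C (replicate (i - k - n) id_factor @ [(int k - 2, k, \<Delta> k)] @
                         replicate n id_factor)
             (\<Delta> (i - k + 1) x)) = 0)"

text \<open>
  Positions are numbered from 0. \<open>koszul_sign es \<sigma>\<close> is the Koszul sign of
  \<open>a\<^sub>0 \<otimes> \<dots> \<otimes> a\<^sub>n\<^sub>-\<^sub>1 \<mapsto> a\<^sub>\<sigma>\<^sub>(\<^sub>0\<^sub>) \<otimes> \<dots> \<otimes> a\<^sub>\<sigma>\<^sub>(\<^sub>n\<^sub>-\<^sub>1\<^sub>)\<close> for entries of degrees \<open>es\<close>, and \<open>graded_perm C \<sigma>\<close> is the
  resulting linear map. Since the sign depends only on the parities, the map is written as a sum
  over all parity patterns \<open>es\<close>.
\<close>

definition koszul_sign :: "int list \<Rightarrow> (nat \<Rightarrow> nat) \<Rightarrow> rat" where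
  "koszul_sign es \<sigma> =
     (\<Prod>(i, j) \<in> {(i, j). i < j \<and> j < length es \<and> \<sigma> j < \<sigma> i}. ksgn (es ! \<sigma> i * es ! \<sigma> j))"

definition graded_perm ::
    "(int \<Rightarrow> 'c::rat_vector set) \<Rightarrow> (nat \<Rightarrow> nat) \<Rightarrow> 'c tensor \<Rightarrow> 'c tensor" where
  "graded_perm C \<sigma> t =
     (\<lambda>\<phi>s. if all_linear \<phi>s
           then \<Sum>es | length es = length \<phi>s \<and> set es \<subseteq> {0, 1}.
                  koszul_sign es \<sigma> *
                  t (map (\<lambda>j. \<phi>s ! (inv \<sigma> j) \<circ> parity_part C (es ! j)) [0..<length \<phi>s])
           else 0)"

definition shuffles_perm :: "nat \<Rightarrow> nat \<Rightarrow> (nat \<Rightarrow> nat) set" where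
  "shuffles_perm i n =
     {\<sigma>. \<sigma> permutes {..<n} \<and> strict_mono_on {..<i} \<sigma> \<and> strict_mono_on {i..<n} \<sigma>}"

text \<open>
  The reduced unshuffle coproduct. Elements of \<open>T(C) \<otimes> T(C)\<close> are represented by functions of
  two lists of functionals.
\<close>

definition unshuffle :: "(int \<Rightarrow> 'c::rat_vector set) \<Rightarrow> 'c tensor \<Rightarrow>
    ('c \<Rightarrow> rat) list \<times> ('c \<Rightarrow> rat) list \<Rightarrow> rat" where
  "unshuffle C t =
     (\<lambda>(\<phi>s, \<psi>s). if \<phi>s \<noteq> [] \<and> \<psi>s \<noteq> []
        then \<Sum>\<sigma>\<in>shuffles_perm (length \<phi>s) (length \<phi>s + length \<psi>s).
               of_int (sign \<sigma>) * graded_perm C \<sigma> t (\<phi>s @ \<psi>s)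
        else 0)"

definition cocommutative ::
    "(int \<Rightarrow> 'c::rat_vector set) \<Rightarrow> 'c set \<Rightarrow> (nat \<Rightarrow> 'c \<Rightarrow> 'c tensor) \<Rightarrow> bool" where
  "cocommutative C V \<Delta> \<longleftrightarrow> (\<forall>k\<ge>1. \<forall>x\<in>V. unshuffle C (\<Delta> k x) = 0)"


section \<open>Augmented and coaugmented differential graded coalgebras\<close>

definition dg_ops :: "('c \<Rightarrow> 'c) \<Rightarrow> ('c \<Rightarrow> 'c tensor) \<Rightarrow> nat \<Rightarrow> 'c::rat_vector \<Rightarrow> 'c tensor" where
  "dg_ops \<delta> \<Delta> k = (if k = 1 then (\<lambda>x. ten1 (\<delta> x)) else if k = 2 then \<Delta> else (\<lambda>x. 0))"

definition dg_coalgebra :: "(int \<Rightarrow> 'c::rat_vector set) \<Rightarrow> ('c \<Rightarrow> 'c) \<Rightarrow> ('c \<Rightarrow> 'c tensor) \<Rightarrow> bool" where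
  "dg_coalgebra C \<delta> \<Delta> \<longleftrightarrow> qlinear \<delta> \<and> ainf_coalgebra C UNIV (dg_ops \<delta> \<Delta>)"

text \<open>The counit, a morphism to \<open>\<rat>\<close>.\<close>

definition augmentation :: "(int \<Rightarrow> 'c::rat_vector set) \<Rightarrow> ('c \<Rightarrow> 'c) \<Rightarrow> ('c \<Rightarrow> 'c tensor) \<Rightarrow>
    ('c \<Rightarrow> rat) \<Rightarrow> bool" where
  "augmentation C \<delta> \<Delta> \<epsilon> \<longleftrightarrow>
     qlinear \<epsilon> \<and> (\<forall>n. n \<noteq> 0 \<longrightarrow> (\<forall>x\<in>C n. \<epsilon> x = 0)) \<and> (\<forall>x. \<epsilon> (\<delta> x) = 0) \<and>
     (\<forall>x. tensor_map C [(0, 0, \<lambda>v. \<epsilon> v *\<^sub>Q pure []), id_factor] (\<Delta> x) = ten1 x) \<and>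
     (\<forall>x. tensor_map C [id_factor, (0, 0, \<lambda>v. \<epsilon> v *\<^sub>Q pure [])] (\<Delta> x) = ten1 x)"

text \<open>The coaugmentation \<open>\<rat> \<rightarrow> C\<close>, given by the image \<open>u\<close> of 1.\<close>

definition coaugmentation :: "(int \<Rightarrow> 'c::rat_vector set) \<Rightarrow> ('c \<Rightarrow> 'c) \<Rightarrow> ('c \<Rightarrow> 'c tensor) \<Rightarrow>
    ('c \<Rightarrow> rat) \<Rightarrow> 'c \<Rightarrow> bool" where
  "coaugmentation C \<delta> \<Delta> \<epsilon> u \<longleftrightarrow> u \<in> C 0 \<and> \<epsilon> u = 1 \<and> \<delta> u = 0 \<and> \<Delta> u = pure [u, u]"

definition aug_ideal :: "('c \<Rightarrow> rat) \<Rightarrow> 'c set" where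
  "aug_ideal \<epsilon> = {x. \<epsilon> x = 0}"

definition reduced_comult :: "('c \<Rightarrow> 'c tensor) \<Rightarrow> 'c \<Rightarrow> 'c::rat_vector \<Rightarrow> 'c tensor" where
  "reduced_comult \<Delta> u x = \<Delta> x - pure [x, u] - pure [u, x]"


section \<open>The homotopy retract and the transferred structure\<close>

definition dg_splitting :: "(int \<Rightarrow> 'c::rat_vector set) \<Rightarrow> 'c set \<Rightarrow> ('c \<Rightarrow> 'c) \<Rightarrow>
    'c set \<Rightarrow> 'c set \<Rightarrow> bool" where
  "dg_splitting C B \<delta> A H \<longleftrightarrow>
     graded_subspace C A \<and> graded_subspace C H \<and> A \<subseteq> B \<and> \<delta> ` A \<subseteq> B \<and> H \<subseteq> B \<and>
     (\<forall>x\<in>B. \<exists>!(a, b, h). a \<in> A \<and> b \<in> \<delta> ` A \<and> h \<in> H \<and> x = a + b + h) \<and>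
     (\<forall>h\<in>H. \<delta> h = 0) \<and> inj_on \<delta> A"

text \<open>
  The maps \<open>p\<close> and \<open>k\<close> on the augmentation ideal, extended to the whole coalgebra by zero on \<open>u\<close>.
  The inclusion \<open>i\<close> is invisible, as \<open>H\<close> is a subspace.
\<close>

definition retract_p :: "('c \<Rightarrow> 'c) \<Rightarrow> ('c \<Rightarrow> rat) \<Rightarrow> 'c \<Rightarrow> 'c set \<Rightarrow> 'c set \<Rightarrow> 'c::rat_vector \<Rightarrow> 'c" where
  "retract_p \<delta> \<epsilon> u A H x =
     (THE h. h \<in> H \<and> (\<exists>a\<in>A. \<exists>b\<in>\<delta> ` A. x - \<epsilon> x *\<^sub>Q u = a + b + h))"

definition retract_k :: "('c \<Rightarrow> 'c) \<Rightarrow> ('c \<Rightarrow> rat) \<Rightarrow> 'c \<Rightarrow> 'c set \<Rightarrow> 'c set \<Rightarrow> 'c::rat_vector \<Rightarrow> 'c" where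
  "retract_k \<delta> \<epsilon> u A H x =
     (THE a. a \<in> A \<and> (\<exists>a'\<in>A. \<exists>h\<in>H. x - \<epsilon> x *\<^sub>Q u = a' + \<delta> a + h))"

text \<open>Planar rooted trees up to isomorphism; \<open>Vertex ts\<close> has the subtrees \<open>ts\<close> as inputs.\<close>

datatype ptree = Leaf | Vertex "ptree list"

fun leaves :: "ptree \<Rightarrow> nat" where
  "leaves Leaf = 1"
| "leaves (Vertex ts) = sum_list (map leaves ts)"

fun proper :: "ptree \<Rightarrow> bool" where
  "proper Leaf \<longleftrightarrow> True"
| "proper (Vertex ts) \<longleftrightarrow> length ts \<ge> 2 \<and> (\<forall>t\<in>set ts. proper t)"

definition PT :: "nat \<Rightarrow> ptree set" where
  "PT j = {T. proper T \<and> leaves T = j}"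

text \<open>
  Signs. They are those of the homological perturbation formulas on \<open>T(s\<^sup>-\<^sup>1C)\<close>, transported along
  the desuspension (see \<open>\<partial>\<^sub>k\<close> below). For a homotopy with \<open>id - i p = \<delta> k + k \<delta>\<close> each internal edge
  contributes \<open>-1\<close>; a vertex whose subtrees have \<open>j\<^sub>1, \<dots>, j\<^sub>r\<close> leaves contributes the sign with
  exponent the sum of \<open>(j\<^sub>p - 1) j\<^sub>q\<close> over \<open>p < q\<close>, from interchanging the operation of degree \<open>j\<^sub>p - 1\<close>
  with \<open>j\<^sub>q\<close> desuspensions. Thus for three leaves the transferred operation is
  \<open>((p \<otimes> p) \<Delta> k \<otimes> p) \<Delta> i - (p \<otimes> (p \<otimes> p) \<Delta> k) \<Delta> i\<close>.
\<close>

definition vertex_sign :: "nat list \<Rightarrow> rat" where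
  "vertex_sign js =
     ksgn (\<Sum>q<length js. \<Sum>p<q. (int (js ! p) - 1) * int (js ! q))"

text \<open>
  The composite along a tree with operations \<open>D\<close> at the vertices, \<open>p\<close> at the leaves, \<open>k\<close> at
  internal edges, and \<open>e\<close> at the root edge of a tree other than \<open>Leaf\<close>. The sign of an internal
  edge is attached to its label.
\<close>

fun tree_op :: "(int \<Rightarrow> 'c::rat_vector set) \<Rightarrow> (nat \<Rightarrow> 'c \<Rightarrow> 'c tensor) \<Rightarrow> ('c \<Rightarrow> 'c) \<Rightarrow> ('c \<Rightarrow> 'c) \<Rightarrow>
    ('c \<Rightarrow> 'c) \<Rightarrow> ptree \<Rightarrow> 'c \<Rightarrow> 'c tensor" where
  "tree_op C D p k e Leaf = (\<lambda>x. ten1 (p x))"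
| "tree_op C D p k e (Vertex ts) =
     (\<lambda>x. vertex_sign (map leaves ts) *\<^sub>Q
        tensor_map C
          (map (\<lambda>t. (int (leaves t) - 1, leaves t, tree_op C D p k (\<lambda>y. - k y) t)) ts)
          (D (length ts) (e x)))"

definition transferred_ops :: "(int \<Rightarrow> 'c::rat_vector set) \<Rightarrow> (nat \<Rightarrow> 'c \<Rightarrow> 'c tensor) \<Rightarrow> ('c \<Rightarrow> 'c) \<Rightarrow>
    ('c \<Rightarrow> 'c) \<Rightarrow> nat \<Rightarrow> 'c \<Rightarrow> 'c tensor" where
  "transferred_ops C D p k j x =
     (if j \<ge> 2 then \<Sum>T\<in>PT j. tree_op C D p k (\<lambda>y. y) T x else 0)"


section \<open>Differential graded Lie algebras\<close>

text \<open>The bracket takes the degrees of its arguments as parameters.\<close>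

record 'x dgl =
  part :: "int \<Rightarrow> 'x set"
  bracket :: "int \<Rightarrow> int \<Rightarrow> 'x \<Rightarrow> 'x \<Rightarrow> 'x"
  bdry :: "'x \<Rightarrow> 'x"

definition is_dgl :: "'x::rat_vector dgl \<Rightarrow> bool" where
  "is_dgl L \<longleftrightarrow>
     (\<forall>n. qsubspace (part L n)) \<and>
     (\<forall>m n. \<forall>x\<in>part L m. \<forall>y\<in>part L n. bracket L m n x y \<in> part L (m + n)) \<and>
     (\<forall>m n. \<forall>x\<in>part L m. \<forall>x'\<in>part L m. \<forall>y\<in>part L n. \<forall>a b.
        bracket L m n (a *\<^sub>Q x + b *\<^sub>Q x') y
          = a *\<^sub>Q bracket L m n x y + b *\<^sub>Q bracket L m n x' y) \<and>
     (\<forall>m n. \<forall>x\<in>part L m. \<forall>y\<in>part L n.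
        bracket L m n x y = - (ksgn (m * n) *\<^sub>Q bracket L n m y x)) \<and>
     (\<forall>l m n. \<forall>x\<in>part L l. \<forall>y\<in>part L m. \<forall>z\<in>part L n.
        bracket L l (m + n) x (bracket L m n y z)
          = bracket L (l + m) n (bracket L l m x y) z
            + ksgn (l * m) *\<^sub>Q bracket L m (l + n) y (bracket L l n x z)) \<and>
     (\<forall>n. \<forall>x\<in>part L n. bdry L x \<in> part L (n - 1)) \<and>
     (\<forall>n. \<forall>x\<in>part L n. \<forall>y\<in>part L n. \<forall>a b.
        bdry L (a *\<^sub>Q x + b *\<^sub>Q y) = a *\<^sub>Q bdry L x + b *\<^sub>Q bdry L y) \<and>
     (\<forall>n. \<forall>x\<in>part L n. bdry L (bdry L x) = 0) \<and>
     (\<forall>m n. \<forall>x\<in>part L m. \<forall>y\<in>part L n.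
        bdry L (bracket L m n x y)
          = bracket L (m - 1) n (bdry L x) y + ksgn m *\<^sub>Q bracket L m (n - 1) x (bdry L y))"

definition dgl_morphism :: "'x::rat_vector dgl \<Rightarrow> 'y::rat_vector dgl \<Rightarrow> ('x \<Rightarrow> 'y) \<Rightarrow> bool" where
  "dgl_morphism L M f \<longleftrightarrow>
     (\<forall>n. \<forall>x\<in>part L n. f x \<in> part M n) \<and>
     (\<forall>n. \<forall>x\<in>part L n. \<forall>y\<in>part L n. \<forall>a b. f (a *\<^sub>Q x + b *\<^sub>Q y) = a *\<^sub>Q f x + b *\<^sub>Q f y) \<and>
     (\<forall>m n. \<forall>x\<in>part L m. \<forall>y\<in>part L n. f (bracket L m n x y) = bracket M m n (f x) (f y)) \<and>
     (\<forall>n. \<forall>x\<in>part L n. f (bdry L x) = bdry M (f x))"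

definition homology_class :: "'x::rat_vector dgl \<Rightarrow> int \<Rightarrow> 'x \<Rightarrow> 'x set" where
  "homology_class L n z = {z + bdry L y | y. y \<in> part L (n + 1)}"

definition homology :: "'x::rat_vector dgl \<Rightarrow> int \<Rightarrow> 'x set set" where
  "homology L n = homology_class L n ` {z \<in> part L n. bdry L z = 0}"

definition quasi_iso :: "'x::rat_vector dgl \<Rightarrow> 'y::rat_vector dgl \<Rightarrow> ('x \<Rightarrow> 'y) \<Rightarrow> bool" where
  "quasi_iso L M f \<longleftrightarrow> dgl_morphism L M f \<and>
     (\<forall>n. bij_betw (\<lambda>X. \<Union>x\<in>X. homology_class M n (f x)) (homology L n) (homology M n))"


section \<open>Free Lie algebras, the functor \<open>\<L>\<close> and Quillen minimal models\<close>

definition tbracket :: "int \<Rightarrow> int \<Rightarrow> 'c tensor \<Rightarrow> 'c tensor \<Rightarrow> 'c tensor" where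
  "tbracket m n s t = tmult s t - ksgn (m * n) *\<^sub>Q tmult t s"

text \<open>
  The free graded Lie algebra on \<open>V\<close> is the graded Lie subalgebra of the tensor algebra generated
  by \<open>V\<close>. \<open>lie_words G V k m\<close> consists of its elements of bracket length \<open>k\<close> and degree \<open>m\<close>.
\<close>

inductive_set lie_words ::
    "(int \<Rightarrow> 'c::rat_vector set) \<Rightarrow> 'c set \<Rightarrow> (nat \<times> int \<times> 'c tensor) set"
  for G :: "int \<Rightarrow> 'c::rat_vector set" and V :: "'c set" where
  gen: "x \<in> V \<inter> G m \<Longrightarrow> (1, m, ten1 x) \<in> lie_words G V"
| zero: "(k, m, 0) \<in> lie_words G V"
| comb: "(k, m, s) \<in> lie_words G V \<Longrightarrow> (k, m, t) \<in> lie_words G V \<Longrightarrow>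
           (k, m, a *\<^sub>Q s + b *\<^sub>Q t) \<in> lie_words G V"
| brac: "(k, m, s) \<in> lie_words G V \<Longrightarrow> (l, n, t) \<in> lie_words G V \<Longrightarrow>
           (k + l, m + n, tbracket m n s t) \<in> lie_words G V"

text \<open>
  Degree \<open>m\<close> part of \<open>\<L>\<^bsup>\<ge> r\<^esup>(V)\<close>, the span of brackets of length at least \<open>r\<close>, and of its
  completion with respect to bracket length. For \<open>r = 1\<close> these are the free Lie algebra and the
  complete free Lie algebra. When \<open>V\<close> is concentrated in positive or in negative degrees the
  two coincide in each degree.
\<close>

definition free_lie :: "(int \<Rightarrow> 'c::rat_vector set) \<Rightarrow> 'c set \<Rightarrow> nat \<Rightarrow> int \<Rightarrow> 'c tensor set" where
  "free_lie G V r m = qspan {t. \<exists>k\<ge>r. (k, m, t) \<in> lie_words G V}"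

definition complete_free_lie ::
    "(int \<Rightarrow> 'c::rat_vector set) \<Rightarrow> 'c set \<Rightarrow> nat \<Rightarrow> int \<Rightarrow> 'c tensor set" where
  "complete_free_lie G V r m =
     {t. (\<forall>k. (k, m, len_part k t) \<in> lie_words G V) \<and> (\<forall>k<r. len_part k t = 0)}"

text \<open>
  \<open>\<partial>\<^sub>k (s\<^sup>-\<^sup>1 a) = (-1)\<^sup>k (s\<^sup>-\<^sup>1)\<^bsup>\<otimes> k\<^esup> (\<Delta>\<^sub>k a)\<close>. With this convention the relations of an
  \<open>A\<^sub>\<infinity>\<close>-coalgebra say that \<open>\<partial>\<close> has square zero, \<open>\<partial>\<^sub>1 (s\<^sup>-\<^sup>1 a) = - s\<^sup>-\<^sup>1 \<delta> a\<close>, and \<open>\<partial>\<^sub>2\<close> is Quillen's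
  \<open>\<partial>\<^sub>2 (s\<^sup>-\<^sup>1 a) = 1/2 \<Sum> (-1)\<^bsup>|a'|\<^esup> [s\<^sup>-\<^sup>1 a', s\<^sup>-\<^sup>1 a'']\<close>.
\<close>

definition desusp_op :: "(int \<Rightarrow> 'c::rat_vector set) \<Rightarrow> (nat \<Rightarrow> 'c \<Rightarrow> 'c tensor) \<Rightarrow> nat \<Rightarrow>
    'c \<Rightarrow> 'c tensor" where
  "desusp_op C \<Delta> k x = ksgn (int k) *\<^sub>Q tensor_map C (replicate k (-1, 1, ten1)) (\<Delta> k x)"

text \<open>
  The derivation of \<open>T(s\<^sup>-\<^sup>1C)\<close> extending \<open>\<Sum> \<partial>\<^sub>k\<close>. Only finitely many \<open>\<partial>\<^sub>k\<close> contribute to the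
  component of a given tensor length.
\<close>

definition tensor_diff :: "(int \<Rightarrow> 'c::rat_vector set) \<Rightarrow> (nat \<Rightarrow> 'c \<Rightarrow> 'c tensor) \<Rightarrow>
    'c tensor \<Rightarrow> 'c tensor" where
  "tensor_diff C \<Delta> t =
     (\<lambda>\<phi>s. let N = length \<phi>s in
        \<Sum>k=1..N. \<Sum>n=0..N-k.
          tensor_map (desusp C)
            (replicate (N - k - n) id_factor @ [(-1, k, desusp_op C \<Delta> k)] @ replicate n id_factor)
            t \<phi>s)"

text \<open>In the following two definitions \<open>F\<close> is \<open>free_lie\<close> or \<open>complete_free_lie\<close>.\<close>

definition quillen_L ::
    "((int \<Rightarrow> 'c::rat_vector set) \<Rightarrow> 'c set \<Rightarrow> nat \<Rightarrow> int \<Rightarrow> 'c tensor set) \<Rightarrow>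
     (int \<Rightarrow> 'c set) \<Rightarrow> 'c set \<Rightarrow> (nat \<Rightarrow> 'c \<Rightarrow> 'c tensor) \<Rightarrow> 'c tensor dgl" where
  "quillen_L F C V \<Delta> =
     \<lparr>part = F (desusp C) V 1, bracket = tbracket, bdry = tensor_diff C \<Delta>\<rparr>"

text \<open>The free dgl on the graded subspace \<open>W\<close> with differential \<open>d\<close> is a Quillen minimal model of \<open>M\<close>.\<close>

definition quillen_minimal_model ::
    "((int \<Rightarrow> 'c::rat_vector set) \<Rightarrow> 'c set \<Rightarrow> nat \<Rightarrow> int \<Rightarrow> 'c tensor set) \<Rightarrow>
     (int \<Rightarrow> 'c set) \<Rightarrow> 'c set \<Rightarrow> ('c tensor \<Rightarrow> 'c tensor) \<Rightarrow> 'y::rat_vector dgl \<Rightarrow> bool" where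
  "quillen_minimal_model F G W d M \<longleftrightarrow>
     (let L = \<lparr>part = F G W 1, bracket = tbracket, bdry = d\<rparr> in
        is_grading G \<and> graded_subspace G W \<and> is_dgl L \<and> is_dgl M \<and>
        (\<forall>n. \<forall>x\<in>W \<inter> G n. d (ten1 x) \<in> F G W 2 (n - 1)) \<and>
        (\<exists>f. quasi_iso L M f))"

end

theory Submission imports Defs begin

text \<open>Write \<open>\<kappa>\<close> for the contracting homotopy. Sums over trees give an algebra map
  \<open>\<Gamma> : T(s\<^sup>-\<^sup>1B) \<rightarrow> T(s\<^sup>-\<^sup>1H)\<close>, where \<open>B\<close> is the reduced coalgebra. It satisfies \<open>d' \<Gamma> = \<Gamma> d\<close>, by induction on
  the tensor length and the decomposition \<open>B = H \<oplus> \<kappa> B \<oplus> \<delta> \<kappa> B\<close>; as \<open>\<Gamma>\<close> is the identity on \<open>H\<close>, it follows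
  that \<open>d'\<close> squares to zero and is Lie-valued. Cocommutativity then follows because Lie elements are
  primitive for the unshuffle coproduct. The derivation \<open>\<eta>\<close> that extends \<open>-\<kappa>\<close> is a homotopy between
  zero and the derivation counting the letters outside \<open>H\<close>, up to terms that increase the length.
  Since the number of these letters can be inverted over the rationals, \<open>\<Gamma>\<close> restricts to an
  isomorphism from the sub-dgl of all \<open>x\<close> with \<open>\<eta> x = 0\<close> and \<open>\<eta> (d x) = 0\<close> to \<open>L(s\<^sup>-\<^sup>1H)\<close>; its inverse,
  followed by the inclusion, is the quasi-isomorphism.\<close>

section \<open>Linear algebra and gradings\<close>

text \<open>The transferred differential may have components of all lengths, so the work takes place
  in the tensor algebra completed by length. Every operator is kept \<open>filtered\<close>: its
  value in length k depends only on the parts of length at most k. Identities can then be checked on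
  words, and equations can be solved one length at a time. The desuspended side absorbs the signs:
  the structure relations become one square-zero derivation, signatures of shuffles disappear, and
  the recursion over trees becomes multiplicativity of \<open>\<Gamma>\<close>. The price is paid in
  \<open>susp_insert\<close>, in \<open>shuf_Cons\<close> and in the \<open>susp_pair\<close> for
  trees. The step from vanishing shuffles to Lie elements concerns only the binary comultiplication,
  hence length two, where halving suffices; in higher lengths only the easy direction occurs. The
  sub-dgl has two conditions because the kernel of a derivation is closed under brackets, and \<eta>
  (d x) = 0 makes it closed under d as well. Obtaining the map out of L(s^-1 H) as an inverse of
  \<open>\<Gamma>\<close> avoids a second family of tree formulas: its compatibilities follow from
  uniqueness of lifts.\<close>

interpretation Q: vector_space "(*\<^sub>Q) :: rat \<Rightarrow> 'a::rat_vector \<Rightarrow> 'a"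
  by unfold_locales (simp_all add: qscale_right_distrib qscale_left_distrib qscale_assoc qscale_one)

section \<open>Linear maps and spans over the rationals\<close>

lemma qlinear_iff:
  fixes f :: "'a::rat_vector \<Rightarrow> 'b::rat_vector"
  shows "qlinear f \<longleftrightarrow> (\<forall>x y. f (x + y) = f x + f y) \<and> (\<forall>a x. f (a *\<^sub>Q x) = a *\<^sub>Q f x)"
  by (simp add: Vector_Spaces.linear_iff Q.vector_space_axioms)

lemma qlinearI:
  fixes f :: "'a::rat_vector \<Rightarrow> 'b::rat_vector"
  assumes "\<And>x y. f (x + y) = f x + f y" "\<And>a x. f (a *\<^sub>Q x) = a *\<^sub>Q f x"
  shows "qlinear f"
  using assms by (simp add: qlinear_iff)

lemma
  fixes f :: "'a::rat_vector \<Rightarrow> 'b::rat_vector"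
  assumes "qlinear f"
  shows qlinear_add: "f (x + y) = f x + f y"
    and qlinear_scale: "f (a *\<^sub>Q x) = a *\<^sub>Q f x"
    and qlinear_0: "f 0 = 0"
    and qlinear_neg: "f (- x) = - f x"
    and qlinear_diff: "f (x - y) = f x - f y"
    and qlinear_sum: "f (sum h I) = (\<Sum>i\<in>I. f (h i))"
proof -
  interpret l: Vector_Spaces.linear "(*\<^sub>Q) :: rat \<Rightarrow> 'a \<Rightarrow> 'a" "(*\<^sub>Q) :: rat \<Rightarrow> 'b \<Rightarrow> 'b" f
    using assms .
  show "f (x + y) = f x + f y" "f (a *\<^sub>Q x) = a *\<^sub>Q f x" "f 0 = 0" "f (- x) = - f x"
    "f (x - y) = f x - f y" "f (sum h I) = (\<Sum>i\<in>I. f (h i))"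
    by (simp_all add: l.add l.scale l.neg l.diff l.sum)
qed

lemma qscale_rat [simp]: "a *\<^sub>Q (b::rat) = a * b"
  by (simp add: qscale_rat_def)

lemma qscale_apply [simp]: "(a *\<^sub>Q f) x = a *\<^sub>Q f x"
  by (simp add: qscale_fun_def)

lemma qlinear_id: "qlinear (\<lambda>x. x)"
  by (rule qlinearI) auto

lemma qlinear_zero: "qlinear (\<lambda>x. 0)"
  by (rule qlinearI) auto

lemma qlinear_comp: "qlinear f \<Longrightarrow> qlinear g \<Longrightarrow> qlinear (\<lambda>x. f (g x))"
  by (simp add: qlinear_iff)

lemma qlinear_compose: "qlinear f \<Longrightarrow> qlinear g \<Longrightarrow> qlinear (f \<circ> g)"
  by (simp add: qlinear_iff)

lemma qlinear_plus: "qlinear f \<Longrightarrow> qlinear g \<Longrightarrow> qlinear (\<lambda>x. f x + g x)"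
  by (simp add: qlinear_iff Q.scale_right_distrib add_ac)

lemma qlinear_cmult: "qlinear f \<Longrightarrow> qlinear (\<lambda>x. a *\<^sub>Q f x)"
  by (simp add: qlinear_iff Q.scale_right_distrib mult_ac)

lemma qlinear_minus: "qlinear f \<Longrightarrow> qlinear g \<Longrightarrow> qlinear (\<lambda>x. f x - g x)"
  by (simp add: qlinear_iff Q.scale_right_diff_distrib)

lemma qlinear_uminus: "qlinear f \<Longrightarrow> qlinear (\<lambda>x. - f x)"
  by (simp add: qlinear_iff)

lemma qlinear_setsum: "(\<And>i. i \<in> I \<Longrightarrow> qlinear (f i)) \<Longrightarrow> qlinear (\<lambda>x. \<Sum>i\<in>I. f i x)"
  by (simp add: qlinear_iff Q.scale_sum_right sum.distrib)

lemma qlinear_eval: "qlinear f \<Longrightarrow> qlinear (\<lambda>x. f x y)"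
  by (simp add: qlinear_iff)

lemma qsubspace_add: "qsubspace S \<Longrightarrow> x \<in> S \<Longrightarrow> y \<in> S \<Longrightarrow> x + y \<in> S"
  by (rule Q.subspace_add)

lemma qsubspace_scale: "qsubspace S \<Longrightarrow> x \<in> S \<Longrightarrow> a *\<^sub>Q x \<in> S"
  by (rule Q.subspace_scale)

lemma qsubspaceI:
  "0 \<in> S \<Longrightarrow> (\<And>x y. x \<in> S \<Longrightarrow> y \<in> S \<Longrightarrow> x + y \<in> S) \<Longrightarrow> (\<And>a x. x \<in> S \<Longrightarrow> a *\<^sub>Q x \<in> S) \<Longrightarrow> qsubspace S"
  by (rule Q.subspaceI)

lemma qspan_qlinear_mem:
  assumes "qlinear f" "qsubspace S" "\<And>x. x \<in> B \<Longrightarrow> f x \<in> S" "x \<in> qspan B"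
  shows "f x \<in> S"
  using assms(4)
proof (induction rule: Q.span_induct_alt)
  case base
  then show ?case using assms by (simp add: qlinear_0 Q.subspace_0)
next
  case (step c x y)
  then show ?case using assms by (simp add: qlinear_add qlinear_scale qsubspace_add qsubspace_scale)
qed

lemma qspan_qlinear_eq:
  assumes "qlinear f" "qlinear g" "\<And>x. x \<in> B \<Longrightarrow> f x = g x" "x \<in> qspan B"
  shows "f x = g x"
  using assms(4)
proof (induction rule: Q.span_induct_alt)
  case base
  then show ?case using assms by (simp add: qlinear_0)
next
  case (step c x y)
  then show ?case using assms by (simp add: qlinear_add qlinear_scale)
qed

text \<open>Multiplication by 2 is invertible over the rationals. Squares of odd derivations are
  reached in this way, as half of a self-commutator.\<close>

lemma qscale_double:
  fixes x :: "'a::rat_vector"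
  assumes "x + x = 0" shows "x = 0"
proof -
  have "2 *\<^sub>Q x = x + x"
    using Q.scale_left_distrib[of 1 1 x] by simp
  then show ?thesis using assms by (simp add: Q.scale_eq_0_iff)
qed

text \<open>Prescribe the value 1 on the independent set {x}. Tensors are known only through their
  values on functionals, so this is what lets a tensor of length one determine its letter.\<close>

lemma separating_functional:
  fixes x :: "'a::rat_vector"
  assumes "x \<noteq> 0"
  shows "\<exists>\<phi> :: 'a \<Rightarrow> rat. qlinear \<phi> \<and> \<phi> x \<noteq> 0"
proof -
  interpret vector_space_pair "(*\<^sub>Q) :: rat \<Rightarrow> 'a \<Rightarrow> 'a" "(*\<^sub>Q) :: rat \<Rightarrow> rat \<Rightarrow> rat"
    by unfold_locales
  have ind: "\<not> Q.dependent {x}" using assms by simp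
  have "qlinear (construct {x} (\<lambda>_. 1))" by (rule linear_construct[OF ind])
  moreover have "construct {x} (\<lambda>_. 1) x = (1::rat)" by (rule construct_basis[OF ind]) simp
  ultimately show ?thesis by fastforce
qed

section \<open>Koszul signs and homogeneous components\<close>

lemma ksgn_add: "ksgn (a + b) = ksgn a * ksgn b"
  by (auto simp: ksgn_def)

lemma ksgn_diff: "ksgn (a - b) = ksgn a * ksgn b"
  by (auto simp: ksgn_def)

lemma ksgn_uminus [simp]: "ksgn (- a) = ksgn a"
  by (auto simp: ksgn_def)

lemma ksgn_simps [simp]: "ksgn 0 = 1" "ksgn 1 = -1" "ksgn 2 = 1" "ksgn a * ksgn a = 1"
  "ksgn a * (ksgn a * b) = b"
  by (auto simp: ksgn_def)

lemma ksgn_nonzero [simp]: "ksgn a \<noteq> 0"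
  by (simp add: ksgn_def)

locale grading =
  fixes G :: "int \<Rightarrow> 'c::rat_vector set"
  assumes is_grading: "is_grading G"
begin

lemma sub: "qsubspace (G n)"
  using is_grading by (auto simp: is_grading_def)

lemma hdecomp_ex1: "\<exists>!f. hdecomp G x f"
  using is_grading by (auto simp: is_grading_def)

lemma hdecomp_hpart: "hdecomp G x (hpart G x)"
  unfolding hpart_def by (rule theI'[OF hdecomp_ex1])

lemma hpart_eqI: "hdecomp G x f \<Longrightarrow> hpart G x = f"
  using hdecomp_ex1 hdecomp_hpart by blast

lemma finite_hpart: "finite {n. hpart G x n \<noteq> 0}"
  and hpart_mem: "hpart G x n \<in> G n"
  and sum_hpart: "(\<Sum>n | hpart G x n \<noteq> 0. hpart G x n) = x"
  using hdecomp_hpart[of x] by (auto simp: hdecomp_def)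

lemma hdecomp_alt:
  assumes "finite I" "\<And>n. n \<notin> I \<Longrightarrow> f n = 0" "\<And>n. f n \<in> G n" "(\<Sum>n\<in>I. f n) = x"
  shows "hdecomp G x f"
proof -
  have *: "{n. f n \<noteq> 0} \<subseteq> I" using assms by auto
  then have "(\<Sum>n | f n \<noteq> 0. f n) = (\<Sum>n\<in>I. f n)"
    using assms(1) by (intro sum.mono_neutral_left) auto
  then show ?thesis
    using assms * finite_subset by (auto simp: hdecomp_def)
qed

lemma hpart_homog: "x \<in> G n \<Longrightarrow> hpart G x = (\<lambda>m. if m = n then x else 0)"
  by (rule hpart_eqI, rule hdecomp_alt[of "{n}"]) (auto simp: Q.subspace_0[OF sub])

lemma hpart_add: "hpart G (x + y) = (\<lambda>n. hpart G x n + hpart G y n)"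
proof (rule hpart_eqI, rule hdecomp_alt)
  let ?I = "{n. hpart G x n \<noteq> 0} \<union> {n. hpart G y n \<noteq> 0}"
  show "finite ?I" using finite_hpart by auto
  have "(\<Sum>n\<in>?I. hpart G x n) = x"
    by (subst (3) sum_hpart[symmetric], rule sum.mono_neutral_right) (use finite_hpart in auto)
  moreover have "(\<Sum>n\<in>?I. hpart G y n) = y"
    by (subst (3) sum_hpart[symmetric], rule sum.mono_neutral_right) (use finite_hpart in auto)
  ultimately show "(\<Sum>n\<in>?I. hpart G x n + hpart G y n) = x + y"
    by (simp add: sum.distrib)
qed (auto intro: qsubspace_add[OF sub] hpart_mem)

lemma hpart_scale: "hpart G (a *\<^sub>Q x) = (\<lambda>n. a *\<^sub>Q hpart G x n)"
proof (rule hpart_eqI, rule hdecomp_alt)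
  let ?I = "{n. hpart G x n \<noteq> 0}"
  show "finite ?I" using finite_hpart by auto
  show "(\<Sum>n\<in>?I. a *\<^sub>Q hpart G x n) = a *\<^sub>Q x"
    by (simp add: Q.scale_sum_right[symmetric] sum_hpart)
qed (auto intro: qsubspace_scale[OF sub] hpart_mem)

lemma qlinear_hpart: "qlinear (\<lambda>x. hpart G x n)"
  by (rule qlinearI) (simp_all add: hpart_add hpart_scale)

lemma weighted_hpart_sum:
  assumes "finite I" "{n. hpart G x n \<noteq> 0} \<subseteq> I"
  shows "(\<Sum>n | hpart G x n \<noteq> 0. c n *\<^sub>Q hpart G x n) = (\<Sum>n\<in>I. c n *\<^sub>Q hpart G x n)"
  using assms by (intro sum.mono_neutral_left) auto

text \<open>\<open>gsign\<close> and \<open>parity_part\<close> are both of this shape. The index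
  set depends on the vector, so the sums are first extended to a common finite set of
  degrees.\<close>

lemma qlinear_weighted: "qlinear (\<lambda>x. \<Sum>n | hpart G x n \<noteq> 0. c n *\<^sub>Q hpart G x n)"
proof (rule qlinearI)
  fix x y
  let ?I = "{n. hpart G x n \<noteq> 0} \<union> {n. hpart G y n \<noteq> 0}"
  have f: "finite ?I" using finite_hpart by auto
  have s: "{n. hpart G (x + y) n \<noteq> 0} \<subseteq> ?I" by (auto simp: hpart_add)
  show "(\<Sum>n | hpart G (x + y) n \<noteq> 0. c n *\<^sub>Q hpart G (x + y) n) =
    (\<Sum>n | hpart G x n \<noteq> 0. c n *\<^sub>Q hpart G x n) + (\<Sum>n | hpart G y n \<noteq> 0. c n *\<^sub>Q hpart G y n)"
    by (subst (1 2 3) weighted_hpart_sum[OF f])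
      (use s in \<open>auto simp: hpart_add Q.scale_right_distrib sum.distrib\<close>)
next
  fix a x
  let ?I = "{n. hpart G x n \<noteq> 0}"
  show "(\<Sum>n | hpart G (a *\<^sub>Q x) n \<noteq> 0. c n *\<^sub>Q hpart G (a *\<^sub>Q x) n) =
    a *\<^sub>Q (\<Sum>n | hpart G x n \<noteq> 0. c n *\<^sub>Q hpart G x n)"
    by (subst weighted_hpart_sum[OF finite_hpart[of x]])
      (auto simp: hpart_scale Q.scale_sum_right mult.commute)
qed

lemma weighted_homog:
  "x \<in> G m \<Longrightarrow> (\<Sum>n | hpart G x n \<noteq> 0. c n *\<^sub>Q hpart G x n) = c m *\<^sub>Q x"
  by (subst weighted_hpart_sum[of "{m}"]) (auto simp: hpart_homog)

lemma qlinear_gsign: "qlinear (gsign G m)"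
  using qlinear_weighted[of "\<lambda>n. ksgn (m * n)"] by (simp add: gsign_def[abs_def])

lemma gsign_homog: "x \<in> G n \<Longrightarrow> gsign G m x = ksgn (m * n) *\<^sub>Q x"
  unfolding gsign_def by (rule weighted_homog)

lemma parity_part_alt:
  "parity_part G e x = (\<Sum>n | hpart G x n \<noteq> 0. (if n mod 2 = e then 1 else 0) *\<^sub>Q hpart G x n)"
  unfolding parity_part_def
  by (rule sum.mono_neutral_cong_left) (use finite_hpart in auto)

lemma qlinear_parity_part: "qlinear (parity_part G e)"
  using qlinear_weighted[of "\<lambda>n. if n mod 2 = e then 1 else 0"]
  by (simp add: parity_part_alt[abs_def])

lemma parity_part_homog: "x \<in> G n \<Longrightarrow> parity_part G e x = (if n mod 2 = e then x else 0)"
  unfolding parity_part_alt by (subst weighted_homog) auto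

text \<open>Reduction to homogeneous vectors: x is the finite sum of its homogeneous parts, and only
  x and these parts have to lie in V.\<close>

lemma homog_induct:
  assumes "x \<in> V" "\<forall>n. hpart G x n \<in> V" "P 0"
    and "\<And>x y. P x \<Longrightarrow> P y \<Longrightarrow> P (x + y)" "\<And>n x. x \<in> V \<Longrightarrow> x \<in> G n \<Longrightarrow> P x"
  shows "P x"
proof -
  have "P (\<Sum>n\<in>I. hpart G x n)" if "finite I" for I
    using that
  proof (induction I)
    case (insert m I)
    have "P (hpart G x m)" using assms(1,2,5) hpart_mem by blast
    then show ?case using insert assms(4) by simp
  qed (simp add: assms)
  from this[OF finite_hpart, of x] show ?thesis by (simp add: sum_hpart)
qed

lemma qlinear_homog_eq:
  assumes "qlinear f" "qlinear g" "\<And>n x. x \<in> G n \<Longrightarrow> f x = g x"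
  shows "f x = g x"
  by (rule homog_induct[of x UNIV]) (use assms in \<open>auto simp: qlinear_0 qlinear_add\<close>)

lemma gsign_0 [simp]: "gsign G 0 x = x"
  by (rule qlinear_homog_eq[OF qlinear_gsign qlinear_id]) (simp add: gsign_homog)

lemma gsign_gsign: "gsign G m (gsign G m' x) = gsign G (m + m') x"
  by (rule qlinear_homog_eq[OF qlinear_comp[OF qlinear_gsign qlinear_gsign] qlinear_gsign])
    (simp add: gsign_homog qlinear_scale[OF qlinear_gsign] ksgn_add[symmetric] distrib_right add.commute)

end

lemma desusp_hdecomp: "hdecomp (desusp C) x f \<longleftrightarrow> hdecomp C x (\<lambda>n. f (n - 1))"
proof -
  have im: "{n. f (n - 1) \<noteq> 0} = (\<lambda>n. n + 1) ` {n. f n \<noteq> 0}"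
    by (auto simp: image_iff) (metis diff_add_cancel)
  have "finite {n. f (n - 1) \<noteq> 0} = finite {n. f n \<noteq> 0}"
    unfolding im by (rule finite_image_iff) (auto simp: inj_on_def)
  moreover have "(\<Sum>n | f (n - 1) \<noteq> 0. f (n - 1)) = (\<Sum>n | f n \<noteq> 0. f n)"
    unfolding im by (subst sum.reindex) (auto simp: inj_on_def)
  moreover have "(\<forall>n. f n \<in> desusp C n) = (\<forall>n. f (n - 1) \<in> C n)"
    unfolding desusp_def by (metis add_diff_cancel_right' diff_add_cancel)
  ultimately show ?thesis unfolding hdecomp_def by simp
qed

lemma is_grading_desusp:
  assumes "is_grading C" shows "is_grading (desusp C)"
proof -
  have "\<exists>!f. hdecomp (desusp C) x f" for x
  proof -
    from assms obtain g where g: "hdecomp C x g" "\<And>h. hdecomp C x h \<Longrightarrow> h = g"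
      unfolding is_grading_def by metis
    show ?thesis
    proof (rule ex1I[of _ "\<lambda>n. g (n + 1)"])
      show "hdecomp (desusp C) x (\<lambda>n. g (n + 1))" by (simp add: desusp_hdecomp g)
      fix h assume "hdecomp (desusp C) x h"
      then have "(\<lambda>n. h (n - 1)) = g" using g(2) desusp_hdecomp by blast
      then show "h = (\<lambda>n. g (n + 1))" by (auto simp: fun_eq_iff) (metis add_diff_cancel_right')
    qed
  qed
  then show ?thesis using assms by (auto simp: is_grading_def desusp_def)
qed

lemma hpart_desusp:
  assumes "is_grading C" shows "hpart (desusp C) x n = hpart C x (n + 1)"
proof -
  interpret grading C by standard (rule assms)
  interpret D: grading "desusp C" by standard (rule is_grading_desusp[OF assms])
  have "hpart (desusp C) x = (\<lambda>n. hpart C x (n + 1))"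
    by (rule D.hpart_eqI) (simp add: desusp_hdecomp hdecomp_hpart)
  then show ?thesis by simp
qed

lemma graded_subspace_desusp:
  "is_grading C \<Longrightarrow> graded_subspace C V \<Longrightarrow> graded_subspace (desusp C) V"
  by (simp add: graded_subspace_def hpart_desusp)

section \<open>Tensors and filtered operators\<close>

lemma sum_fun_apply: "(\<Sum>i\<in>I. f i) x = (\<Sum>i\<in>I. f i x)"
  by (induction I rule: infinite_finite_induct) auto

lemma all_linear_simps [simp]:
  "all_linear []" "all_linear (f # fs) \<longleftrightarrow> qlinear f \<and> all_linear fs"
  "all_linear (fs @ gs) \<longleftrightarrow> all_linear fs \<and> all_linear gs"
  by (auto simp: all_linear_def)

lemma all_linear_take: "all_linear fs \<Longrightarrow> all_linear (take n fs)"
  by (auto simp: all_linear_def dest: in_set_takeD)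

lemma all_linear_drop: "all_linear fs \<Longrightarrow> all_linear (drop n fs)"
  by (auto simp: all_linear_def dest: in_set_dropD)

lemma all_linear_take_drop: "all_linear (take n fs) \<Longrightarrow> all_linear (drop n fs) \<Longrightarrow> all_linear fs"
  by (metis all_linear_simps(3) append_take_drop_id)

lemma pure_Nil: "pure [] = (\<lambda>\<phi>s. if \<phi>s = [] then 1 else 0)"
  by (auto simp: pure_def)

lemma pure_Nil_simps [simp]: "pure [] [] = 1" "pure [] (f # \<phi>s) = 0"
  by (simp_all add: pure_Nil)

lemma pure_Cons_simps [simp]:
  "pure (x # xs) [] = 0"
  "pure (x # xs) (f # \<phi>s) = (if qlinear f then f x * pure xs \<phi>s else 0)"
  by (auto simp: pure_def prod.lessThan_Suc_shift simp del: prod.lessThan_Suc)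

lemma pure_length: "length \<phi>s \<noteq> length xs \<Longrightarrow> pure xs \<phi>s = 0"
  by (auto simp: pure_def)

lemma pure_not_linear: "\<not> all_linear \<phi>s \<Longrightarrow> pure xs \<phi>s = 0"
  by (auto simp: pure_def)

lemma ten1_simps [simp]:
  "ten1 x [] = 0" "ten1 x [f] = (if qlinear f then f x else 0)" "ten1 x (f # g # \<phi>s) = 0"
  by (simp_all add: ten1_def)

lemma ten1_eqI:
  assumes "\<And>f. qlinear f \<Longrightarrow> t [f] = f x"
    and "\<And>\<phi>s. length \<phi>s \<noteq> 1 \<or> \<not> all_linear \<phi>s \<Longrightarrow> t \<phi>s = 0"
  shows "t = ten1 x"
proof
  fix \<phi>s
  show "t \<phi>s = ten1 x \<phi>s"
  proof (cases "length \<phi>s = 1 \<and> all_linear \<phi>s")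
    case True
    then obtain f where "\<phi>s = [f]" "qlinear f" by (auto simp: length_Suc_conv)
    then show ?thesis using assms(1) by simp
  next
    case False
    then show ?thesis using assms(2) by (auto simp: ten1_def pure_def)
  qed
qed

lemma ten1_zero_off: "length \<phi>s \<noteq> 1 \<or> \<not> all_linear \<phi>s \<Longrightarrow> ten1 x \<phi>s = 0"
  by (auto simp: ten1_def pure_def)

lemma qlinear_ten1: "qlinear ten1"
proof (rule qlinearI)
  show "ten1 (x + y) = ten1 x + ten1 y" for x y :: 'a
    by (rule ten1_eqI[symmetric]) (simp_all add: qlinear_iff ten1_zero_off)
  show "ten1 (a *\<^sub>Q x) = a *\<^sub>Q ten1 x" for x :: 'a and a
    by (rule ten1_eqI[symmetric]) (simp_all add: qlinear_iff ten1_zero_off)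
qed

lemmas ten1_linear [simp] = qlinear_add[OF qlinear_ten1] qlinear_scale[OF qlinear_ten1]
  qlinear_0[OF qlinear_ten1] qlinear_neg[OF qlinear_ten1] qlinear_diff[OF qlinear_ten1]

text \<open>Distinct vectors are separated by a functional, so nothing is lost in passing to tensors
  of length one.\<close>

lemma ten1_inject: "ten1 x = ten1 y \<longleftrightarrow> x = y"
proof
  assume e: "ten1 x = ten1 y"
  show "x = y"
  proof (rule ccontr)
    assume "x \<noteq> y"
    then obtain \<phi> :: "_ \<Rightarrow> rat" where \<phi>: "qlinear \<phi>" "\<phi> (x - y) \<noteq> 0"
      using separating_functional[of "x - y"] by auto
    then show False using fun_cong[OF e, of "[\<phi>]"] by (simp add: qlinear_diff)
  qed
qed simp

text \<open>The cut of the list lies either before the first functional or after it; in the second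
  case the left factor is partially evaluated. This recursion replaces sums over cuts in later
  inductions.\<close>

lemma tmult_simps [simp]:
  "tmult s t [] = s [] * t []"
  "tmult s t (f # \<phi>s) = s [] * t (f # \<phi>s) + tmult (\<lambda>\<psi>s. s (f # \<psi>s)) t \<phi>s"
  by (simp_all add: tmult_def sum.atMost_Suc_shift del: sum.atMost_Suc)

lemma tmult_add_left: "tmult (s + s') t = tmult s t + tmult s' t"
  and tmult_add_right: "tmult s (t + t') = tmult s t + tmult s t'"
  and tmult_scale_left: "tmult (a *\<^sub>Q s) t = a *\<^sub>Q tmult s t"
  and tmult_scale_right: "tmult s (a *\<^sub>Q t) = a *\<^sub>Q tmult s t"
  by (simp_all add: fun_eq_iff tmult_def algebra_simps sum.distrib sum_distrib_left)

lemma qlinear_tmult_left: "qlinear (\<lambda>s. tmult s t)"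
  by (rule qlinearI) (simp_all add: tmult_add_left tmult_scale_left)

lemma qlinear_tmult_right: "qlinear (tmult s)"
  by (rule qlinearI) (simp_all add: tmult_add_right tmult_scale_right)

lemmas tmult_linear = tmult_add_left tmult_add_right tmult_scale_left tmult_scale_right
  qlinear_0[OF qlinear_tmult_left] qlinear_0[OF qlinear_tmult_right]
  qlinear_diff[OF qlinear_tmult_left] qlinear_diff[OF qlinear_tmult_right]
  qlinear_neg[OF qlinear_tmult_left] qlinear_neg[OF qlinear_tmult_right]

lemmas tmult_sum_left = qlinear_sum[OF qlinear_tmult_left]
lemmas tmult_sum_right = qlinear_sum[OF qlinear_tmult_right]

lemma tmult_assoc: "tmult (tmult s t) w = tmult s (tmult t w)"
proof
  show "tmult (tmult s t) w \<phi>s = tmult s (tmult t w) \<phi>s" for \<phi>s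
  proof (induction \<phi>s arbitrary: s t)
    case (Cons f \<phi>s)
    have "(\<lambda>\<psi>s. tmult s t (f # \<psi>s)) = s [] *\<^sub>Q (\<lambda>\<psi>s. t (f # \<psi>s)) + tmult (\<lambda>\<psi>s. s (f # \<psi>s)) t"
      by (simp add: fun_eq_iff)
    then show ?case
      by (simp add: tmult_linear Cons.IH algebra_simps)
  qed simp
qed

lemma tmult_one_left [simp]: "tmult (pure []) t = t"
proof
  fix \<phi>s
  have "(\<lambda>\<psi>s. pure [] (f # \<psi>s)) = 0" for f :: "'a \<Rightarrow> rat"
    by (simp add: fun_eq_iff)
  then show "tmult (pure []) t \<phi>s = t \<phi>s"
    by (cases \<phi>s) (simp_all add: tmult_linear)
qed

lemma tmult_one_right [simp]: "tmult t (pure []) = t"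
proof
  show "tmult t (pure []) \<phi>s = t \<phi>s" for \<phi>s
    by (induction \<phi>s arbitrary: t) auto
qed

text \<open>A letter consumes exactly one functional, so only the cut after the first functional
  survives.\<close>

lemma tmult_ten1_Cons:
  "tmult (ten1 x) t (f # \<phi>s) = (if qlinear f then f x * t \<phi>s else 0)"
proof -
  have "(\<lambda>\<psi>s. ten1 x (f # \<psi>s)) = (if qlinear f then f x else 0) *\<^sub>Q pure []"
    unfolding ten1_def by (auto simp: fun_eq_iff)
  then show ?thesis by (simp add: tmult_linear)
qed

lemma pure_Cons: "pure (x # xs) = tmult (ten1 x) (pure xs)"
proof
  show "pure (x # xs) \<phi>s = tmult (ten1 x) (pure xs) \<phi>s" for \<phi>s
    by (cases \<phi>s) (simp_all add: tmult_ten1_Cons del: tmult_simps(2))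
qed

lemma pure_append: "pure (xs @ ys) = tmult (pure xs) (pure ys)"
  by (induction xs) (simp_all add: pure_Cons tmult_assoc)

lemma len_part_add: "len_part k (s + t) = len_part k s + len_part k t"
  and len_part_scale: "len_part k (a *\<^sub>Q t) = a *\<^sub>Q len_part k t"
  by (auto simp: len_part_def fun_eq_iff)

lemma qlinear_len_part: "qlinear (len_part k)"
  by (rule qlinearI) (simp_all add: len_part_add len_part_scale)

lemmas len_part_linear = len_part_add len_part_scale qlinear_0[OF qlinear_len_part]
  qlinear_diff[OF qlinear_len_part] qlinear_neg[OF qlinear_len_part]

lemmas len_part_sum = qlinear_sum[OF qlinear_len_part]

lemma len_part_len_part: "len_part j (len_part k t) = (if j = k then len_part k t else 0)"
  by (auto simp: len_part_def fun_eq_iff)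

lemma len_part_pure: "len_part k (pure xs) = (if k = length xs then pure xs else 0)"
  by (auto simp: len_part_def fun_eq_iff pure_length)

lemma len_part_ten1: "len_part k (ten1 x) = (if k = 1 then ten1 x else 0)"
  by (simp add: ten1_def len_part_pure)

lemma len_part_tmult:
  "len_part n (tmult s t) = (\<Sum>i\<le>n. tmult (len_part i s) (len_part (n - i) t))"
proof
  fix \<phi>s
  show "len_part n (tmult s t) \<phi>s = (\<Sum>i\<le>n. tmult (len_part i s) (len_part (n - i) t)) \<phi>s"
  proof (cases "length \<phi>s = n")
    case True
    have "(\<Sum>i\<le>n. tmult (len_part i s) (len_part (n - i) t)) \<phi>s
        = (\<Sum>i\<le>n. \<Sum>j\<le>n. if j = i then s (take j \<phi>s) * t (drop j \<phi>s) else 0)"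
      using True unfolding sum_fun_apply tmult_def
      by (intro sum.cong) (auto simp: len_part_def)
    also have "\<dots> = (\<Sum>i\<le>n. s (take i \<phi>s) * t (drop i \<phi>s))" by simp
    finally show ?thesis using True by (simp add: len_part_def tmult_def)
  next
    case False
    have "tmult (len_part i s) (len_part (n - i) t) \<phi>s = 0" if "i \<le> n" for i
      unfolding tmult_def using False that by (intro sum.neutral) (auto simp: len_part_def)
    then show ?thesis
      using False by (simp add: sum_fun_apply len_part_def)
  qed
qed

lemma len_part_eqI: "(\<And>k. len_part k s = len_part k t) \<Longrightarrow> s = t"
proof
  fix \<phi>s :: "('a \<Rightarrow> rat) list"
  assume "\<And>k. len_part k s = len_part k t"
  then have "len_part (length \<phi>s) s \<phi>s = len_part (length \<phi>s) t \<phi>s" by simp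
  then show "s \<phi>s = t \<phi>s" by (simp add: len_part_def)
qed

lemma len_part_tmult_homog:
  assumes "len_part a s = s" "len_part b t = t"
  shows "len_part n (tmult s t) = (if n = a + b then tmult s t else 0)"
proof -
  have s: "len_part i s = (if i = a then s else 0)" for i
    by (metis assms(1) len_part_len_part)
  have t: "len_part i t = (if i = b then t else 0)" for i
    by (metis assms(2) len_part_len_part)
  have "len_part n (tmult s t) = (\<Sum>i\<le>n. if i = a then if n - i = b then tmult s t else 0 else 0)"
    unfolding len_part_tmult by (intro sum.cong) (auto simp: s t tmult_linear)
  then show ?thesis by auto
qed

text \<open>Filtered operators on complete tensors are determined by their values on tensors of finite length.\<close>

definition filtered :: "('c tensor \<Rightarrow> 'd tensor) \<Rightarrow> bool" where
  "filtered F \<longleftrightarrow> qlinear F \<and>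
     (\<forall>t \<phi>s. (\<forall>\<psi>s. length \<psi>s \<le> length \<phi>s \<longrightarrow> t \<psi>s = 0) \<longrightarrow> F t \<phi>s = 0)"

lemma filteredI:
  assumes "\<And>s t. F (s + t) = F s + F t" "\<And>a t. F (a *\<^sub>Q t) = a *\<^sub>Q F t"
    and "\<And>t \<phi>s. (\<And>\<psi>s. length \<psi>s \<le> length \<phi>s \<Longrightarrow> t \<psi>s = 0) \<Longrightarrow> F t \<phi>s = 0"
  shows "filtered F"
  using assms unfolding filtered_def by (simp add: qlinear_iff)

lemma filtered_qlinear: "filtered F \<Longrightarrow> qlinear F"
  by (simp add: filtered_def)

lemma filtered_vanish:
  "filtered F \<Longrightarrow> (\<And>\<psi>s. length \<psi>s \<le> length \<phi>s \<Longrightarrow> t \<psi>s = 0) \<Longrightarrow> F t \<phi>s = 0"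
  by (simp add: filtered_def)

lemma filtered_len_part_vanish:
  "filtered F \<Longrightarrow> (\<And>j. j \<le> n \<Longrightarrow> len_part j t = 0) \<Longrightarrow> k \<le> n \<Longrightarrow> len_part k (F t) = 0"
proof
  fix \<phi>s assume *: "filtered F" "\<And>j. j \<le> n \<Longrightarrow> len_part j t = 0" "k \<le> n"
  have "t \<psi>s = 0" if "length \<psi>s \<le> n" for \<psi>s
    using fun_cong[OF *(2)[OF that], of \<psi>s] by (simp add: len_part_def)
  then have "length \<phi>s = k \<Longrightarrow> F t \<phi>s = 0"
    using *(3) by (intro filtered_vanish[OF *(1)]) auto
  then show "len_part k (F t) \<phi>s = 0 \<phi>s"
    by (auto simp: len_part_def)
qed

lemma filtered_cong_le:
  assumes "filtered F" "\<And>j. j \<le> n \<Longrightarrow> len_part j s = len_part j t" "k \<le> n"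
  shows "len_part k (F s) = len_part k (F t)"
proof -
  have "len_part k (F (s - t)) = 0"
    by (rule filtered_len_part_vanish[OF assms(1) _ assms(3)]) (simp add: len_part_linear assms(2))
  then show ?thesis
    by (simp add: qlinear_diff[OF filtered_qlinear[OF assms(1)]] len_part_linear)
qed

lemma len_part_trunc: "len_part j (\<Sum>i\<le>n. len_part i t) = (if j \<le> n then len_part j t else 0)"
  by (simp add: len_part_sum len_part_len_part)

text \<open>Longer parts of t are invisible in length k. This turns a statement about an infinite
  sum into one about F on finitely many single lengths.\<close>

lemma filtered_trunc:
  assumes "filtered F" "k \<le> n"
  shows "len_part k (F t) = (\<Sum>i\<le>n. len_part k (F (len_part i t)))"
proof -
  have "len_part k (F t) = len_part k (F (\<Sum>i\<le>n. len_part i t))"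
    by (rule filtered_cong_le[OF assms(1) _ assms(2)]) (simp add: len_part_trunc)
  then show ?thesis
    by (simp add: qlinear_sum[OF filtered_qlinear[OF assms(1)]] len_part_sum)
qed

lemma filtered_id: "filtered (\<lambda>t. t)"
  by (rule filteredI) auto

lemma filtered_zero: "filtered (\<lambda>t. 0)"
  by (rule filteredI) auto

lemma filtered_comp:
  assumes F: "filtered F" and F': "filtered F'" shows "filtered (\<lambda>t. F (F' t))"
  using qlinear_comp[OF filtered_qlinear[OF F] filtered_qlinear[OF F']]
  unfolding filtered_def by (auto intro!: filtered_vanish[OF F] filtered_vanish[OF F'])

lemma filtered_plus: "filtered F \<Longrightarrow> filtered F' \<Longrightarrow> filtered (\<lambda>t. F t + F' t)"
  by (simp add: filtered_def qlinear_plus)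

lemma filtered_minus: "filtered F \<Longrightarrow> filtered F' \<Longrightarrow> filtered (\<lambda>t. F t - F' t)"
  by (simp add: filtered_def qlinear_minus)

lemma filtered_cmult: "filtered F \<Longrightarrow> filtered (\<lambda>t. a *\<^sub>Q F t)"
  by (simp add: filtered_def qlinear_cmult)

lemma filtered_len_part: "filtered (len_part k)"
  by (rule filteredI) (auto simp: len_part_linear, simp add: len_part_def)

lemma filtered_tmult_left: "filtered (\<lambda>s. tmult s t)"
  by (rule filteredI) (auto simp: tmult_linear, auto simp: tmult_def intro!: sum.neutral)

lemma filtered_tmult_right: "filtered (tmult s)"
  by (rule filteredI) (auto simp: tmult_linear, auto simp: tmult_def intro!: sum.neutral)

text \<open>A common interface for tensor powers, spans of words and Lie words, so that the passage
  to the completion is done once.\<close>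

definition length_family :: "(nat \<Rightarrow> 'c tensor set) \<Rightarrow> bool" where
  "length_family K \<longleftrightarrow> (\<forall>k. qsubspace (K k) \<and> (\<forall>t\<in>K k. len_part k t = t))"

text \<open>The completed direct sum, that is, the product over all lengths: infinitely many
  components may be nonzero.\<close>

definition lprod :: "(nat \<Rightarrow> 'c tensor set) \<Rightarrow> 'c tensor set" where
  "lprod K = {t. \<forall>k. len_part k t \<in> K k}"

lemma length_family_sub: "length_family K \<Longrightarrow> qsubspace (K k)"
  and length_family_len: "length_family K \<Longrightarrow> t \<in> K k \<Longrightarrow> len_part j t = (if j = k then t else 0)"
  by (auto simp: length_family_def) (metis len_part_len_part)+

lemma lprodD: "t \<in> lprod K \<Longrightarrow> len_part k t \<in> K k"
  by (simp add: lprod_def)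

lemma lprod_mono: "(\<And>k. K k \<subseteq> K' k) \<Longrightarrow> lprod K \<subseteq> lprod K'"
  by (auto simp: lprod_def)

lemma lprod_subspace:
  assumes K: "length_family K" shows "qsubspace (lprod K)"
  using Q.subspace_0[OF length_family_sub[OF K]] Q.subspace_add[OF length_family_sub[OF K]]
    Q.subspace_scale[OF length_family_sub[OF K]]
  by (intro qsubspaceI) (auto simp: lprod_def len_part_linear)

lemma lprod_member:
  assumes K: "length_family K" and t: "t \<in> K k" shows "t \<in> lprod K"
  using t Q.subspace_0[OF length_family_sub[OF K]] by (simp add: lprod_def length_family_len[OF K t])

lemma lprod_trunc: "length_family K \<Longrightarrow> t \<in> lprod K \<Longrightarrow> len_part k t \<in> lprod K"
  by (rule lprod_member[OF _ lprodD])

text \<open>Each component of F t is a finite sum of components of F on single-length parts, and the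
  target is a subspace in each length.\<close>

lemma filtered_lprod_mem:
  assumes F: "filtered F" and K': "length_family K'"
    and step: "\<And>k s. s \<in> K k \<Longrightarrow> F s \<in> lprod K'" and t: "t \<in> lprod K"
  shows "F t \<in> lprod K'"
proof -
  have "len_part k (F t) \<in> K' k" for k
    by (subst filtered_trunc[OF F order_refl], rule Q.subspace_sum[OF length_family_sub[OF K']])
      (rule lprodD[OF step[OF lprodD[OF t]]])
  then show ?thesis by (simp add: lprod_def)
qed

lemma filtered_lprod_eq:
  assumes F: "filtered F" "filtered F'"
    and step: "\<And>k s. s \<in> K k \<Longrightarrow> F s = F' s" and t: "t \<in> lprod K"
  shows "F t = F' t"
proof (rule len_part_eqI)
  fix k
  have "F (len_part i t) = F' (len_part i t)" for i
    using step lprodD[OF t] by blast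
  then show "len_part k (F t) = len_part k (F' t)"
    unfolding filtered_trunc[OF F(1) order_refl, of k t] filtered_trunc[OF F(2) order_refl, of k t]
    by simp
qed

text \<open>The indexwise condition in \<open>tensor_power\<close> as an inductive predicate, so
  that arguments on words become rule inductions over the letters.\<close>

inductive hword :: "(int \<Rightarrow> 'c::rat_vector set) \<Rightarrow> 'c set \<Rightarrow> int \<Rightarrow> 'c list \<Rightarrow> bool"
  for G V where
  Nil: "hword G V 0 []"
| Cons: "x \<in> V \<Longrightarrow> x \<in> G d \<Longrightarrow> hword G V m xs \<Longrightarrow> hword G V (d + m) (x # xs)"

lemma hword_iff_degrees:
  "hword G V m xs \<longleftrightarrow>
    (\<exists>ds. length ds = length xs \<and> sum_list ds = m \<and> (\<forall>i<length xs. xs ! i \<in> V \<inter> G (ds ! i)))"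
proof
  assume "hword G V m xs"
  then show "\<exists>ds. length ds = length xs \<and> sum_list ds = m \<and> (\<forall>i<length xs. xs ! i \<in> V \<inter> G (ds ! i))"
  proof induction
    case (Cons x d m xs)
    then obtain ds where "length ds = length xs" "sum_list ds = m" "\<forall>i<length xs. xs ! i \<in> V \<inter> G (ds ! i)"
      by blast
    then show ?case using Cons by (intro exI[of _ "d # ds"]) (auto simp: nth_Cons split: nat.split)
  qed simp
next
  assume "\<exists>ds. length ds = length xs \<and> sum_list ds = m \<and> (\<forall>i<length xs. xs ! i \<in> V \<inter> G (ds ! i))"
  then obtain ds where "length ds = length xs" "sum_list ds = m" "\<forall>i<length xs. xs ! i \<in> V \<inter> G (ds ! i)"
    by blast
  then show "hword G V m xs"
  proof (induction ds xs arbitrary: m rule: list_induct2)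
    case (Cons d ds x xs)
    have "xs ! i \<in> V \<inter> G (ds ! i)" if "i < length xs" for i
      using Cons.prems(2)[rule_format, of "Suc i"] that by simp
    then have "hword G V (sum_list ds) xs" by (intro Cons.IH) auto
    moreover have "x \<in> V" "x \<in> G d" using Cons.prems(2)[rule_format, of 0] by auto
    ultimately show ?case using Cons.prems(1) hword.Cons by fastforce
  qed (auto intro: hword.Nil)
qed

lemma tensor_power_hword: "tensor_power G V k m = qspan {pure xs |xs. length xs = k \<and> hword G V m xs}"
  unfolding tensor_power_def hword_iff_degrees by (rule arg_cong[of _ _ qspan]) auto

lemma hword_append: "hword G V m xs \<Longrightarrow> hword G V n ys \<Longrightarrow> hword G V (m + n) (xs @ ys)"
  by (induction rule: hword.induct) (simp_all add: add.assoc hword.Cons)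

lemma hword_single: "x \<in> V \<Longrightarrow> x \<in> G d \<Longrightarrow> hword G V d [x]"
  using hword.Cons[OF _ _ hword.Nil] by fastforce

lemma hword_mono: "hword G V m xs \<Longrightarrow> V \<subseteq> V' \<Longrightarrow> hword G V' m xs"
  by (induction rule: hword.induct) (auto intro: hword.intros)

text \<open>Words of one length but of arbitrary, possibly mixed degrees. Statements without a
  Koszul sign for the element are made for these.\<close>

definition tall :: "(int \<Rightarrow> 'c::rat_vector set) \<Rightarrow> 'c set \<Rightarrow> nat \<Rightarrow> 'c tensor set" where
  "tall G V k = qspan {pure xs |xs. length xs = k \<and> (\<exists>m. hword G V m xs)}"

lemma span_length:
  assumes "t \<in> qspan B" "\<And>b. b \<in> B \<Longrightarrow> len_part k b = b"
  shows "len_part k t = t"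
  using qspan_qlinear_eq[OF qlinear_len_part qlinear_id assms(2,1)] .

lemma length_family_tensor_power: "length_family (\<lambda>k. tensor_power G V k m)"
  unfolding length_family_def tensor_power_hword
  by (intro allI conjI ballI Q.subspace_span) (erule span_length, auto simp: len_part_pure)

lemma length_family_tall: "length_family (tall G V)"
  unfolding length_family_def tall_def
  by (intro allI conjI ballI Q.subspace_span) (erule span_length, auto simp: len_part_pure)

lemma tensor_power_subset_tall: "tensor_power G V k m \<subseteq> tall G V k"
  unfolding tensor_power_hword tall_def by (rule Q.span_mono) auto

abbreviation Tc :: "(int \<Rightarrow> 'c::rat_vector set) \<Rightarrow> 'c set \<Rightarrow> int \<Rightarrow> 'c tensor set" where
  "Tc G V m \<equiv> lprod (\<lambda>k. tensor_power G V k m)"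

abbreviation Tca :: "(int \<Rightarrow> 'c::rat_vector set) \<Rightarrow> 'c set \<Rightarrow> 'c tensor set" where
  "Tca G V \<equiv> lprod (tall G V)"

lemma Tc_subset_Tca: "Tc G V m \<subseteq> Tca G V"
  by (rule lprod_mono) (rule tensor_power_subset_tall)

lemma Tca_mono: "V \<subseteq> V' \<Longrightarrow> Tca G V \<subseteq> Tca G V'"
  unfolding tall_def by (intro lprod_mono Q.span_mono) (blast intro: hword_mono)

lemmas Tc_subspace = lprod_subspace[OF length_family_tensor_power]
lemmas Tca_subspace = lprod_subspace[OF length_family_tall]

lemma pure_in_power: "hword G V m xs \<Longrightarrow> pure xs \<in> tensor_power G V (length xs) m"
  unfolding tensor_power_hword by (rule Q.span_base) auto

lemma pure_in_Tc: "hword G V m xs \<Longrightarrow> pure xs \<in> Tc G V m"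
  by (rule lprod_member[OF length_family_tensor_power]) (rule pure_in_power)

lemma ten1_in_Tc: "x \<in> V \<Longrightarrow> x \<in> G m \<Longrightarrow> ten1 x \<in> Tc G V m"
  unfolding ten1_def by (intro pure_in_Tc hword_single)

lemma filtered_Tc_mem:
  assumes "filtered F" "length_family K" "\<And>xs. hword G V m xs \<Longrightarrow> F (pure xs) \<in> lprod K" "t \<in> Tc G V m"
  shows "F t \<in> lprod K"
proof (rule filtered_lprod_mem[OF assms(1,2) _ assms(4)])
  fix k s assume "s \<in> tensor_power G V k m"
  then show "F s \<in> lprod K"
    unfolding tensor_power_hword
    by (rule qspan_qlinear_mem[OF filtered_qlinear[OF assms(1)] lprod_subspace[OF assms(2)], rotated])
      (use assms(3) in auto)
qed

lemma filtered_Tc_eq: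
  assumes "filtered F" "filtered F'" "\<And>xs. hword G V m xs \<Longrightarrow> F (pure xs) = F' (pure xs)" "t \<in> Tc G V m"
  shows "F t = F' t"
proof (rule filtered_lprod_eq[OF assms(1,2) _ assms(4)])
  fix k s assume "s \<in> tensor_power G V k m"
  then show "F s = F' s"
    unfolding tensor_power_hword
    by (rule qspan_qlinear_eq[OF filtered_qlinear[OF assms(1)] filtered_qlinear[OF assms(2)], rotated])
      (use assms(3) in auto)
qed

lemma filtered_Tca_mem:
  assumes "filtered F" "length_family K" "\<And>m xs. hword G V m xs \<Longrightarrow> F (pure xs) \<in> lprod K" "t \<in> Tca G V"
  shows "F t \<in> lprod K"
proof (rule filtered_lprod_mem[OF assms(1,2) _ assms(4)])
  fix k s assume "s \<in> tall G V k"
  then show "F s \<in> lprod K"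
    unfolding tall_def
    by (rule qspan_qlinear_mem[OF filtered_qlinear[OF assms(1)] lprod_subspace[OF assms(2)], rotated])
      (use assms(3) in auto)
qed

lemma filtered_Tca_eq:
  assumes "filtered F" "filtered F'" "\<And>m xs. hword G V m xs \<Longrightarrow> F (pure xs) = F' (pure xs)" "t \<in> Tca G V"
  shows "F t = F' t"
proof (rule filtered_lprod_eq[OF assms(1,2) _ assms(4)])
  fix k s assume "s \<in> tall G V k"
  then show "F s = F' s"
    unfolding tall_def
    by (rule qspan_qlinear_eq[OF filtered_qlinear[OF assms(1)] filtered_qlinear[OF assms(2)], rotated])
      (use assms(3) in auto)
qed

text \<open>The reduction to words is applied to each factor in turn, and words are
  concatenated.\<close>

lemma tmult_Tc:
  assumes "s \<in> Tc G V m" "t \<in> Tc G V n" shows "tmult s t \<in> Tc G V (m + n)"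
proof (rule filtered_Tc_mem[OF filtered_tmult_left length_family_tensor_power _ assms(1)])
  fix xs assume xs: "hword G V m xs"
  show "tmult (pure xs) t \<in> Tc G V (m + n)"
    by (rule filtered_Tc_mem[OF filtered_tmult_right length_family_tensor_power _ assms(2)])
      (simp add: pure_append[symmetric] hword_append pure_in_Tc xs)
qed

lemma Tc_not_linear: "t \<in> Tca G V \<Longrightarrow> \<not> all_linear \<phi>s \<Longrightarrow> t \<phi>s = 0"
proof -
  assume t: "t \<in> Tca G V" and \<phi>: "\<not> all_linear \<phi>s"
  have "len_part (length \<phi>s) t \<in> tall G V (length \<phi>s)" using t by (rule lprodD)
  then have "len_part (length \<phi>s) t \<phi>s = 0"
    unfolding tall_def
    by (rule qspan_qlinear_eq[where f = "\<lambda>s. s \<phi>s" and g = "\<lambda>s. 0", rotated -1])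
      (auto simp: qlinear_iff pure_not_linear \<phi>)
  then show ?thesis by (simp add: len_part_def)
qed

lemmas tensor_apply = plus_fun_apply zero_fun_apply qscale_apply minus_apply uminus_apply

text \<open>Tensors are functions, but from now on they are to be treated as vectors: these rules would
  rewrite them pointwise.\<close>

declare tensor_apply [simp del]

section \<open>Derivations and algebra maps\<close>

text \<open>\<open>tensor_map\<close>, and with it \<open>der\<close>, is forced to vanish as soon
  as one functional is not linear. A Leibniz rule can hold only for tensors that obey the same
  convention.\<close>

definition lin_supp :: "'c::rat_vector tensor \<Rightarrow> bool" where
  "lin_supp t \<longleftrightarrow> (\<forall>\<phi>s. \<not> all_linear \<phi>s \<longrightarrow> t \<phi>s = 0)"

lemma lin_supp_Tca: "t \<in> Tca G V \<Longrightarrow> lin_supp t"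
  unfolding lin_supp_def using Tc_not_linear by blast

lemma lin_supp_Tc: "t \<in> Tc G V m \<Longrightarrow> lin_supp t"
  using lin_supp_Tca Tc_subset_Tca by blast

lemma lin_supp_pure: "lin_supp (pure xs)"
  by (simp add: lin_supp_def pure_not_linear)

lemma lin_supp_tmult: "lin_supp s \<Longrightarrow> lin_supp t \<Longrightarrow> lin_supp (tmult s t)"
  unfolding lin_supp_def tmult_def
proof (intro allI impI sum.neutral ballI)
  fix \<phi>s :: "('a \<Rightarrow> rat) list" and i
  assume "\<forall>\<phi>s. \<not> all_linear \<phi>s \<longrightarrow> s \<phi>s = 0" "\<forall>\<phi>s. \<not> all_linear \<phi>s \<longrightarrow> t \<phi>s = 0" "\<not> all_linear \<phi>s"
  moreover from this(3) have "\<not> all_linear (take i \<phi>s) \<or> \<not> all_linear (drop i \<phi>s)"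
    using all_linear_take_drop by blast
  ultimately show "s (take i \<phi>s) * t (drop i \<phi>s) = 0" by auto
qed

text \<open>The value on a letter \<open>x\<close> of the derivation (or algebra map) with components \<open>\<theta> k\<close>, \<open>k \<ge> 1\<close>.\<close>

definition letter :: "(nat \<Rightarrow> 'c \<Rightarrow> 'c tensor) \<Rightarrow> 'c \<Rightarrow> 'c tensor" where
  "letter \<theta> x = (\<lambda>\<phi>s. if \<phi>s = [] then 0 else \<theta> (length \<phi>s) x \<phi>s)"

text \<open>The shape of \<open>tensor_diff\<close> with free degree and components, so that the
  contracting derivation and the linear part of a differential are instances as well.\<close>

definition der :: "(int \<Rightarrow> 'c::rat_vector set) \<Rightarrow> int \<Rightarrow> (nat \<Rightarrow> 'c \<Rightarrow> 'c tensor) \<Rightarrow>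
    'c tensor \<Rightarrow> 'c tensor" where
  "der G d \<theta> t =
     (\<lambda>\<phi>s. let N = length \<phi>s in
        \<Sum>k=1..N. \<Sum>n=0..N-k.
          tensor_map G (replicate (N - k - n) id_factor @ [(d, k, \<theta> k)] @ replicate n id_factor) t \<phi>s)"

lemma tensor_diff_der: "tensor_diff C \<Delta> = der (desusp C) (-1) (desusp_op C \<Delta>)"
  by (simp add: tensor_diff_def der_def fun_eq_iff)

section \<open>The Leibniz rule for derivations\<close>

lemma tensor_map_add: "tensor_map G fs (s + t) = tensor_map G fs s + tensor_map G fs t"
  and tensor_map_scale: "tensor_map G fs (a *\<^sub>Q t) = a *\<^sub>Q tensor_map G fs t"
  by (auto simp: tensor_map_def fun_eq_iff tensor_apply)

lemma qlinear_tensor_map: "qlinear (tensor_map G fs)"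
  by (rule qlinearI) (simp_all add: tensor_map_add tensor_map_scale)

lemma length_pullback [simp]: "length (pullback G fs \<phi>s) = length fs"
  by (induction fs arbitrary: \<phi>s) auto

lemma id_factor_simps [simp]:
  "fst id_factor = 0" "(case id_factor of (d, k, f) \<Rightarrow> k) = 1"
  by (simp_all add: id_factor_def)

lemma filtered_der: "filtered (der G d \<theta>)"
proof (rule filteredI)
  show "der G d \<theta> (s + t) = der G d \<theta> s + der G d \<theta> t" for s t
    by (simp add: der_def fun_eq_iff tensor_map_add sum.distrib Let_def tensor_apply)
  show "der G d \<theta> (a *\<^sub>Q t) = a *\<^sub>Q der G d \<theta> t" for a t
    by (simp add: der_def fun_eq_iff tensor_map_scale sum_distrib_left Let_def tensor_apply)
  fix t :: "'a tensor" and \<phi>s :: "('a \<Rightarrow> rat) list"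
  assume "\<And>\<psi>s. length \<psi>s \<le> length \<phi>s \<Longrightarrow> t \<psi>s = 0"
  then show "der G d \<theta> t \<phi>s = 0"
    unfolding der_def tensor_map_def Let_def by (intro sum.neutral ballI) auto
qed

lemma der_Nil: "der G d \<theta> (pure []) = 0"
  by (auto simp: der_def fun_eq_iff tensor_map_def Let_def pure_Nil tensor_apply
      simp flip: length_0_conv intro!: sum.neutral)

lemma der_apply_Nil [simp]: "der G d \<theta> t [] = 0"
  by (simp add: der_def)

lemma der_not_linear: "\<not> all_linear \<phi>s \<Longrightarrow> der G d \<theta> t \<phi>s = 0"
  by (simp add: der_def tensor_map_def)

context grading
begin

lemma pullback_id_Cons:
  "qlinear f \<Longrightarrow> pullback G (id_factor # fs) (f # \<phi>s) =
    (\<lambda>v. f (gsign G (sum_list (map fst fs)) v)) # pullback G fs \<phi>s"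
  by (simp add: id_factor_def)

lemma replicate_sums [simp]: "sum_list (replicate n (0::int)) = 0" "sum_list (replicate n (Suc 0)) = n"
  by (simp_all add: sum_list_replicate)

lemma pullback_id: "all_linear \<phi>s \<Longrightarrow> length \<phi>s = n \<Longrightarrow> pullback G (replicate n id_factor) \<phi>s = \<phi>s"
proof (induction n arbitrary: \<phi>s)
  case (Suc n)
  then obtain f \<psi>s where "\<phi>s = f # \<psi>s" by (cases \<phi>s) auto
  then show ?case using Suc by (simp add: pullback_id_Cons)
qed simp

lemma lin_supp_letter: "(\<And>k. k \<ge> 1 \<Longrightarrow> lin_supp (\<theta> k x)) \<Longrightarrow> lin_supp (letter \<theta> x)"
  by (auto simp: lin_supp_def letter_def Suc_le_eq)

text \<open>In each summand the operation either hits the first letter, which gives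
  \<open>letter\<close>, or leaves it alone. In the second case the identity consumes the first
  functional, and the Koszul sign of moving an operation of degree d past x remains.\<close>

lemma der_Cons:
  assumes \<theta>: "\<And>k. k \<ge> 1 \<Longrightarrow> qlinear (\<theta> k)" and \<theta>x: "\<And>k. k \<ge> 1 \<Longrightarrow> lin_supp (\<theta> k x)"
    and x: "x \<in> G m" and t: "lin_supp t"
  shows "der G d \<theta> (tmult (ten1 x) t) =
    tmult (letter \<theta> x) t + ksgn (d * m) *\<^sub>Q tmult (ten1 x) (der G d \<theta> t)"
proof
  fix \<phi>s :: "('c \<Rightarrow> rat) list"
  show "der G d \<theta> (tmult (ten1 x) t) \<phi>s =
    (tmult (letter \<theta> x) t + ksgn (d * m) *\<^sub>Q tmult (ten1 x) (der G d \<theta> t)) \<phi>s"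
  proof (cases "all_linear \<phi>s")
    case False
    have "lin_supp (der G d \<theta> t)" by (simp add: lin_supp_def der_not_linear)
    then have "lin_supp (tmult (ten1 x) (der G d \<theta> t))" "lin_supp (tmult (letter \<theta> x) t)"
      using t \<theta>x by (auto intro!: lin_supp_tmult lin_supp_letter simp: ten1_def lin_supp_pure)
    then show ?thesis using False by (simp add: lin_supp_def der_not_linear tensor_apply)
  next
    case True
    show ?thesis
    proof (cases \<phi>s)
      case Nil
      then show ?thesis by (simp add: letter_def tensor_apply)
    next
      case (Cons f \<psi>s)
      define M where "M = length \<psi>s"
      have lin: "qlinear f" "all_linear \<psi>s" using True Cons by auto
      have len: "length \<phi>s = Suc M" by (simp add: Cons M_def)
      define T where "T k n = tensor_map G (replicate (Suc M - k - n) id_factor @ [(d, k, \<theta> k)] @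
        replicate n id_factor) (tmult (ten1 x) t) \<phi>s" for k n
      define U where "U k n = tensor_map G (replicate (M - k - n) id_factor @ [(d, k, \<theta> k)] @
        replicate n id_factor) t \<psi>s" for k n
      \<comment> \<open>For n = Suc M - k no identity stands in front, so the operation acts on x
        and takes the first k functionals.\<close>
      have head: "T k (Suc M - k) = \<theta> k x (take k \<phi>s) * t (drop k \<phi>s)" if k: "1 \<le> k" "k \<le> Suc M" for k
      proof -
        have "pullback G (replicate (Suc M - k) id_factor) (drop k \<phi>s) = drop k \<phi>s"
          by (rule pullback_id) (use True len in \<open>auto intro: all_linear_drop\<close>)
        then show ?thesis
          using True len k qlinear_eval[OF \<theta>[OF k(1)]] by (simp add: T_def tensor_map_def tmult_ten1_Cons del: tmult_simps)
      qed
      \<comment> \<open>Otherwise an identity comes first, and removing it gives the same summand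
        for the shorter list.\<close>
      have tail: "T k n = ksgn (d * m) * f x * U k n" if k: "1 \<le> k" "k \<le> M" "n \<le> M - k" for k n
      proof -
        have e: "Suc M - k - n = Suc (M - k - n)" using k by auto
        have "qlinear (\<lambda>v. f (gsign G d v))" by (rule qlinear_comp[OF lin(1) qlinear_gsign])
        then show ?thesis
          using True lin k unfolding T_def U_def e
          by (simp add: tensor_map_def Cons pullback_id_Cons tmult_ten1_Cons M_def
              gsign_homog[OF x] qlinear_scale[OF lin(1)] del: tmult_simps)
      qed
      have "der G d \<theta> (tmult (ten1 x) t) \<phi>s = (\<Sum>k=1..Suc M. \<Sum>n=0..Suc M - k. T k n)"
        by (simp add: der_def T_def len)
      also have "\<dots> = (\<Sum>k=1..Suc M. T k (Suc M - k) + (\<Sum>n<Suc M - k. T k n))"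
        by (intro sum.cong refl) (simp add: atLeast0AtMost lessThan_Suc_atMost[symmetric])
      also have "\<dots> = (\<Sum>k=1..Suc M. T k (Suc M - k)) + (\<Sum>k=1..Suc M. \<Sum>n<Suc M - k. T k n)"
        by (rule sum.distrib)
      also have "(\<Sum>k=1..Suc M. \<Sum>n<Suc M - k. T k n) = (\<Sum>k=1..M. \<Sum>n<Suc M - k. T k n)"
        by simp
      also have "\<dots> = (\<Sum>k=1..M. \<Sum>n=0..M - k. ksgn (d * m) * f x * U k n)"
      proof (intro sum.cong)
        fix k n assume k: "k \<in> {1..M}"
        then show "{..<Suc M - k} = {0..M - k}" by auto
        assume "n \<in> {0..M - k}"
        then show "T k n = ksgn (d * m) * f x * U k n" using k by (intro tail) auto
      qed simp
      also have "\<dots> = ksgn (d * m) * tmult (ten1 x) (der G d \<theta> t) \<phi>s"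
        using lin by (simp add: Cons tmult_ten1_Cons der_def Let_def U_def M_def sum_distrib_left mult_ac del: tmult_simps)
      also have "(\<Sum>k=1..Suc M. T k (Suc M - k)) = (\<Sum>k=1..Suc M. letter \<theta> x (take k \<phi>s) * t (drop k \<phi>s))"
        using len by (intro sum.cong refl) (auto simp: head letter_def min_absorb2)
      \<comment> \<open>The term k = 0 may be added because \<open>letter\<close> vanishes on the
        empty list.\<close>
      also have "\<dots> = (\<Sum>k=0..Suc M. letter \<theta> x (take k \<phi>s) * t (drop k \<phi>s))"
        by (subst (2) sum.atLeast_Suc_atMost) (simp_all add: letter_def)
      also have "\<dots> = tmult (letter \<theta> x) t \<phi>s"
        by (simp add: tmult_def len atLeast0AtMost)
      finally show ?thesis by (simp add: tensor_apply)
    qed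
  qed
qed

lemma der_ten1:
  assumes "\<And>k. k \<ge> 1 \<Longrightarrow> qlinear (\<theta> k)" "\<And>k. k \<ge> 1 \<Longrightarrow> lin_supp (\<theta> k x)" "x \<in> G m"
  shows "der G d \<theta> (ten1 x) = letter \<theta> x"
proof -
  have "der G d \<theta> (tmult (ten1 x) (pure [])) =
      tmult (letter \<theta> x) (pure []) + ksgn (d * m) *\<^sub>Q tmult (ten1 x) (der G d \<theta> (pure []))"
    by (rule der_Cons) (use assms lin_supp_pure in auto)
  then show ?thesis by (simp add: der_Nil tmult_linear)
qed

definition letter_map :: "'c set \<Rightarrow> int \<Rightarrow> (nat \<Rightarrow> 'c \<Rightarrow> 'c tensor) \<Rightarrow> bool" where
  "letter_map V d \<theta> \<longleftrightarrow> (\<forall>k\<ge>1. qlinear (\<theta> k)) \<and>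
     (\<forall>k\<ge>1. \<forall>n. \<forall>x\<in>V \<inter> G n. \<theta> k x \<in> tensor_power G V k (n + d))"

lemma letter_map_lin: "letter_map V d \<theta> \<Longrightarrow> k \<ge> 1 \<Longrightarrow> qlinear (\<theta> k)"
  by (simp add: letter_map_def)

lemma letter_map_power:
  "letter_map V d \<theta> \<Longrightarrow> k \<ge> 1 \<Longrightarrow> x \<in> V \<Longrightarrow> x \<in> G n \<Longrightarrow> \<theta> k x \<in> tensor_power G V k (n + d)"
  by (simp add: letter_map_def)

lemma power_in_Tc: "t \<in> tensor_power G V k m \<Longrightarrow> t \<in> Tc G V m"
  by (rule lprod_member[OF length_family_tensor_power])

lemma letter_map_lin_supp:
  "letter_map V d \<theta> \<Longrightarrow> k \<ge> 1 \<Longrightarrow> x \<in> V \<Longrightarrow> x \<in> G n \<Longrightarrow> lin_supp (\<theta> k x)"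
  by (rule lin_supp_Tc, rule power_in_Tc, rule letter_map_power)

lemma len_part_letter: "k \<ge> 1 \<Longrightarrow> len_part k (letter \<theta> x) = len_part k (\<theta> k x)"
  by (auto simp: len_part_def letter_def fun_eq_iff tensor_apply)

lemma len_part_0_letter: "len_part 0 (letter \<theta> x) = 0"
  by (auto simp: len_part_def letter_def fun_eq_iff tensor_apply)

lemma letter_lprod:
  assumes "length_family K" "\<And>k. k \<ge> 1 \<Longrightarrow> \<theta> k x \<in> K k"
  shows "letter \<theta> x \<in> lprod K"
proof -
  have "len_part k (letter \<theta> x) \<in> K k" for k
  proof (cases "k = 0")
    case True
    then show ?thesis using Q.subspace_0[OF length_family_sub[OF assms(1)]] by (simp add: len_part_0_letter)
  next
    case False
    then have "k \<ge> 1" by simp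
    then show ?thesis using assms(2)[OF \<open>k \<ge> 1\<close>] by (simp add: len_part_letter length_family_len[OF assms(1)])
  qed
  then show ?thesis by (simp add: lprod_def)
qed

lemma letter_Tc: "letter_map V d \<theta> \<Longrightarrow> x \<in> V \<Longrightarrow> x \<in> G n \<Longrightarrow> letter \<theta> x \<in> Tc G V (n + d)"
  by (rule letter_lprod[OF length_family_tensor_power], rule letter_map_power)

context
  fixes V d \<theta>
  assumes lm: "letter_map V d \<theta>"
begin

lemma der_letter_Cons:
  assumes "x \<in> V" "x \<in> G m" "lin_supp t"
  shows "der G d \<theta> (tmult (ten1 x) t) =
    tmult (letter \<theta> x) t + ksgn (d * m) *\<^sub>Q tmult (ten1 x) (der G d \<theta> t)"
  using letter_map_lin[OF lm] letter_map_lin_supp[OF lm _ assms(1,2)] assms(2,3) by (rule der_Cons)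

lemma der_letter_pure:
  assumes "x \<in> V" "x \<in> G m"
  shows "der G d \<theta> (pure (x # xs)) =
    tmult (letter \<theta> x) (pure xs) + ksgn (d * m) *\<^sub>Q tmult (ten1 x) (der G d \<theta> (pure xs))"
  unfolding pure_Cons by (rule der_letter_Cons[OF assms lin_supp_pure])

lemma der_letter_ten1:
  assumes "x \<in> V" "x \<in> G m"
  shows "der G d \<theta> (ten1 x) = letter \<theta> x"
  using letter_map_lin[OF lm] letter_map_lin_supp[OF lm _ assms(1,2)] assms(2) by (rule der_ten1)

lemma der_pure_mem: "hword G V m xs \<Longrightarrow> der G d \<theta> (pure xs) \<in> Tc G V (m + d)"
proof (induction rule: hword.induct)
  case Nil
  then show ?case by (simp add: der_Nil Q.subspace_0[OF Tc_subspace])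
next
  case (Cons x n m xs)
  have "tmult (letter \<theta> x) (pure xs) \<in> Tc G V (n + m + d)"
    using tmult_Tc[OF letter_Tc[OF lm Cons(1,2)] pure_in_Tc[OF Cons(3)]] by (simp add: add_ac)
  moreover have "tmult (ten1 x) (der G d \<theta> (pure xs)) \<in> Tc G V (n + m + d)"
    using tmult_Tc[OF ten1_in_Tc[of x V G n] Cons(4)] Cons(1,2) by (simp add: add_ac)
  ultimately show ?case
    unfolding der_letter_pure[OF Cons(1,2)]
    by (intro qsubspace_add[OF Tc_subspace] qsubspace_scale[OF Tc_subspace])
qed

lemma der_Tc: "t \<in> Tc G V m \<Longrightarrow> der G d \<theta> t \<in> Tc G V (m + d)"
  by (rule filtered_Tc_mem[OF filtered_der length_family_tensor_power der_pure_mem])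

lemma der_Tca: "t \<in> Tca G V \<Longrightarrow> der G d \<theta> t \<in> Tca G V"
  by (rule filtered_Tca_mem[OF filtered_der length_family_tall])
    (use der_pure_mem Tc_subset_Tca in blast)+

text \<open>Induction on a word for s, moving one letter at a time across the product by
  associativity.\<close>

lemma der_tmult:
  assumes s: "s \<in> Tc G V m" and t: "lin_supp t"
  shows "der G d \<theta> (tmult s t) = tmult (der G d \<theta> s) t + ksgn (d * m) *\<^sub>Q tmult s (der G d \<theta> t)"
proof (rule filtered_Tc_eq[OF _ _ _ s])
  show "filtered (\<lambda>s. der G d \<theta> (tmult s t))"
    by (rule filtered_comp[OF filtered_der filtered_tmult_left])
  show "filtered (\<lambda>s. tmult (der G d \<theta> s) t + ksgn (d * m) *\<^sub>Q tmult s (der G d \<theta> t))"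
    by (intro filtered_plus filtered_cmult filtered_tmult_left filtered_comp[OF filtered_tmult_left filtered_der])
  fix xs assume "hword G V m xs"
  then show "der G d \<theta> (tmult (pure xs) t) =
    tmult (der G d \<theta> (pure xs)) t + ksgn (d * m) *\<^sub>Q tmult (pure xs) (der G d \<theta> t)"
  proof (induction rule: hword.induct)
    case Nil
    then show ?case by (simp add: der_Nil tmult_linear)
  next
    case (Cons x n m xs)
    have "der G d \<theta> (tmult (pure (x # xs)) t) = der G d \<theta> (tmult (ten1 x) (tmult (pure xs) t))"
      by (simp add: pure_Cons tmult_assoc)
    also have "\<dots> = tmult (letter \<theta> x) (tmult (pure xs) t) +
        ksgn (d * n) *\<^sub>Q tmult (ten1 x) (der G d \<theta> (tmult (pure xs) t))"
      by (rule der_letter_Cons) (use Cons lin_supp_tmult lin_supp_pure t in auto)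
    finally show ?case
      unfolding Cons.IH
      by (simp add: pure_Cons der_letter_Cons[OF Cons(1,2) lin_supp_pure] tmult_linear tmult_assoc
          Q.scale_right_distrib ksgn_add distrib_left add_ac)
  qed
qed

end

text \<open>The graded commutator of two derivations. For an odd derivation with itself it is twice
  the square.\<close>

definition dcomm :: "int \<Rightarrow> (nat \<Rightarrow> 'c \<Rightarrow> 'c tensor) \<Rightarrow> int \<Rightarrow> (nat \<Rightarrow> 'c \<Rightarrow> 'c tensor) \<Rightarrow>
    'c tensor \<Rightarrow> 'c tensor" where
  "dcomm d \<theta> e \<eta> t = der G d \<theta> (der G e \<eta> t) - ksgn (d * e) *\<^sub>Q der G e \<eta> (der G d \<theta> t)"

lemma filtered_dcomm: "filtered (dcomm d \<theta> e \<eta>)"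
  unfolding dcomm_def[abs_def]
  by (intro filtered_minus filtered_cmult filtered_comp[OF filtered_der filtered_der])

context
  fixes V d \<theta> e \<eta>
  assumes lm1: "letter_map V d \<theta>" and lm2: "letter_map V e \<eta>"
begin

text \<open>The mixed terms, in which the two derivations act on different factors, cancel by the
  sign in the commutator. The commutator is therefore again a derivation, of degree d + e.\<close>

lemma dcomm_tmult:
  assumes s: "s \<in> Tc G V m" and t: "t \<in> Tca G V"
  shows "dcomm d \<theta> e \<eta> (tmult s t) = tmult (dcomm d \<theta> e \<eta> s) t + ksgn ((d + e) * m) *\<^sub>Q tmult s (dcomm d \<theta> e \<eta> t)"
proof -
  note l1 = lin_supp_Tca[OF t] lin_supp_Tca[OF der_Tca[OF lm1 t]] lin_supp_Tca[OF der_Tca[OF lm2 t]]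
  have 1: "der G d \<theta> (der G e \<eta> (tmult s t)) = tmult (der G d \<theta> (der G e \<eta> s)) t
     + ksgn (d * (m + e)) *\<^sub>Q tmult (der G e \<eta> s) (der G d \<theta> t)
     + ksgn (e * m) *\<^sub>Q tmult (der G d \<theta> s) (der G e \<eta> t)
     + ksgn ((d + e) * m) *\<^sub>Q tmult s (der G d \<theta> (der G e \<eta> t))"
    by (simp add: der_tmult[OF lm2 s] der_tmult[OF lm1 s] der_tmult[OF lm1 der_Tc[OF lm2 s]] l1
        qlinear_add[OF filtered_qlinear[OF filtered_der]] qlinear_scale[OF filtered_qlinear[OF filtered_der]]
        Q.scale_right_distrib ksgn_add distrib_right distrib_left mult_ac add_ac)
  have 2: "der G e \<eta> (der G d \<theta> (tmult s t)) = tmult (der G e \<eta> (der G d \<theta> s)) t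
     + ksgn (e * (m + d)) *\<^sub>Q tmult (der G d \<theta> s) (der G e \<eta> t)
     + ksgn (d * m) *\<^sub>Q tmult (der G e \<eta> s) (der G d \<theta> t)
     + ksgn ((d + e) * m) *\<^sub>Q tmult s (der G e \<eta> (der G d \<theta> t))"
    by (simp add: der_tmult[OF lm2 s] der_tmult[OF lm1 s] der_tmult[OF lm2 der_Tc[OF lm1 s]] l1
        qlinear_add[OF filtered_qlinear[OF filtered_der]] qlinear_scale[OF filtered_qlinear[OF filtered_der]]
        Q.scale_right_distrib ksgn_add distrib_right distrib_left mult_ac add_ac)
  show ?thesis unfolding dcomm_def 1 2
    by (simp add: tmult_linear Q.scale_right_distrib Q.scale_right_diff_distrib ksgn_add distrib_left
        distrib_right mult_ac)
qed

text \<open>A derivation that vanishes on letters vanishes on words, hence on the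
  completion.\<close>

lemma dcomm_eq_0:
  assumes "\<And>n x. x \<in> V \<Longrightarrow> x \<in> G n \<Longrightarrow> dcomm d \<theta> e \<eta> (ten1 x) = 0" and t: "t \<in> Tca G V"
  shows "dcomm d \<theta> e \<eta> t = 0"
proof (rule filtered_Tca_eq[OF filtered_dcomm filtered_zero _ t])
  fix m xs assume "hword G V m xs"
  then show "dcomm d \<theta> e \<eta> (pure xs) = 0"
  proof (induction rule: hword.induct)
    case Nil
    then show ?case
      by (simp add: dcomm_def der_Nil qlinear_0[OF filtered_qlinear[OF filtered_der]])
  next
    case (Cons x n m xs)
    have "pure xs \<in> Tca G V" using Cons(3) pure_in_Tc Tc_subset_Tca by blast
    then show ?case
      using Cons assms(1) ten1_in_Tc[of x V G n, OF Cons(1,2)]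
      by (simp add: pure_Cons dcomm_tmult tmult_linear)
  qed
qed

end

end

lemmas der_linear = qlinear_add[OF filtered_qlinear[OF filtered_der]]
  qlinear_scale[OF filtered_qlinear[OF filtered_der]] qlinear_0[OF filtered_qlinear[OF filtered_der]]
  qlinear_neg[OF filtered_qlinear[OF filtered_der]] qlinear_diff[OF filtered_qlinear[OF filtered_der]]

text \<open>The algebra map with value \<open>\<gamma> x\<close> on the letter \<open>x\<close>: the functionals are cut into consecutive
  non-empty blocks, one for each letter.\<close>

function alg :: "('c \<Rightarrow> 'c tensor) \<Rightarrow> 'c tensor \<Rightarrow> 'c tensor" where
  "alg \<gamma> t \<phi>s =
     (if \<phi>s = [] then t []
      else \<Sum>i=1..length \<phi>s. alg \<gamma> (\<lambda>\<psi>s. t ((\<lambda>v. \<gamma> v (take i \<phi>s)) # \<psi>s)) (drop i \<phi>s))"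
  by pat_completeness auto
termination
  by (relation "measure (\<lambda>(\<gamma>, t, \<phi>s). length \<phi>s)") auto

declare alg.simps [simp del]

lemma alg_apply_Nil [simp]: "alg \<gamma> t [] = t []"
  by (simp add: alg.simps)

lemma alg_add: "alg \<gamma> (s + t) \<phi>s = alg \<gamma> s \<phi>s + alg \<gamma> t \<phi>s"
proof (induction "length \<phi>s" arbitrary: s t \<phi>s rule: less_induct)
  case less
  show ?case
  proof (cases "\<phi>s = []")
    case False
    have "alg \<gamma> (\<lambda>\<psi>s. (s + t) ((\<lambda>v. \<gamma> v (take i \<phi>s)) # \<psi>s)) (drop i \<phi>s) =
       alg \<gamma> (\<lambda>\<psi>s. s ((\<lambda>v. \<gamma> v (take i \<phi>s)) # \<psi>s)) (drop i \<phi>s) +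
       alg \<gamma> (\<lambda>\<psi>s. t ((\<lambda>v. \<gamma> v (take i \<phi>s)) # \<psi>s)) (drop i \<phi>s)" if "i \<in> {1..length \<phi>s}" for i
      using that False by (subst less[symmetric]) (auto simp: plus_fun_def)
    then show ?thesis
      using False by (simp add: alg.simps[of _ _ \<phi>s] sum.distrib)
  qed (simp add: tensor_apply)
qed

lemma alg_scale: "alg \<gamma> (a *\<^sub>Q t) \<phi>s = a * alg \<gamma> t \<phi>s"
proof (induction "length \<phi>s" arbitrary: t \<phi>s rule: less_induct)
  case less
  show ?case
  proof (cases "\<phi>s = []")
    case False
    have "alg \<gamma> (\<lambda>\<psi>s. (a *\<^sub>Q t) ((\<lambda>v. \<gamma> v (take i \<phi>s)) # \<psi>s)) (drop i \<phi>s) =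
       a * alg \<gamma> (\<lambda>\<psi>s. t ((\<lambda>v. \<gamma> v (take i \<phi>s)) # \<psi>s)) (drop i \<phi>s)" if "i \<in> {1..length \<phi>s}" for i
      using that False by (subst less[symmetric]) (auto simp: qscale_fun_def)
    then show ?thesis
      using False by (simp add: alg.simps[of _ _ \<phi>s] sum_distrib_left)
  qed (simp add: tensor_apply)
qed

lemma alg_vanish: "(\<And>\<psi>s. length \<psi>s \<le> length \<phi>s \<Longrightarrow> t \<psi>s = 0) \<Longrightarrow> alg \<gamma> t \<phi>s = 0"
proof (induction "length \<phi>s" arbitrary: t \<phi>s rule: less_induct)
  case less
  show ?case
  proof (cases "\<phi>s = []")
    case True
    then show ?thesis using less.prems by simp
  next
    case False
    have "alg \<gamma> (\<lambda>\<psi>s. t ((\<lambda>v. \<gamma> v (take i \<phi>s)) # \<psi>s)) (drop i \<phi>s) = 0" if "i \<in> {1..length \<phi>s}" for i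
      using that False by (intro less.hyps less.prems) auto
    then show ?thesis
      using False by (simp add: alg.simps[of _ _ \<phi>s])
  qed
qed

lemma filtered_alg: "filtered (alg \<gamma>)"
  by (rule filteredI) (auto simp: fun_eq_iff alg_add alg_scale tensor_apply intro: alg_vanish)

lemmas alg_linear = qlinear_add[OF filtered_qlinear[OF filtered_alg]]
  qlinear_scale[OF filtered_qlinear[OF filtered_alg]] qlinear_0[OF filtered_qlinear[OF filtered_alg]]
  qlinear_neg[OF filtered_qlinear[OF filtered_alg]] qlinear_diff[OF filtered_qlinear[OF filtered_alg]]

lemma alg_Nil: "alg \<gamma> (pure []) = pure []"
proof
  fix \<phi>s
  have "(\<lambda>\<psi>s. pure [] ((\<lambda>v. \<gamma> v (take i \<phi>s)) # \<psi>s)) = 0" for i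
    by (simp add: fun_eq_iff tensor_apply)
  then show "alg \<gamma> (pure []) \<phi>s = pure [] \<phi>s"
    by (cases \<phi>s) (simp_all add: alg.simps[of _ _ "_ # _"] alg_linear tensor_apply)
qed

lemma alg_Cons:
  assumes "qlinear \<gamma>" "\<gamma> x [] = 0"
  shows "alg \<gamma> (tmult (ten1 x) t) = tmult (\<gamma> x) (alg \<gamma> t)"
proof
  fix \<phi>s
  show "alg \<gamma> (tmult (ten1 x) t) \<phi>s = tmult (\<gamma> x) (alg \<gamma> t) \<phi>s"
  proof (cases "\<phi>s = []")
    case False
    have "(\<lambda>\<psi>s. tmult (ten1 x) t ((\<lambda>v. \<gamma> v (take i \<phi>s)) # \<psi>s)) = \<gamma> x (take i \<phi>s) *\<^sub>Q t" for i
      by (simp add: fun_eq_iff tmult_ten1_Cons qlinear_eval[OF assms(1)] tensor_apply del: tmult_simps)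
    then have "alg \<gamma> (tmult (ten1 x) t) \<phi>s = (\<Sum>i=1..length \<phi>s. \<gamma> x (take i \<phi>s) * alg \<gamma> t (drop i \<phi>s))"
      using False by (simp only: alg.simps[of _ _ \<phi>s] alg_scale if_False)
    \<comment> \<open>An empty first block contributes nothing since \<gamma> x [] = 0, so the sum
      is extended to the one in \<open>tmult\<close>.\<close>
    also have "\<dots> = (\<Sum>i=0..length \<phi>s. \<gamma> x (take i \<phi>s) * alg \<gamma> t (drop i \<phi>s))"
      by (subst (2) sum.atLeast_Suc_atMost) (simp_all add: assms)
    finally show ?thesis by (simp add: tmult_def atLeast0AtMost)
  qed (simp add: assms)
qed

lemma alg_pure_Cons: "qlinear \<gamma> \<Longrightarrow> \<gamma> x [] = 0 \<Longrightarrow> alg \<gamma> (pure (x # xs)) = tmult (\<gamma> x) (alg \<gamma> (pure xs))"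
  by (simp add: pure_Cons alg_Cons)

lemma alg_ten1: "qlinear \<gamma> \<Longrightarrow> \<gamma> x [] = 0 \<Longrightarrow> alg \<gamma> (ten1 x) = \<gamma> x"
  unfolding ten1_def by (simp add: alg_pure_Cons alg_Nil)

lemma alg_tmult:
  assumes \<gamma>: "qlinear \<gamma>" "\<And>x. \<gamma> x [] = 0" and s: "s \<in> Tca G V"
  shows "alg \<gamma> (tmult s t) = tmult (alg \<gamma> s) (alg \<gamma> t)"
proof (rule filtered_Tca_eq[OF _ _ _ s])
  show "filtered (\<lambda>s. alg \<gamma> (tmult s t))"
    by (rule filtered_comp[OF filtered_alg filtered_tmult_left])
  show "filtered (\<lambda>s. tmult (alg \<gamma> s) (alg \<gamma> t))"
    by (rule filtered_comp[OF filtered_tmult_left filtered_alg])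
  fix m xs assume "hword G V m xs"
  show "alg \<gamma> (tmult (pure xs) t) = tmult (alg \<gamma> (pure xs)) (alg \<gamma> t)"
    by (induction xs) (simp_all add: alg_Nil pure_Cons tmult_assoc alg_Cons \<gamma>)
qed

lemma alg_Tc:
  assumes \<gamma>: "qlinear \<gamma>" "\<And>x. \<gamma> x [] = 0" and W: "\<And>n x. x \<in> V \<Longrightarrow> x \<in> G n \<Longrightarrow> \<gamma> x \<in> Tc G W n"
  shows "t \<in> Tc G V m \<Longrightarrow> alg \<gamma> t \<in> Tc G W m"
    and "t \<in> Tca G V \<Longrightarrow> alg \<gamma> t \<in> Tca G W"
proof -
  have *: "alg \<gamma> (pure xs) \<in> Tc G W m" if "hword G V m xs" for m xs
    using that
  proof (induction rule: hword.induct)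
    case Nil
    then show ?case by (simp add: alg_Nil pure_in_Tc hword.Nil)
  next
    case (Cons x n m xs)
    then show ?case by (simp add: alg_pure_Cons \<gamma> tmult_Tc W)
  qed
  show "t \<in> Tc G V m \<Longrightarrow> alg \<gamma> t \<in> Tc G W m"
    by (rule filtered_Tc_mem[OF filtered_alg length_family_tensor_power *])
  show "t \<in> Tca G V \<Longrightarrow> alg \<gamma> t \<in> Tca G W"
    by (rule filtered_Tca_mem[OF filtered_alg length_family_tall]) (use * Tc_subset_Tca in blast)+
qed

section \<open>Free Lie algebras\<close>

lemma tbracket_linear:
  "tbracket m n (s + s') t = tbracket m n s t + tbracket m n s' t"
  "tbracket m n s (t + t') = tbracket m n s t + tbracket m n s t'"
  "tbracket m n (a *\<^sub>Q s) t = a *\<^sub>Q tbracket m n s t"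
  "tbracket m n s (a *\<^sub>Q t) = a *\<^sub>Q tbracket m n s t"
  "tbracket m n 0 t = 0" "tbracket m n s 0 = 0"
  by (simp_all add: tbracket_def tmult_linear Q.scale_right_distrib Q.scale_right_diff_distrib mult.commute)

lemma filtered_tbracket_left: "filtered (\<lambda>s. tbracket m n s t)"
  unfolding tbracket_def
  by (intro filtered_minus filtered_cmult filtered_tmult_left filtered_tmult_right)

lemma filtered_tbracket_right: "filtered (tbracket m n s)"
  unfolding tbracket_def[abs_def]
  by (intro filtered_minus filtered_cmult filtered_tmult_left filtered_tmult_right)

lemma tbracket_antisym: "tbracket m n s t = - (ksgn (m * n) *\<^sub>Q tbracket n m t s)"
  by (simp add: tbracket_def Q.scale_right_diff_distrib mult.commute)

lemma tbracket_jacobi: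
  "tbracket l (m + n) s (tbracket m n t w) = tbracket (l + m) n (tbracket l m s t) w +
    ksgn (l * m) *\<^sub>Q tbracket m (l + n) t (tbracket l n s w)"
proof -
  \<comment> \<open>All signs are products of these three, each of square one. Once they are named,
    only associativity and ring arithmetic remain.\<close>
  define a b c where "a = ksgn (l * m)" "b = ksgn (m * n)" "c = ksgn (l * n)"
  have sq: "a * a = 1" "b * b = 1" "c * c = 1" by (simp_all add: a_b_c_def)
  have k: "ksgn (l * (m + n)) = a * c" "ksgn ((l + m) * n) = b * c" "ksgn (m * (l + n)) = a * b"
    by (auto simp: a_b_c_def ksgn_def)
  have sq': "a * (a * x) = x" "a * (b * (a * x)) = b * x" "a * (a * b * x) = b * x" for x
    using sq by (metis mult.assoc mult.commute mult_1)+
  show ?thesis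
    unfolding tbracket_def k a_b_c_def(2,3)[symmetric] a_b_c_def(1)[symmetric]
    by (simp only: tmult_linear tmult_assoc Q.scale_right_diff_distrib Q.scale_scale)
      (simp add: sq' sq algebra_simps)
qed

definition lie_family :: "(int \<Rightarrow> 'c::rat_vector set) \<Rightarrow> 'c set \<Rightarrow> int \<Rightarrow> nat \<Rightarrow> 'c tensor set" where
  "lie_family G V m k = {t. (k, m, t) \<in> lie_words G V}"

abbreviation Lc :: "(int \<Rightarrow> 'c::rat_vector set) \<Rightarrow> 'c set \<Rightarrow> int \<Rightarrow> 'c tensor set" where
  "Lc G V m \<equiv> lprod (lie_family G V m)"

section \<open>Lie words and their completion\<close>

lemma lie_words_scale: "(k, m, s) \<in> lie_words G V \<Longrightarrow> (k, m, a *\<^sub>Q s) \<in> lie_words G V"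
  using lie_words.comb[of k m s G V s a 0] by simp

lemma lie_words_add: "(k, m, s) \<in> lie_words G V \<Longrightarrow> (k, m, t) \<in> lie_words G V \<Longrightarrow> (k, m, s + t) \<in> lie_words G V"
  using lie_words.comb[of k m s G V t 1 1] by simp

lemma qsubspace_lie_family: "qsubspace (lie_family G V m k)"
  unfolding lie_family_def
  by (rule qsubspaceI) (auto intro: lie_words.zero lie_words_add lie_words_scale)

lemma tensor_power_tmult:
  assumes "s \<in> tensor_power G V k m" "t \<in> tensor_power G V l n"
  shows "tmult s t \<in> tensor_power G V (k + l) (m + n)"
proof -
  have 1: "len_part k s = s" "len_part l t = t"
    using assms length_family_len[OF length_family_tensor_power] by fastforce+
  have "tmult s t \<in> Tc G V (m + n)"
    using assms by (intro tmult_Tc lprod_member[OF length_family_tensor_power])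
  then have "len_part (k + l) (tmult s t) \<in> tensor_power G V (k + l) (m + n)" by (rule lprodD)
  then show ?thesis by (simp add: len_part_tmult_homog[OF 1])
qed

lemmas tensor_power_subspace = length_family_sub[OF length_family_tensor_power]

lemma lie_words_power: "(k, m, t) \<in> lie_words G V \<Longrightarrow> t \<in> tensor_power G V k m"
proof (induction k m t rule: lie_words.induct)
  case (gen x m)
  then show ?case using pure_in_power[OF hword_single[of x V G m]] by (simp add: ten1_def)
next
  case (zero k m)
  then show ?case by (rule Q.subspace_0[OF tensor_power_subspace])
next
  case (comb k m s t a b)
  then show ?case
    by (intro qsubspace_add[OF tensor_power_subspace] qsubspace_scale[OF tensor_power_subspace])
next
  case (brac k m s l n t)
  then have "tmult s t \<in> tensor_power G V (k + l) (m + n)" "tmult t s \<in> tensor_power G V (k + l) (m + n)"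
    using tensor_power_tmult[of s G V k m t l n] tensor_power_tmult[of t G V l n s k m] by (simp_all add: add.commute)
  then show ?case unfolding tbracket_def
    by (intro Q.subspace_diff[OF tensor_power_subspace] qsubspace_scale[OF tensor_power_subspace])
qed

lemma length_family_lie: "length_family (lie_family G V m)"
  unfolding length_family_def
  using qsubspace_lie_family lie_words_power length_family_len[OF length_family_tensor_power]
  by (fastforce simp: lie_family_def)

lemmas Lc_subspace = lprod_subspace[OF length_family_lie]

lemma lie_words_0: "(k, m, t) \<in> lie_words G V \<Longrightarrow> k = 0 \<Longrightarrow> t = 0"
  by (induction k m t rule: lie_words.induct) (auto simp: tbracket_linear)

lemma lie_words_Lc: "(k, m, t) \<in> lie_words G V \<Longrightarrow> t \<in> Lc G V m"
  by (rule lprod_member[OF length_family_lie]) (simp add: lie_family_def)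

lemma Lc_subset_Tc: "Lc G V m \<subseteq> Tc G V m"
  by (rule lprod_mono) (auto simp: lie_family_def lie_words_power)

lemma lie_words_mono: "(k, m, t) \<in> lie_words G V \<Longrightarrow> V \<subseteq> V' \<Longrightarrow> (k, m, t) \<in> lie_words G V'"
proof (induction k m t rule: lie_words.induct)
  case (gen x m)
  then show ?case by (intro lie_words.gen) auto
qed (simp_all add: lie_words.zero lie_words.comb lie_words.brac)

lemma len_part_0_Lc: "t \<in> Lc G V m \<Longrightarrow> len_part 0 t = 0"
  using lprodD[of t "lie_family G V m" 0] lie_words_0[OF _ refl] by (auto simp: lie_family_def)

text \<open>Every Lie word of length 0 is zero, so the length bound 1 is automatic.\<close>

lemma complete_free_lie_1: "complete_free_lie G V 1 m = Lc G V m"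
  using len_part_0_Lc[of _ G V m] by (auto simp: complete_free_lie_def lprod_def lie_family_def)

lemma complete_free_lie_alt: "complete_free_lie G V r m = {t \<in> Lc G V m. \<forall>k<r. len_part k t = 0}"
  by (auto simp: complete_free_lie_def lprod_def lie_family_def)

lemma ten1_in_Lc: "x \<in> V \<Longrightarrow> x \<in> G m \<Longrightarrow> ten1 x \<in> Lc G V m"
  by (rule lie_words_Lc, rule lie_words.gen) simp

lemma tbracket_Lc:
  assumes s: "s \<in> Lc G V m" and t: "t \<in> Lc G V n" shows "tbracket m n s t \<in> Lc G V (m + n)"
proof (rule filtered_lprod_mem[OF filtered_tbracket_left length_family_lie _ s])
  fix k s assume s: "s \<in> lie_family G V m k"
  show "tbracket m n s t \<in> Lc G V (m + n)"
  proof (rule filtered_lprod_mem[OF filtered_tbracket_right length_family_lie _ t])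
    fix l t assume "t \<in> lie_family G V n l"
    then have "(k + l, m + n, tbracket m n s t) \<in> lie_words G V"
      using s by (simp add: lie_family_def lie_words.brac)
    then show "tbracket m n s t \<in> Lc G V (m + n)" by (rule lie_words_Lc)
  qed
qed

text \<open>Induction over Lie words. Membership of the word itself is carried along, because a
  derivation applied to a bracket also leaves factors untouched.\<close>

lemma filtered_Lc_mem:
  assumes F: "filtered F"
    and gen: "\<And>n x. x \<in> V \<Longrightarrow> x \<in> G n \<Longrightarrow> F (ten1 x) \<in> Lc G W (n + d)"
    and brac: "\<And>m n s t. s \<in> Lc G V m \<Longrightarrow> t \<in> Lc G V n \<Longrightarrow> F s \<in> Lc G W (m + d) \<Longrightarrow> F t \<in> Lc G W (n + d) \<Longrightarrow>
      F (tbracket m n s t) \<in> Lc G W (m + n + d)"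
    and t: "t \<in> Lc G V m"
  shows "F t \<in> Lc G W (m + d)"
proof (rule filtered_lprod_mem[OF F length_family_lie _ t])
  have *: "(k, m, s) \<in> lie_words G V \<Longrightarrow> s \<in> Lc G V m \<and> F s \<in> Lc G W (m + d)" for k m s
  proof (induction k m s rule: lie_words.induct)
    case (gen x m)
    then show ?case using assms(2)[of x] ten1_in_Lc[of x V G] by simp
  next
    case (zero k m)
    then show ?case by (simp add: qlinear_0[OF filtered_qlinear[OF F]] Q.subspace_0[OF Lc_subspace])
  next
    case (comb k m s t a b)
    then show ?case
      by (simp add: qlinear_add[OF filtered_qlinear[OF F]] qlinear_scale[OF filtered_qlinear[OF F]]
          Q.subspace_add[OF Lc_subspace] Q.subspace_scale[OF Lc_subspace])
  next
    case (brac k m s l n t)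
    then show ?case using assms(3)[of s m t n] tbracket_Lc by blast
  qed
  show "s \<in> lie_family G V m k \<Longrightarrow> F s \<in> Lc G W (m + d)" for k s
    using * by (simp add: lie_family_def)
qed

context grading
begin

lemma der_tbracket:
  assumes lm: "letter_map V d \<theta>" and s: "s \<in> Tc G V m" and t: "t \<in> Tc G V n"
  shows "der G d \<theta> (tbracket m n s t) = tbracket (m + d) n (der G d \<theta> s) t +
    ksgn (d * m) *\<^sub>Q tbracket m (n + d) s (der G d \<theta> t)"
proof -
  have "ksgn (d * m) * ksgn (m * (n + d)) = ksgn (m * n)"
    "ksgn ((m + d) * n) = ksgn (m * n) * ksgn (d * n)"
    by (auto simp: ksgn_def)
  then show ?thesis
    unfolding tbracket_def der_linear der_tmult[OF lm s lin_supp_Tc[OF t]] der_tmult[OF lm t lin_supp_Tc[OF s]]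
    by (simp add: Q.scale_right_diff_distrib Q.scale_right_distrib)
qed

lemma der_Lc:
  assumes lm: "letter_map V d \<theta>"
    and gen: "\<And>n x. x \<in> V \<Longrightarrow> x \<in> G n \<Longrightarrow> letter \<theta> x \<in> Lc G V (n + d)" and t: "t \<in> Lc G V m"
  shows "der G d \<theta> t \<in> Lc G V (m + d)"
proof (rule filtered_Lc_mem[OF filtered_der _ _ t])
  show "der G d \<theta> (ten1 x) \<in> Lc G V (n + d)" if "x \<in> V" "x \<in> G n" for n x
    using that by (simp add: der_letter_ten1[OF lm] gen)
  fix m n s t
  assume *: "s \<in> Lc G V m" "t \<in> Lc G V n" "der G d \<theta> s \<in> Lc G V (m + d)" "der G d \<theta> t \<in> Lc G V (n + d)"
  have "tbracket (m + d) n (der G d \<theta> s) t \<in> Lc G V (m + n + d)"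
    using tbracket_Lc[OF *(3,2)] by (simp add: add_ac)
  moreover have "tbracket m (n + d) s (der G d \<theta> t) \<in> Lc G V (m + n + d)"
    using tbracket_Lc[OF *(1,4)] by (simp add: add_ac)
  moreover have "s \<in> Tc G V m" "t \<in> Tc G V n" using * Lc_subset_Tc by blast+
  ultimately show "der G d \<theta> (tbracket m n s t) \<in> Lc G V (m + n + d)"
    by (simp add: der_tbracket[OF lm] Q.subspace_add[OF Lc_subspace] Q.subspace_scale[OF Lc_subspace])
qed

lemma alg_tbracket:
  assumes "qlinear \<gamma>" "\<And>x. \<gamma> x [] = 0" "s \<in> Tca G V" "t \<in> Tca G V"
  shows "alg \<gamma> (tbracket m n s t) = tbracket m n (alg \<gamma> s) (alg \<gamma> t)"
  unfolding tbracket_def by (simp add: alg_linear alg_tmult[OF assms(1,2,3)] alg_tmult[OF assms(1,2,4)])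

lemma alg_Lc:
  assumes "qlinear \<gamma>" "\<And>x. \<gamma> x [] = 0"
    and gen: "\<And>n x. x \<in> V \<Longrightarrow> x \<in> G n \<Longrightarrow> \<gamma> x \<in> Lc G W n" and t: "t \<in> Lc G V m"
  shows "alg \<gamma> t \<in> Lc G W m"
proof -
  have "alg \<gamma> t \<in> Lc G W (m + 0)"
  proof (rule filtered_Lc_mem[OF filtered_alg _ _ t])
    fix m n s t assume *: "s \<in> Lc G V m" "t \<in> Lc G V n" "alg \<gamma> s \<in> Lc G W (m + 0)" "alg \<gamma> t \<in> Lc G W (n + 0)"
    have "s \<in> Tca G V" "t \<in> Tca G V" using * Lc_subset_Tc Tc_subset_Tca by blast+
    then show "alg \<gamma> (tbracket m n s t) \<in> Lc G W (m + n + 0)"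
      using * by (simp add: alg_tbracket[OF assms(1,2)] tbracket_Lc)
  qed (simp add: alg_ten1 assms)
  then show ?thesis by simp
qed

text \<open>The bracket axioms are formal for commutators in an associative algebra. The square of
  the differential is half its self-commutator, hence determined by its values on letters.\<close>

lemma is_dgl_free:
  assumes lm: "letter_map V (-1) \<theta>"
    and gen: "\<And>n x. x \<in> V \<Longrightarrow> x \<in> G n \<Longrightarrow> letter \<theta> x \<in> Lc G V (n - 1)"
    and sq: "\<And>n x. x \<in> V \<Longrightarrow> x \<in> G n \<Longrightarrow> der G (-1) \<theta> (der G (-1) \<theta> (ten1 x)) = 0"
  shows "is_dgl \<lparr>part = Lc G V, bracket = tbracket, bdry = der G (-1) \<theta>\<rparr>"
    and "\<And>t. t \<in> Tca G V \<Longrightarrow> der G (-1) \<theta> (der G (-1) \<theta> t) = 0"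
proof -
  have comm: "dcomm (-1) \<theta> (-1) \<theta> t = der G (-1) \<theta> (der G (-1) \<theta> t) + der G (-1) \<theta> (der G (-1) \<theta> t)" for t
    by (simp add: dcomm_def)
  show sq': "der G (-1) \<theta> (der G (-1) \<theta> t) = 0" if "t \<in> Tca G V" for t
  proof -
    have "dcomm (-1) \<theta> (-1) \<theta> t = 0"
      by (rule dcomm_eq_0[OF lm lm _ that]) (simp add: comm sq)
    then show ?thesis unfolding comm by (rule qscale_double)
  qed
  have L: "s \<in> Lc G V m \<Longrightarrow> s \<in> Tc G V m" "s \<in> Lc G V m \<Longrightarrow> s \<in> Tca G V" for s m
    using Lc_subset_Tc Tc_subset_Tca by blast+
  have "der G (-1) \<theta> t \<in> Lc G V (m - 1)" if "t \<in> Lc G V m" for t m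
    using der_Lc[OF lm _ that] gen by simp
  moreover have "der G (-1) \<theta> (tbracket m n s t) = tbracket (m - 1) n (der G (-1) \<theta> s) t +
     ksgn m *\<^sub>Q tbracket m (n - 1) s (der G (-1) \<theta> t)"
    if "s \<in> Lc G V m" "t \<in> Lc G V n" for s t m n
    using der_tbracket[OF lm L(1)[OF that(1)] L(1)[OF that(2)]] by simp
  ultimately show "is_dgl \<lparr>part = Lc G V, bracket = tbracket, bdry = der G (-1) \<theta>\<rparr>"
    unfolding is_dgl_def dgl.simps
    by (intro conjI allI ballI tbracket_antisym tbracket_jacobi)
      (simp_all add: Lc_subspace tbracket_Lc tbracket_linear der_linear sq' L)
qed

end

text \<open>The sign e treats positive and negative degrees together: up to e, nonzero letters have
  degree at least 1, so a nonzero word of length k has degree at least k. If a bracket violates this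
  bound, one of its factors does.\<close>

lemma lie_words_bounded:
  assumes "is_grading G" "e = 1 \<or> e = -1" "\<And>n. e * n \<le> 0 \<Longrightarrow> V \<inter> G n \<subseteq> {0}"
  shows "(k, m, t) \<in> lie_words G V \<Longrightarrow> e * m < int k \<Longrightarrow> t = 0"
proof (induction k m t rule: lie_words.induct)
  case (gen x m)
  then have "e * m \<le> 0" by simp
  then show ?case using assms(3)[of m] gen by auto
next
  case (comb k m s t a b)
  then show ?case by simp
next
  case (brac k m s l n t)
  then have "e * m < int k \<or> e * n < int l" by (auto simp: distrib_left)
  then show ?case using brac by (auto simp: tbracket_linear)
qed simp

lemma free_lie_subset: "free_lie G V r m \<subseteq> complete_free_lie G V r m"
proof -
  have sub: "qsubspace (complete_free_lie G V r m)"
    using Q.subspace_0[OF Lc_subspace[of G V m]] Q.subspace_add[OF Lc_subspace[of G V m]]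
      Q.subspace_scale[OF Lc_subspace[of G V m]]
    by (intro qsubspaceI) (simp_all add: complete_free_lie_alt len_part_linear)
  have "t \<in> complete_free_lie G V r m" if t: "(k, m, t) \<in> lie_words G V" and k: "k \<ge> r" for k t
  proof -
    have "len_part j t = (if j = k then t else 0)" for j
      using t by (intro length_family_len[OF length_family_lie]) (simp add: lie_family_def)
    then show ?thesis using k lie_words_Lc[OF t] by (simp add: complete_free_lie_alt)
  qed
  then show ?thesis
    unfolding free_lie_def by (intro Q.span_minimal[OF _ sub]) blast
qed

lemma bounded_length_sum:
  fixes t :: "'c::rat_vector tensor"
  assumes "\<And>k. k > N \<Longrightarrow> len_part k t = 0"
  shows "t = (\<Sum>k\<le>N. len_part k t)"
proof (rule len_part_eqI)
  show "len_part k t = len_part k (\<Sum>k\<le>N. len_part k t)" for k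
    using assms[of k] unfolding len_part_trunc by (cases "k \<le> N") auto
qed

lemma free_lie_eq_complete:
  assumes "is_grading G" "e = 1 \<or> e = -1" "\<And>n. e * n \<le> 0 \<Longrightarrow> V \<inter> G n \<subseteq> {0}"
  shows "free_lie G V r m = complete_free_lie G V r m"
proof (rule antisym[OF free_lie_subset], rule subsetI)
  fix t assume t: "t \<in> complete_free_lie G V r m"
  \<comment> \<open>An upper bound for the length of a nonzero Lie word of degree m, by
    \<open>lie_words_bounded\<close>. Hence t has finitely many components.\<close>
  define N where "N = nat (e * m)"
  have l: "(k, m, len_part k t) \<in> lie_words G V" for k
    using t by (simp add: complete_free_lie_def)
  have "len_part k t = 0" if "k > N" for k
  proof (rule lie_words_bounded[OF assms l])
    show "e * m < int k" using that by (simp add: N_def)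
  qed
  then have eq: "t = (\<Sum>k\<le>N. len_part k t)" by (rule bounded_length_sum)
  have "len_part k t \<in> free_lie G V r m" for k
  proof (cases "k < r")
    case True
    then show ?thesis using t by (simp add: complete_free_lie_def free_lie_def Q.span_zero)
  next
    case False
    then have "len_part k t \<in> {t. \<exists>k\<ge>r. (k, m, t) \<in> lie_words G V}"
      using l[of k] by (intro CollectI exI[of _ k]) simp
    then show ?thesis unfolding free_lie_def by (rule Q.span_base)
  qed
  then have "(\<Sum>k\<le>N. len_part k t) \<in> free_lie G V r m"
    unfolding free_lie_def by (rule Q.span_sum)
  then show "t \<in> free_lie G V r m" by (simp only: eq[symmetric])
qed

section \<open>Desuspension and the relations of an \<open>A\<^sub>\<infinity>\<close>-coalgebra\<close>

context grading
begin

section \<open>Tensor products of maps on words\<close>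

lemma tensor_map_Nil: "tensor_map G [] (pure []) = pure []"
  by (auto simp: tensor_map_def fun_eq_iff pure_Nil)

text \<open>The sign comes from moving all operations that stand to the right of f past x.\<close>

lemma tensor_map_Cons:
  assumes f: "qlinear f" and x: "x \<in> G n" and len: "len_part k (f x) = f x" and lin: "lin_supp (f x)"
  shows "tensor_map G ((d, k, f) # fs) (tmult (ten1 x) t) =
    ksgn (sum_list (map fst fs) * n) *\<^sub>Q tmult (f x) (tensor_map G fs t)"
proof
  fix \<phi>s :: "('c \<Rightarrow> rat) list"
  define K where "K = (\<Sum>(d, k, f)\<leftarrow>fs. k)"
  have off: "f x \<psi>s = 0" if "length \<psi>s \<noteq> k" for \<psi>s
    using fun_cong[OF len, of \<psi>s] that by (simp add: len_part_def)
  have off': "tensor_map G fs t \<psi>s = 0" if "length \<psi>s \<noteq> K \<or> \<not> all_linear \<psi>s" for \<psi>s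
    using that by (auto simp: tensor_map_def K_def)
  show "tensor_map G ((d, k, f) # fs) (tmult (ten1 x) t) \<phi>s =
    (ksgn (sum_list (map fst fs) * n) *\<^sub>Q tmult (f x) (tensor_map G fs t)) \<phi>s"
  proof (cases "all_linear \<phi>s \<and> length \<phi>s = k + K")
    case True
    have ql: "qlinear (\<lambda>v. f (gsign G (sum_list (map fst fs)) v) (take k \<phi>s))"
      by (rule qlinear_eval[OF qlinear_comp[OF f qlinear_gsign]])
    have "tmult (f x) (tensor_map G fs t) \<phi>s =
      (\<Sum>i\<le>length \<phi>s. if i = k then f x (take k \<phi>s) * tensor_map G fs t (drop k \<phi>s) else 0)"
      unfolding tmult_def by (intro sum.cong refl) (auto simp: off)
    also have "\<dots> = f x (take k \<phi>s) * tensor_map G fs t (drop k \<phi>s)"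
      using True by simp
    also have "tensor_map G fs t (drop k \<phi>s) = t (pullback G fs (drop k \<phi>s))"
      using True by (simp add: tensor_map_def K_def all_linear_drop)
    finally have "tmult (f x) (tensor_map G fs t) \<phi>s = f x (take k \<phi>s) * t (pullback G fs (drop k \<phi>s))" .
    then show ?thesis
      using True ql by (simp add: tensor_map_def K_def[symmetric] tmult_ten1_Cons gsign_homog[OF x]
          qlinear_scale[OF f] tensor_apply del: tmult_simps)
  next
    case False
    have "f x (take i \<phi>s) * tensor_map G fs t (drop i \<phi>s) = 0" if "i \<le> length \<phi>s" for i
    proof (rule ccontr)
      assume "f x (take i \<phi>s) * tensor_map G fs t (drop i \<phi>s) \<noteq> 0"
      then have nz: "f x (take i \<phi>s) \<noteq> 0" "tensor_map G fs t (drop i \<phi>s) \<noteq> 0" by auto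
      then have "all_linear (take i \<phi>s)" "all_linear (drop i \<phi>s)"
        using lin off' by (auto simp: lin_supp_def)
      moreover have "length (take i \<phi>s) = k" "length (drop i \<phi>s) = K" using nz off off' by blast+
      ultimately show False using False all_linear_take_drop[of i \<phi>s] that by auto
    qed
    then have "tmult (f x) (tensor_map G fs t) \<phi>s = 0" unfolding tmult_def by (intro sum.neutral) auto
    moreover have "tensor_map G ((d, k, f) # fs) (tmult (ten1 x) t) \<phi>s = 0"
      using False by (auto simp: tensor_map_def K_def)
    ultimately show ?thesis by (simp only: tensor_apply Q.scale_zero_right)
  qed
qed

lemma len_part_tensor_map:
  "len_part j (tensor_map G fs t) = (if j = (\<Sum>(d, k, f)\<leftarrow>fs. k) then tensor_map G fs t else 0)"
  by (auto simp: len_part_def tensor_map_def fun_eq_iff tensor_apply)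

lemma lin_supp_ten1: "lin_supp (ten1 x)"
  unfolding ten1_def by (rule lin_supp_pure)

lemma tensor_map_id_Cons:
  "x \<in> G n \<Longrightarrow> tensor_map G (id_factor # fs) (tmult (ten1 x) t) =
    ksgn (sum_list (map fst fs) * n) *\<^sub>Q tmult (ten1 x) (tensor_map G fs t)"
  unfolding id_factor_def[THEN arg_cong[of _ _ "\<lambda>u. u # fs"]]
  by (rule tensor_map_Cons) (auto simp: qlinear_ten1 len_part_ten1 lin_supp_ten1)

lemma tensor_map_ids:
  assumes "hword G V m ys"
  shows "tensor_map G (replicate (length ys) id_factor @ fs) (tmult (pure ys) t) =
    ksgn (sum_list (map fst fs) * m) *\<^sub>Q tmult (pure ys) (tensor_map G fs t)"
  using assms
proof (induction rule: hword.induct)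
  case (Cons x d m xs)
  then show ?case
    by (simp add: pure_Cons tmult_assoc tensor_map_id_Cons[OF Cons(2)] tmult_linear ksgn_add distrib_left)
qed simp

lemma tensor_map_all_ids: "hword G V m ys \<Longrightarrow> tensor_map G (replicate (length ys) id_factor) (pure ys) = pure ys"
  using tensor_map_ids[of V m ys "[]" "pure []"] by (simp add: tensor_map_Nil)

lemma tensor_map_insert:
  assumes ys: "hword G V m ys" and zs: "hword G V l zs" and y: "y \<in> G n" and f: "qlinear f"
    and len: "len_part k (f y) = f y" and lin: "lin_supp (f y)"
  shows "tensor_map G (replicate (length ys) id_factor @ [(d, k, f)] @ replicate (length zs) id_factor)
     (tmult (pure ys) (tmult (ten1 y) (pure zs))) =
    ksgn (d * m) *\<^sub>Q tmult (pure ys) (tmult (f y) (pure zs))"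
  by (simp add: tensor_map_ids[OF ys] tensor_map_Cons[OF f y len lin] tensor_map_all_ids[OF zs])

end

text \<open>The k-fold tensor power of the desuspension. Since \<open>desusp\<close> keeps the
  vectors and shifts only their degrees, this map multiplies each homogeneous word by a
  sign.\<close>

definition susp :: "(int \<Rightarrow> 'c::rat_vector set) \<Rightarrow> nat \<Rightarrow> 'c tensor \<Rightarrow> 'c tensor" where
  "susp C k t = tensor_map C (replicate k (-1, 1, ten1)) t"

lemma desusp_op_susp: "desusp_op C \<Delta> k x = ksgn (int k) *\<^sub>Q susp C k (\<Delta> k x)"
  by (simp add: desusp_op_def susp_def)

section \<open>Signs of the desuspension\<close>

lemma qlinear_susp: "qlinear (susp C k)"
  unfolding susp_def[abs_def] by (rule qlinear_tensor_map)

lemmas susp_linear = qlinear_add[OF qlinear_susp] qlinear_scale[OF qlinear_susp] qlinear_0[OF qlinear_susp]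
  qlinear_neg[OF qlinear_susp] qlinear_diff[OF qlinear_susp]

lemma hword_desusp: "hword C V m xs \<Longrightarrow> hword (desusp C) V (m - int (length xs)) xs"
proof (induction rule: hword.induct)
  case Nil
  then show ?case by (simp add: hword.Nil)
next
  case (Cons x d m xs)
  then have "x \<in> desusp C (d - 1)" by (simp add: desusp_def)
  then have "hword (desusp C) V ((d - 1) + (m - int (length xs))) (x # xs)"
    by (rule hword.Cons[OF Cons(1) _ Cons.IH])
  then show ?case by (simp add: algebra_simps)
qed

text \<open>Words are split at position a. This is used to compare operators that act at this one
  position.\<close>

lemma tensor_power_split:
  assumes F: "qlinear F" "qlinear F'" and t: "t \<in> tensor_power G V (a + 1 + b) m"
    and step: "\<And>p n r ys y zs. hword G V p ys \<Longrightarrow> length ys = a \<Longrightarrow> y \<in> V \<Longrightarrow> y \<in> G n \<Longrightarrow> hword G V r zs \<Longrightarrow>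
      length zs = b \<Longrightarrow> F (tmult (pure ys) (tmult (ten1 y) (pure zs))) = F' (tmult (pure ys) (tmult (ten1 y) (pure zs)))"
  shows "F t = F' t"
proof (rule qspan_qlinear_eq[OF F _ t[unfolded tensor_power_hword]])
  fix s assume "s \<in> {pure xs |xs. length xs = a + 1 + b \<and> hword G V m xs}"
  then obtain xs where s: "s = pure xs" and xs: "length xs = a + 1 + b" "hword G V m xs" by blast
  have "\<exists>p n r ys y zs. xs = ys @ y # zs \<and> hword G V p ys \<and> length ys = a \<and> y \<in> V \<and> y \<in> G n \<and>
     hword G V r zs \<and> length zs = b"
    using xs(2,1)
  proof (induction arbitrary: a rule: hword.induct)
    case (Cons x d m xs)
    show ?case
    proof (cases a)
      case 0
      then show ?thesis using Cons by (intro exI[of _ 0] exI[of _ d] exI[of _ m] exI[of _ "[]"] exI[of _ x] exI[of _ xs])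
          (auto intro: hword.Nil)
    next
      case (Suc a')
      then obtain p n r ys y zs where "xs = ys @ y # zs" "hword G V p ys" "length ys = a'" "y \<in> V" "y \<in> G n"
        "hword G V r zs" "length zs = b"
        using Cons by (metis add_Suc add_Suc_right length_Cons nat.inject)
      then show ?thesis using Cons Suc
        by (intro exI[of _ "d + p"] exI[of _ n] exI[of _ r] exI[of _ "x # ys"] exI[of _ y] exI[of _ zs])
          (auto intro: hword.Cons)
    qed
  qed simp
  then show "F s = F' s" using step by (auto simp: s pure_append pure_Cons)
qed

context grading
begin

lemma susp_Nil: "susp G 0 (pure []) = pure []"
  by (simp add: susp_def tensor_map_Nil)

lemma susp_Cons:
  assumes "x \<in> G n"
  shows "susp G (Suc k) (tmult (ten1 x) t) = ksgn (int k * n) *\<^sub>Q tmult (ten1 x) (susp G k t)"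
proof -
  have "sum_list (map fst (replicate k (-1, 1, ten1))) = - int k" for ten1 :: "'c \<Rightarrow> 'c tensor"
    by (simp add: sum_list_replicate)
  then show ?thesis
    using tensor_map_Cons[OF qlinear_ten1 assms, of 1 "-1" "replicate k (-1, 1, ten1)" t]
    by (simp add: susp_def len_part_ten1) (simp add: ten1_def lin_supp_pure)
qed

lemma len_part_susp: "len_part j (susp G k t) = (if j = k then susp G k t else 0)"
  by (simp add: susp_def len_part_tensor_map sum_list_replicate)

lemma susp_pure: "hword G V m xs \<Longrightarrow> \<exists>c. c * c = 1 \<and> susp G (length xs) (pure xs) = c *\<^sub>Q pure xs"
proof (induction rule: hword.induct)
  case Nil
  then show ?case by (intro exI[of _ 1]) (simp add: susp_Nil)
next
  case (Cons x d m xs)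
  then obtain c where "c * c = 1" "susp G (length xs) (pure xs) = c *\<^sub>Q pure xs" by blast
  then show ?case
    by (intro exI[of _ "ksgn (int (length xs) * d) * c"])
      (simp add: pure_Cons susp_Cons[OF Cons(2)] tmult_linear mult_ac)
qed

lemma susp_tmult:
  assumes "hword G V m xs"
  shows "susp G (length xs + b) (tmult (pure xs) t) =
    ksgn (int b * m) *\<^sub>Q tmult (susp G (length xs) (pure xs)) (susp G b t)"
  using assms
proof (induction rule: hword.induct)
  case Nil
  then show ?case by (simp add: susp_Nil)
next
  case (Cons x d m xs)
  then show ?case
    by (simp add: pure_Cons tmult_assoc susp_Cons[OF Cons(2)] tmult_linear Cons.IH ksgn_add distrib_left
        distrib_right mult_ac)
qed

lemma susp_tmult_power:
  assumes "s \<in> tensor_power G V a m"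
  shows "susp G (a + b) (tmult s t) = ksgn (int b * m) *\<^sub>Q tmult (susp G a s) (susp G b t)"
proof -
  have "qlinear (\<lambda>s. susp G (a + b) (tmult s t))"
    by (rule qlinear_comp[OF qlinear_susp qlinear_tmult_left])
  moreover have "qlinear (\<lambda>s. ksgn (int b * m) *\<^sub>Q tmult (susp G a s) (susp G b t))"
    by (intro qlinear_cmult qlinear_comp[OF qlinear_tmult_left qlinear_susp])
  ultimately show ?thesis
    by (rule qspan_qlinear_eq[OF _ _ _ assms[unfolded tensor_power_hword]]) (auto simp: susp_tmult)
qed

text \<open>On words \<open>susp\<close> is a sign of square one, so it is an involution and shifts
  only the degree.\<close>

lemma susp_power:
  assumes "t \<in> tensor_power G V k m"
  shows "susp G k t \<in> tensor_power (desusp G) V k (m - int k)" and "susp G k (susp G k t) = t"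
proof -
  have "susp G k (pure xs) \<in> tensor_power (desusp G) V k (m - int k)"
    if "length xs = k" "hword G V m xs" for xs
    using susp_pure[OF that(2)] pure_in_power[OF hword_desusp[OF that(2)]] that
    by (auto intro: Q.subspace_scale[OF tensor_power_subspace])
  then show "susp G k t \<in> tensor_power (desusp G) V k (m - int k)"
    by (intro qspan_qlinear_mem[OF qlinear_susp tensor_power_subspace _ assms[unfolded tensor_power_hword]]) auto
  have "susp G k (susp G k (pure xs)) = pure xs" if "length xs = k" "hword G V m xs" for xs
    using susp_pure[OF that(2)] that(1) by (auto simp: susp_linear)
  then show "susp G k (susp G k t) = t"
    by (intro qspan_qlinear_eq[OF qlinear_comp[OF qlinear_susp qlinear_susp] qlinear_id _
          assms[unfolded tensor_power_hword]]) auto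
qed

end

definition ainf_relation :: "(int \<Rightarrow> 'c::rat_vector set) \<Rightarrow> (nat \<Rightarrow> 'c \<Rightarrow> 'c tensor) \<Rightarrow> nat \<Rightarrow> 'c \<Rightarrow> 'c tensor" where
  "ainf_relation C \<Delta> i x = (\<Sum>k=1..i. \<Sum>n=0..i-k. ksgn (int (k + n + k * n)) *\<^sub>Q
     tensor_map C (replicate (i - k - n) id_factor @ [(int k - 2, k, \<Delta> k)] @ replicate n id_factor)
       (\<Delta> (i - k + 1) x))"

text \<open>The data of an A-infinity coalgebra without its relations. The derivation can already be
  formed from it, as is required for the transferred operations before their relations are
  known.\<close>

definition coop_family :: "(int \<Rightarrow> 'c::rat_vector set) \<Rightarrow> 'c set \<Rightarrow> (nat \<Rightarrow> 'c \<Rightarrow> 'c tensor) \<Rightarrow> bool" where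
  "coop_family C V \<Delta> \<longleftrightarrow> (\<forall>k\<ge>1. qlinear (\<Delta> k) \<and>
     (\<forall>n. \<forall>x\<in>V \<inter> C n. \<Delta> k x \<in> tensor_power C V k (n + int k - 2)))"

lemma ainf_coalgebra_alt:
  "ainf_coalgebra C V \<Delta> \<longleftrightarrow> is_grading C \<and> graded_subspace C V \<and> coop_family C V \<Delta> \<and>
     (\<forall>i\<ge>1. \<forall>x\<in>V. ainf_relation C \<Delta> i x = 0)"
  by (simp add: ainf_coalgebra_def ainf_relation_def coop_family_def)

locale coop = grading C for C :: "int \<Rightarrow> 'c::rat_vector set" +
  fixes V :: "'c set" and \<Delta> :: "nat \<Rightarrow> 'c \<Rightarrow> 'c tensor"
  assumes coop: "coop_family C V \<Delta>"
begin

sublocale D: grading "desusp C"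
  by standard (rule is_grading_desusp[OF is_grading])

lemma coop_lin: "k \<ge> 1 \<Longrightarrow> qlinear (\<Delta> k)"
  and coop_power: "k \<ge> 1 \<Longrightarrow> x \<in> V \<Longrightarrow> x \<in> C n \<Longrightarrow> \<Delta> k x \<in> tensor_power C V k (n + int k - 2)"
  using coop by (auto simp: coop_family_def)

lemma letter_map_desusp_op: "D.letter_map V (-1) (desusp_op C \<Delta>)"
  unfolding D.letter_map_def
proof (intro conjI allI impI ballI)
  show "qlinear (desusp_op C \<Delta> k)" if "k \<ge> 1" for k
    unfolding desusp_op_susp[abs_def]
    by (intro qlinear_cmult qlinear_comp[OF qlinear_susp coop_lin[OF that]])
  fix k :: nat and n x assume "1 \<le> k" "x \<in> V \<inter> desusp C n"
  then have "susp C k (\<Delta> k x) \<in> tensor_power (desusp C) V k (n + 1 + int k - 2 - int k)"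
    by (intro susp_power(1) coop_power) (auto simp: desusp_def)
  then show "desusp_op C \<Delta> k x \<in> tensor_power (desusp C) V k (n + (-1))"
    unfolding desusp_op_susp by (intro Q.subspace_scale[OF tensor_power_subspace]) simp
qed

text \<open>Desuspension turns an operation of degree k - 2 into one of degree -1. In the exponent,
  a counts the desuspended letters that the odd operation passes, k is the sign built into
  \<open>desusp_op\<close>, and b k comes from moving the b desuspensions on the right past
  \<open>\<Delta> k\<close>.\<close>

lemma susp_insert:
  assumes k: "k \<ge> 1" and t: "t \<in> tensor_power C V (a + 1 + b) m"
  shows "tensor_map (desusp C) (replicate a id_factor @ [(-1, k, desusp_op C \<Delta> k)] @ replicate b id_factor)
      (susp C (a + 1 + b) t) =
    ksgn (int (a + k + b * k)) *\<^sub>Q susp C (a + k + b)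
      (tensor_map C (replicate a id_factor @ [(int k - 2, k, \<Delta> k)] @ replicate b id_factor) t)"
proof (rule tensor_power_split[OF _ _ t])
  show "qlinear (\<lambda>t. tensor_map (desusp C) (replicate a id_factor @ [(-1, k, desusp_op C \<Delta> k)] @
      replicate b id_factor) (susp C (a + 1 + b) t))"
    by (rule qlinear_comp[OF qlinear_tensor_map qlinear_susp])
  show "qlinear (\<lambda>t. ksgn (int (a + k + b * k)) *\<^sub>Q susp C (a + k + b)
      (tensor_map C (replicate a id_factor @ [(int k - 2, k, \<Delta> k)] @ replicate b id_factor) t))"
    by (intro qlinear_cmult qlinear_comp[OF qlinear_susp qlinear_tensor_map])
  fix p q r ys y zs
  assume ys: "hword C V p ys" "length ys = a" and y: "y \<in> V" "y \<in> C q"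
    and zs: "hword C V r zs" "length zs = b"
  note P = coop_power[OF k y]
  note P' = D.letter_map_power[OF letter_map_desusp_op k y(1), of "q - 1"]
  have y': "y \<in> desusp C (q - 1)" using y by (simp add: desusp_def)
  note fam = length_family_len[OF length_family_tensor_power]
  obtain c where c: "susp C a (pure ys) = c *\<^sub>Q pure ys" using susp_pure[OF ys(1)] ys(2) by auto
  obtain c' where c': "susp C b (pure zs) = c' *\<^sub>Q pure zs" using susp_pure[OF zs(1)] zs(2) by auto
  have 1: "susp C (a + 1 + b) (tmult (pure ys) (tmult (ten1 y) (pure zs))) =
     (ksgn (int (1 + b) * p) * c * ksgn (int b * q) * c') *\<^sub>Q tmult (pure ys) (tmult (ten1 y) (pure zs))"
    using susp_tmult[OF ys(1), of "Suc b" "tmult (ten1 y) (pure zs)"]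
    by (simp add: ys(2) c c' susp_Cons[OF y(2)] tmult_linear mult_ac)
  have 2: "tensor_map (desusp C) (replicate a id_factor @ [(-1, k, desusp_op C \<Delta> k)] @ replicate b id_factor)
      (tmult (pure ys) (tmult (ten1 y) (pure zs))) =
     ksgn (p - int a) *\<^sub>Q tmult (pure ys) (tmult (desusp_op C \<Delta> k y) (pure zs))"
    using D.tensor_map_insert[OF hword_desusp[OF ys(1)] hword_desusp[OF zs(1)] y'
        D.letter_map_lin[OF letter_map_desusp_op k] _ D.letter_map_lin_supp[OF letter_map_desusp_op k y(1) y'], of k "-1"]
      fam[OF P'[OF y'], of k] ys(2) zs(2) by (simp add: ksgn_diff mult.commute)
  have 3: "tensor_map C (replicate a id_factor @ [(int k - 2, k, \<Delta> k)] @ replicate b id_factor)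
      (tmult (pure ys) (tmult (ten1 y) (pure zs))) =
     ksgn ((int k - 2) * p) *\<^sub>Q tmult (pure ys) (tmult (\<Delta> k y) (pure zs))"
    using tensor_map_insert[OF ys(1) zs(1) y(2) coop_lin[OF k], of k "int k - 2"]
      lin_supp_Tc[OF power_in_Tc[OF P]] fam[OF P, of k] ys(2) zs(2) by simp
  have 4: "susp C (a + k + b) (tmult (pure ys) (tmult (\<Delta> k y) (pure zs))) =
     (ksgn (int (k + b) * p) * c * ksgn (int b * (q + int k - 2)) * c') *\<^sub>Q
     tmult (pure ys) (tmult (susp C k (\<Delta> k y)) (pure zs))"
    using susp_tmult[OF ys(1), of "k + b" "tmult (\<Delta> k y) (pure zs)"] susp_tmult_power[OF P, of b "pure zs"]
    by (simp add: ys(2) c c' tmult_linear mult_ac add_ac)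
  have sgn: "ksgn (int (1 + b) * p) * ksgn (int b * q) * ksgn (p - int a) * ksgn (int k) =
     ksgn (int (a + k + b * k)) * ksgn ((int k - 2) * p) * ksgn (int (k + b) * p) * ksgn (int b * (q + int k - 2))"
    by (auto simp: ksgn_def)
  show "tensor_map (desusp C) (replicate a id_factor @ [(-1, k, desusp_op C \<Delta> k)] @ replicate b id_factor)
      (susp C (a + 1 + b) (tmult (pure ys) (tmult (ten1 y) (pure zs)))) =
    ksgn (int (a + k + b * k)) *\<^sub>Q susp C (a + k + b)
      (tensor_map C (replicate a id_factor @ [(int k - 2, k, \<Delta> k)] @ replicate b id_factor)
        (tmult (pure ys) (tmult (ten1 y) (pure zs))))"
    unfolding 1 3 tensor_map_scale 2 susp_linear 4 desusp_op_susp tmult_linear Q.scale_scale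
    by (rule arg_cong[of _ _ "\<lambda>u. u *\<^sub>Q _"]) (use arg_cong[OF sgn, of "\<lambda>u. c * c' * u"] in \<open>simp add: mult_ac\<close>)
qed

lemma insert_power:
  assumes k: "k \<ge> 1" and t: "t \<in> tensor_power C V (a + 1 + b) m"
  shows "tensor_map C (replicate a id_factor @ [(int k - 2, k, \<Delta> k)] @ replicate b id_factor) t
    \<in> tensor_power C V (a + k + b) (m + int k - 2)"
proof -
  let ?F = "tensor_map C (replicate a id_factor @ [(int k - 2, k, \<Delta> k)] @ replicate b id_factor)"
  have "?F (pure xs) \<in> tensor_power C V (a + k + b) (m + int k - 2)"
    if xs: "length xs = a + 1 + b" "hword C V m xs" for xs
    using xs
  proof (induction a arbitrary: xs m)
    case 0
    then obtain y zs where "xs = y # zs" "length zs = b" by (cases xs) auto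
    then obtain n r where *: "y \<in> V" "y \<in> C n" "hword C V r zs" "m = n + r" using 0(2) by (auto elim: hword.cases)
    note P = coop_power[OF k *(1,2)]
    have "tensor_map C ((int k - 2, k, \<Delta> k) # replicate (length zs) id_factor) (tmult (ten1 y) (pure zs)) =
      tmult (\<Delta> k y) (pure zs)"
      using lin_supp_Tc[OF power_in_Tc[OF P]] length_family_len[OF length_family_tensor_power P, of k]
      by (subst tensor_map_Cons[OF coop_lin[OF k] *(2)]) (simp_all add: tensor_map_all_ids[OF *(3)])
    then show ?case
      using tensor_power_tmult[OF P pure_in_power[OF *(3)]] \<open>length zs = b\<close>
      by (simp add: \<open>xs = y # zs\<close> pure_Cons *(4) algebra_simps)
  next
    case (Suc a)
    then obtain x ys where "xs = x # ys" "length ys = a + 1 + b" by (cases xs) auto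
    then obtain n r where *: "x \<in> V" "x \<in> C n" "hword C V r ys" "m = n + r" using Suc(3) by (auto elim: hword.cases)
    let ?T = "tensor_map C (replicate a id_factor @ [(int k - 2, k, \<Delta> k)] @ replicate b id_factor) (pure ys)"
    have "tensor_map C (replicate (Suc a) id_factor @ [(int k - 2, k, \<Delta> k)] @ replicate b id_factor) (pure xs) =
      ksgn ((int k - 2) * n) *\<^sub>Q tmult (ten1 x) ?T"
      using tensor_map_id_Cons[OF *(2), of "replicate a id_factor @ [(int k - 2, k, \<Delta> k)] @
          replicate b id_factor" "pure ys"]
      by (simp add: \<open>xs = x # ys\<close> pure_Cons)
    moreover have "tmult (ten1 x) ?T \<in> tensor_power C V (1 + (a + k + b)) (n + (r + int k - 2))"
      using pure_in_power[OF hword_single[of x V C n]] * Suc.IH[OF \<open>length ys = a + 1 + b\<close> *(3)]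
      by (intro tensor_power_tmult) (simp_all add: ten1_def)
    ultimately show ?case
      by (simp add: *(4) Q.subspace_scale[OF tensor_power_subspace] algebra_simps)
  qed
  then show ?thesis
    by (intro qspan_qlinear_mem[OF qlinear_tensor_map tensor_power_subspace _ t[unfolded tensor_power_hword]]) auto
qed

text \<open>Inserting one operation into another gives, after desuspension, a summand of the squared
  derivation. In length i these are exactly the summands of the relation of index i.\<close>

lemma der_square_relation:
  assumes x: "x \<in> V" "x \<in> C n" and i: "i \<ge> 1"
  shows "len_part i (tensor_diff C \<Delta> (tensor_diff C \<Delta> (ten1 x))) = - susp C i (ainf_relation C \<Delta> i x)"
    and "ainf_relation C \<Delta> i x \<in> tensor_power C V i (n + int i - 3)"
proof -
  have x': "x \<in> desusp C (n - 1)" using x by (simp add: desusp_def)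
  have pw: "\<Delta> (i - k + 1) x \<in> tensor_power C V ((i - k - j) + 1 + j) (n + int (i - k + 1) - 2)"
    if "1 \<le> k" "k \<le> i" "j \<le> i - k" for k j
    using coop_power[OF _ x, of "i - k + 1"] that by simp
  let ?T = "\<lambda>k j. tensor_map C (replicate (i - k - j) id_factor @ [(int k - 2, k, \<Delta> k)] @ replicate j id_factor)
     (\<Delta> (i - k + 1) x)"
  let ?U = "\<lambda>k j. tensor_map (desusp C) (replicate (i - k - j) id_factor @ [(-1, k, desusp_op C \<Delta> k)] @
     replicate j id_factor)"
  have U: "?U k j (letter (desusp_op C \<Delta>) x) = - (ksgn (int (k + j + k * j)) *\<^sub>Q susp C i (?T k j))"
    if kj: "1 \<le> k" "k \<le> i" "j \<le> i - k" for k j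
  proof -
    have "?U k j (letter (desusp_op C \<Delta>) x) = ?U k j (desusp_op C \<Delta> (i - k + 1) x)"
      using kj by (auto simp: tensor_map_def fun_eq_iff letter_def simp flip: length_0_conv)
    also have "\<dots> = ksgn (int (i - k + 1)) *\<^sub>Q ?U k j (susp C (i - k - j + 1 + j) (\<Delta> (i - k + 1) x))"
      using kj by (simp add: desusp_op_susp tensor_map_scale)
    also have "\<dots> = (ksgn (int (i - k + 1)) * ksgn (int (i - k - j + k + j * k))) *\<^sub>Q susp C (i - k - j + k + j) (?T k j)"
      by (subst susp_insert[OF kj(1) pw[OF kj]]) simp
    \<comment> \<open>Modulo 2 the exponents add up to 1 + k + j + k j, so every summand differs
      from its sign in the relation by the same factor -1.\<close>
    also have "ksgn (int (i - k + 1)) * ksgn (int (i - k - j + k + j * k)) = - ksgn (int (k + j + k * j))"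
      using kj by (auto simp: ksgn_def)
    finally show ?thesis using kj by simp
  qed
  have "tensor_diff C \<Delta> (ten1 x) = letter (desusp_op C \<Delta>) x"
    unfolding tensor_diff_der by (rule D.der_letter_ten1[OF letter_map_desusp_op x(1) x'])
  then have "len_part i (tensor_diff C \<Delta> (tensor_diff C \<Delta> (ten1 x))) =
     len_part i (\<Sum>k=1..i. \<Sum>j=0..i-k. ?U k j (letter (desusp_op C \<Delta>) x))"
    by (auto simp: len_part_def fun_eq_iff tensor_diff_def Let_def sum_fun_apply)
  also have "(\<Sum>k=1..i. \<Sum>j=0..i-k. ?U k j (letter (desusp_op C \<Delta>) x)) =
     (\<Sum>k=1..i. \<Sum>j=0..i-k. - (ksgn (int (k + j + k * j)) *\<^sub>Q susp C i (?T k j)))"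
    by (intro sum.cong refl, rule U) auto
  also have "\<dots> = - susp C i (ainf_relation C \<Delta> i x)"
    by (simp add: ainf_relation_def qlinear_sum[OF qlinear_susp] susp_linear sum_negf)
  finally show "len_part i (tensor_diff C \<Delta> (tensor_diff C \<Delta> (ten1 x))) = - susp C i (ainf_relation C \<Delta> i x)"
    by (simp add: len_part_linear len_part_susp)
  have "?T k j \<in> tensor_power C V i (n + int i - 3)" if kj: "1 \<le> k" "k \<le> i" "j \<le> i - k" for k j
    using insert_power[OF kj(1) pw[OF kj]] kj by (simp add: algebra_simps of_nat_diff)
  then show "ainf_relation C \<Delta> i x \<in> tensor_power C V i (n + int i - 3)"
    unfolding ainf_relation_def
    by (intro Q.subspace_sum[OF tensor_power_subspace] Q.subspace_scale[OF tensor_power_subspace]) auto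
qed

text \<open>Compare length by length. \<open>susp\<close> is injective on tensor powers, so a
  relation can be recovered from its desuspension.\<close>

lemma tensor_diff_square_iff:
  assumes x: "x \<in> V" "x \<in> C n"
  shows "tensor_diff C \<Delta> (tensor_diff C \<Delta> (ten1 x)) = 0 \<longleftrightarrow> (\<forall>i\<ge>1. ainf_relation C \<Delta> i x = 0)"
proof
  assume *: "tensor_diff C \<Delta> (tensor_diff C \<Delta> (ten1 x)) = 0"
  show "\<forall>i\<ge>1. ainf_relation C \<Delta> i x = 0"
  proof (intro allI impI)
    fix i :: nat assume i: "i \<ge> 1"
    from der_square_relation(1)[OF x i] * have "susp C i (ainf_relation C \<Delta> i x) = 0"
      by (simp add: len_part_linear)
    then show "ainf_relation C \<Delta> i x = 0"
      using susp_power(2)[OF der_square_relation(2)[OF x i]] by (simp add: susp_linear)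
  qed
next
  assume *: "\<forall>i\<ge>1. ainf_relation C \<Delta> i x = 0"
  show "tensor_diff C \<Delta> (tensor_diff C \<Delta> (ten1 x)) = 0"
  proof (rule len_part_eqI)
    fix i
    show "len_part i (tensor_diff C \<Delta> (tensor_diff C \<Delta> (ten1 x))) = len_part i 0"
    proof (cases "i \<ge> 1")
      case True
      then show ?thesis using der_square_relation(1)[OF x True] * by (simp add: len_part_linear susp_linear)
    next
      case False
      then show ?thesis by (auto simp: len_part_def fun_eq_iff tensor_diff_def tensor_apply)
    qed
  qed
qed

lemma qlinear_ainf_relation: "qlinear (ainf_relation C \<Delta> i)"
  unfolding ainf_relation_def[abs_def]
  by (intro qlinear_setsum qlinear_cmult qlinear_comp[OF qlinear_tensor_map] coop_lin) auto

text \<open>The relations are linear in x, and every vector of a graded subspace is a sum of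
  homogeneous ones in it, so the criterion on homogeneous letters is enough.\<close>

lemma ainf_coalgebra_iff:
  assumes "graded_subspace C V"
  shows "ainf_coalgebra C V \<Delta> \<longleftrightarrow>
    (\<forall>n. \<forall>x\<in>V \<inter> C n. tensor_diff C \<Delta> (tensor_diff C \<Delta> (ten1 x)) = 0)"
proof -
  have "(\<forall>x\<in>V. ainf_relation C \<Delta> i x = 0) \<longleftrightarrow> (\<forall>n. \<forall>x\<in>V \<inter> C n. ainf_relation C \<Delta> i x = 0)" for i
  proof
    assume *: "\<forall>n. \<forall>x\<in>V \<inter> C n. ainf_relation C \<Delta> i x = 0"
    show "\<forall>x\<in>V. ainf_relation C \<Delta> i x = 0"
    proof
      fix x assume x: "x \<in> V"
      then show "ainf_relation C \<Delta> i x = 0"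
        by (rule homog_induct)
          (use assms * x in \<open>auto simp: graded_subspace_def qlinear_0[OF qlinear_ainf_relation]
            qlinear_add[OF qlinear_ainf_relation]\<close>)
    qed
  qed blast
  then show ?thesis
    using tensor_diff_square_iff assms coop is_grading unfolding ainf_coalgebra_alt by blast
qed

end

section \<open>Shuffles of Lie elements\<close>

definition plift :: "(nat \<Rightarrow> nat) \<Rightarrow> nat \<Rightarrow> nat" where
  "plift \<sigma> p = (case p of 0 \<Rightarrow> 0 | Suc q \<Rightarrow> Suc (\<sigma> q))"

text \<open>The cycle through 0, 1, ..., i, of sign \<open>(-1) ^ i\<close>. It accounts for the
  sign that \<open>pins\<close> adds to that of \<sigma>.\<close>

definition pcyc :: "nat \<Rightarrow> nat \<Rightarrow> nat" where
  "pcyc i p = (if p < i then Suc p else if p = i then 0 else p)"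

text \<open>The permutation obtained from \<open>\<sigma>\<close> by inserting the value 0 at position \<open>i\<close>.\<close>

definition pins :: "nat \<Rightarrow> (nat \<Rightarrow> nat) \<Rightarrow> nat \<Rightarrow> nat" where
  "pins i \<sigma> = plift \<sigma> \<circ> pcyc i"

section \<open>Recursive description of shuffles\<close>

lemma pins_simps: "p < i \<Longrightarrow> pins i \<sigma> p = Suc (\<sigma> p)" "pins i \<sigma> i = 0"
  "p \<ge> i \<Longrightarrow> pins i \<sigma> (Suc p) = Suc (\<sigma> p)"
  by (auto simp: pins_def plift_def pcyc_def split: nat.split)

lemma pcyc_permutes: "pcyc i permutes {..i}"
proof (rule bij_imp_permutes)
  have inj: "inj_on (pcyc i) {..i}" by (auto simp: inj_on_def pcyc_def split: if_splits)
  have "pcyc i ` {..i} \<subseteq> {..i}" by (auto simp: pcyc_def)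
  then show "bij_betw (pcyc i) {..i} {..i}"
    using inj endo_inj_surj[of "{..i}" "pcyc i"] by (auto simp: bij_betw_def)
qed (auto simp: pcyc_def)

lemma sign_pcyc: "sign (pcyc i) = (-1) ^ i"
proof (induction i)
  case 0
  have "pcyc 0 = id" by (auto simp: pcyc_def fun_eq_iff)
  then show ?case by simp
next
  case (Suc i)
  have "pcyc (Suc i) = pcyc i \<circ> transpose i (Suc i)"
    by (auto simp: pcyc_def fun_eq_iff transpose_def)
  moreover have "permutation (pcyc i)" using pcyc_permutes by (auto simp: permutation_permutes)
  ultimately have "sign (pcyc (Suc i)) = sign (pcyc i) * sign (transpose i (Suc i))"
    by (simp only: sign_compose permutation_swap_id)
  then show ?case using Suc by (simp add: sign_swap_id)
qed

lemma plift_map_permutation: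
  assumes "\<sigma> permutes {..<n}" shows "plift \<sigma> = map_permutation {..<n} Suc \<sigma>"
proof
  fix p
  show "plift \<sigma> p = map_permutation {..<n} Suc \<sigma> p"
  proof (cases p)
    case 0
    then show ?thesis by (simp add: plift_def map_permutation_def image_iff)
  next
    case (Suc q)
    then show ?thesis
      using permutes_not_in[OF assms, of q] by (auto simp: plift_def map_permutation_def restrict_id_def inv_into_f_f)
  qed
qed

lemma plift_permutes:
  assumes "\<sigma> permutes {..<n}" shows "plift \<sigma> permutes {..<Suc n}" and "sign (plift \<sigma>) = sign \<sigma>"
proof -
  have "map_permutation {..<n} Suc \<sigma> permutes Suc ` {..<n}"
    by (rule map_permutation_permutes) (auto simp: assms)
  then show "plift \<sigma> permutes {..<Suc n}"
    unfolding plift_map_permutation[OF assms] by (rule permutes_subset) auto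
  show "sign (plift \<sigma>) = sign \<sigma>"
    unfolding plift_map_permutation[OF assms] by (rule sign_map_permutation) (use assms in auto)
qed

lemma pins_permutes:
  assumes "\<sigma> permutes {..<n}" "i \<le> n"
  shows "pins i \<sigma> permutes {..<Suc n}" and "sign (pins i \<sigma>) = (-1) ^ i * sign \<sigma>"
proof -
  have c: "pcyc i permutes {..<Suc n}"
    by (rule permutes_subset[OF pcyc_permutes]) (use assms in auto)
  show "pins i \<sigma> permutes {..<Suc n}"
    unfolding pins_def by (rule permutes_compose[OF c plift_permutes(1)[OF assms(1)]])
  have "permutation (pcyc i)" "permutation (plift \<sigma>)"
    using c plift_permutes(1)[OF assms(1)] by (auto simp: permutation_permutes)
  then show "sign (pins i \<sigma>) = (-1) ^ i * sign \<sigma>"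
    unfolding pins_def by (simp add: sign_compose plift_permutes(2)[OF assms(1)] sign_pcyc)
qed

lemma inj_pins: "inj (pins i)"
proof (rule injI)
  fix \<sigma> \<tau> assume eq: "pins i \<sigma> = pins i \<tau>"
  show "\<sigma> = \<tau>"
  proof
    fix p
    show "\<sigma> p = \<tau> p"
    proof (cases "p < i")
      case True
      then show ?thesis using fun_cong[OF eq, of p] by (simp add: pins_simps)
    next
      case False
      then show ?thesis using fun_cong[OF eq, of "Suc p"] by (simp add: pins_simps)
    qed
  qed
qed

lemma pins_surj:
  assumes \<tau>: "\<tau> permutes {..<Suc n}" and i: "i \<le> n" "\<tau> i = 0"
  shows "\<exists>\<sigma>. \<sigma> permutes {..<n} \<and> \<tau> = pins i \<sigma>"
proof -
  \<comment> \<open>This enumerates the positions other than i in increasing order; \<sigma> is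
    \<tau> along them, lowered by one.\<close>
  define c where "c p = (if p < i then p else Suc p)" for p
  have c: "c p \<noteq> i" "inj c" for p by (auto simp: c_def inj_def)
  have inj: "inj \<tau>" using \<tau> permutes_inj by blast
  have pos: "\<tau> (c p) \<noteq> 0" for p
    using injD[OF inj, of "c p" i] i(2) c(1)[of p] by auto
  define \<sigma> where "\<sigma> p = \<tau> (c p) - 1" for p
  have S: "Suc (\<sigma> p) = \<tau> (c p)" for p using pos[of p] by (simp add: \<sigma>_def)
  have injs: "inj \<sigma>"
    by (rule injI) (metis S c(2) inj injD)
  have img: "\<sigma> p < n" if "p < n" for p
  proof -
    have "c p \<in> {..<Suc n}" using that by (auto simp: c_def)
    then have "\<tau> (c p) \<in> {..<Suc n}" using permutes_in_image[OF \<tau>] by blast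
    then show ?thesis using S[of p] by simp
  qed
  have "\<sigma> permutes {..<n}"
  proof (rule bij_imp_permutes)
    show "bij_betw \<sigma> {..<n} {..<n}"
      using endo_inj_surj[of "{..<n}" \<sigma>] img inj_on_subset[OF injs subset_UNIV]
      by (auto simp: bij_betw_def)
    show "\<sigma> p = p" if "p \<notin> {..<n}" for p
    proof -
      have "c p = Suc p" using that i(1) by (auto simp: c_def)
      moreover have "\<tau> (Suc p) = Suc p" using that permutes_not_in[OF \<tau>, of "Suc p"] by simp
      ultimately show ?thesis using S[of p] by simp
    qed
  qed
  moreover have "\<tau> p = pins i \<sigma> p" for p
  proof (cases "p < i")
    case True
    then show ?thesis using S[of p] by (simp add: pins_simps c_def)
  next
    case False
    then consider "p = i" | q where "p = Suc q" "q \<ge> i"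
      by (metis Suc_pred bot_nat_0.not_eq_extremum leI le_neq_implies_less less_Suc_eq_le less_zeroE)
    then show ?thesis
    proof cases
      case 1
      then show ?thesis by (simp add: pins_simps i)
    next
      case 2
      then show ?thesis using S[of q] by (simp add: pins_simps c_def)
    qed
  qed
  ultimately show ?thesis by (auto simp: fun_eq_iff)
qed

lemma shuffles_perm_pins_0:
  assumes "\<sigma> permutes {..<n}" "i \<le> n"
  shows "pins 0 \<sigma> \<in> shuffles_perm (Suc i) (Suc n) \<longleftrightarrow> \<sigma> \<in> shuffles_perm i n"
proof -
  have "strict_mono_on {..<Suc i} (pins 0 \<sigma>) \<longleftrightarrow> strict_mono_on {..<i} \<sigma>"
  proof
    assume *: "strict_mono_on {..<Suc i} (pins 0 \<sigma>)"
    show "strict_mono_on {..<i} \<sigma>"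
    proof (rule strict_mono_onI)
      fix p q assume "p \<in> {..<i}" "q \<in> {..<i}" "p < q"
      then show "\<sigma> p < \<sigma> q" using strict_mono_onD[OF *, of "Suc p" "Suc q"] by (simp add: pins_simps)
    qed
  next
    assume *: "strict_mono_on {..<i} \<sigma>"
    show "strict_mono_on {..<Suc i} (pins 0 \<sigma>)"
    proof (rule strict_mono_onI)
      fix p q assume "p \<in> {..<Suc i}" "q \<in> {..<Suc i}" "p < q"
      then show "pins 0 \<sigma> p < pins 0 \<sigma> q" using strict_mono_onD[OF *, of "p - 1" "q - 1"]
        by (cases p; cases q) (auto simp: pins_simps)
    qed
  qed
  moreover have "strict_mono_on {Suc i..<Suc n} (pins 0 \<sigma>) \<longleftrightarrow> strict_mono_on {i..<n} \<sigma>"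
  proof
    assume *: "strict_mono_on {Suc i..<Suc n} (pins 0 \<sigma>)"
    show "strict_mono_on {i..<n} \<sigma>"
    proof (rule strict_mono_onI)
      fix p q assume "p \<in> {i..<n}" "q \<in> {i..<n}" "p < q"
      then show "\<sigma> p < \<sigma> q" using strict_mono_onD[OF *, of "Suc p" "Suc q"] by (simp add: pins_simps)
    qed
  next
    assume *: "strict_mono_on {i..<n} \<sigma>"
    show "strict_mono_on {Suc i..<Suc n} (pins 0 \<sigma>)"
    proof (rule strict_mono_onI)
      fix p q assume "p \<in> {Suc i..<Suc n}" "q \<in> {Suc i..<Suc n}" "p < q"
      then show "pins 0 \<sigma> p < pins 0 \<sigma> q" using strict_mono_onD[OF *, of "p - 1" "q - 1"]
        by (cases p; cases q) (auto simp: pins_simps)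
    qed
  qed
  ultimately show ?thesis
    using pins_permutes(1)[OF assms(1), of 0] assms by (simp add: shuffles_perm_def)
qed

lemma shuffles_perm_pins:
  assumes "\<sigma> permutes {..<n}" "i \<le> n"
  shows "pins i \<sigma> \<in> shuffles_perm i (Suc n) \<longleftrightarrow> \<sigma> \<in> shuffles_perm i n"
proof -
  have "strict_mono_on {..<i} (pins i \<sigma>) \<longleftrightarrow> strict_mono_on {..<i} \<sigma>"
    unfolding strict_mono_on_def by (auto simp: pins_simps)
  moreover have "strict_mono_on {i..<Suc n} (pins i \<sigma>) \<longleftrightarrow> strict_mono_on {i..<n} \<sigma>"
  proof
    assume *: "strict_mono_on {i..<Suc n} (pins i \<sigma>)"
    show "strict_mono_on {i..<n} \<sigma>"
    proof (rule strict_mono_onI)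
      fix p q assume "p \<in> {i..<n}" "q \<in> {i..<n}" "p < q"
      then show "\<sigma> p < \<sigma> q" using strict_mono_onD[OF *, of "Suc p" "Suc q"] by (simp add: pins_simps)
    qed
  next
    assume *: "strict_mono_on {i..<n} \<sigma>"
    show "strict_mono_on {i..<Suc n} (pins i \<sigma>)"
    proof (rule strict_mono_onI)
      fix p q assume pq: "p \<in> {i..<Suc n}" "q \<in> {i..<Suc n}" "p < q"
      then obtain q' where q': "q = Suc q'" "q' \<ge> i" by (cases q) auto
      show "pins i \<sigma> p < pins i \<sigma> q"
      proof (cases "p = i")
        case True
        then show ?thesis using q' by (simp add: pins_simps)
      next
        case False
        then obtain p' where "p = Suc p'" "p' \<ge> i" using pq by (cases p) auto
        then show ?thesis using q' pq strict_mono_onD[OF *, of p' q'] by (simp add: pins_simps)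
      qed
    qed
  qed
  ultimately show ?thesis
    using pins_permutes(1)[OF assms] assms by (simp add: shuffles_perm_def)
qed

text \<open>The least value 0 must open one of the two increasing blocks, so it stands at position 0
  or i. Removing it leaves a shuffle with one letter less.\<close>

lemma shuffles_perm_Suc:
  assumes "i \<le> Suc n"
  shows "shuffles_perm i (Suc n) =
    (if i = 0 then {} else pins 0 ` shuffles_perm (i - 1) n) \<union> (if i \<le> n then pins i ` shuffles_perm i n else {})"
    (is "_ = ?R")
proof (intro set_eqI iffI)
  fix \<tau> assume \<tau>: "\<tau> \<in> shuffles_perm i (Suc n)"
  then have p: "\<tau> permutes {..<Suc n}" and m: "strict_mono_on {..<i} \<tau>" "strict_mono_on {i..<Suc n} \<tau>"
    by (auto simp: shuffles_perm_def)
  have "0 \<in> \<tau> ` {..<Suc n}" using permutes_image[OF p] by simp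
  then obtain q where q: "q < Suc n" "\<tau> q = 0" by auto
  have "q = 0 \<and> i \<noteq> 0 \<or> q = i"
  proof (cases "q < i")
    case True
    then show ?thesis using strict_mono_onD[OF m(1), of 0 q] q by (cases q) auto
  next
    case False
    then show ?thesis using strict_mono_onD[OF m(2), of i q] q by (cases "q = i") auto
  qed
  then show "\<tau> \<in> ?R"
  proof (elim disjE conjE)
    assume q0: "q = 0" "i \<noteq> 0"
    then obtain \<sigma> where \<sigma>: "\<sigma> permutes {..<n}" "\<tau> = pins 0 \<sigma>" using pins_surj[OF p, of 0] q by auto
    then have "\<sigma> \<in> shuffles_perm (i - 1) n"
      using \<tau> q0 assms shuffles_perm_pins_0[OF \<sigma>(1), of "i - 1"] by simp
    then show ?thesis using q0 \<sigma> by simp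
  next
    assume qi: "q = i"
    then obtain \<sigma> where \<sigma>: "\<sigma> permutes {..<n}" "\<tau> = pins i \<sigma>" using pins_surj[OF p, of i] q by auto
    then have "\<sigma> \<in> shuffles_perm i n"
      using \<tau> q qi shuffles_perm_pins[OF \<sigma>(1), of i] by simp
    then show ?thesis using qi q \<sigma> by simp
  qed
next
  fix \<tau> assume "\<tau> \<in> ?R"
  then consider \<sigma> where "i \<noteq> 0" "\<sigma> \<in> shuffles_perm (i - 1) n" "\<tau> = pins 0 \<sigma>"
    | \<sigma> where "i \<le> n" "\<sigma> \<in> shuffles_perm i n" "\<tau> = pins i \<sigma>"
    by (auto split: if_splits)
  then show "\<tau> \<in> shuffles_perm i (Suc n)"
  proof cases
    case 1
    then have "\<sigma> permutes {..<n}" by (simp add: shuffles_perm_def)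
    then show ?thesis using 1 assms shuffles_perm_pins_0[of \<sigma> n "i - 1"] by simp
  next
    case 2
    then have "\<sigma> permutes {..<n}" by (simp add: shuffles_perm_def)
    then show ?thesis using 2 shuffles_perm_pins[of \<sigma> n i] by simp
  qed
qed

lemma finite_shuffles_perm [simp]: "finite (shuffles_perm i n)"
  by (rule finite_subset[OF _ finite_permutations[of "{..<n}"]]) (auto simp: shuffles_perm_def)

lemma sum_shuffles_perm_Suc:
  assumes "i \<le> Suc n"
  shows "(\<Sum>\<tau>\<in>shuffles_perm i (Suc n). F \<tau>) =
    (if i = 0 then 0 else \<Sum>\<sigma>\<in>shuffles_perm (i - 1) n. F (pins 0 \<sigma>)) +
    (if i \<le> n then \<Sum>\<sigma>\<in>shuffles_perm i n. F (pins i \<sigma>) else (0::'b::comm_monoid_add))"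
proof -
  have r: "sum F (pins j ` X) = (\<Sum>\<sigma>\<in>X. F (pins j \<sigma>))" for j X
    by (subst sum.reindex[OF inj_on_subset[OF inj_pins subset_UNIV]]) simp
  \<comment> \<open>The value at position 0 tells the two kinds apart, so the union is
    disjoint.\<close>
  have "pins 0 \<sigma> \<noteq> pins i \<tau>" if "i \<noteq> 0" for \<sigma> \<tau>
  proof
    assume "pins 0 \<sigma> = pins i \<tau>"
    then have "pins 0 \<sigma> 0 = pins i \<tau> 0" by simp
    then show False using that by (simp add: pins_simps)
  qed
  then show ?thesis
    unfolding shuffles_perm_Suc[OF assms]
    by (subst sum.union_disjoint) (auto simp: r)
qed

text \<open>Inserting the value 0 at position i adds exactly the inversions (p, i) with p < i. The
  others are those of \<sigma> with renumbered positions.\<close>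

lemma koszul_sign_pins:
  assumes \<sigma>: "\<sigma> permutes {..<n}" and i: "i \<le> n" and n: "length es = n"
  shows "koszul_sign (e # es) (pins i \<sigma>) = (\<Prod>p<i. ksgn (e * es ! \<sigma> p)) * koszul_sign es \<sigma>"
proof -
  define c where "c p = (if p < i then p else Suc p)" for p
  have c: "pins i \<sigma> (c p) = Suc (\<sigma> p)" for p by (simp add: c_def pins_simps)
  have injc: "inj c" by (auto simp: c_def inj_def)
  define I where "I = {(a, b). a < b \<and> b < length es \<and> \<sigma> b < \<sigma> a}"
  define A where "A = (\<lambda>p. (p, i)) ` {..<i}"
  define B where "B = (\<lambda>(a, b). (c a, c b)) ` I"
  have finI: "finite I"
    by (rule finite_subset[of _ "{..<length es} \<times> {..<length es}"]) (auto simp: I_def)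
  have "{(a, b). a < b \<and> b < length (e # es) \<and> pins i \<sigma> b < pins i \<sigma> a} = A \<union> B"
  proof (rule subset_antisym; rule subsetI)
    fix z assume "z \<in> {(a, b). a < b \<and> b < length (e # es) \<and> pins i \<sigma> b < pins i \<sigma> a}"
    then obtain a b where z: "z = (a, b)" and ab: "a < b" "b < length (e # es)" "pins i \<sigma> b < pins i \<sigma> a"
      by blast
    then have "a \<noteq> i" by (auto simp: pins_simps)
    then obtain a' where a': "a = c a'" unfolding c_def
      by (metis Suc_pred gr_implies_not0 le_Suc_eq leI linorder_neqE_nat not_gr_zero not_less_eq)
    show "z \<in> A \<union> B"
    proof (cases "b = i")
      case True
      then have "(a, b) \<in> A" using ab by (auto simp: A_def)
      then show ?thesis by (simp add: z)
    next
      case False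
      then obtain b' where b': "b = c b'" unfolding c_def
        by (metis Suc_pred gr_implies_not0 le_Suc_eq leI linorder_neqE_nat not_gr_zero not_less_eq)
      have "a' < b'" "b' < length es" using ab i n unfolding a' b' c_def by (auto split: if_splits)
      moreover have "\<sigma> b' < \<sigma> a'" using ab unfolding a' b' c by simp
      ultimately show ?thesis unfolding z a' b' B_def I_def by auto
    qed
  next
    fix z assume "z \<in> A \<union> B"
    then show "z \<in> {(a, b). a < b \<and> b < length (e # es) \<and> pins i \<sigma> b < pins i \<sigma> a}"
    proof
      assume "z \<in> A"
      then show ?thesis using i n by (auto simp: A_def pins_simps)
    next
      assume "z \<in> B"
      then obtain a' b' where *: "z = (c a', c b')" "a' < b'" "b' < length es" "\<sigma> b' < \<sigma> a'"
        by (auto simp: B_def I_def)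
      then show ?thesis by (auto simp: c) (auto simp: c_def)
    qed
  qed
  moreover have "A \<inter> B = {}" by (auto simp: A_def B_def c_def split: if_splits)
  moreover have "finite A" "finite B" using finI by (auto simp: A_def B_def)
  ultimately have "koszul_sign (e # es) (pins i \<sigma>) =
     (\<Prod>(a, b)\<in>A. ksgn ((e # es) ! pins i \<sigma> a * (e # es) ! pins i \<sigma> b)) *
     (\<Prod>(a, b)\<in>B. ksgn ((e # es) ! pins i \<sigma> a * (e # es) ! pins i \<sigma> b))"
    unfolding koszul_sign_def by (simp add: prod.union_disjoint)
  also have "(\<Prod>(a, b)\<in>A. ksgn ((e # es) ! pins i \<sigma> a * (e # es) ! pins i \<sigma> b)) = (\<Prod>p<i. ksgn (e * es ! \<sigma> p))"
    unfolding A_def by (subst prod.reindex) (auto simp: inj_on_def pins_simps mult.commute intro!: prod.cong)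
  also have "(\<Prod>(a, b)\<in>B. ksgn ((e # es) ! pins i \<sigma> a * (e # es) ! pins i \<sigma> b)) = koszul_sign es \<sigma>"
    unfolding B_def koszul_sign_def I_def[symmetric]
    by (subst prod.reindex) (auto simp: inj_on_def c injD[OF injc] intro!: prod.cong)
  finally show ?thesis .
qed

lemma koszul_sign_parity: "koszul_sign (map (\<lambda>d. d mod 2) ds) \<sigma> = koszul_sign ds \<sigma>"
  if "\<sigma> permutes {..<length ds}"
  unfolding koszul_sign_def
proof (rule prod.cong)
  fix ab assume "ab \<in> {(i, j). i < j \<and> j < length ds \<and> \<sigma> j < \<sigma> i}"
  then obtain a b where ab: "ab = (a, b)" "a < b" "b < length ds" by auto
  then have "\<sigma> a < length ds" "\<sigma> b < length ds"
    using permutes_in_image[OF that] by auto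
  then show "(case ab of (i, j) \<Rightarrow> ksgn (map (\<lambda>d. d mod 2) ds ! \<sigma> i * map (\<lambda>d. d mod 2) ds ! \<sigma> j)) =
     (case ab of (i, j) \<Rightarrow> ksgn (ds ! \<sigma> i * ds ! \<sigma> j))"
    by (simp add: ab ksgn_def)
qed simp

text \<open>The value of the unshuffle coproduct on a word with letters \<open>xs\<close> of degrees \<open>ds\<close>.\<close>

definition shsum :: "int list \<Rightarrow> 'c list \<Rightarrow> nat \<Rightarrow> ('c \<Rightarrow> rat) list \<Rightarrow> rat" where
  "shsum ds xs i \<Phi> = (\<Sum>\<sigma>\<in>shuffles_perm i (length xs). of_int (sign \<sigma>) * koszul_sign ds \<sigma> *
     (\<Prod>p<length xs. (\<Phi> ! p) (xs ! \<sigma> p)))"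

lemma prod_pins:
  assumes \<sigma>: "\<sigma> permutes {..<n}" and i: "i \<le> n" and n: "length xs = n" "length As = i" "length Bs = n - i"
  shows "(\<Prod>p<Suc n. ((As @ g # Bs) ! p) ((x # xs) ! pins i \<sigma> p)) =
    g x * (\<Prod>p<n. ((As @ Bs) ! p) (xs ! \<sigma> p))"
proof -
  define c where "c p = (if p < i then p else Suc p)" for p
  have injc: "inj c" by (auto simp: c_def inj_def)
  have "{..<Suc n} = insert i (c ` {..<n})"
  proof (intro set_eqI iffI)
    fix p assume p: "p \<in> {..<Suc n}"
    show "p \<in> insert i (c ` {..<n})"
    proof (cases "p = i")
      case False
      then have "p = c (if p < i then p else p - 1)" "(if p < i then p else p - 1) < n"
        using p i by (auto simp: c_def)
      then show ?thesis by blast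
    qed simp
  qed (use i in \<open>auto simp: c_def split: if_splits\<close>)
  then have "(\<Prod>p<Suc n. ((As @ g # Bs) ! p) ((x # xs) ! pins i \<sigma> p)) =
     (\<Prod>p\<in>insert i (c ` {..<n}). ((As @ g # Bs) ! p) ((x # xs) ! pins i \<sigma> p))" by simp
  also have "\<dots> = g x * (\<Prod>p\<in>c ` {..<n}. ((As @ g # Bs) ! p) ((x # xs) ! pins i \<sigma> p))"
    by (subst prod.insert) (auto simp: c_def pins_simps n nth_append)
  also have "(\<Prod>p\<in>c ` {..<n}. ((As @ g # Bs) ! p) ((x # xs) ! pins i \<sigma> p)) =
     (\<Prod>p<n. ((As @ Bs) ! p) (xs ! \<sigma> p))"
    by (subst prod.reindex[OF inj_on_subset[OF injc subset_UNIV]])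
      (auto simp: c_def pins_simps n nth_append intro!: prod.cong)
  finally show ?thesis .
qed

context grading
begin

text \<open>Split by the position of the first letter. At position 0 it costs nothing; at position i
  it has passed i letters, which gives \<open>(-1) ^ i\<close> and Koszul signs. The latter depend
  on the letters passed and are stored in the functionals through \<open>gsign G d\<close>.\<close>

lemma shsum_Cons:
  assumes n: "length xs = n" "length ds = n" and i: "i \<le> Suc n" and \<Phi>: "length \<Phi> = Suc n" "all_linear \<Phi>"
    and ds: "\<And>p. p < n \<Longrightarrow> xs ! p \<in> G (ds ! p)"
  shows "shsum (d # ds) (x # xs) i \<Phi> =
    (if i = 0 then 0 else (\<Phi> ! 0) x * shsum ds xs (i - 1) (tl \<Phi>)) +
    (if i \<le> n then (-1) ^ i * (\<Phi> ! i) x *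
       shsum ds xs i (map (\<lambda>f. f \<circ> gsign G d) (take i \<Phi>) @ drop (Suc i) \<Phi>) else 0)"
proof -
  have perm: "\<sigma> permutes {..<n}" if "\<sigma> \<in> shuffles_perm j n" for \<sigma> j
    using that by (simp add: shuffles_perm_def)
  have 1: "of_int (sign (pins 0 \<sigma>)) * koszul_sign (d # ds) (pins 0 \<sigma>) *
      (\<Prod>p<Suc n. (\<Phi> ! p) ((x # xs) ! pins 0 \<sigma> p)) =
      (\<Phi> ! 0) x * (of_int (sign \<sigma>) * koszul_sign ds \<sigma> * (\<Prod>p<n. (tl \<Phi> ! p) (xs ! \<sigma> p)))"
    if "\<sigma> \<in> shuffles_perm (i - 1) n" for \<sigma>
  proof -
    have \<Phi>': "\<Phi> = [] @ (\<Phi> ! 0) # tl \<Phi>" using \<Phi>(1) by (cases \<Phi>) auto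
    have "(\<Prod>p<Suc n. (([] @ (\<Phi> ! 0) # tl \<Phi>) ! p) ((x # xs) ! pins 0 \<sigma> p)) =
       (\<Phi> ! 0) x * (\<Prod>p<n. (([] @ tl \<Phi>) ! p) (xs ! \<sigma> p))"
      by (rule prod_pins[OF perm[OF that]]) (use n \<Phi> in auto)
    then show ?thesis
      unfolding \<Phi>'[symmetric]
      by (simp only: koszul_sign_pins[OF perm[OF that] le0 n(2)] pins_permutes(2)[OF perm[OF that] le0]) simp
  qed
  have 2: "of_int (sign (pins i \<sigma>)) * koszul_sign (d # ds) (pins i \<sigma>) *
      (\<Prod>p<Suc n. (\<Phi> ! p) ((x # xs) ! pins i \<sigma> p)) =
      (-1) ^ i * (\<Phi> ! i) x * (of_int (sign \<sigma>) * koszul_sign ds \<sigma> *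
        (\<Prod>p<n. ((map (\<lambda>f. f \<circ> gsign G d) (take i \<Phi>) @ drop (Suc i) \<Phi>) ! p) (xs ! \<sigma> p)))"
    if i: "i \<le> n" and \<sigma>: "\<sigma> \<in> shuffles_perm i n" for \<sigma>
  proof -
    have \<Phi>': "\<Phi> = take i \<Phi> @ (\<Phi> ! i) # drop (Suc i) \<Phi>" using \<Phi>(1) i by (simp add: id_take_nth_drop)
    have e: "(\<Prod>p<Suc n. ((take i \<Phi> @ (\<Phi> ! i) # drop (Suc i) \<Phi>) ! p) ((x # xs) ! pins i \<sigma> p)) =
       (\<Phi> ! i) x * (\<Prod>p<n. ((take i \<Phi> @ drop (Suc i) \<Phi>) ! p) (xs ! \<sigma> p))"
      by (rule prod_pins[OF perm[OF \<sigma>]]) (use n \<Phi> i in auto)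
    have "(\<Prod>p<i. ksgn (d * ds ! \<sigma> p)) * (\<Prod>p<n. ((take i \<Phi> @ drop (Suc i) \<Phi>) ! p) (xs ! \<sigma> p)) =
       (\<Prod>p<n. if p < i then ksgn (d * ds ! \<sigma> p) else 1) * (\<Prod>p<n. ((take i \<Phi> @ drop (Suc i) \<Phi>) ! p) (xs ! \<sigma> p))"
    proof -
      have "(\<Prod>p<n. if p < i then ksgn (d * ds ! \<sigma> p) else 1) = (\<Prod>p<i. ksgn (d * ds ! \<sigma> p))"
        using i by (intro prod.mono_neutral_cong_right) auto
      then show ?thesis by simp
    qed
    also have "\<dots> = (\<Prod>p<n. ((map (\<lambda>f. f \<circ> gsign G d) (take i \<Phi>) @ drop (Suc i) \<Phi>) ! p) (xs ! \<sigma> p))"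
      unfolding prod.distrib[symmetric]
    proof (rule prod.cong)
      fix p assume p: "p \<in> {..<n}"
      then have "\<sigma> p < n" using permutes_in_image[OF perm[OF \<sigma>]] by auto
      then have g: "gsign G d (xs ! \<sigma> p) = ksgn (d * ds ! \<sigma> p) *\<^sub>Q (xs ! \<sigma> p)"
        by (intro gsign_homog ds)
      have "p < i \<Longrightarrow> qlinear (\<Phi> ! p)" using \<Phi> i by (simp add: all_linear_def)
      then show "(if p < i then ksgn (d * ds ! \<sigma> p) else 1) * ((take i \<Phi> @ drop (Suc i) \<Phi>) ! p) (xs ! \<sigma> p) =
         ((map (\<lambda>f. f \<circ> gsign G d) (take i \<Phi>) @ drop (Suc i) \<Phi>) ! p) (xs ! \<sigma> p)"
        using \<Phi>(1) i p by (auto simp: nth_append g qlinear_scale)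
    qed simp
    finally show ?thesis
      using e unfolding \<Phi>'[symmetric]
      by (simp only: koszul_sign_pins[OF perm[OF \<sigma>] i n(2)] pins_permutes(2)[OF perm[OF \<sigma>] i])
        (simp add: mult_ac)
  qed
  show ?thesis
    using n i unfolding shsum_def length_Cons n(1)
    by (simp only: sum_shuffles_perm_Suc[OF i]) (simp add: 1 2 sum_distrib_left del: prod.lessThan_Suc)
qed

text \<open>The parity projections annihilate every pattern except that of the word, so a single
  term of the sum in \<open>graded_perm\<close> survives.\<close>

lemma graded_perm_pure:
  assumes \<sigma>: "\<sigma> permutes {..<n}" and n: "length xs = n" "length ds = n" "length \<Phi> = n"
    and \<Phi>: "all_linear \<Phi>" and ds: "\<And>p. p < n \<Longrightarrow> xs ! p \<in> G (ds ! p)"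
  shows "graded_perm G \<sigma> (pure xs) \<Phi> = koszul_sign ds \<sigma> * (\<Prod>p<n. (\<Phi> ! p) (xs ! \<sigma> p))"
proof -
  define es0 where "es0 = map (\<lambda>d. d mod 2) ds"
  have inv: "inv \<sigma> j < n" if "j < n" for j
    using permutes_in_image[OF permutes_inv[OF \<sigma>], of j] that by auto
  have lin: "qlinear (\<Phi> ! inv \<sigma> j)" if "j < n" for j
    using \<Phi> inv[OF that] n by (simp add: all_linear_def)
  have L: "all_linear (map (\<lambda>j. \<Phi> ! inv \<sigma> j \<circ> parity_part G (es ! j)) [0..<n])" for es
    by (auto simp: all_linear_def intro!: qlinear_compose lin qlinear_parity_part)
  have at_word: "pure xs (map (\<lambda>j. \<Phi> ! inv \<sigma> j \<circ> parity_part G (es ! j)) [0..<n]) =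
      (if es = es0 then \<Prod>j<n. (\<Phi> ! inv \<sigma> j) (xs ! j) else 0)" if es: "length es = n" for es
  proof -
    have "pure xs (map (\<lambda>j. \<Phi> ! inv \<sigma> j \<circ> parity_part G (es ! j)) [0..<n]) =
       (\<Prod>j<n. (\<Phi> ! inv \<sigma> j) (parity_part G (es ! j) (xs ! j)))"
      using L[of es] n by (simp add: pure_def)
    also have "\<dots> = (\<Prod>j<n. if es ! j = es0 ! j then (\<Phi> ! inv \<sigma> j) (xs ! j) else 0)"
    proof (intro prod.cong refl)
      fix j assume "j \<in> {..<n}"
      then show "(\<Phi> ! inv \<sigma> j) (parity_part G (es ! j) (xs ! j)) =
         (if es ! j = es0 ! j then (\<Phi> ! inv \<sigma> j) (xs ! j) else 0)"
        using parity_part_homog[OF ds[of j], of "es ! j"] lin[of j] n by (auto simp: es0_def qlinear_0)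
    qed
    also have "\<dots> = (if es = es0 then \<Prod>j<n. (\<Phi> ! inv \<sigma> j) (xs ! j) else 0)"
    proof (cases "es = es0")
      case False
      then obtain j where "j < n" "es ! j \<noteq> es0 ! j"
        using es n by (auto simp: es0_def list_eq_iff_nth_eq)
      then have "(\<Prod>j<n. if es ! j = es0 ! j then (\<Phi> ! inv \<sigma> j) (xs ! j) else 0) = 0"
        by (intro prod_zero) auto
      then show ?thesis using False by simp
    qed simp
    finally show ?thesis .
  qed
  have fin: "finite {es. length es = n \<and> set es \<subseteq> {0, 1::int}}"
    using finite_lists_length_eq[of "{0, 1::int}" n] by (simp add: conj_commute)
  have es0: "es0 \<in> {es. length es = n \<and> set es \<subseteq> {0, 1}}" using n by (auto simp: es0_def)
  have "graded_perm G \<sigma> (pure xs) \<Phi> = (\<Sum>es | length es = n \<and> set es \<subseteq> {0, 1}. koszul_sign es \<sigma> *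
      pure xs (map (\<lambda>j. \<Phi> ! inv \<sigma> j \<circ> parity_part G (es ! j)) [0..<n]))"
    using \<Phi> n by (simp add: graded_perm_def)
  also have "\<dots> = (\<Sum>es | length es = n \<and> set es \<subseteq> {0, 1}.
      if es = es0 then koszul_sign es0 \<sigma> * (\<Prod>j<n. (\<Phi> ! inv \<sigma> j) (xs ! j)) else 0)"
    by (rule sum.cong) (auto simp: at_word)
  also have "\<dots> = koszul_sign es0 \<sigma> * (\<Prod>j<n. (\<Phi> ! inv \<sigma> j) (xs ! j))"
    using es0 fin by simp
  also have "(\<Prod>j<n. (\<Phi> ! inv \<sigma> j) (xs ! j)) = (\<Prod>p<n. (\<Phi> ! inv \<sigma> (\<sigma> p)) (xs ! \<sigma> p))"
    using prod.permute[OF \<sigma>, of "\<lambda>j. (\<Phi> ! inv \<sigma> j) (xs ! j)"] by simp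
  also have "koszul_sign es0 \<sigma> = koszul_sign ds \<sigma>"
    unfolding es0_def by (rule koszul_sign_parity) (use \<sigma> n in simp)
  finally show ?thesis by (simp add: permutes_inverses[OF \<sigma>])
qed

end

inductive_cases hword_ConsE: "hword G V m (x # xs)"

inductive_cases hword_NilE: "hword G V m []"

definition words :: "(int \<Rightarrow> 'c::rat_vector set) \<Rightarrow> 'c set \<Rightarrow> 'c tensor set" where
  "words G V = qspan {pure xs |xs. \<exists>m. hword G V m xs}"

lemma power_words: "tensor_power G V k m \<subseteq> words G V"
  unfolding tensor_power_hword words_def by (rule Q.span_mono) auto

lemma words_tmult:
  assumes "s \<in> words G V" "t \<in> words G V" shows "tmult s t \<in> words G V"
proof -
  have sub: "qsubspace (words G V)" by (simp add: words_def)
  have base: "pure xs \<in> words G V" if "hword G V m xs" for m xs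
    using that unfolding words_def by (intro Q.span_base) blast
  have "tmult (pure xs) t \<in> words G V" if xs: "hword G V m xs" for m xs
    by (rule qspan_qlinear_mem[OF qlinear_tmult_right sub _ assms(2)[unfolded words_def]])
      (auto simp: pure_append[symmetric] dest: base[OF hword_append[OF xs]])
  then show ?thesis
    by (intro qspan_qlinear_mem[OF qlinear_tmult_left sub _ assms(1)[unfolded words_def]]) auto
qed

text \<open>The sign of \<open>susp\<close> transposed to functionals: one with n successors is
  composed with the sign of n times the degree.\<close>

fun twist :: "(int \<Rightarrow> 'c::rat_vector set) \<Rightarrow> ('c \<Rightarrow> rat) list \<Rightarrow> ('c \<Rightarrow> rat) list" where
  "twist C [] = []"
| "twist C (f # fs) = (f \<circ> gsign C (int (length fs))) # twist C fs"

lemma length_twist [simp]: "length (twist C fs) = length fs"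
  by (induction fs) auto

lemma twist_nth: "p < length fs \<Longrightarrow> twist C fs ! p = fs ! p \<circ> gsign C (int (length fs - Suc p))"
  by (induction fs arbitrary: p) (auto simp: nth_Cons split: nat.split)

lemma twist_append: "drop (length fs) (twist C (fs @ gs)) = twist C gs"
  by (induction fs) auto

text \<open>The unshuffle coproduct without signatures on \<open>T(s\<^sup>-\<^sup>1C)\<close>, obtained from the one with
  signatures on \<open>T(C)\<close> by conjugation with the desuspension.\<close>

definition shuf :: "(int \<Rightarrow> 'c::rat_vector set) \<Rightarrow> 'c tensor \<Rightarrow> ('c \<Rightarrow> rat) list \<Rightarrow> ('c \<Rightarrow> rat) list \<Rightarrow> rat" where
  "shuf C t \<phi>s \<psi>s = (\<Sum>\<sigma>\<in>shuffles_perm (length \<phi>s) (length \<phi>s + length \<psi>s).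
     of_int (sign \<sigma>) * graded_perm C \<sigma> (susp C (length \<phi>s + length \<psi>s) t) (twist C (\<phi>s @ \<psi>s)))"

lemma graded_perm_add: "graded_perm C \<sigma> (s + t) = graded_perm C \<sigma> s + graded_perm C \<sigma> t"
  and graded_perm_scale: "graded_perm C \<sigma> (a *\<^sub>Q t) = a *\<^sub>Q graded_perm C \<sigma> t"
  by (auto simp: graded_perm_def fun_eq_iff tensor_apply algebra_simps sum.distrib sum_distrib_left)

lemma graded_perm_zero: "graded_perm C \<sigma> 0 = 0"
  using graded_perm_scale[of C \<sigma> 0 0] by simp

lemma graded_perm_vanish: "(\<And>fs. length fs = length \<Phi> \<Longrightarrow> t fs = 0) \<Longrightarrow> graded_perm C \<sigma> t \<Phi> = 0"
  by (auto simp: graded_perm_def intro!: sum.neutral)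

lemma shuf_add: "shuf C (s + t) \<phi>s \<psi>s = shuf C s \<phi>s \<psi>s + shuf C t \<phi>s \<psi>s"
  and shuf_scale: "shuf C (a *\<^sub>Q t) \<phi>s \<psi>s = a * shuf C t \<phi>s \<psi>s"
  by (simp_all add: shuf_def susp_linear graded_perm_add graded_perm_scale tensor_apply algebra_simps
      sum.distrib sum_distrib_left)

lemma qlinear_shuf: "qlinear (\<lambda>t. shuf C t \<phi>s \<psi>s)"
  by (rule qlinearI) (simp_all add: shuf_add shuf_scale)

lemma shuf_diff: "shuf C (s - t) \<phi>s \<psi>s = shuf C s \<phi>s \<psi>s - shuf C t \<phi>s \<psi>s"
  by (rule qlinear_diff[OF qlinear_shuf])

lemma shuf_zero: "shuf C 0 \<phi>s \<psi>s = 0"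
  by (rule qlinear_0[OF qlinear_shuf])

abbreviation gtwist :: "(int \<Rightarrow> 'c::rat_vector set) \<Rightarrow> int \<Rightarrow> ('c \<Rightarrow> rat) list \<Rightarrow> ('c \<Rightarrow> rat) list" where
  "gtwist G m fs \<equiv> map (\<lambda>f. f \<circ> gsign G m) fs"

lemma tmult_cong_right:
  assumes "\<And>a. a \<le> length \<phi>s \<Longrightarrow> X (drop a \<phi>s) = Y (drop a \<phi>s)" shows "tmult s X \<phi>s = tmult s Y \<phi>s"
  unfolding tmult_def using assms by (intro sum.cong) auto

section \<open>The coproduct on desuspended words\<close>

context grading
begin

lemma all_linear_gtwist: "all_linear fs \<Longrightarrow> all_linear (gtwist G m fs)"
  by (auto simp: all_linear_def intro!: qlinear_compose qlinear_gsign)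

lemma all_linear_twist: "all_linear fs \<Longrightarrow> all_linear (twist G fs)"
  by (induction fs) (auto intro!: qlinear_compose qlinear_gsign)

text \<open>Each \<open>gsign\<close> is invertible, so every list of linear functionals is a twist.
  This is how values of \<open>unshuffle\<close> are read off from \<open>shuf\<close>.\<close>

lemma twist_surj: "all_linear gs \<Longrightarrow> \<exists>fs. all_linear fs \<and> length fs = length gs \<and> twist G fs = gs"
proof (induction gs)
  case (Cons g gs)
  then obtain fs where fs: "all_linear fs" "length fs = length gs" "twist G fs = gs" by auto
  have "qlinear (g \<circ> gsign G (- int (length gs)))"
    using Cons.prems by (intro qlinear_compose qlinear_gsign) simp
  moreover have "(g \<circ> gsign G (- int (length gs))) \<circ> gsign G (int (length gs)) = g"
    by (simp add: fun_eq_iff gsign_gsign)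
  ultimately show ?case
    using fs by (intro exI[of _ "(g \<circ> gsign G (- int (length gs))) # fs"]) simp
qed simp

lemma gtwist_power:
  assumes "t \<in> tensor_power G V k n" "all_linear fs"
  shows "t (gtwist G m fs) = ksgn (m * n) * t fs"
proof -
  have "pure xs (gtwist G m fs) = ksgn (m * n) * pure xs fs" if "hword G V n xs" for xs
    using that assms(2)
  proof (induction arbitrary: fs rule: hword.induct)
    case Nil
    then show ?case by (cases fs) auto
  next
    case (Cons x d n xs)
    then show ?case
      by (cases fs) (auto simp: gsign_homog qlinear_scale comp_def qlinear_comp[OF _ qlinear_gsign] ksgn_add
          distrib_left)
  qed
  then show ?thesis
    by (intro qspan_qlinear_eq[where f = "\<lambda>t. t (gtwist G m fs)" and g = "\<lambda>t. ksgn (m * n) * t fs",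
          OF _ _ _ assms(1)[unfolded tensor_power_hword]])
      (auto simp: qlinear_iff tensor_apply algebra_simps)
qed

end

text \<open>The sign by which \<open>susp\<close> acts on a word with letters of these
  degrees.\<close>

primrec ssgn :: "int list \<Rightarrow> rat" where
  "ssgn [] = 1"
| "ssgn (d # ds) = ksgn (int (length ds) * d) * ssgn ds"

context grading
begin

interpretation D: grading "desusp G"
  by standard (rule is_grading_desusp[OF is_grading])

lemma susp_pure_ssgn:
  "length ds = length xs \<Longrightarrow> (\<And>p. p < length xs \<Longrightarrow> xs ! p \<in> G (ds ! p)) \<Longrightarrow>
    susp G (length xs) (pure xs) = ssgn ds *\<^sub>Q pure xs"
proof (induction ds xs rule: list_induct2)
  case (Cons d ds x xs)
  have "x \<in> G d" using Cons.prems[of 0] by simp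
  moreover have "susp G (length xs) (pure xs) = ssgn ds *\<^sub>Q pure xs"
    using Cons.prems[of "Suc _"] by (intro Cons.IH) simp
  ultimately show ?case by (simp add: pure_Cons susp_Cons tmult_linear Cons.hyps)
qed (simp add: susp_Nil)

lemma susp_pure_other: "n \<noteq> length xs \<Longrightarrow> susp G n (pure xs) = 0"
  by (auto simp: susp_def tensor_map_def fun_eq_iff pure_length tensor_apply)

lemma shuf_pure:
  assumes "length ds = length xs" "\<And>p. p < length xs \<Longrightarrow> xs ! p \<in> G (ds ! p)" "all_linear \<phi>s" "all_linear \<psi>s"
  shows "shuf G (pure xs) \<phi>s \<psi>s = (if length xs = length \<phi>s + length \<psi>s then
     ssgn ds * shsum ds xs (length \<phi>s) (twist G (\<phi>s @ \<psi>s)) else 0)"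
proof (cases "length xs = length \<phi>s + length \<psi>s")
  case True
  have "graded_perm G \<sigma> (pure xs) (twist G (\<phi>s @ \<psi>s)) =
     koszul_sign ds \<sigma> * (\<Prod>p<length xs. (twist G (\<phi>s @ \<psi>s) ! p) (xs ! \<sigma> p))"
    if "\<sigma> \<in> shuffles_perm (length \<phi>s) (length \<phi>s + length \<psi>s)" for \<sigma>
    by (rule graded_perm_pure) (use assms that True in \<open>auto simp: shuffles_perm_def all_linear_twist\<close>)
  then show ?thesis
    using True susp_pure_ssgn[OF assms(1,2)]
    by (simp add: shuf_def shsum_def graded_perm_scale tensor_apply sum_distrib_left mult_ac)
next
  case False
  then show ?thesis
    by (simp add: shuf_def susp_pure_other graded_perm_zero tensor_apply)
qed

lemma shuf_Nil: "all_linear \<phi>s \<Longrightarrow> all_linear \<psi>s \<Longrightarrow> shuf G (pure []) \<phi>s \<psi>s = (if \<phi>s = [] \<and> \<psi>s = [] then 1 else 0)"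
proof -
  have "shuffles_perm 0 0 = {id}" by (auto simp: shuffles_perm_def strict_mono_on_def)
  then show "all_linear \<phi>s \<Longrightarrow> all_linear \<psi>s \<Longrightarrow> ?thesis"
    by (subst shuf_pure[of "[]"]) (auto simp: shsum_def koszul_sign_def)
qed

text \<open>Unshuffling by the first letter. The signature \<open>(-1) ^ i\<close> combines with the
  desuspension signs in such a way that only the Koszul sign for the shifted degree d - 1 is
  left.\<close>

lemma shuf_Cons:
  assumes xs: "length ds = length xs" "\<And>p. p < length xs \<Longrightarrow> xs ! p \<in> G (ds ! p)" and x: "x \<in> G d"
    and lin: "all_linear \<phi>s" "all_linear \<psi>s"
  shows "shuf G (pure (x # xs)) \<phi>s \<psi>s =
    (if \<phi>s = [] then 0 else hd \<phi>s x * shuf G (pure xs) (tl \<phi>s) \<psi>s) +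
    (if \<psi>s = [] then 0 else hd \<psi>s x * shuf G (pure xs) (gtwist (desusp G) (d - 1) \<phi>s) (tl \<psi>s))"
proof (cases "length (x # xs) = length \<phi>s + length \<psi>s")
  case False
  have "all_linear (tl \<phi>s)" "all_linear (tl \<psi>s)" "all_linear (gtwist (desusp G) (d - 1) \<phi>s)"
    using lin by (auto simp: D.all_linear_gtwist) (cases \<phi>s; cases \<psi>s; simp)+
  moreover have "shuf G (pure (x # xs)) \<phi>s \<psi>s = 0"
    using False assms by (subst shuf_pure[of "d # ds"]) (auto simp: nth_Cons split: nat.split)
  moreover have "shuf G (pure xs) \<alpha> \<beta> = 0"
    if "all_linear \<alpha>" "all_linear \<beta>" "length xs \<noteq> length \<alpha> + length \<beta>" for \<alpha> \<beta>
    using shuf_pure[OF xs that(1,2)] that(3) by simp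
  ultimately show ?thesis
    using False lin by (cases \<phi>s; cases \<psi>s) auto
next
  case True
  define n i j where "n = length xs" "i = length \<phi>s" "j = length \<psi>s"
  have nij: "Suc n = i + j" using True by (simp add: n_i_j_def)
  define \<Phi> where "\<Phi> = twist G (\<phi>s @ \<psi>s)"
  have \<Phi>: "length \<Phi> = Suc n" "all_linear \<Phi>"
    using nij lin by (auto simp: \<Phi>_def n_i_j_def all_linear_twist)
  have linT: "all_linear (tl \<phi>s)" "all_linear (tl \<psi>s)" "all_linear (gtwist (desusp G) (d - 1) \<phi>s)"
    using lin by (auto simp: D.all_linear_gtwist) (cases \<phi>s; cases \<psi>s; simp)+
  have 0: "shuf G (pure (x # xs)) \<phi>s \<psi>s = ksgn (int n * d) * ssgn ds * shsum (d # ds) (x # xs) i \<Phi>"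
    using True assms by (subst shuf_pure[of "d # ds"]) (auto simp: nth_Cons \<Phi>_def n_i_j_def split: nat.split)
  have 1: "shsum (d # ds) (x # xs) i \<Phi> =
    (if i = 0 then 0 else (\<Phi> ! 0) x * shsum ds xs (i - 1) (tl \<Phi>)) +
    (if i \<le> n then (-1) ^ i * (\<Phi> ! i) x * shsum ds xs i (gtwist G d (take i \<Phi>) @ drop (Suc i) \<Phi>) else 0)"
    by (rule shsum_Cons) (use xs \<Phi> nij in \<open>auto simp: n_i_j_def\<close>)
  have 2: "ksgn (int n * d) * ssgn ds * ((\<Phi> ! 0) x * shsum ds xs (i - 1) (tl \<Phi>)) =
     hd \<phi>s x * shuf G (pure xs) (tl \<phi>s) \<psi>s" if ne: "\<phi>s \<noteq> []"
  proof -
    obtain f fs where fs: "\<phi>s = f # fs" using ne by (cases \<phi>s) auto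
    have f: "qlinear f" using lin fs by simp
    have "(\<Phi> ! 0) x = ksgn (int n * d) * f x"
      using nij by (simp add: \<Phi>_def fs gsign_homog[OF x] qlinear_scale[OF f] n_i_j_def)
    moreover have "tl \<Phi> = twist G (fs @ \<psi>s)" by (simp add: \<Phi>_def fs)
    ultimately show ?thesis
      using nij shuf_pure[OF xs linT(1) lin(2)] by (simp add: fs n_i_j_def)
  qed
  have 3: "ksgn (int n * d) * ssgn ds * ((-1) ^ i * (\<Phi> ! i) x * shsum ds xs i (gtwist G d (take i \<Phi>) @ drop (Suc i) \<Phi>)) =
     hd \<psi>s x * shuf G (pure xs) (gtwist (desusp G) (d - 1) \<phi>s) (tl \<psi>s)" if ne: "\<psi>s \<noteq> []"
  proof -
    obtain g gs where gs: "\<psi>s = g # gs" using ne by (cases \<psi>s) auto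
    have g: "qlinear g" using lin gs by simp
    have jg: "j = Suc (length gs)" "n = i + length gs" using nij by (auto simp: gs n_i_j_def)
    have dr: "drop i \<Phi> = twist G \<psi>s" unfolding \<Phi>_def n_i_j_def by (rule twist_append)
    have "\<Phi> ! i = drop i \<Phi> ! 0" using \<Phi>(1) nij jg by (simp add: nth_drop)
    then have v: "(\<Phi> ! i) x = ksgn (int (length gs) * d) * g x"
      unfolding dr gs by (simp add: gsign_homog[OF x] qlinear_scale[OF g])
    have dr': "drop (Suc i) \<Phi> = twist G gs"
      using dr by (metis drop_Suc gs list.sel(3) tl_drop twist.simps(2))
    define \<Psi> where "\<Psi> = twist G (gtwist (desusp G) (d - 1) \<phi>s @ gs)"
    have dr'': "drop i \<Psi> = twist G gs"
      unfolding \<Psi>_def using twist_append[of "gtwist (desusp G) (d - 1) \<phi>s" G gs] by (simp add: n_i_j_def)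
    have len: "length \<Psi> = n" using jg by (simp add: \<Psi>_def n_i_j_def)
    \<comment> \<open>Each of the i functionals of the first factor is off by the same sign, that of
      d + 1. Their product is what cancels the signature in the end.\<close>
    have "shsum ds xs i (gtwist G d (take i \<Phi>) @ drop (Suc i) \<Phi>) = ksgn (d + 1) ^ i * shsum ds xs i \<Psi>"
      unfolding shsum_def sum_distrib_left
    proof (rule sum.cong)
      fix \<sigma> assume "\<sigma> \<in> shuffles_perm i (length xs)"
      then have \<sigma>: "\<sigma> permutes {..<n}" by (simp add: shuffles_perm_def n_i_j_def)
      have "(\<Prod>p<n. ((gtwist G d (take i \<Phi>) @ drop (Suc i) \<Phi>) ! p) (xs ! \<sigma> p)) =
        (\<Prod>p<n. (if p < i then ksgn (d + 1) else 1) * (\<Psi> ! p) (xs ! \<sigma> p))"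
      proof (rule prod.cong)
        fix p assume p: "p \<in> {..<n}"
        define y e where "y = xs ! \<sigma> p" "e = ds ! \<sigma> p"
        have "\<sigma> p < n" using p permutes_in_image[OF \<sigma>] by auto
        then have y: "y \<in> G e" unfolding y_e_def using xs(2) by (simp add: n_i_j_def)
        then have y': "y \<in> desusp G (e - 1)" by (simp add: desusp_def)
        show "((gtwist G d (take i \<Phi>) @ drop (Suc i) \<Phi>) ! p) (xs ! \<sigma> p) =
          (if p < i then ksgn (d + 1) else 1) * (\<Psi> ! p) (xs ! \<sigma> p)"
        proof (cases "p < i")
          case True
          have f: "qlinear (\<phi>s ! p)" using True lin(1) by (simp add: all_linear_def n_i_j_def)
          have "((gtwist G d (take i \<Phi>) @ drop (Suc i) \<Phi>) ! p) y =
             ksgn (d * e) * ksgn (int (i + j - Suc p) * e) * (\<phi>s ! p) y"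
            using True \<Phi>(1) nij
            by (simp add: nth_append \<Phi>_def twist_nth gsign_homog[OF y] qlinear_scale[OF f]
                qlinear_scale[OF qlinear_gsign] n_i_j_def)
          also have "ksgn (d * e) * ksgn (int (i + j - Suc p) * e) =
             ksgn (d + 1) * (ksgn ((d - 1) * (e - 1)) * ksgn (int (i + length gs - Suc p) * e))"
          proof -
            have "i + j - Suc p = Suc (i + length gs - Suc p)" using True jg by simp
            then show ?thesis by (auto simp: ksgn_def)
          qed
          also have "\<dots> * (\<phi>s ! p) y = ksgn (d + 1) * (\<Psi> ! p) y"
            using True
            by (simp add: nth_append \<Psi>_def twist_nth gsign_homog[OF y] D.gsign_homog[OF y'] qlinear_scale[OF f]
                qlinear_scale[OF qlinear_gsign] qlinear_scale[OF D.qlinear_gsign] n_i_j_def)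
          finally show ?thesis unfolding y_e_def(1)[symmetric] using True by (simp only: if_True)
        next
          case False
          then obtain q where q: "p = i + q" by (metis le_add_diff_inverse not_less)
          have "\<Psi> ! p = drop i \<Psi> ! q" using len p q by (simp add: nth_drop)
          then show ?thesis using False q \<Phi>(1) nij by (simp add: nth_append dr' dr'' min_def)
        qed
      qed simp
      also have "\<dots> = ksgn (d + 1) ^ i * (\<Prod>p<n. (\<Psi> ! p) (xs ! \<sigma> p))"
      proof -
        have "(\<Prod>p<n. if p < i then ksgn (d + 1) else 1) = (\<Prod>p<i. ksgn (d + 1))"
          using jg by (intro prod.mono_neutral_cong_right) auto
        then show ?thesis by (simp add: prod.distrib)
      qed
      finally show "of_int (sign \<sigma>) * koszul_sign ds \<sigma> *
          (\<Prod>p<length xs. ((gtwist G d (take i \<Phi>) @ drop (Suc i) \<Phi>) ! p) (xs ! \<sigma> p)) =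
        ksgn (d + 1) ^ i * (of_int (sign \<sigma>) * koszul_sign ds \<sigma> * (\<Prod>p<length xs. (\<Psi> ! p) (xs ! \<sigma> p)))"
        by (simp add: n_i_j_def)
    qed simp
    moreover have "shuf G (pure xs) (gtwist (desusp G) (d - 1) \<phi>s) (tl \<psi>s) = ssgn ds * shsum ds xs i \<Psi>"
      using shuf_pure[OF xs linT(3) linT(2)] jg by (simp add: gs \<Psi>_def n_i_j_def)
    moreover have "ksgn (int n * d) * (-1) ^ i * ksgn (int (length gs) * d) * ksgn (d + 1) ^ i = 1"
      unfolding jg(2) by (auto simp: ksgn_def)
    moreover have "ksgn (int n * d) * ssgn ds * ((-1) ^ i * (ksgn (int (length gs) * d) * g x) * (ksgn (d + 1) ^ i * S)) =
       (ksgn (int n * d) * (-1) ^ i * ksgn (int (length gs) * d) * ksgn (d + 1) ^ i) * (g x * (ssgn ds * S))" for S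
      by (simp only: mult_ac)
    ultimately show ?thesis by (simp only: v gs list.sel mult_1_left)
  qed
  have "i \<le> n \<longleftrightarrow> \<psi>s \<noteq> []" "i = 0 \<longleftrightarrow> \<phi>s = []"
    using nij by (cases \<psi>s; auto simp: n_i_j_def)+
  then show ?thesis unfolding 0 1 using 2 3 by (auto simp: distrib_left)
qed

lemma hword_degrees_nth:
  assumes "hword G V m xs"
  obtains ds where "length ds = length xs" "\<And>p. p < length xs \<Longrightarrow> xs ! p \<in> G (ds ! p)"
  using assms unfolding hword_iff_degrees by blast

lemma hword_undesusp: "hword (desusp G) V m xs \<Longrightarrow> hword G V (m + int (length xs)) xs"
proof (induction rule: hword.induct)
  case (Cons x d m xs)
  then have "hword G V ((d + 1) + (m + int (length xs))) (x # xs)"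
    by (intro hword.Cons) (auto simp: desusp_def)
  then show ?case by (simp add: add_ac)
qed (simp add: hword.Nil)

text \<open>Lie elements are primitive for the unshuffle coproduct.\<close>

lemma shuf_lie_mult:
  "(k, m, s) \<in> lie_words (desusp G) V \<Longrightarrow> w \<in> words (desusp G) V \<Longrightarrow> all_linear \<phi>s \<Longrightarrow> all_linear \<psi>s \<Longrightarrow>
    shuf G (tmult s w) \<phi>s \<psi>s = tmult s (\<lambda>\<alpha>. shuf G w \<alpha> \<psi>s) \<phi>s +
      tmult s (\<lambda>\<beta>. shuf G w (gtwist (desusp G) m \<phi>s) \<beta>) \<psi>s"
proof (induction k m s arbitrary: w \<phi>s \<psi>s rule: lie_words.induct)
  case (gen x m)
  have xm: "x \<in> G (m + 1)" using gen by (simp add: desusp_def)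
  have lin: "all_linear (gtwist (desusp G) m \<phi>s)" by (rule D.all_linear_gtwist[OF gen(3)])
  have red: "shuf G (tmult (ten1 x) w) \<phi>s \<psi>s =
     (if \<phi>s = [] then 0 else hd \<phi>s x * shuf G w (tl \<phi>s) \<psi>s) +
     (if \<psi>s = [] then 0 else hd \<psi>s x * shuf G w (gtwist (desusp G) m \<phi>s) (tl \<psi>s))"
  proof (rule qspan_qlinear_eq[OF _ _ _ gen(2)[unfolded words_def]])
    show "qlinear (\<lambda>w. shuf G (tmult (ten1 x) w) \<phi>s \<psi>s)"
      by (rule qlinear_comp[OF qlinear_shuf qlinear_tmult_right])
    show "qlinear (\<lambda>w. (if \<phi>s = [] then 0 else hd \<phi>s x * shuf G w (tl \<phi>s) \<psi>s) +
     (if \<psi>s = [] then 0 else hd \<psi>s x * shuf G w (gtwist (desusp G) m \<phi>s) (tl \<psi>s)))"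
      by (simp add: qlinear_iff shuf_add shuf_scale algebra_simps)
    fix w assume "w \<in> {pure xs |xs. \<exists>m. hword (desusp G) V m xs}"
    then obtain xs n where w: "w = pure xs" and "hword (desusp G) V n xs" by blast
    then obtain ds where "length ds = length xs" "\<And>p. p < length xs \<Longrightarrow> xs ! p \<in> G (ds ! p)"
      using hword_degrees_nth[OF hword_undesusp] by metis
    from shuf_Cons[OF this xm gen(3,4)] show "shuf G (tmult (ten1 x) w) \<phi>s \<psi>s =
      (if \<phi>s = [] then 0 else hd \<phi>s x * shuf G w (tl \<phi>s) \<psi>s) +
      (if \<psi>s = [] then 0 else hd \<psi>s x * shuf G w (gtwist (desusp G) m \<phi>s) (tl \<psi>s))"
      by (simp add: w pure_Cons)
  qed
  show ?case
    unfolding red using gen(3,4)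
    by (cases \<phi>s; cases \<psi>s) (simp_all add: tmult_ten1_Cons comp_def del: tmult_simps(2))
next
  case (zero k m)
  then show ?case by (simp only: tmult_linear shuf_zero) (simp add: tensor_apply)
next
  case (comb k m s t a b)
  show ?case
    unfolding tmult_linear shuf_add shuf_scale comb.IH(1)[OF comb.prems] comb.IH(2)[OF comb.prems]
    by (simp add: tensor_apply algebra_simps)
next
  case (brac k m s l n t)
  note lin = brac.prems(2,3)
  note s = lie_words_power[OF brac.hyps(1)] and t = lie_words_power[OF brac.hyps(2)]
  have tw: "tmult t w \<in> words (desusp G) V" "tmult s w \<in> words (desusp G) V"
    using words_tmult[OF subsetD[OF power_words t] brac.prems(1)]
      words_tmult[OF subsetD[OF power_words s] brac.prems(1)] by auto
  \<comment> \<open>The mixed contributions, with s and t in different factors. They occur in both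
    orders of the product, and the sign of the graded commutator makes them cancel.\<close>
  let ?X = "\<lambda>s t n. tmult s (\<lambda>\<alpha>. tmult t (\<lambda>\<beta>. shuf G w (gtwist (desusp G) n \<alpha>) \<beta>) \<psi>s) \<phi>s"
  have expand: "shuf G (tmult s (tmult t w)) \<phi>s \<psi>s =
     tmult (tmult s t) (\<lambda>\<alpha>. shuf G w \<alpha> \<psi>s) \<phi>s + ?X s t n + ksgn (m * n) * ?X t s m +
     tmult (tmult s t) (\<lambda>\<beta>. shuf G w (gtwist (desusp G) (m + n) \<phi>s) \<beta>) \<psi>s"
    if IHs: "\<And>w \<phi>s \<psi>s. w \<in> words (desusp G) V \<Longrightarrow> all_linear \<phi>s \<Longrightarrow> all_linear \<psi>s \<Longrightarrow>
        shuf G (tmult s w) \<phi>s \<psi>s = tmult s (\<lambda>\<alpha>. shuf G w \<alpha> \<psi>s) \<phi>s +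
        tmult s (\<lambda>\<beta>. shuf G w (gtwist (desusp G) m \<phi>s) \<beta>) \<psi>s"
      and IHt: "\<And>w \<phi>s \<psi>s. w \<in> words (desusp G) V \<Longrightarrow> all_linear \<phi>s \<Longrightarrow> all_linear \<psi>s \<Longrightarrow>
        shuf G (tmult t w) \<phi>s \<psi>s = tmult t (\<lambda>\<alpha>. shuf G w \<alpha> \<psi>s) \<phi>s +
        tmult t (\<lambda>\<beta>. shuf G w (gtwist (desusp G) n \<phi>s) \<beta>) \<psi>s"
      and t: "t \<in> tensor_power (desusp G) V l n" and tw: "tmult t w \<in> words (desusp G) V"
    for s t m n l
  proof -
    have lin': "all_linear (gtwist (desusp G) m \<phi>s)" by (rule D.all_linear_gtwist[OF lin(1)])
    have A: "tmult s (\<lambda>\<alpha>. shuf G (tmult t w) \<alpha> \<psi>s) \<phi>s =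
       tmult s (tmult t (\<lambda>\<alpha>. shuf G w \<alpha> \<psi>s)) \<phi>s + ?X s t n"
    proof -
      have "tmult s (\<lambda>\<alpha>. shuf G (tmult t w) \<alpha> \<psi>s) \<phi>s =
         tmult s (tmult t (\<lambda>\<alpha>. shuf G w \<alpha> \<psi>s) + (\<lambda>\<alpha>. tmult t (\<lambda>\<beta>. shuf G w (gtwist (desusp G) n \<alpha>) \<beta>) \<psi>s)) \<phi>s"
        by (rule tmult_cong_right)
          (simp only: plus_fun_apply IHt[OF brac.prems(1) all_linear_drop[OF lin(1)] lin(2)])
      then show ?thesis by (simp only: tmult_add_right plus_fun_apply)
    qed
    have B: "tmult s (\<lambda>\<beta>. shuf G (tmult t w) (gtwist (desusp G) m \<phi>s) \<beta>) \<psi>s =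
       tmult s (\<lambda>\<beta>. tmult t (\<lambda>\<alpha>. shuf G w \<alpha> \<beta>) (gtwist (desusp G) m \<phi>s)) \<psi>s +
       tmult s (tmult t (\<lambda>\<beta>. shuf G w (gtwist (desusp G) n (gtwist (desusp G) m \<phi>s)) \<beta>)) \<psi>s"
    proof -
      have "tmult s (\<lambda>\<beta>. shuf G (tmult t w) (gtwist (desusp G) m \<phi>s) \<beta>) \<psi>s =
         tmult s ((\<lambda>\<beta>. tmult t (\<lambda>\<alpha>. shuf G w \<alpha> \<beta>) (gtwist (desusp G) m \<phi>s)) +
           tmult t (\<lambda>\<beta>. shuf G w (gtwist (desusp G) n (gtwist (desusp G) m \<phi>s)) \<beta>)) \<psi>s"
        by (rule tmult_cong_right)
          (simp only: plus_fun_apply IHt[OF brac.prems(1) lin' all_linear_drop[OF lin(2)]])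
      then show ?thesis by (simp only: tmult_add_right plus_fun_apply)
    qed
    have "tmult s (\<lambda>\<beta>. tmult t (\<lambda>\<alpha>. shuf G w \<alpha> \<beta>) (gtwist (desusp G) m \<phi>s)) \<psi>s =
       (\<Sum>b\<le>length \<psi>s. \<Sum>a\<le>length \<phi>s. s (take b \<psi>s) * (t (gtwist (desusp G) m (take a \<phi>s)) *
          shuf G w (gtwist (desusp G) m (drop a \<phi>s)) (drop b \<psi>s)))"
      by (simp add: tmult_def sum_distrib_left take_map drop_map)
    also have "\<dots> = (\<Sum>a\<le>length \<phi>s. \<Sum>b\<le>length \<psi>s. s (take b \<psi>s) * (t (gtwist (desusp G) m (take a \<phi>s)) *
          shuf G w (gtwist (desusp G) m (drop a \<phi>s)) (drop b \<psi>s)))"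
      by (rule sum.swap)
    \<comment> \<open>Here t meets functionals already twisted by the degree of s; as t is
      homogeneous, the twist is a sign.\<close>
    also have "\<dots> = ksgn (m * n) * ?X t s m"
      by (simp add: tmult_def sum_distrib_left D.gtwist_power[OF t all_linear_take[OF lin(1)]] mult_ac)
    finally have Cc: "tmult s (\<lambda>\<beta>. tmult t (\<lambda>\<alpha>. shuf G w \<alpha> \<beta>) (gtwist (desusp G) m \<phi>s)) \<psi>s =
       ksgn (m * n) * ?X t s m" .
    have "gtwist (desusp G) n (gtwist (desusp G) m \<phi>s) = gtwist (desusp G) (m + n) \<phi>s"
      by (simp add: fun_eq_iff D.gsign_gsign)
    then show ?thesis
      unfolding IHs[OF tw lin] A B Cc by (simp only: tmult_assoc add.assoc)
  qed
  have 1: "shuf G (tmult s (tmult t w)) \<phi>s \<psi>s =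
     tmult (tmult s t) (\<lambda>\<alpha>. shuf G w \<alpha> \<psi>s) \<phi>s + ?X s t n + ksgn (m * n) * ?X t s m +
     tmult (tmult s t) (\<lambda>\<beta>. shuf G w (gtwist (desusp G) (m + n) \<phi>s) \<beta>) \<psi>s"
    by (rule expand[OF brac.IH(1) brac.IH(2) t tw(1)])
  have 2: "shuf G (tmult t (tmult s w)) \<phi>s \<psi>s =
     tmult (tmult t s) (\<lambda>\<alpha>. shuf G w \<alpha> \<psi>s) \<phi>s + ?X t s m + ksgn (n * m) * ?X s t n +
     tmult (tmult t s) (\<lambda>\<beta>. shuf G w (gtwist (desusp G) (n + m) \<phi>s) \<beta>) \<psi>s"
    by (rule expand[OF brac.IH(2) brac.IH(1) s tw(2)])
  have c: "ksgn (n * m) = ksgn (m * n)" "n + m = m + n" by (simp_all add: mult.commute)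
  show ?case
    unfolding tbracket_def tmult_linear tmult_assoc shuf_diff shuf_scale 1[unfolded tmult_assoc] 2[unfolded tmult_assoc] c
    by (simp add: tensor_apply algebra_simps)
qed

text \<open>Multiply by the empty word. Its coproduct vanishes as soon as one list is nonempty, so
  both terms of the product formula are zero.\<close>

lemma shuf_lie:
  assumes "(k, m, s) \<in> lie_words (desusp G) V" "all_linear \<phi>s" "all_linear \<psi>s" "\<phi>s \<noteq> []" "\<psi>s \<noteq> []"
  shows "shuf G s \<phi>s \<psi>s = 0"
proof -
  have "pure [] \<in> words (desusp G) V"
    unfolding words_def by (rule Q.span_base) (auto intro: hword.Nil)
  from shuf_lie_mult[OF assms(1) this assms(2,3)]
  have "shuf G s \<phi>s \<psi>s = tmult s (\<lambda>\<alpha>. shuf G (pure []) \<alpha> \<psi>s) \<phi>s +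
      tmult s (\<lambda>\<beta>. shuf G (pure []) (gtwist (desusp G) m \<phi>s) \<beta>) \<psi>s" by simp
  also have "tmult s (\<lambda>\<alpha>. shuf G (pure []) \<alpha> \<psi>s) \<phi>s = tmult s 0 \<phi>s"
    by (rule tmult_cong_right) (simp add: shuf_Nil all_linear_drop assms tensor_apply)
  also have "tmult s (\<lambda>\<beta>. shuf G (pure []) (gtwist (desusp G) m \<phi>s) \<beta>) \<psi>s = tmult s 0 \<psi>s"
    by (rule tmult_cong_right) (simp add: shuf_Nil all_linear_drop assms D.all_linear_gtwist tensor_apply)
  finally show ?thesis by (simp add: tmult_def tensor_apply)
qed

lemma unshuffle_shuf:
  assumes t: "t \<in> tensor_power G V k m" and ne: "\<phi>s \<noteq> []" "\<psi>s \<noteq> []" and lin: "all_linear \<phi>s" "all_linear \<psi>s"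
    and k: "k = length \<phi>s + length \<psi>s"
  obtains \<phi>s' \<psi>s' where "all_linear \<phi>s'" "all_linear \<psi>s'" "\<phi>s' \<noteq> []" "\<psi>s' \<noteq> []"
    "unshuffle G t (\<phi>s, \<psi>s) = shuf G (susp G k t) \<phi>s' \<psi>s'"
proof -
  obtain fs where fs: "all_linear fs" "length fs = length (\<phi>s @ \<psi>s)" "twist G fs = \<phi>s @ \<psi>s"
    using twist_surj[of "\<phi>s @ \<psi>s"] lin by auto
  have "unshuffle G t (\<phi>s, \<psi>s) = shuf G (susp G k t) (take (length \<phi>s) fs) (drop (length \<phi>s) fs)"
    using ne fs k susp_power(2)[OF t] by (simp add: unshuffle_def shuf_def)
  moreover have "take (length \<phi>s) fs \<noteq> []" "drop (length \<phi>s) fs \<noteq> []" using fs(2) ne by auto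
  ultimately show ?thesis using that all_linear_take[OF fs(1)] all_linear_drop[OF fs(1)] by blast
qed

text \<open>Degenerate lists of functionals give 0 by definition or by length. On the others the
  value is one of \<open>shuf\<close> on the desuspended tensor, which is a Lie element.\<close>

lemma unshuffle_lie:
  assumes t: "t \<in> tensor_power G V k m" and lie: "(k, n, susp G k t) \<in> lie_words (desusp G) V"
  shows "unshuffle G t = 0"
proof
  fix \<phi>\<psi> :: "('c \<Rightarrow> rat) list \<times> ('c \<Rightarrow> rat) list"
  obtain \<phi>s \<psi>s where p: "\<phi>\<psi> = (\<phi>s, \<psi>s)" by fastforce
  consider "\<phi>s = [] \<or> \<psi>s = []" | "\<not> all_linear (\<phi>s @ \<psi>s)" | "k \<noteq> length \<phi>s + length \<psi>s" |
    "\<phi>s \<noteq> []" "\<psi>s \<noteq> []" "all_linear \<phi>s" "all_linear \<psi>s" "k = length \<phi>s + length \<psi>s" by auto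
  then have "unshuffle G t (\<phi>s, \<psi>s) = 0"
  proof cases
    case 3
    have "t fs = 0" if "length fs \<noteq> k" for fs
      using fun_cong[OF length_family_len[OF length_family_tensor_power t, of k], of fs] that
      by (auto simp: len_part_def)
    then have "graded_perm G \<sigma> t (\<phi>s @ \<psi>s) = 0" for \<sigma> using 3 by (intro graded_perm_vanish) simp
    then show ?thesis by (simp add: unshuffle_def)
  next
    case 4
    from unshuffle_shuf[OF t this] obtain \<phi>s' \<psi>s' where
      *: "all_linear \<phi>s'" "all_linear \<psi>s'" "\<phi>s' \<noteq> []" "\<psi>s' \<noteq> []"
        "unshuffle G t (\<phi>s, \<psi>s) = shuf G (susp G k t) \<phi>s' \<psi>s'" by blast
    show ?thesis unfolding *(5) by (rule shuf_lie[OF lie *(1-4)])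
  qed (auto simp: unshuffle_def graded_perm_def)
  then show "unshuffle G t \<phi>\<psi> = 0 \<phi>\<psi>" by (simp add: p tensor_apply)
qed

text \<open>Twice a word of two letters minus its unshuffling is the bracket of the letters. If the
  unshuffling of a tensor vanishes, twice the tensor is therefore a Lie element, and over the
  rationals so is its half.\<close>

lemma lie_words_of_unshuffle_2:
  assumes t: "t \<in> tensor_power G V 2 m" and u: "unshuffle G t = 0"
  shows "(2, m - 2, susp G 2 t) \<in> lie_words (desusp G) V"
proof -
  define s where "s = susp G 2 t"
  have s: "s \<in> tensor_power (desusp G) V 2 (m - 2)" and st: "t = susp G 2 s"
    using susp_power[OF t] by (simp_all add: s_def)
  define B where "B w = (2::rat) *\<^sub>Q w - (\<lambda>fs. if all_linear fs \<and> length fs = 2 then shuf G w [fs ! 0] [fs ! 1] else 0)" for w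
  have qB: "qlinear B"
    by (rule qlinearI) (simp_all add: B_def fun_eq_iff shuf_add shuf_scale tensor_apply algebra_simps)
  have "B (pure xs) \<in> lie_family (desusp G) V (m - 2) 2"
    if xs: "length xs = 2" "hword (desusp G) V (m - 2) xs" for xs
  proof -
    obtain x y where xy: "xs = [x, y]" using xs(1) by (auto simp: numeral_2_eq_2 length_Suc_conv)
    then have "hword (desusp G) V (m - 2) [x, y]" using xs(2) by simp
    then obtain d m' where d: "x \<in> V" "x \<in> desusp G d" "m - 2 = d + m'" "hword (desusp G) V m' [y]"
      by (rule hword_ConsE)
    from d(4) obtain e m'' where e: "y \<in> V" "y \<in> desusp G e" "m' = e + m''" "hword (desusp G) V m'' []"
      by (rule hword_ConsE)
    from e(4) have "m'' = 0" by (rule hword_NilE)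
    with d e have de: "x \<in> V" "x \<in> desusp G d" "y \<in> V" "y \<in> desusp G e" "m - 2 = d + e" by simp_all
    then have G: "x \<in> G (d + 1)" "y \<in> G (e + 1)" by (auto simp: desusp_def)
    have sh: "shuf G (pure [x, y]) [f] [g] = f x * g y + ksgn (d * e) * g x * f y" if "qlinear f" "qlinear g" for f g
    proof -
      have y1: "shuf G (pure [y]) \<phi>s \<psi>s = (if \<phi>s = [] then 0 else hd \<phi>s y * shuf G (pure []) (tl \<phi>s) \<psi>s) +
        (if \<psi>s = [] then 0 else hd \<psi>s y * shuf G (pure []) (gtwist (desusp G) (e + 1 - 1) \<phi>s) (tl \<psi>s))"
        if "all_linear \<phi>s" "all_linear \<psi>s" for \<phi>s \<psi>s
        by (rule shuf_Cons[of "[]" "[]"]) (use that G in auto)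
      have "shuf G (pure [x, y]) [f] [g] = f x * shuf G (pure [y]) [] [g] +
         g x * shuf G (pure [y]) (gtwist (desusp G) d [f]) []"
        using shuf_Cons[of "[e + 1]" "[y]" x "d + 1" "[f]" "[g]"] G that by simp
      also have "shuf G (pure [y]) [] [g] = g y"
        using that by (subst y1) (simp_all add: shuf_Nil)
      also have "shuf G (pure [y]) (gtwist (desusp G) d [f]) [] = ksgn (d * e) * f y"
        using that D.all_linear_gtwist[of "[f]" d] D.gsign_homog[OF de(4), of d]
        by (subst y1) (simp_all add: shuf_Nil qlinear_scale[OF that(1)])
      finally show ?thesis by simp
    qed
    have "B (pure [x, y]) = tbracket d e (ten1 x) (ten1 y)"
    proof
      fix fs :: "('c \<Rightarrow> rat) list"
      show "B (pure [x, y]) fs = tbracket d e (ten1 x) (ten1 y) fs"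
      proof (cases "all_linear fs \<and> length fs = 2")
        case True
        then obtain f g where "fs = [f, g]" "qlinear f" "qlinear g"
          by (auto simp: numeral_2_eq_2 length_Suc_conv)
        then show ?thesis
          by (simp add: B_def sh tbracket_def tmult_ten1_Cons tensor_apply algebra_simps del: tmult_simps(2))
      next
        case False
        have e: "tmult (ten1 a) (ten1 b) = pure [a, b]" for a b :: 'c
          by (simp only: pure_Cons[of a "[b]"] ten1_def)
        have "pure [a, b] fs = 0" for a b using False by (auto simp: pure_def)
        then show ?thesis using False by (auto simp: B_def tbracket_def e tensor_apply)
      qed
    qed
    moreover have "(1 + 1, d + e, tbracket d e (ten1 x) (ten1 y)) \<in> lie_words (desusp G) V"
      by (intro lie_words.brac lie_words.gen) (use de in auto)
    ultimately show ?thesis by (simp add: lie_family_def xy de(5) numeral_2_eq_2)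
  qed
  then have "B s \<in> lie_family (desusp G) V (m - 2) 2"
    by (intro qspan_qlinear_mem[OF qB qsubspace_lie_family _ s[unfolded tensor_power_hword]]) auto
  moreover have "shuf G s [f] [g] = 0" if "qlinear f" "qlinear g" for f g
  proof -
    \<comment> \<open>The functional \<open>f \<circ> gsign G 1\<close> is what \<open>twist\<close>
      makes of f in front of one more functional.\<close>
    have "unshuffle G t ([f \<circ> gsign G 1], [g]) = shuf G s [f] [g]"
      by (simp add: unshuffle_def shuf_def st numeral_2_eq_2 comp_def)
    then show ?thesis using u by (simp add: tensor_apply)
  qed
  then have "(if all_linear fs \<and> length fs = 2 then shuf G s [fs ! 0] [fs ! 1] else 0) = 0" for fs
    by (simp add: all_linear_def)
  then have "B s = (2::rat) *\<^sub>Q s"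
    unfolding B_def by (simp add: fun_eq_iff tensor_apply)
  ultimately have "(2::rat) *\<^sub>Q s \<in> lie_family (desusp G) V (m - 2) 2" by simp
  from Q.subspace_scale[OF qsubspace_lie_family this, of "1/2"]
  have "s \<in> lie_family (desusp G) V (m - 2) 2" by simp
  then show ?thesis by (simp add: lie_family_def s_def)
qed

end

section \<open>Sums over trees\<close>

lemma leaves_pos: "proper T \<Longrightarrow> leaves T \<ge> 1"
proof (induction T)
  case (Vertex ts)
  then obtain t ts' where ts: "ts = t # ts'" by (cases ts) auto
  then have "leaves t \<ge> 1" using Vertex by simp
  then show ?case using ts by simp
qed simp

lemma length_le_leaves: "(\<And>t. t \<in> set ts \<Longrightarrow> proper t) \<Longrightarrow> length ts \<le> sum_list (map leaves ts)"
proof (induction ts)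
  case (Cons t ts)
  then show ?case using leaves_pos[of t] by fastforce
qed simp

lemma leaves_subtree:
  assumes "t \<in> set ts" "length ts \<ge> 2" "\<And>t. t \<in> set ts \<Longrightarrow> proper t"
  shows "leaves t < sum_list (map leaves ts)"
proof -
  obtain as bs where ts: "ts = as @ t # bs" using assms(1) by (auto simp: in_set_conv_decomp)
  have "length as + length bs \<le> sum_list (map leaves as) + sum_list (map leaves bs)"
    using assms(3) ts by (intro add_mono length_le_leaves) auto
  then show ?thesis using assms(2) ts by auto
qed

text \<open>A proper vertex has at least two subtrees with at least one leaf each. So each subtree
  has fewer leaves, and there are at most j of them.\<close>

lemma finite_PT: "finite (PT j)"
proof (induction j rule: less_induct)
  case (less j)
  have "PT j \<subseteq> {Leaf} \<union> Vertex ` {ts. set ts \<subseteq> (\<Union>i<j. PT i) \<and> length ts \<le> j}"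
  proof
    fix T assume T: "T \<in> PT j"
    show "T \<in> {Leaf} \<union> Vertex ` {ts. set ts \<subseteq> (\<Union>i<j. PT i) \<and> length ts \<le> j}"
    proof (cases T)
      case (Vertex ts)
      then have ts: "length ts \<ge> 2" "\<And>t. t \<in> set ts \<Longrightarrow> proper t" "sum_list (map leaves ts) = j"
        using T by (auto simp: PT_def)
      then have "set ts \<subseteq> (\<Union>i<j. PT i)" using leaves_subtree[of _ ts] by (auto simp: PT_def)
      moreover have "length ts \<le> j" using length_le_leaves[of ts] ts by simp
      ultimately show ?thesis using Vertex by auto
    qed simp
  qed
  moreover have "finite {ts. set ts \<subseteq> (\<Union>i<j. PT i) \<and> length ts \<le> j}"
    using less by (intro finite_lists_length_le) auto
  ultimately show ?case by (meson finite.emptyI finite.insertI finite_Un finite_imageI finite_subset)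
qed

lemma PT_1: "PT 1 = {Leaf}"
proof -
  have "T = Leaf" if "proper T" "leaves T = 1" for T
  proof (cases T)
    case (Vertex ts)
    then show ?thesis using that length_le_leaves[of ts] by auto
  qed
  then show ?thesis by (auto simp: PT_def)
qed

text \<open>Made for operations that vanish at nonbinary vertices: what remains is a root with two
  subtrees, sorted by the number a of leaves on the left.\<close>

lemma sum_binary_trees:
  fixes F :: "ptree \<Rightarrow> 'b::comm_monoid_add"
  assumes j: "j \<ge> 2" and F: "\<And>ts. length ts \<noteq> 2 \<Longrightarrow> F (Vertex ts) = 0"
  shows "(\<Sum>T\<in>PT j. F T) = (\<Sum>a=1..j-1. \<Sum>t1\<in>PT a. \<Sum>t2\<in>PT (j - a). F (Vertex [t1, t2]))"
proof -
  let ?S = "SIGMA a:{1..j-1}. PT a \<times> PT (j - a)"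
  let ?g = "\<lambda>(a, t1, t2). Vertex [t1, t2]"
  have inj: "inj_on ?g ?S" by (auto simp: inj_on_def PT_def)
  have sub: "?g ` ?S \<subseteq> PT j" by (auto simp: PT_def)
  have "F T = 0" if "T \<in> PT j - ?g ` ?S" for T
  proof (cases T)
    case Leaf
    then show ?thesis using that j by (auto simp: PT_def)
  next
    case (Vertex ts)
    have "length ts \<noteq> 2"
    proof
      assume "length ts = 2"
      then obtain t1 t2 where ts: "ts = [t1, t2]" by (auto simp: numeral_2_eq_2 length_Suc_conv)
      then have *: "proper t1" "proper t2" "leaves t1 + leaves t2 = j" using that Vertex by (auto simp: PT_def)
      then have "(leaves t1, t1, t2) \<in> ?S" using leaves_pos[of t1] leaves_pos[of t2] by (auto simp: PT_def)
      then have "?g (leaves t1, t1, t2) \<in> ?g ` ?S" by (rule imageI)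
      then show False using that Vertex ts by simp
    qed
    then show ?thesis using F Vertex by simp
  qed
  then have "(\<Sum>T\<in>PT j. F T) = (\<Sum>T\<in>?g ` ?S. F T)"
    by (intro sum.mono_neutral_right finite_PT sub) auto
  also have "\<dots> = (\<Sum>(a, t1, t2)\<in>?S. F (Vertex [t1, t2]))"
    by (subst sum.reindex[OF inj]) (auto intro!: sum.cong)
  also have "\<dots> = (\<Sum>a=1..j-1. \<Sum>(t1, t2)\<in>PT a \<times> PT (j - a). F (Vertex [t1, t2]))"
    by (subst sum.Sigma[symmetric]) (auto simp: finite_PT)
  also have "\<dots> = (\<Sum>a=1..j-1. \<Sum>t1\<in>PT a. \<Sum>t2\<in>PT (j - a). F (Vertex [t1, t2]))"
    by (simp add: sum.cartesian_product)
  finally show ?thesis .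
qed

lemma vertex_sign_2: "vertex_sign [a, b] = ksgn ((int a - 1) * int b)"
  by (simp add: vertex_sign_def)

lemma tensor_power_2_induct:
  assumes F: "qlinear F" "qsubspace S" and t: "t \<in> tensor_power G V 2 m"
    and step: "\<And>y z n n'. y \<in> V \<Longrightarrow> y \<in> G n \<Longrightarrow> z \<in> V \<Longrightarrow> z \<in> G n' \<Longrightarrow> m = n + n' \<Longrightarrow> F (pure [y, z]) \<in> S"
  shows "F t \<in> S"
proof (rule qspan_qlinear_mem[OF F _ t[unfolded tensor_power_hword]])
  fix s assume "s \<in> {pure xs |xs. length xs = 2 \<and> hword G V m xs}"
  then obtain y z where s: "s = pure [y, z]" and h: "hword G V m [y, z]"
    by (auto simp: numeral_2_eq_2 length_Suc_conv)
  from h obtain n m' where 1: "y \<in> V" "y \<in> G n" "m = n + m'" "hword G V m' [z]" by (rule hword_ConsE)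
  from 1(4) obtain n' m'' where 2: "z \<in> V" "z \<in> G n'" "m' = n' + m''" "hword G V m'' []" by (rule hword_ConsE)
  from 2(4) have "m'' = 0" by (rule hword_NilE)
  then show "F s \<in> S" unfolding s using 1 2 by (intro step) auto
qed

lemma tensor_power_2_eq:
  assumes F: "qlinear F" "qlinear F'" and t: "t \<in> tensor_power G V 2 m"
    and step: "\<And>y z n n'. y \<in> V \<Longrightarrow> y \<in> G n \<Longrightarrow> z \<in> V \<Longrightarrow> z \<in> G n' \<Longrightarrow> m = n + n' \<Longrightarrow>
      F (pure [y, z]) = F' (pure [y, z])"
  shows "F t = F' t"
proof -
  have "F t - F' t \<in> {0}"
    by (rule tensor_power_2_induct[OF qlinear_minus[OF F] _ t, of "{0}"]) (auto simp: Q.subspace_single_0 step)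
  then show ?thesis by simp
qed

lemma (in grading) tensor_map_pair:
  assumes f: "qlinear f" "len_part a (f y) = f y" "lin_supp (f y)"
    and g: "qlinear g" "len_part b (g z) = g z" "lin_supp (g z)" and y: "y \<in> G n" and z: "z \<in> G n'"
  shows "tensor_map G [(d, a, f), (e, b, g)] (pure [y, z]) = ksgn (e * n) *\<^sub>Q tmult (f y) (g z)"
proof -
  have "pure [y, z] = tmult (ten1 y) (tmult (ten1 z) (pure []))"
    by (simp only: pure_Cons)
  then show ?thesis
    by (simp add: tensor_map_Cons[OF f(1) y f(2,3)] tensor_map_Cons[OF g(1) z g(2,3)] tensor_map_Nil
        del: tmult_one_right) simp
qed

text \<open>Linearity and degrees are what sums over trees require; the homotopy identities enter in
  \<open>contraction\<close>.\<close>

locale tree_transfer = coop C B D for C :: "int \<Rightarrow> 'c::rat_vector set" and B D +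
  fixes p \<kappa> :: "'c \<Rightarrow> 'c" and H :: "'c set"
  assumes D_zero: "\<And>k. k \<ge> 3 \<Longrightarrow> D k = (\<lambda>x. 0)"
    and p_lin: "qlinear p" and p_mem: "\<And>x n. x \<in> B \<Longrightarrow> x \<in> C n \<Longrightarrow> p x \<in> H \<inter> C n"
    and k_lin: "qlinear \<kappa>" and k_mem: "\<And>x n. x \<in> B \<Longrightarrow> x \<in> C n \<Longrightarrow> \<kappa> x \<in> B \<inter> C (n + 1)"
    and B_sub: "qsubspace B" and H_sub: "H \<subseteq> B"
begin

section \<open>Operations along trees\<close>

abbreviation top :: "('c \<Rightarrow> 'c) \<Rightarrow> ptree \<Rightarrow> 'c \<Rightarrow> 'c tensor" where
  "top e T \<equiv> tree_op C D p \<kappa> e T"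

abbreviation ktree :: "ptree \<Rightarrow> 'c \<Rightarrow> 'c tensor" where
  "ktree T \<equiv> tree_op C D p \<kappa> (\<lambda>y. - \<kappa> y) T"

lemma neg_k_mem: "x \<in> B \<Longrightarrow> x \<in> C n \<Longrightarrow> - \<kappa> x \<in> B \<inter> C (n + 1)"
  using k_mem[of x n] Q.subspace_neg[OF sub] Q.subspace_neg[OF B_sub] by auto

lemma top_lin: "proper T \<Longrightarrow> qlinear e \<Longrightarrow> qlinear (top e T)"
proof (cases T)
  case Leaf
  then show ?thesis by (simp add: qlinear_comp[OF qlinear_ten1 p_lin])
next
  case (Vertex ts)
  assume "proper T" "qlinear e"
  then show ?thesis using Vertex
    by (simp add: qlinear_cmult qlinear_comp[OF qlinear_tensor_map] qlinear_comp[OF coop_lin])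
qed

lemma ktree_lin: "proper T \<Longrightarrow> qlinear (ktree T)"
  by (rule top_lin) (auto intro: qlinear_uminus k_lin)

lemma top_zero: "length ts \<noteq> 2 \<Longrightarrow> proper (Vertex ts) \<Longrightarrow> top e (Vertex ts) x = 0"
  using D_zero[of "length ts"] by (simp add: qlinear_0[OF qlinear_tensor_map])

lemma top_pair: "top e (Vertex [t1, t2]) x = vertex_sign [leaves t1, leaves t2] *\<^sub>Q
    tensor_map C [(int (leaves t1) - 1, leaves t1, ktree t1), (int (leaves t2) - 1, leaves t2, ktree t2)] (D 2 (e x))"
  by (simp add: numeral_2_eq_2)

lemma pair_power:
  assumes t: "t \<in> tensor_power C B 2 m"
    and f: "qlinear f" "\<And>x n. x \<in> B \<Longrightarrow> x \<in> C n \<Longrightarrow> f x \<in> tensor_power C H a (n + d)"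
    and g: "qlinear g" "\<And>x n. x \<in> B \<Longrightarrow> x \<in> C n \<Longrightarrow> g x \<in> tensor_power C H b (n + e)"
  shows "tensor_map C [(d, a, f), (e, b, g)] t \<in> tensor_power C H (a + b) (m + d + e)"
proof (rule tensor_power_2_induct[OF qlinear_tensor_map tensor_power_subspace t])
  fix y z n n' assume y: "y \<in> B" "y \<in> C n" and z: "z \<in> B" "z \<in> C n'" and m: "m = n + n'"
  have len: "len_part a (f y) = f y" "len_part b (g z) = g z"
    using length_family_len[OF length_family_tensor_power f(2)[OF y], of a]
      length_family_len[OF length_family_tensor_power g(2)[OF z], of b] by auto
  have "tensor_map C [(d, a, f), (e, b, g)] (pure [y, z]) = ksgn (e * n) *\<^sub>Q tmult (f y) (g z)"
    by (rule tensor_map_pair[OF f(1) len(1) lin_supp_Tc[OF power_in_Tc[OF f(2)[OF y]]]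
          g(1) len(2) lin_supp_Tc[OF power_in_Tc[OF g(2)[OF z]]] y(2) z(2)])
  then show "tensor_map C [(d, a, f), (e, b, g)] (pure [y, z]) \<in> tensor_power C H (a + b) (m + d + e)"
    using tensor_power_tmult[OF f(2)[OF y] g(2)[OF z]]
    by (simp add: Q.subspace_scale[OF tensor_power_subspace] m algebra_simps)
qed

lemma ktree_power:
  "proper T \<Longrightarrow> x \<in> B \<Longrightarrow> x \<in> C n \<Longrightarrow> ktree T x \<in> tensor_power C H (leaves T) (n + (int (leaves T) - 1))"
proof (induction T arbitrary: x n)
  case Leaf
  then show ?case
    using pure_in_power[OF hword_single[of "p x" H C n]] p_mem[of x n] by (simp add: ten1_def)
next
  case (Vertex ts)
  show ?case
  proof (cases "length ts = 2")
    case True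
    then obtain t1 t2 where ts: "ts = [t1, t2]" by (auto simp: numeral_2_eq_2 length_Suc_conv)
    then have pr: "proper t1" "proper t2" using Vertex.prems by auto
    have "D 2 (- \<kappa> x) \<in> tensor_power C B 2 (n + 1)"
      using coop_power[of 2 "- \<kappa> x" "n + 1"] neg_k_mem[OF Vertex.prems(2,3)] by (simp add: add.commute)
    then have "tensor_map C [(int (leaves t1) - 1, leaves t1, ktree t1), (int (leaves t2) - 1, leaves t2, ktree t2)]
        (D 2 (- \<kappa> x)) \<in> tensor_power C H (leaves t1 + leaves t2) (n + 1 + (int (leaves t1) - 1) + (int (leaves t2) - 1))"
    proof (rule pair_power[OF _ ktree_lin[OF pr(1)] _ ktree_lin[OF pr(2)]])
      show "ktree t1 y \<in> tensor_power C H (leaves t1) (q + (int (leaves t1) - 1))" if "y \<in> B" "y \<in> C q" for y q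
        using that by (intro Vertex.IH) (simp_all add: ts pr)
      show "ktree t2 y \<in> tensor_power C H (leaves t2) (q + (int (leaves t2) - 1))" if "y \<in> B" "y \<in> C q" for y q
        using that by (intro Vertex.IH) (simp_all add: ts pr)
    qed
    then show ?thesis
      unfolding ts top_pair by (simp add: Q.subspace_scale[OF tensor_power_subspace] algebra_simps)
  next
    case False
    then show ?thesis
      unfolding top_zero[OF False Vertex.prems(1)] by (intro Q.subspace_0[OF tensor_power_subspace])
  qed
qed

text \<open>Trees with the homotopy also on the root edge: the projection before desuspension, up to
  sign. The trivial tree contributes p.\<close>

definition gop :: "nat \<Rightarrow> 'c \<Rightarrow> 'c tensor" where
  "gop j x = (\<Sum>T\<in>PT j. ktree T x)"

text \<open>The map e on the root edge separates two uses: the identity gives the transferred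
  operations, the negative homotopy gives \<open>gop\<close>.\<close>

definition top_sum :: "nat \<Rightarrow> ('c \<Rightarrow> 'c) \<Rightarrow> 'c \<Rightarrow> 'c tensor" where
  "top_sum j e x = (\<Sum>T\<in>PT j. top e T x)"

lemma gop_lin: "qlinear (gop j)"
  unfolding gop_def[abs_def] by (intro qlinear_setsum ktree_lin) (auto simp: PT_def)

lemma gop_power: "x \<in> B \<Longrightarrow> x \<in> C n \<Longrightarrow> gop j x \<in> tensor_power C H j (n + (int j - 1))"
  unfolding gop_def using ktree_power[of _ x n]
  by (intro Q.subspace_sum[OF tensor_power_subspace]) (auto simp: PT_def)

lemma gop_1: "gop 1 x = ten1 (p x)"
  by (simp add: gop_def PT_1[simplified])

lemma pair_sum:
  assumes t: "t \<in> tensor_power C B 2 m"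
  shows "(\<Sum>t1\<in>PT a. \<Sum>t2\<in>PT b. tensor_map C [(d, a, ktree t1), (e, b, ktree t2)] t) =
    tensor_map C [(d, a, gop a), (e, b, gop b)] t"
proof (rule tensor_power_2_eq[OF _ _ t])
  show "qlinear (\<lambda>t. \<Sum>t1\<in>PT a. \<Sum>t2\<in>PT b. tensor_map C [(d, a, ktree t1), (e, b, ktree t2)] t)"
    by (intro qlinear_setsum qlinear_tensor_map)
  show "qlinear (tensor_map C [(d, a, gop a), (e, b, gop b)])" by (rule qlinear_tensor_map)
  fix y z n n' assume y: "y \<in> B" "y \<in> C n" and z: "z \<in> B" "z \<in> C n'"
  note fam = length_family_len[OF length_family_tensor_power]
  have "tensor_map C [(d, a, ktree t1), (e, b, ktree t2)] (pure [y, z]) = ksgn (e * n) *\<^sub>Q tmult (ktree t1 y) (ktree t2 z)"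
    if "t1 \<in> PT a" "t2 \<in> PT b" for t1 t2
  proof -
    have pr: "proper t1" "proper t2" "leaves t1 = a" "leaves t2 = b" using that by (auto simp: PT_def)
    note P = ktree_power[OF pr(1) y] ktree_power[OF pr(2) z]
    show ?thesis
      using fam[OF P(1), of a] fam[OF P(2), of b] pr
      by (intro tensor_map_pair[OF ktree_lin[OF pr(1)] _ lin_supp_Tc[OF power_in_Tc[OF P(1)]]
          ktree_lin[OF pr(2)] _ lin_supp_Tc[OF power_in_Tc[OF P(2)]] y(2) z(2)]) auto
  qed
  then have "(\<Sum>t1\<in>PT a. \<Sum>t2\<in>PT b. tensor_map C [(d, a, ktree t1), (e, b, ktree t2)] (pure [y, z])) =
    ksgn (e * n) *\<^sub>Q tmult (gop a y) (gop b z)"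
    by (simp add: gop_def tmult_sum_left tmult_sum_right Q.scale_sum_right) (rule sum.swap)
  also have "\<dots> = tensor_map C [(d, a, gop a), (e, b, gop b)] (pure [y, z])"
    using fam[OF gop_power[OF y, of a], of a] fam[OF gop_power[OF z, of b], of b]
    by (intro tensor_map_pair[symmetric, OF gop_lin _ lin_supp_Tc[OF power_in_Tc[OF gop_power[OF y]]]
          gop_lin _ lin_supp_Tc[OF power_in_Tc[OF gop_power[OF z]]] y(2) z(2)]) auto
  finally show "(\<Sum>t1\<in>PT a. \<Sum>t2\<in>PT b. tensor_map C [(d, a, ktree t1), (e, b, ktree t2)] (pure [y, z])) =
    tensor_map C [(d, a, gop a), (e, b, gop b)] (pure [y, z])" .
qed

text \<open>Cut at the root vertex. The two subtrees vary independently, so their sums assemble to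
  \<open>gop\<close>.\<close>

lemma top_sum_eq:
  assumes "j \<ge> 2" and t: "D 2 (e x) \<in> tensor_power C B 2 m"
  shows "top_sum j e x = (\<Sum>a=1..j-1. ksgn ((int a - 1) * int (j - a)) *\<^sub>Q
    tensor_map C [(int a - 1, a, gop a), (int (j - a) - 1, j - a, gop (j - a))] (D 2 (e x)))"
proof -
  \<comment> \<open>The guard makes the summand vanish at every nonbinary vertex, improper trees
    included, as \<open>sum_binary_trees\<close> requires.\<close>
  have "top_sum j e x = (\<Sum>T\<in>PT j. if proper T then top e T x else 0)"
    unfolding top_sum_def by (intro sum.cong) (auto simp: PT_def)
  also have "\<dots> = (\<Sum>a=1..j-1. \<Sum>t1\<in>PT a. \<Sum>t2\<in>PT (j - a).
      if proper (Vertex [t1, t2]) then top e (Vertex [t1, t2]) x else 0)"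
    by (rule sum_binary_trees[OF assms(1)]) (auto simp: top_zero simp del: tree_op.simps)
  also have "\<dots> = (\<Sum>a=1..j-1. \<Sum>t1\<in>PT a. \<Sum>t2\<in>PT (j - a). ksgn ((int a - 1) * int (j - a)) *\<^sub>Q
      tensor_map C [(int a - 1, a, ktree t1), (int (j - a) - 1, j - a, ktree t2)] (D 2 (e x)))"
    by (intro sum.cong refl) (auto simp: PT_def top_pair vertex_sign_2 simp del: tree_op.simps)
  also have "\<dots> = (\<Sum>a=1..j-1. ksgn ((int a - 1) * int (j - a)) *\<^sub>Q
    tensor_map C [(int a - 1, a, gop a), (int (j - a) - 1, j - a, gop (j - a))] (D 2 (e x)))"
    unfolding Q.scale_sum_right[symmetric] pair_sum[OF t] ..
  finally show ?thesis .
qed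

text \<open>The components of the projection \<open>T(s\<^sup>-\<^sup>1B) \<rightarrow> T(s\<^sup>-\<^sup>1H)\<close> on generators.\<close>

definition \<gamma> :: "nat \<Rightarrow> 'c \<Rightarrow> 'c tensor" where
  "\<gamma> j x = - (ksgn (int j) *\<^sub>Q susp C j (gop j x))"

lemma \<gamma>_lin: "qlinear (\<gamma> j)"
  unfolding \<gamma>_def[abs_def] by (intro qlinear_uminus qlinear_cmult qlinear_comp[OF qlinear_susp gop_lin])

lemma \<gamma>_power: 
  assumes "x \<in> B" "x \<in> desusp C n" shows "\<gamma> j x \<in> tensor_power (desusp C) H j n"
proof -
  have "susp C j (gop j x) \<in> tensor_power (desusp C) H j (n + 1 + (int j - 1) - int j)"
    using assms by (intro susp_power(1) gop_power) (auto simp: desusp_def)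
  then show ?thesis
    unfolding \<gamma>_def
    by (intro Q.subspace_neg[OF tensor_power_subspace] Q.subspace_scale[OF tensor_power_subspace]) simp
qed

text \<open>Here the choice of \<open>vertex_sign\<close> pays off: after desuspension the recursion
  at the root is, up to the sign of j, the value of an algebra map on words of two letters.\<close>

lemma susp_pair:
  assumes t: "t \<in> tensor_power C B 2 m" and j: "j \<ge> 2"
  shows "susp C j (\<Sum>a=1..j-1. ksgn ((int a - 1) * int (j - a)) *\<^sub>Q
      tensor_map C [(int a - 1, a, gop a), (int (j - a) - 1, j - a, gop (j - a))] t) =
    ksgn (int j) *\<^sub>Q len_part j (alg (letter \<gamma>) (susp C 2 t))"
proof (rule tensor_power_2_eq[OF _ _ t])
  have lin: "qlinear (letter \<gamma>)"
    by (rule qlinearI) (auto simp: letter_def fun_eq_iff qlinear_add[OF \<gamma>_lin] qlinear_scale[OF \<gamma>_lin] tensor_apply)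
  have nil: "letter \<gamma> x [] = 0" for x by (simp add: letter_def)
  show "qlinear (\<lambda>t. susp C j (\<Sum>a=1..j-1. ksgn ((int a - 1) * int (j - a)) *\<^sub>Q
      tensor_map C [(int a - 1, a, gop a), (int (j - a) - 1, j - a, gop (j - a))] t))"
    by (intro qlinear_comp[OF qlinear_susp] qlinear_setsum qlinear_cmult qlinear_tensor_map)
  show "qlinear (\<lambda>t. ksgn (int j) *\<^sub>Q len_part j (alg (letter \<gamma>) (susp C 2 t)))"
    by (intro qlinear_cmult qlinear_comp[OF qlinear_len_part] qlinear_comp[OF filtered_qlinear[OF filtered_alg] qlinear_susp])
  fix y z n n' assume y: "y \<in> B" "y \<in> C n" and z: "z \<in> B" "z \<in> C n'"
  note fam = length_family_len[OF length_family_tensor_power]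
  have y': "y \<in> desusp C (n - 1)" and z': "z \<in> desusp C (n' - 1)" using y z by (auto simp: desusp_def)
  have s2: "susp C 2 (pure [y, z]) = ksgn n *\<^sub>Q pure [y, z]"
  proof -
    have "susp C (Suc (Suc 0)) (tmult (ten1 y) (tmult (ten1 z) (pure []))) =
       ksgn n *\<^sub>Q tmult (ten1 y) (tmult (ten1 z) (pure []))"
      unfolding susp_Cons[OF y(2)] susp_Cons[OF z(2)] susp_Nil by simp
    then show ?thesis by (simp only: pure_Cons numeral_2_eq_2)
  qed
  have term_eq: "susp C j (ksgn ((int a - 1) * int (j - a)) *\<^sub>Q
      tensor_map C [(int a - 1, a, gop a), (int (j - a) - 1, j - a, gop (j - a))] (pure [y, z])) =
      (ksgn (int j) * ksgn n) *\<^sub>Q tmult (\<gamma> a y) (\<gamma> (j - a) z)" if a: "a \<in> {1..j-1}" for a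
  proof -
    define b where "b = j - a"
    have ab: "j = a + b" using a by (auto simp: b_def)
    have tm: "tensor_map C [(int a - 1, a, gop a), (int b - 1, b, gop b)] (pure [y, z]) =
       ksgn ((int b - 1) * n) *\<^sub>Q tmult (gop a y) (gop b z)"
      using fam[OF gop_power[OF y, of a], of a] fam[OF gop_power[OF z, of b], of b]
      by (intro tensor_map_pair[OF gop_lin _ lin_supp_Tc[OF power_in_Tc[OF gop_power[OF y]]]
            gop_lin _ lin_supp_Tc[OF power_in_Tc[OF gop_power[OF z]]] y(2) z(2)]) auto
    have g: "susp C i (gop i x) = - (ksgn (int i) *\<^sub>Q \<gamma> i x)" for i x by (simp add: \<gamma>_def)
    have "susp C (a + b) (tmult (gop a y) (gop b z)) =
       ksgn (int b * (n + (int a - 1))) *\<^sub>Q tmult (susp C a (gop a y)) (susp C b (gop b z))"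
      by (rule susp_tmult_power[OF gop_power[OF y]])
    also have "\<dots> = (ksgn (int b * (n + (int a - 1))) * ksgn (int a) * ksgn (int b)) *\<^sub>Q tmult (\<gamma> a y) (\<gamma> b z)"
      unfolding g by (simp add: tmult_linear mult_ac)
    finally have "susp C j (ksgn ((int a - 1) * int b) *\<^sub>Q
        tensor_map C [(int a - 1, a, gop a), (int b - 1, b, gop b)] (pure [y, z])) =
      (ksgn ((int a - 1) * int b) * ksgn ((int b - 1) * n) * (ksgn (int b * (n + (int a - 1))) * ksgn (int a) * ksgn (int b))) *\<^sub>Q
        tmult (\<gamma> a y) (\<gamma> b z)"
      unfolding tm ab by (simp add: susp_linear mult_ac)
    also have "ksgn ((int a - 1) * int b) * ksgn ((int b - 1) * n) * (ksgn (int b * (n + (int a - 1))) * ksgn (int a) * ksgn (int b)) =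
      ksgn (int j) * ksgn n"
      unfolding ab by (auto simp: ksgn_def)
    finally show ?thesis by (simp add: b_def)
  qed
  have len: "len_part i (letter \<gamma> x) = (if i = 0 then 0 else \<gamma> i x)" if "x \<in> B" "x \<in> desusp C m" for i x m
    using fam[OF \<gamma>_power[OF that, of i], of i] by (simp add: len_part_0_letter D.len_part_letter)
  have "alg (letter \<gamma>) (pure [y, z]) = tmult (letter \<gamma> y) (letter \<gamma> z)"
    by (simp only: alg_pure_Cons[OF lin nil] alg_Nil tmult_one_right)
  \<comment> \<open>The ends i = 0 and i = j drop out because \<open>letter\<close> has no component
    of length 0.\<close>
  then have "len_part j (alg (letter \<gamma>) (pure [y, z])) = (\<Sum>i\<le>j. if i \<in> {1..j-1} then tmult (\<gamma> i y) (\<gamma> (j - i) z) else 0)"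
    by (simp only: len_part_tmult len[OF y(1) y'] len[OF z(1) z'])
      (intro sum.cong refl, use j in \<open>auto simp: tmult_linear\<close>)
  also have "\<dots> = (\<Sum>a=1..j-1. tmult (\<gamma> a y) (\<gamma> (j - a) z))"
    by (rule sum.mono_neutral_cong_right) auto
  finally have "ksgn (int j) *\<^sub>Q len_part j (alg (letter \<gamma>) (susp C 2 (pure [y, z]))) =
     (\<Sum>a=1..j-1. (ksgn (int j) * ksgn n) *\<^sub>Q tmult (\<gamma> a y) (\<gamma> (j - a) z))"
    by (simp add: s2 alg_linear len_part_linear Q.scale_sum_right)
  then show "susp C j (\<Sum>a=1..j-1. ksgn ((int a - 1) * int (j - a)) *\<^sub>Q
      tensor_map C [(int a - 1, a, gop a), (int (j - a) - 1, j - a, gop (j - a))] (pure [y, z])) =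
    ksgn (int j) *\<^sub>Q len_part j (alg (letter \<gamma>) (susp C 2 (pure [y, z])))"
    unfolding qlinear_sum[OF qlinear_susp] by (simp only: term_eq cong: sum.cong)
qed

lemma top_sum_alg:
  assumes "j \<ge> 2" and "e x \<in> B" "e x \<in> C m"
  shows "susp C j (top_sum j e x) = ksgn (int j) *\<^sub>Q len_part j (alg (letter \<gamma>) (susp C 2 (D 2 (e x))))"
  using top_sum_eq[where e = e, OF assms(1) coop_power[of 2, OF _ assms(2,3)]]
    susp_pair[OF coop_power[of 2, OF _ assms(2,3)] assms(1)] by simp

end

section \<open>The projection onto the transferred structure\<close>

text \<open>The coalgebra axioms enter in desuspended form: \<open>d_square\<close> holds the
  structure relations and \<open>lie_2\<close> the cocommutativity.\<close>

locale contraction = tree_transfer C B D p \<kappa> H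
  for C :: "int \<Rightarrow> 'c::rat_vector set" and B D p \<kappa> H +
  fixes \<delta> :: "'c \<Rightarrow> 'c"
  assumes D_1: "D 1 = (\<lambda>x. ten1 (\<delta> x))"
    and d_lin: "qlinear \<delta>" and d_mem: "\<And>x n. x \<in> B \<Longrightarrow> x \<in> C n \<Longrightarrow> \<delta> x \<in> B \<inter> C (n - 1)"
    and d_square: "\<And>x n. x \<in> B \<Longrightarrow> x \<in> C n \<Longrightarrow> tensor_diff C D (tensor_diff C D (ten1 x)) = 0"
    and lie_2: "\<And>x n. x \<in> B \<Longrightarrow> x \<in> C n \<Longrightarrow> (2, n - 2, susp C 2 (D 2 x)) \<in> lie_words (desusp C) B"
    and p_H: "\<And>h. h \<in> H \<Longrightarrow> p h = h" and k_H: "\<And>h. h \<in> H \<Longrightarrow> \<kappa> h = 0" and d_H: "\<And>h. h \<in> H \<Longrightarrow> \<delta> h = 0"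
    and kk: "\<And>x. x \<in> B \<Longrightarrow> \<kappa> (\<kappa> x) = 0" and pk: "\<And>x. x \<in> B \<Longrightarrow> p (\<kappa> x) = 0" and pd: "\<And>x. x \<in> B \<Longrightarrow> p (\<delta> x) = 0"
    and homotopy: "\<And>x. x \<in> B \<Longrightarrow> \<delta> (\<kappa> x) + \<kappa> (\<delta> x) = x - p x"
begin

abbreviation "G \<equiv> desusp C"

definition s2 :: "'c \<Rightarrow> 'c tensor" where
  "s2 x = susp C 2 (D 2 x)"

abbreviation "bd \<equiv> tensor_diff C D"

definition \<Gamma> :: "'c tensor \<Rightarrow> 'c tensor" where
  "\<Gamma> = alg (letter \<gamma>)"

definition \<Delta>' :: "nat \<Rightarrow> 'c \<Rightarrow> 'c tensor" where
  "\<Delta>' j x = (if j \<ge> 2 then top_sum j (\<lambda>y. y) x else 0)"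

abbreviation "d' \<equiv> tensor_diff C \<Delta>'"

lemma desusp_iff: "x \<in> desusp C n \<longleftrightarrow> x \<in> C (n + 1)"
  by (simp add: desusp_def)

lemma s2_lin: "qlinear s2"
  unfolding s2_def[abs_def] by (intro qlinear_comp[OF qlinear_susp coop_lin]) simp

lemma s2_lie: "x \<in> B \<Longrightarrow> x \<in> G n \<Longrightarrow> (2, n - 1, s2 x) \<in> lie_words G B"
  using lie_2[of x "n + 1"] by (simp add: s2_def desusp_iff)

lemma s2_power: "x \<in> B \<Longrightarrow> x \<in> G n \<Longrightarrow> s2 x \<in> tensor_power G B 2 (n - 1)"
  by (rule lie_words_power[OF s2_lie])

lemma s2_len: "x \<in> B \<Longrightarrow> x \<in> G n \<Longrightarrow> len_part j (s2 x) = (if j = 2 then s2 x else 0)"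
  by (rule length_family_len[OF length_family_tensor_power s2_power])

lemma k_G: "x \<in> B \<Longrightarrow> x \<in> G n \<Longrightarrow> \<kappa> x \<in> B" "x \<in> B \<Longrightarrow> x \<in> G n \<Longrightarrow> \<kappa> x \<in> G (n + 1)"
  using k_mem[of x "n + 1"] by (auto simp: desusp_iff)

lemma d_G: "x \<in> B \<Longrightarrow> x \<in> G n \<Longrightarrow> \<delta> x \<in> B" "x \<in> B \<Longrightarrow> x \<in> G n \<Longrightarrow> \<delta> x \<in> G (n - 1)"
  using d_mem[of x "n + 1"] by (auto simp: desusp_iff)

lemma p_G: "x \<in> B \<Longrightarrow> x \<in> G n \<Longrightarrow> p x \<in> H" "x \<in> B \<Longrightarrow> x \<in> G n \<Longrightarrow> p x \<in> G n"
  using p_mem[of x "n + 1"] by (auto simp: desusp_iff)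

lemma partial_ten1: "x \<in> B \<Longrightarrow> x \<in> G n \<Longrightarrow> bd (ten1 x) = s2 x - ten1 (\<delta> x)"
proof (rule len_part_eqI)
  fix j :: nat assume x: "x \<in> B" "x \<in> G n"
  have e: "bd (ten1 x) = letter (desusp_op C D) x"
    unfolding tensor_diff_der by (rule D.der_letter_ten1[OF letter_map_desusp_op x])
  have op: "desusp_op C D 2 x = s2 x" "desusp_op C D 1 x = - ten1 (\<delta> x)"
  proof -
    show "desusp_op C D 2 x = s2 x" by (simp add: desusp_op_susp s2_def)
    have "susp C (Suc 0) (tmult (ten1 (\<delta> x)) (pure [])) = tmult (ten1 (\<delta> x)) (pure [])"
      using d_mem[of x "n + 1"] x by (subst susp_Cons[of _ n]) (auto simp: desusp_iff susp_Nil)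
    then show "desusp_op C D 1 x = - ten1 (\<delta> x)" using D_1 by (simp add: desusp_op_susp)
  qed
  consider "j = 0" | "j = 1" | "j = 2" | "j \<ge> 3" by linarith
  then show "len_part j (bd (ten1 x)) = len_part j (s2 x - ten1 (\<delta> x))"
  proof cases
    case 4
    then show ?thesis unfolding e
      by (simp add: D.len_part_letter desusp_op_susp D_zero susp_linear len_part_linear s2_len[OF x] len_part_ten1)
  qed (simp_all add: e D.len_part_0_letter D.len_part_letter op op(2)[simplified] len_part_linear s2_len[OF x] len_part_ten1)
qed

section \<open>The projection as an algebra map\<close>

lemma letter_\<gamma>_lin: "qlinear (letter \<gamma>)"
  by (rule qlinearI) (auto simp: letter_def fun_eq_iff qlinear_add[OF \<gamma>_lin] qlinear_scale[OF \<gamma>_lin] tensor_apply)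

lemma letter_nil: "letter \<theta> x [] = 0"
  by (simp add: letter_def)

lemma letter_\<gamma>_Tc: "x \<in> B \<Longrightarrow> x \<in> G n \<Longrightarrow> letter \<gamma> x \<in> Tc G H n"
  by (rule D.letter_lprod[OF length_family_tensor_power]) (rule \<gamma>_power)

lemma filtered_\<Gamma>: "filtered \<Gamma>"
  unfolding \<Gamma>_def by (rule filtered_alg)

lemma \<Gamma>_Tc: "t \<in> Tc G B m \<Longrightarrow> \<Gamma> t \<in> Tc G H m" and \<Gamma>_Tca: "t \<in> Tca G B \<Longrightarrow> \<Gamma> t \<in> Tca G H"
  unfolding \<Gamma>_def using alg_Tc[OF letter_\<gamma>_lin letter_nil letter_\<gamma>_Tc] by blast+

lemma \<Gamma>_tmult: "s \<in> Tca G B \<Longrightarrow> \<Gamma> (tmult s t) = tmult (\<Gamma> s) (\<Gamma> t)"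
  unfolding \<Gamma>_def by (rule alg_tmult[OF letter_\<gamma>_lin letter_nil])

lemma \<Gamma>_ten1: "\<Gamma> (ten1 x) = letter \<gamma> x"
  unfolding \<Gamma>_def by (rule alg_ten1[OF letter_\<gamma>_lin letter_nil])

lemmas \<Gamma>_linear = qlinear_add[OF filtered_qlinear[OF filtered_\<Gamma>]]
  qlinear_scale[OF filtered_qlinear[OF filtered_\<Gamma>]] qlinear_0[OF filtered_qlinear[OF filtered_\<Gamma>]]
  qlinear_neg[OF filtered_qlinear[OF filtered_\<Gamma>]] qlinear_diff[OF filtered_qlinear[OF filtered_\<Gamma>]]

lemma \<Gamma>_vanish: "(\<And>j. j < n \<Longrightarrow> len_part j t = 0) \<Longrightarrow> k < n \<Longrightarrow> len_part k (\<Gamma> t) = 0"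
  by (rule filtered_len_part_vanish[OF filtered_\<Gamma>, of k]) auto

lemma top_sum_\<Gamma>:
  assumes "j \<ge> 2" "e x \<in> B" "e x \<in> G m"
  shows "susp C j (top_sum j e x) = ksgn (int j) *\<^sub>Q len_part j (\<Gamma> (s2 (e x)))"
  using top_sum_alg[where e = e, OF assms(1,2)] assms(3) by (simp add: \<Gamma>_def s2_def desusp_iff)

lemma \<gamma>_1:
  assumes "x \<in> B" "x \<in> G n" shows "\<gamma> 1 x = ten1 (p x)"
proof -
  have "susp C (Suc 0) (tmult (ten1 (p x)) (pure [])) = tmult (ten1 (p x)) (pure [])"
    using p_mem[of x "n + 1"] assms by (subst susp_Cons[of _ "n + 1"]) (auto simp: desusp_iff susp_Nil)
  then show ?thesis using gop_1[of x] by (simp add: \<gamma>_def)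
qed

text \<open>Cut at the root edge: the trivial tree gives p x, and any other tree applies the
  homotopy and then the comultiplication. The sign of the internal edge cancels the one in
  \<open>\<gamma>\<close>.\<close>

lemma letter_\<gamma>:
  assumes x: "x \<in> B" "x \<in> G n"
  shows "letter \<gamma> x = ten1 (p x) + \<Gamma> (s2 (\<kappa> x))"
proof (rule len_part_eqI)
  fix j :: nat
  note k = k_G[OF x]
  have v: "len_part i (\<Gamma> (s2 (\<kappa> x))) = 0" if "i < 2" for i
    by (rule \<Gamma>_vanish[OF _ that]) (simp add: s2_len[OF k])
  consider "j = 0" | "j = 1" | "j \<ge> 2" by linarith
  then show "len_part j (letter \<gamma> x) = len_part j (ten1 (p x) + \<Gamma> (s2 (\<kappa> x)))"
  proof cases
    case 1
    then show ?thesis by (simp add: D.len_part_0_letter len_part_linear len_part_ten1 v)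
  next
    case 2
    then show ?thesis using \<gamma>_1[OF x] by (simp add: D.len_part_letter len_part_linear len_part_ten1 v)
  next
    case 3
    have nk: "- \<kappa> x \<in> B" "- \<kappa> x \<in> G (n + 1)" using neg_k_mem[of x "n + 1"] x by (auto simp: desusp_iff)
    have "\<gamma> j x = - len_part j (\<Gamma> (s2 (- \<kappa> x)))"
      using top_sum_\<Gamma>[where e = "\<lambda>y. - \<kappa> y" and x = x, OF 3 nk] by (simp add: \<gamma>_def gop_def top_sum_def)
    then have "\<gamma> j x = len_part j (\<Gamma> (s2 (\<kappa> x)))"
      by (simp add: qlinear_neg[OF s2_lin] \<Gamma>_linear len_part_linear)
    then show ?thesis using 3 by (simp add: D.len_part_letter len_part_linear len_part_ten1 len_part_len_part)
  qed
qed

lemma coop_transferred: "coop_family C H \<Delta>'"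
  unfolding coop_family_def
proof (intro allI impI conjI ballI)
  fix j :: nat assume "1 \<le> j"
  have "qlinear (top_sum j (\<lambda>y. y))"
    unfolding top_sum_def[abs_def] by (intro qlinear_setsum top_lin qlinear_id) (auto simp: PT_def)
  then show "qlinear (\<Delta>' j)" by (cases "j \<ge> 2") (simp_all add: \<Delta>'_def[abs_def] qlinear_zero)
  fix n x assume x: "x \<in> H \<inter> C n"
  then have D2: "D 2 x \<in> tensor_power C B 2 n" using coop_power[of 2 x n] H_sub by auto
  show "\<Delta>' j x \<in> tensor_power C H j (n + int j - 2)"
  proof (cases "j \<ge> 2")
    case True
    have "tensor_map C [(int a - 1, a, gop a), (int (j - a) - 1, j - a, gop (j - a))] (D 2 x) \<in>
        tensor_power C H j (n + int j - 2)" if a: "a \<in> {1..j-1}" for a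
    proof -
      have "tensor_map C [(int a - 1, a, gop a), (int (j - a) - 1, j - a, gop (j - a))] (D 2 x) \<in>
        tensor_power C H (a + (j - a)) (n + (int a - 1) + (int (j - a) - 1))"
        by (rule pair_power[OF D2 gop_lin gop_power gop_lin gop_power])
      moreover have "a + (j - a) = j" "n + (int a - 1) + (int (j - a) - 1) = n + int j - 2" using a by auto
      ultimately show ?thesis by (simp only:)
    qed
    then have "top_sum j (\<lambda>y. y) x \<in> tensor_power C H j (n + int j - 2)"
      unfolding top_sum_eq[where e = "\<lambda>y. y", OF True D2]
      by (intro Q.subspace_sum[OF tensor_power_subspace] Q.subspace_scale[OF tensor_power_subspace])
    then show ?thesis using True by (simp add: \<Delta>'_def)
  next
    case False
    then show ?thesis by (simp add: \<Delta>'_def Q.subspace_0[OF tensor_power_subspace])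
  qed
qed

interpretation T: coop C H \<Delta>'
  by unfold_locales (rule coop_transferred)

text \<open>The same cut with the identity on the root edge. On H the transferred differential is
  thus \<open>\<Gamma>\<close> applied to the quadratic part \<open>s2\<close>.\<close>

lemma letter_transferred:
  assumes x: "x \<in> B" "x \<in> G n"
  shows "letter (desusp_op C \<Delta>') x = \<Gamma> (s2 x)"
proof (rule len_part_eqI)
  fix j :: nat
  have v: "len_part i (\<Gamma> (s2 x)) = 0" if "i < 2" for i
    by (rule \<Gamma>_vanish[OF _ that]) (simp add: s2_len[OF x])
  show "len_part j (letter (desusp_op C \<Delta>') x) = len_part j (\<Gamma> (s2 x))"
  proof (cases "j \<ge> 2")
    case True
    then show ?thesis
      using top_sum_\<Gamma>[where e = "\<lambda>y. y" and x = x, OF True x]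
      by (simp add: D.len_part_letter desusp_op_susp \<Delta>'_def len_part_len_part)
  next
    case False
    then have "len_part j (letter (desusp_op C \<Delta>') x) = 0"
      by (cases "j = 0") (simp_all add: D.len_part_0_letter D.len_part_letter desusp_op_susp \<Delta>'_def susp_linear len_part_linear)
    then show ?thesis using v[of j] False by simp
  qed
qed

lemma d'_ten1: "h \<in> H \<Longrightarrow> h \<in> G n \<Longrightarrow> d' (ten1 h) = \<Gamma> (s2 h)"
  unfolding tensor_diff_der
  using D.der_letter_ten1[OF T.letter_map_desusp_op] letter_transferred H_sub by fastforce

lemmas partial_linear = der_linear[of G "-1" "desusp_op C D", folded tensor_diff_der]
lemmas d'_linear = der_linear[of G "-1" "desusp_op C \<Delta>'", folded tensor_diff_der]

lemma filtered_tensor_diff: "filtered (tensor_diff C X)"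
  unfolding tensor_diff_der by (rule filtered_der)

lemma partial_Tc: "t \<in> Tc G B m \<Longrightarrow> bd t \<in> Tc G B (m - 1)" and partial_Tca: "t \<in> Tca G B \<Longrightarrow> bd t \<in> Tca G B"
  unfolding tensor_diff_der using D.der_Tc[OF letter_map_desusp_op] D.der_Tca[OF letter_map_desusp_op] by fastforce+

lemma partial_tmult: "s \<in> Tc G B m \<Longrightarrow> lin_supp t \<Longrightarrow>
    bd (tmult s t) = tmult (bd s) t + ksgn m *\<^sub>Q tmult s (bd t)"
  using D.der_tmult[OF letter_map_desusp_op, of s m t] unfolding tensor_diff_der by simp

lemma d'_tmult: "s \<in> Tc G H m \<Longrightarrow> lin_supp t \<Longrightarrow>
    d' (tmult s t) = tmult (d' s) t + ksgn m *\<^sub>Q tmult s (d' t)"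
  using D.der_tmult[OF T.letter_map_desusp_op, of s m t] unfolding tensor_diff_der by simp

section \<open>Compatibility of the projection with the differentials\<close>

definition defect :: "'c tensor \<Rightarrow> 'c tensor" where
  "defect t = d' (\<Gamma> t) - \<Gamma> (bd t)"

lemma filtered_defect: "filtered defect"
  unfolding defect_def[abs_def]
  by (intro filtered_minus filtered_comp[OF filtered_tensor_diff filtered_\<Gamma>]
      filtered_comp[OF filtered_\<Gamma> filtered_tensor_diff])

text \<open>The defect is a derivation along \<open>\<Gamma>\<close>, so it is determined by its
  values on letters.\<close>

lemma defect_tmult:
  assumes s: "s \<in> Tc G B m" and t: "t \<in> Tca G B"
  shows "defect (tmult s t) = tmult (defect s) (\<Gamma> t) + ksgn m *\<^sub>Q tmult (\<Gamma> s) (defect t)"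
proof -
  have s': "s \<in> Tca G B" "bd s \<in> Tca G B" using s partial_Tc[OF s] Tc_subset_Tca by blast+
  have "defect (tmult s t) = tmult (d' (\<Gamma> s)) (\<Gamma> t) + ksgn m *\<^sub>Q tmult (\<Gamma> s) (d' (\<Gamma> t)) -
     (tmult (\<Gamma> (bd s)) (\<Gamma> t) + ksgn m *\<^sub>Q tmult (\<Gamma> s) (\<Gamma> (bd t)))"
    unfolding defect_def \<Gamma>_tmult[OF s'(1)] d'_tmult[OF \<Gamma>_Tc[OF s] lin_supp_Tca[OF \<Gamma>_Tca[OF t]]]
      partial_tmult[OF s lin_supp_Tca[OF t]]
    by (simp add: \<Gamma>_linear \<Gamma>_tmult[OF s'(1)] \<Gamma>_tmult[OF s'(2)])
  then show ?thesis by (simp add: defect_def tmult_linear Q.scale_right_diff_distrib)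
qed

lemma len_part_0_\<Gamma>_ten1: "len_part 0 (\<Gamma> (ten1 x)) = 0"
  by (simp add: \<Gamma>_ten1 D.len_part_0_letter)

text \<open>The image of a letter has no part of length 0, so in a product of two letters the factor
  without defect takes up at least one unit of length. This is the gain of one length in the
  induction.\<close>

lemma defect_pair:
  assumes N: "\<And>x n k. x \<in> B \<Longrightarrow> x \<in> G n \<Longrightarrow> k \<le> N \<Longrightarrow> len_part k (defect (ten1 x)) = 0"
    and t: "t \<in> tensor_power G B 2 m" and k: "k \<le> Suc N"
  shows "len_part k (defect t) = 0"
proof (rule tensor_power_2_eq[OF _ qlinear_zero t])
  show "qlinear (\<lambda>t. len_part k (defect t))"
    by (rule qlinear_comp[OF qlinear_len_part filtered_qlinear[OF filtered_defect]])
  fix y z n n' assume y: "y \<in> B" "y \<in> G n" and z: "z \<in> B" "z \<in> G n'"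
  have "pure [y, z] = tmult (ten1 y) (ten1 z)" by (simp only: pure_Cons[of y "[z]"] ten1_def)
  moreover have "defect (tmult (ten1 y) (ten1 z)) =
     tmult (defect (ten1 y)) (\<Gamma> (ten1 z)) + ksgn n *\<^sub>Q tmult (\<Gamma> (ten1 y)) (defect (ten1 z))"
    using ten1_in_Tc[of z B G n', OF z] Tc_subset_Tca by (intro defect_tmult[OF ten1_in_Tc[of y B G n, OF y]]) blast
  moreover have "len_part k (tmult (defect (ten1 y)) (\<Gamma> (ten1 z))) = 0"
    unfolding len_part_tmult
  proof (intro sum.neutral ballI)
    fix i assume "i \<in> {..k}"
    then have "i \<le> N \<or> k - i = 0" using k by auto
    then show "tmult (len_part i (defect (ten1 y))) (len_part (k - i) (\<Gamma> (ten1 z))) = 0"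
      using N[OF y] by (auto simp: len_part_0_\<Gamma>_ten1 tmult_linear)
  qed
  moreover have "len_part k (tmult (\<Gamma> (ten1 y)) (defect (ten1 z))) = 0"
    unfolding len_part_tmult
  proof (intro sum.neutral ballI)
    fix i assume "i \<in> {..k}"
    then have "k - i \<le> N \<or> i = 0" using k by auto
    then show "tmult (len_part i (\<Gamma> (ten1 y))) (len_part (k - i) (defect (ten1 z))) = 0"
      using N[OF z] by (auto simp: len_part_0_\<Gamma>_ten1 tmult_linear)
  qed
  ultimately show "len_part k (defect (pure [y, z])) = 0" by (simp add: len_part_linear)
qed

lemma \<Gamma>_H: "h \<in> H \<Longrightarrow> h \<in> G n \<Longrightarrow> \<Gamma> (ten1 h) = ten1 h"
  using letter_\<gamma>[of h n] H_sub by (auto simp: \<Gamma>_ten1 p_H k_H qlinear_0[OF s2_lin] \<Gamma>_linear)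

lemma defect_H: "h \<in> H \<Longrightarrow> h \<in> G n \<Longrightarrow> defect (ten1 h) = 0"
  using partial_ten1[of h n] H_sub by (auto simp: defect_def \<Gamma>_H d'_ten1 d_H)

text \<open>Apply the homotopy identity to \<kappa> x and use that \<kappa> \<kappa> and p \<kappa>
  vanish.\<close>

lemma kdk:
  assumes "x \<in> B" "x \<in> G n" shows "\<kappa> (\<delta> (\<kappa> x)) = \<kappa> x"
  using homotopy[OF k_G(1)[OF assms]] by (simp add: kk pk assms(1) qlinear_0[OF d_lin])

text \<open>\<open>\<Gamma>\<close> kills the letter since p \<kappa> and \<kappa> \<kappa> vanish,
  and the two parts of its differential have the same image because \<kappa> \<delta> \<kappa> =
  \<kappa>.\<close>

lemma defect_k:
  assumes x: "x \<in> B" "x \<in> G n" shows "defect (ten1 (\<kappa> x)) = 0"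
proof -
  note k = k_G[OF x]
  note dk = d_G[OF k]
  have 1: "\<Gamma> (ten1 (\<kappa> x)) = 0"
    unfolding \<Gamma>_ten1 letter_\<gamma>[OF k] by (simp add: pk kk x qlinear_0[OF s2_lin] \<Gamma>_linear)
  have 2: "\<Gamma> (ten1 (\<delta> (\<kappa> x))) = \<Gamma> (s2 (\<kappa> x))"
    unfolding \<Gamma>_ten1 letter_\<gamma>[OF dk] by (simp add: pd k kdk[OF x])
  show ?thesis unfolding defect_def 1 partial_ten1[OF k] by (simp add: \<Gamma>_linear 2 d'_linear)
qed

text \<open>Since the differential squares to zero on \<kappa> x, the tensors on both sides have the
  same differential, and they also have the same image. A defect on one letter is traded for a
  defect on two.\<close>

lemma defect_dk:
  assumes x: "x \<in> B" "x \<in> G n" shows "defect (ten1 (\<delta> (\<kappa> x))) = defect (s2 (\<kappa> x))"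
proof -
  note k = k_G[OF x]
  note dk = d_G[OF k]
  have 2: "\<Gamma> (ten1 (\<delta> (\<kappa> x))) = \<Gamma> (s2 (\<kappa> x))"
    unfolding \<Gamma>_ten1 letter_\<gamma>[OF dk] by (simp add: pd k kdk[OF x])
  have "bd (bd (ten1 (\<kappa> x))) = 0"
    using d_square[OF k(1), of "n + 1 + 1"] k by (simp add: desusp_iff)
  then have "bd (ten1 (\<delta> (\<kappa> x))) = bd (s2 (\<kappa> x))"
    unfolding partial_ten1[OF k] partial_linear by simp
  then show ?thesis by (simp add: defect_def 2)
qed

text \<open>Split x by the homotopy identity into p x, \<delta> \<kappa> x and \<kappa> \<delta> x.
  Only the middle part needs the induction hypothesis, and there \<open>defect_pair\<close> supplies
  the next length.\<close>

lemma defect_letter: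
  assumes "x \<in> B" "x \<in> G n" "k \<le> N" shows "len_part k (defect (ten1 x)) = 0"
  using assms
proof (induction N arbitrary: x n k)
  case 0
  then show ?case by (auto simp: len_part_def fun_eq_iff defect_def \<Gamma>_def tensor_diff_der tensor_apply)
next
  case (Suc N)
  note x = Suc.prems(1,2)
  note p = p_G[OF x]
  note k = k_G[OF x]
  note d = d_G[OF x]
  have "ten1 x = ten1 (p x) + ten1 (\<delta> (\<kappa> x)) + ten1 (\<kappa> (\<delta> x))"
    using homotopy[OF x(1)] unfolding ten1_linear(1)[symmetric] by (simp add: add.assoc)
  then have "defect (ten1 x) = defect (ten1 (p x)) + defect (ten1 (\<delta> (\<kappa> x))) + defect (ten1 (\<kappa> (\<delta> x)))"
    by (simp only: qlinear_add[OF filtered_qlinear[OF filtered_defect]])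
  then show ?case
    unfolding defect_H[OF p] defect_dk[OF x] defect_k[OF d]
    using defect_pair[OF Suc.IH s2_power[OF k] Suc.prems(3)] by simp
qed

lemma \<Gamma>_chain: "t \<in> Tca G B \<Longrightarrow> d' (\<Gamma> t) = \<Gamma> (bd t)"
proof -
  assume t: "t \<in> Tca G B"
  have 0: "defect (ten1 x) = 0" if "x \<in> B" "x \<in> G n" for x n
    by (rule len_part_eqI) (simp add: defect_letter[OF that order_refl] len_part_linear)
  have "defect t = 0"
  proof (rule filtered_Tca_eq[OF filtered_defect filtered_zero _ t])
    fix m xs assume "hword G B m xs"
    then show "defect (pure xs) = 0"
    proof (induction rule: hword.induct)
      case Nil
      then show ?case
        by (simp add: defect_def \<Gamma>_def alg_Nil tensor_diff_der der_Nil alg_linear)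
    next
      case (Cons x n m xs)
      have "pure xs \<in> Tca G B" using Cons(3) pure_in_Tc Tc_subset_Tca by blast
      then show ?case
        unfolding pure_Cons by (simp add: defect_tmult[OF ten1_in_Tc[of x B G n, OF Cons(1,2)]] 0[OF Cons(1,2)]
            Cons.IH tmult_linear)
    qed
  qed
  then show ?thesis by (simp add: defect_def)
qed

lemma s2_Tca: "x \<in> B \<Longrightarrow> x \<in> G n \<Longrightarrow> s2 x \<in> Tca G B"
  using D.power_in_Tc[OF s2_power] Tc_subset_Tca by blast

text \<open>On H the original differential is purely quadratic, so d' d' h is the image under
  \<open>\<Gamma>\<close> of bd (bd h), which is zero.\<close>

lemma d'_square_letter:
  assumes h: "h \<in> H" "h \<in> G n" shows "d' (d' (ten1 h)) = 0"
proof -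
  have hB: "h \<in> B" using h H_sub by auto
  have "bd (ten1 h) = s2 h" using partial_ten1[OF hB h(2)] by (simp add: d_H h)
  moreover have "bd (bd (ten1 h)) = 0" using d_square[OF hB, of "n + 1"] h by (simp add: desusp_iff)
  ultimately show ?thesis
    by (simp add: d'_ten1[OF h] \<Gamma>_chain[OF s2_Tca[OF hB h(2)]] \<Gamma>_linear)
qed

lemma s2_Lc: "x \<in> B \<Longrightarrow> x \<in> G n \<Longrightarrow> s2 x \<in> Lc G B (n - 1)"
  by (rule lie_words_Lc[OF s2_lie])

text \<open>The component of length \<open>j\<close> of \<open>\<Gamma>\<close> on products of two letters involves only the components
  of \<open>\<gamma>\<close> of length less than \<open>j\<close>, hence it can be computed with a truncation of \<open>\<gamma>\<close>.\<close>

lemma \<gamma>_lie: "x \<in> B \<Longrightarrow> x \<in> G n \<Longrightarrow> \<gamma> j x \<in> lie_family G H n j"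
proof (induction j arbitrary: x n rule: less_induct)
  case (less j)
  note x = less.prems
  note k = k_G[OF x]
  note fam = length_family_len[OF length_family_tensor_power]
  have gl: "len_part j (letter \<gamma> x) = \<gamma> j x" if "j \<noteq> 0"
    using fam[OF \<gamma>_power[OF x, of j], of j] that by (simp add: D.len_part_letter)
  consider "j = 0" | "j = 1" | "j \<ge> 2" by linarith
  then show ?case
  proof cases
    case 1
    have "len_part 0 (\<gamma> 0 x) = \<gamma> 0 x" using fam[OF \<gamma>_power[OF x, of 0], of 0] by simp
    moreover have "T \<notin> PT 0" for T using leaves_pos[of T] by (auto simp: PT_def)
    then have "PT 0 = {}" by (meson equals0I)
    then have "gop 0 x = 0" by (simp add: gop_def)
    then have "\<gamma> 0 x = 0" by (simp add: \<gamma>_def susp_linear)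
    ultimately show ?thesis using 1 by (simp add: Q.subspace_0[OF qsubspace_lie_family])
  next
    case 2
    then show ?thesis using \<gamma>_1[OF x] lie_words.gen[of "p x" H G n] p_G[OF x] by (simp add: lie_family_def)
  next
    case 3
    define \<beta> where "\<beta> i y = (if i < j then \<gamma> i y else 0)" for i y
    have \<beta>_lin: "qlinear (letter \<beta>)"
      by (rule qlinearI) (auto simp: \<beta>_def letter_def fun_eq_iff qlinear_add[OF \<gamma>_lin] qlinear_scale[OF \<gamma>_lin] tensor_apply)
    have lb: "len_part i (letter \<beta> y) = (if i < j then len_part i (letter \<gamma> y) else 0)" for i y
      by (cases "i = 0") (auto simp: D.len_part_0_letter D.len_part_letter \<beta>_def len_part_linear)
    have \<beta>_Lc: "letter \<beta> y \<in> Lc G H q" if "y \<in> B" "y \<in> G q" for y q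
      by (rule D.letter_lprod[OF length_family_lie])
        (auto simp: \<beta>_def less.IH that Q.subspace_0[OF qsubspace_lie_family])
    have "len_part j (\<Gamma> t) = len_part j (alg (letter \<beta>) t)" if "t \<in> tensor_power G B 2 m" for t m
    proof (rule tensor_power_2_eq[OF _ _ that])
      show "qlinear (\<lambda>t. len_part j (\<Gamma> t))"
        by (rule qlinear_comp[OF qlinear_len_part filtered_qlinear[OF filtered_\<Gamma>]])
      show "qlinear (\<lambda>t. len_part j (alg (letter \<beta>) t))"
        by (rule qlinear_comp[OF qlinear_len_part filtered_qlinear[OF filtered_alg]])
      fix y z
      have pair: "alg \<phi> (pure [y, z]) = tmult (\<phi> y) (\<phi> z)" if "qlinear \<phi>" "\<And>x. \<phi> x [] = 0" for \<phi> :: "'c \<Rightarrow> 'c tensor"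
        by (simp only: alg_pure_Cons[OF that] alg_Nil tmult_one_right)
      have e: "alg (letter \<gamma>) (pure [y, z]) = tmult (letter \<gamma> y) (letter \<gamma> z)"
        "alg (letter \<beta>) (pure [y, z]) = tmult (letter \<beta> y) (letter \<beta> z)"
        by (rule pair[OF letter_\<gamma>_lin letter_nil], rule pair[OF \<beta>_lin letter_nil])
      show "len_part j (\<Gamma> (pure [y, z])) = len_part j (alg (letter \<beta>) (pure [y, z]))"
        unfolding \<Gamma>_def e len_part_tmult
      proof (intro sum.cong refl)
        fix i assume i: "i \<in> {..j}"
        show "tmult (len_part i (letter \<gamma> y)) (len_part (j - i) (letter \<gamma> z)) =
          tmult (len_part i (letter \<beta> y)) (len_part (j - i) (letter \<beta> z))"
          using i by (cases "i = 0"; cases "i = j") (auto simp: lb D.len_part_0_letter tmult_linear)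
      qed
    qed
    then have "len_part j (\<Gamma> (s2 (\<kappa> x))) = len_part j (alg (letter \<beta>) (s2 (\<kappa> x)))"
      using s2_power[OF k] by blast
    moreover have "alg (letter \<beta>) (s2 (\<kappa> x)) \<in> Lc G H (n + 1 - 1)"
      by (rule D.alg_Lc[OF \<beta>_lin letter_nil \<beta>_Lc s2_Lc[OF k]])
    ultimately have "len_part j (\<Gamma> (s2 (\<kappa> x))) \<in> lie_family G H n j"
      using lprodD by fastforce
    moreover have "\<gamma> j x = len_part j (\<Gamma> (s2 (\<kappa> x)))"
      using gl 3 by (simp add: letter_\<gamma>[OF x] len_part_linear len_part_ten1)
    ultimately show ?thesis by simp
  qed
qed

section \<open>The transferred structure: Lie values, square zero, cocommutativity\<close>

lemma \<Gamma>_Lc: "t \<in> Lc G B m \<Longrightarrow> \<Gamma> t \<in> Lc G H m"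
  unfolding \<Gamma>_def
  by (rule D.alg_Lc[OF letter_\<gamma>_lin letter_nil])
    (rule D.letter_lprod[OF length_family_lie], rule \<gamma>_lie)

lemma letter_transferred_Lc: "h \<in> H \<Longrightarrow> h \<in> G n \<Longrightarrow> letter (desusp_op C \<Delta>') h \<in> Lc G H (n - 1)"
  using letter_transferred[of h n] \<Gamma>_Lc[OF s2_Lc[of h n]] H_sub by auto

lemma letter_D_Lc: "x \<in> B \<Longrightarrow> x \<in> G n \<Longrightarrow> letter (desusp_op C D) x \<in> Lc G B (n - 1)"
proof -
  assume x: "x \<in> B" "x \<in> G n"
  have "letter (desusp_op C D) x = s2 x - ten1 (\<delta> x)"
    using D.der_letter_ten1[OF letter_map_desusp_op x] partial_ten1[OF x] by (simp add: tensor_diff_der)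
  then show ?thesis using s2_Lc[OF x] ten1_in_Lc[of "\<delta> x" B G "n - 1", OF d_G[OF x]] by (simp add: Q.subspace_diff[OF Lc_subspace])
qed

lemma dgl_B: "is_dgl \<lparr>part = Lc G B, bracket = tbracket, bdry = bd\<rparr>"
  and partial_square: "t \<in> Tca G B \<Longrightarrow> bd (bd t) = 0"
  unfolding tensor_diff_der
  using D.is_dgl_free[OF letter_map_desusp_op letter_D_Lc d_square[unfolded tensor_diff_der]]
  by (auto simp: desusp_iff)

lemma dgl_H: "is_dgl \<lparr>part = Lc G H, bracket = tbracket, bdry = d'\<rparr>"
  and d'_square: "t \<in> Tca G H \<Longrightarrow> d' (d' t) = 0"
  unfolding tensor_diff_der
  using D.is_dgl_free[OF T.letter_map_desusp_op letter_transferred_Lc d'_square_letter[unfolded tensor_diff_der]]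
  by (auto simp: desusp_iff)

lemma ainf_transferred:
  assumes "graded_subspace C H" shows "ainf_coalgebra C H \<Delta>'"
  unfolding T.ainf_coalgebra_iff[OF assms]
proof (intro allI ballI)
  fix n x assume "x \<in> H \<inter> C n"
  then show "d' (d' (ten1 x)) = 0" using d'_square_letter[of x "n - 1"] by (simp add: desusp_iff)
qed

text \<open>Up to sign \<open>\<Delta>' j\<close> desuspends to the length j component of a Lie
  element, and Lie elements have vanishing unshuffle coproduct.\<close>

lemma cocommutative_transferred:
  assumes H: "graded_subspace C H" shows "cocommutative C H \<Delta>'"
  unfolding cocommutative_def
proof (intro allI impI ballI)
  fix j :: nat and x assume j: "j \<ge> 1" and x: "x \<in> H"
  have add: "unshuffle C (s + t) = unshuffle C s + unshuffle C t" for s t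
    by (auto simp: unshuffle_def fun_eq_iff graded_perm_add tensor_apply algebra_simps sum.distrib)
  show "unshuffle C (\<Delta>' j x) = 0"
  proof (rule homog_induct[where V = H, OF x])
    show "\<forall>n. hpart C x n \<in> H" using H x by (simp add: graded_subspace_def)
    have "unshuffle C (0 + 0) = 0" using add[of 0 0] by (metis add_cancel_right_right add_0)
    then show "unshuffle C (\<Delta>' j 0) = 0" by (simp add: qlinear_0[OF T.coop_lin[OF j]])
    show "unshuffle C (\<Delta>' j (x + y)) = 0" if "unshuffle C (\<Delta>' j x) = 0" "unshuffle C (\<Delta>' j y) = 0" for x y
      by (simp add: qlinear_add[OF T.coop_lin[OF j]] add that)
    fix n x assume x: "x \<in> H" "x \<in> C n"
    have x': "x \<in> B" "x \<in> G (n - 1)" using x H_sub by (auto simp: desusp_iff)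
    have "letter (desusp_op C \<Delta>') x \<in> Lc G H (n - 1 - 1)" using letter_transferred_Lc[OF x(1) x'(2)] .
    then have "len_part j (letter (desusp_op C \<Delta>') x) \<in> lie_family G H (n - 1 - 1) j" by (rule lprodD)
    then have "ksgn (int j) *\<^sub>Q susp C j (\<Delta>' j x) \<in> lie_family G H (n - 1 - 1) j"
      using j by (simp add: D.len_part_letter desusp_op_susp len_part_linear len_part_susp)
    from Q.subspace_scale[OF qsubspace_lie_family this, of "ksgn (int j)"]
    have "(j, n - 1 - 1, susp C j (\<Delta>' j x)) \<in> lie_words G H" by (simp add: lie_family_def)
    then show "unshuffle C (\<Delta>' j x) = 0" by (rule unshuffle_lie[OF T.coop_power[OF j x]])
  qed
qed

text \<open>\<open>s2\<close> has length two, and \<open>\<Gamma>\<close> never lowers the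
  length.\<close>

lemma d'_decomposable:
  assumes h: "h \<in> H" "h \<in> G n" shows "d' (ten1 h) \<in> complete_free_lie G H 2 (n - 1)"
proof -
  have hB: "h \<in> B" using h H_sub by auto
  have "len_part k (\<Gamma> (s2 h)) = 0" if "k < 2" for k
    by (rule \<Gamma>_vanish[OF _ that]) (simp add: s2_len[OF hB h(2)])
  then show ?thesis
    using \<Gamma>_Lc[OF s2_Lc[OF hB h(2)]] by (simp add: complete_free_lie_alt d'_ten1[OF h])
qed

end

section \<open>Quasi-isomorphisms\<close>

lemma quasi_isoI:
  assumes L: "is_dgl L" and M: "is_dgl M" and f: "dgl_morphism L M f"
    and inj: "\<And>n x y. x \<in> part L n \<Longrightarrow> bdry L x = 0 \<Longrightarrow> y \<in> part M (n + 1) \<Longrightarrow> f x = bdry M y \<Longrightarrow>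
      \<exists>x'\<in>part L (n + 1). x = bdry L x'"
    and surj: "\<And>n z. z \<in> part M n \<Longrightarrow> bdry M z = 0 \<Longrightarrow>
      \<exists>x\<in>part L n. bdry L x = 0 \<and> (\<exists>y\<in>part M (n + 1). z = f x + bdry M y)"
  shows "quasi_iso L M f"
proof -
  have sub: "qsubspace (part N n)" if "is_dgl N" for N :: "'x::rat_vector dgl" and n
    using that by (simp add: is_dgl_def)
  have lin: "bdry N (a *\<^sub>Q x + b *\<^sub>Q y) = a *\<^sub>Q bdry N x + b *\<^sub>Q bdry N y"
    if "is_dgl N" "x \<in> part N n" "y \<in> part N n" for N :: "'x::rat_vector dgl" and n a b x y
    using that unfolding is_dgl_def by blast
  have diff: "bdry N (x - y) = bdry N x - bdry N y" and add: "bdry N (x + y) = bdry N x + bdry N y"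
    and zero: "bdry N 0 = 0"
    if "is_dgl N" "x \<in> part N n" "y \<in> part N n" for N :: "'x::rat_vector dgl" and n x y
    using lin[OF that, of 1 "-1"] lin[OF that, of 1 1] lin[OF that, of 0 0] by simp_all
  have cls: "homology_class N n z = homology_class N n z' \<longleftrightarrow> (\<exists>y\<in>part N (n + 1). z = z' + bdry N y)"
    if N: "is_dgl N" for N :: "'x::rat_vector dgl" and n z z'
  proof
    assume eq: "homology_class N n z = homology_class N n z'"
    have "z + bdry N 0 \<in> homology_class N n z"
      unfolding homology_class_def using Q.subspace_0[OF sub[OF N]] by blast
    then have "z \<in> homology_class N n z'"
      using eq zero[OF N Q.subspace_0[OF sub[OF N]] Q.subspace_0[OF sub[OF N]]] by simp
    then show "\<exists>y\<in>part N (n + 1). z = z' + bdry N y" by (auto simp: homology_class_def)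
  next
    assume "\<exists>y\<in>part N (n + 1). z = z' + bdry N y"
    then obtain y where y: "y \<in> part N (n + 1)" "z = z' + bdry N y" by blast
    show "homology_class N n z = homology_class N n z'"
    proof (rule subset_antisym; rule subsetI)
      fix w assume "w \<in> homology_class N n z"
      then obtain v where v: "v \<in> part N (n + 1)" "w = z + bdry N v" by (auto simp: homology_class_def)
      then have "w = z' + bdry N (y + v)" using y add[OF N y(1) v(1)] by (simp add: add.assoc)
      then show "w \<in> homology_class N n z'"
        unfolding homology_class_def using Q.subspace_add[OF sub[OF N] y(1) v(1)] by blast
    next
      fix w assume "w \<in> homology_class N n z'"
      then obtain v where v: "v \<in> part N (n + 1)" "w = z' + bdry N v" by (auto simp: homology_class_def)
      then have "w = z + bdry N (v - y)" using y diff[OF N v(1) y(1)] by simp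
      then show "w \<in> homology_class N n z"
        unfolding homology_class_def using Q.subspace_diff[OF sub[OF N] v(1) y(1)] by blast
    qed
  qed
  have fm: "f x \<in> part M n" if "x \<in> part L n" for x n using f that by (simp add: dgl_morphism_def)
  have fl: "f (a *\<^sub>Q x + b *\<^sub>Q y) = a *\<^sub>Q f x + b *\<^sub>Q f y" if "x \<in> part L n" "y \<in> part L n" for x y n a b
    using f that unfolding dgl_morphism_def by blast
  have fa: "f (x + y) = f x + f y" and fd: "f (x - y) = f x - f y"
    if "x \<in> part L n" "y \<in> part L n" for x y n
    using fl[OF that, of 1 1] fl[OF that, of 1 "-1"] by simp_all
  have fb: "f (bdry L x) = bdry M (f x)" if "x \<in> part L n" for x n
    using f that unfolding dgl_morphism_def by blast
  have bm: "bdry L x \<in> part L n" if "x \<in> part L (n + 1)" for x n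
  proof -
    have "bdry L x \<in> part L (n + 1 - 1)" using L that unfolding is_dgl_def by blast
    then show ?thesis by simp
  qed
  \<comment> \<open>All representatives of a class have their images in one class, so the union is
    that single class.\<close>
  have map: "(\<Union>x\<in>homology_class L n z. homology_class M n (f x)) = homology_class M n (f z)"
    if z: "z \<in> part L n" for n z
  proof -
    have "homology_class M n (f x) = homology_class M n (f z)" if x: "x \<in> homology_class L n z" for x
    proof -
      obtain y where y: "y \<in> part L (n + 1)" "x = z + bdry L y" using x by (auto simp: homology_class_def)
      then have "f x = f z + bdry M (f y)" using fa[OF z bm[OF y(1)]] fb[OF y(1)] by simp
      then show ?thesis unfolding cls[OF M] using fm[OF y(1)] by blast
    qed
    moreover have "z + bdry L 0 \<in> homology_class L n z"
      unfolding homology_class_def using Q.subspace_0[OF sub[OF L]] by blast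
    ultimately show ?thesis by blast
  qed
  have "bij_betw (\<lambda>X. \<Union>x\<in>X. homology_class M n (f x)) (homology L n) (homology M n)" for n
    unfolding bij_betw_def
  proof
    show "inj_on (\<lambda>X. \<Union>x\<in>X. homology_class M n (f x)) (homology L n)"
    proof (rule inj_onI)
      fix X Y assume "X \<in> homology L n" "Y \<in> homology L n"
        and eq: "(\<Union>x\<in>X. homology_class M n (f x)) = (\<Union>x\<in>Y. homology_class M n (f x))"
      then obtain x y where x: "x \<in> part L n" "bdry L x = 0" "X = homology_class L n x"
        and y: "y \<in> part L n" "bdry L y = 0" "Y = homology_class L n y" by (auto simp: homology_def)
      then have "homology_class M n (f x) = homology_class M n (f y)" using eq map by simp
      then obtain w where w: "w \<in> part M (n + 1)" "f x = f y + bdry M w" unfolding cls[OF M] by blast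
      have "\<exists>x'\<in>part L (n + 1). x - y = bdry L x'"
      proof (rule inj[OF _ _ w(1)])
        show "x - y \<in> part L n" by (rule Q.subspace_diff[OF sub[OF L] x(1) y(1)])
        show "bdry L (x - y) = 0" using diff[OF L x(1) y(1)] x y by simp
        show "f (x - y) = bdry M w" using fd[OF x(1) y(1)] w by simp
      qed
      then obtain x' where "x' \<in> part L (n + 1)" "x = y + bdry L x'" by (metis add_diff_cancel_left' diff_add_cancel add.commute)
      then show "X = Y" unfolding x(3) y(3) cls[OF L] by blast
    qed
    show "(\<lambda>X. \<Union>x\<in>X. homology_class M n (f x)) ` homology L n = homology M n"
    proof (rule subset_antisym; rule subsetI)
      fix Z assume "Z \<in> (\<lambda>X. \<Union>x\<in>X. homology_class M n (f x)) ` homology L n"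
      then obtain x where x: "x \<in> part L n" "bdry L x = 0" "Z = (\<Union>x\<in>homology_class L n x. homology_class M n (f x))"
        by (auto simp: homology_def)
      then have "Z = homology_class M n (f x)" using map by simp
      moreover have "bdry M (f x) = 0"
        using fb[OF x(1)] x(2) fl[OF x(1) x(1), of 0 0] by simp
      ultimately show "Z \<in> homology M n" using fm[OF x(1)] by (simp add: homology_def)
    next
      fix Z assume "Z \<in> homology M n"
      then obtain z where z: "z \<in> part M n" "bdry M z = 0" "Z = homology_class M n z" by (auto simp: homology_def)
      then obtain x y where x: "x \<in> part L n" "bdry L x = 0" and y: "y \<in> part M (n + 1)" "z = f x + bdry M y"
        using surj by blast
      then have "Z = homology_class M n (f x)" unfolding z(3) cls[OF M] by blast
      then have "Z = (\<Union>x\<in>homology_class L n x. homology_class M n (f x))" using map[OF x(1)] by simp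
      then show "Z \<in> (\<lambda>X. \<Union>x\<in>X. homology_class M n (f x)) ` homology L n"
        using x by (auto simp: homology_def)
    qed
  qed
  then show ?thesis using f by (simp add: quasi_iso_def)
qed

section \<open>Contracting the non-minimal generators\<close>

text \<open>Successive approximation: the correction in step i lives in length i + 1 only, so every
  fixed length becomes stationary.\<close>

lemma lprod_recursion:
  assumes K: "length_family K" and base: "Inv 0 0"
    and step: "\<And>i X. X \<in> lprod K \<Longrightarrow> Inv i X \<Longrightarrow> \<exists>c\<in>K (Suc i). Inv (Suc i) (X + c)"
  obtains x where "x \<in> lprod K" "\<forall>i. \<exists>X\<in>lprod K. Inv i X \<and> (\<forall>j\<le>i. len_part j X = len_part j x)"
proof -
  have "\<exists>X. \<forall>i. (X i \<in> lprod K \<and> Inv i (X i)) \<and> X (Suc i) - X i \<in> K (Suc i)"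
  proof (rule dependent_nat_choice)
    show "\<exists>x. x \<in> lprod K \<and> Inv 0 x" using base Q.subspace_0[OF lprod_subspace[OF K]] by blast
    fix X i assume X: "X \<in> lprod K \<and> Inv i X"
    then obtain c where c: "c \<in> K (Suc i)" "Inv (Suc i) (X + c)" using step by blast
    moreover have "X + c \<in> lprod K"
      using X c lprod_member[OF K c(1)] Q.subspace_add[OF lprod_subspace[OF K]] by blast
    ultimately show "\<exists>Y. (Y \<in> lprod K \<and> Inv (Suc i) Y) \<and> Y - X \<in> K (Suc i)"
      by (intro exI[of _ "X + c"]) simp
  qed
  then obtain X where X: "\<And>i. X i \<in> lprod K" "\<And>i. Inv i (X i)" "\<And>i. X (Suc i) - X i \<in> K (Suc i)" by blast
  have stable: "len_part j (X (i + k)) = len_part j (X i)" if "j \<le> i" for i j k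
  proof (induction k)
    case (Suc k)
    have "len_part j (X (Suc (i + k)) - X (i + k)) = 0"
      using length_family_len[OF K X(3)[of "i + k"], of j] that by simp
    then show ?case using Suc by (simp add: len_part_linear)
  qed simp
  \<comment> \<open>The limit, read off diagonally: step n already has the final value in length
    n.\<close>
  define x where "x \<phi>s = X (length \<phi>s) \<phi>s" for \<phi>s
  have x: "len_part j x = len_part j (X j)" for j by (auto simp: x_def len_part_def fun_eq_iff)
  have "x \<in> lprod K" using lprodD[OF X(1)] by (simp add: lprod_def x)
  moreover have "len_part j (X i) = len_part j x" if "j \<le> i" for i j
    using stable[of j j "i - j"] that by (simp add: x)
  ultimately show ?thesis using that X by blast
qed

definition linear_letter :: "('c::rat_vector \<Rightarrow> 'c) \<Rightarrow> nat \<Rightarrow> 'c \<Rightarrow> 'c tensor" where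
  "linear_letter f k x = (if k = 1 then ten1 (f x) else 0)"

lemma letter_linear_letter: "letter (linear_letter f) x = ten1 (f x)"
proof (rule len_part_eqI)
  fix k :: nat
  show "len_part k (letter (linear_letter f) x) = len_part k (ten1 (f x))"
    by (auto simp: len_part_def letter_def linear_letter_def fun_eq_iff ten1_zero_off tensor_apply)
qed

context grading
begin

lemma linear_letter_map:
  assumes "qlinear f" "\<And>x n. x \<in> V \<Longrightarrow> x \<in> G n \<Longrightarrow> f x \<in> V \<inter> G (n + d)"
  shows "letter_map V d (linear_letter f)"
  unfolding letter_map_def
proof (intro conjI allI impI ballI)
  show "qlinear (linear_letter f k)" for k
    by (cases "k = 1") (simp_all add: linear_letter_def[abs_def] qlinear_zero qlinear_comp[OF qlinear_ten1 assms(1)])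
  show "linear_letter f k x \<in> tensor_power G V k (n + d)" if "x \<in> V \<inter> G n" for k n x
    using assms(2)[of x n] that pure_in_power[OF hword_single[of "f x" V G "n + d"]]
    by (auto simp: linear_letter_def ten1_def Q.subspace_0[OF tensor_power_subspace])
qed

text \<open>A derivation that sends letters to letters preserves the length of words.\<close>

lemma len_part_linear_der:
  assumes lm: "letter_map V d (linear_letter f)" and t: "t \<in> Tca G V"
  shows "len_part k (der G d (linear_letter f) t) = der G d (linear_letter f) (len_part k t)"
proof (rule filtered_Tca_eq[OF _ _ _ t])
  show "filtered (\<lambda>t. len_part k (der G d (linear_letter f) t))"
    by (rule filtered_comp[OF filtered_len_part filtered_der])
  show "filtered (\<lambda>t. der G d (linear_letter f) (len_part k t))"
    by (rule filtered_comp[OF filtered_der filtered_len_part])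
  have "len_part (length xs) (der G d (linear_letter f) (pure xs)) = der G d (linear_letter f) (pure xs)"
    if "hword G V m xs" for m xs
    using that
  proof (induction rule: hword.induct)
    case Nil
    then show ?case by (simp add: der_Nil len_part_linear)
  next
    case (Cons x n m xs)
    have 1: "len_part 1 (ten1 y) = ten1 y" for y :: 'c by (simp add: len_part_ten1)
    have "len_part (length (x # xs)) (tmult (ten1 y) t) = tmult (ten1 y) t"
      if "len_part (length xs) t = t" for y :: 'c and t
      using len_part_tmult_homog[OF 1 that] by simp
    then show ?case
      unfolding der_letter_pure[OF lm Cons(1,2)] letter_linear_letter
      by (simp add: len_part_add len_part_scale Cons.IH len_part_pure)
  qed
  then have "len_part k (der G d (linear_letter f) (pure xs)) =
      (if k = length xs then der G d (linear_letter f) (pure xs) else 0)" if "hword G V m xs" for m xs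
    using that by (metis len_part_len_part)
  then show "len_part k (der G d (linear_letter f) (pure xs)) = der G d (linear_letter f) (len_part k (pure xs))"
    if "hword G V m xs" for m xs
    using that by (simp add: len_part_pure der_linear)
qed

lemma linear_der_Lc:
  assumes lm: "letter_map V d (linear_letter f)"
    and f: "\<And>x n. x \<in> V \<Longrightarrow> x \<in> G n \<Longrightarrow> f x \<in> V \<inter> G (n + d)" and t: "t \<in> Lc G V m"
  shows "der G d (linear_letter f) t \<in> Lc G V (m + d)"
proof (rule der_Lc[OF lm _ t])
  show "letter (linear_letter f) x \<in> Lc G V (n + d)" if "x \<in> V" "x \<in> G n" for n x
    using f[OF that] ten1_in_Lc[of "f x" V G "n + d"] by (simp add: letter_linear_letter)
qed

end

context contraction
begin

interpretation T: coop C H \<Delta>'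
  by unfold_locales (rule coop_transferred)

text \<open>The minus sign matches the one that desuspension puts on the linear part of the
  differential; in \<open>NN\<close> the two cancel.\<close>

definition \<eta> :: "'c tensor \<Rightarrow> 'c tensor" where
  "\<eta> = der G 1 (linear_letter (\<lambda>x. - \<kappa> x))"

definition bd1 :: "'c tensor \<Rightarrow> 'c tensor" where
  "bd1 = der G (-1) (linear_letter (\<lambda>x. - \<delta> x))"

definition NN :: "'c tensor \<Rightarrow> 'c tensor" where
  "NN t = bd1 (\<eta> t) + \<eta> (bd1 t)"

text \<open>The part of \<open>\<Gamma>\<close> that keeps the length.\<close>

definition PP :: "'c tensor \<Rightarrow> 'c tensor" where
  "PP = alg (\<lambda>x. ten1 (p x))"

section \<open>The contracting derivation and the counting derivation\<close>

lemma letter_\<eta>: "x \<in> B \<Longrightarrow> x \<in> G n \<Longrightarrow> - \<kappa> x \<in> B \<inter> G (n + 1)"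
  using neg_k_mem[of x "n + 1"] by (simp add: desusp_iff)

lemma letter_bd1: "x \<in> B \<Longrightarrow> x \<in> G n \<Longrightarrow> - \<delta> x \<in> B \<inter> G (n + -1)"
  using d_G[of x n] Q.subspace_neg[OF B_sub] Q.subspace_neg[OF D.sub] by auto

lemma lm_\<eta>: "D.letter_map B 1 (linear_letter (\<lambda>x. - \<kappa> x))"
  by (rule D.linear_letter_map[OF qlinear_uminus[OF k_lin] letter_\<eta>])

lemma lm_bd1: "D.letter_map B (-1) (linear_letter (\<lambda>x. - \<delta> x))"
  by (rule D.linear_letter_map[OF qlinear_uminus[OF d_lin] letter_bd1])

lemma filtered_\<eta>: "filtered \<eta>" and filtered_bd1: "filtered bd1" and filtered_PP: "filtered PP"
  unfolding \<eta>_def bd1_def PP_def by (rule filtered_der filtered_alg)+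

lemma filtered_NN: "filtered NN"
  unfolding NN_def[abs_def]
  by (intro filtered_plus filtered_comp[OF filtered_bd1 filtered_\<eta>] filtered_comp[OF filtered_\<eta> filtered_bd1])

lemmas \<eta>_linear = qlinear_add[OF filtered_qlinear[OF filtered_\<eta>]]
  qlinear_scale[OF filtered_qlinear[OF filtered_\<eta>]] qlinear_0[OF filtered_qlinear[OF filtered_\<eta>]]
  qlinear_neg[OF filtered_qlinear[OF filtered_\<eta>]] qlinear_diff[OF filtered_qlinear[OF filtered_\<eta>]]
lemmas bd1_linear = qlinear_add[OF filtered_qlinear[OF filtered_bd1]]
  qlinear_scale[OF filtered_qlinear[OF filtered_bd1]] qlinear_0[OF filtered_qlinear[OF filtered_bd1]]
  qlinear_neg[OF filtered_qlinear[OF filtered_bd1]] qlinear_diff[OF filtered_qlinear[OF filtered_bd1]]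
lemmas NN_linear = qlinear_add[OF filtered_qlinear[OF filtered_NN]]
  qlinear_scale[OF filtered_qlinear[OF filtered_NN]] qlinear_0[OF filtered_qlinear[OF filtered_NN]]
  qlinear_neg[OF filtered_qlinear[OF filtered_NN]] qlinear_diff[OF filtered_qlinear[OF filtered_NN]]
lemmas PP_linear = qlinear_add[OF filtered_qlinear[OF filtered_PP]]
  qlinear_scale[OF filtered_qlinear[OF filtered_PP]] qlinear_0[OF filtered_qlinear[OF filtered_PP]]
  qlinear_neg[OF filtered_qlinear[OF filtered_PP]] qlinear_diff[OF filtered_qlinear[OF filtered_PP]]

lemma \<eta>_Tca: "t \<in> Tca G B \<Longrightarrow> \<eta> t \<in> Tca G B" and bd1_Tca: "t \<in> Tca G B \<Longrightarrow> bd1 t \<in> Tca G B"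
  unfolding \<eta>_def bd1_def by (rule D.der_Tca[OF lm_\<eta>] D.der_Tca[OF lm_bd1], assumption)+

lemma NN_Tca: "t \<in> Tca G B \<Longrightarrow> NN t \<in> Tca G B"
  unfolding NN_def by (intro Q.subspace_add[OF Tca_subspace] bd1_Tca \<eta>_Tca)

lemma \<eta>_Lc: "t \<in> Lc G B m \<Longrightarrow> \<eta> t \<in> Lc G B (m + 1)"
  unfolding \<eta>_def by (rule D.linear_der_Lc[OF lm_\<eta> letter_\<eta>])

lemma bd1_Lc: "t \<in> Lc G B m \<Longrightarrow> bd1 t \<in> Lc G B (m - 1)"
  unfolding bd1_def using D.linear_der_Lc[OF lm_bd1 letter_bd1, of t m] by simp

lemma NN_Lc: "t \<in> Lc G B m \<Longrightarrow> NN t \<in> Lc G B m"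
  unfolding NN_def using bd1_Lc[OF \<eta>_Lc, of t m] \<eta>_Lc[OF bd1_Lc, of t m]
  by (intro Q.subspace_add[OF Lc_subspace]) auto

lemma bd_Lc: "t \<in> Lc G B m \<Longrightarrow> bd t \<in> Lc G B (m - 1)"
  using D.der_Lc[OF letter_map_desusp_op, of t m] letter_D_Lc unfolding tensor_diff_der by simp

lemma len_part_\<eta>: "t \<in> Tca G B \<Longrightarrow> len_part k (\<eta> t) = \<eta> (len_part k t)"
  unfolding \<eta>_def by (rule D.len_part_linear_der[OF lm_\<eta>])

lemma len_part_bd1: "t \<in> Tca G B \<Longrightarrow> len_part k (bd1 t) = bd1 (len_part k t)"
  unfolding bd1_def by (rule D.len_part_linear_der[OF lm_bd1])

lemma len_part_NN: "t \<in> Tca G B \<Longrightarrow> len_part k (NN t) = NN (len_part k t)"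
  unfolding NN_def by (simp add: len_part_linear len_part_\<eta> len_part_bd1 \<eta>_Tca bd1_Tca)

lemma \<eta>_ten1: "x \<in> B \<Longrightarrow> x \<in> G n \<Longrightarrow> \<eta> (ten1 x) = - ten1 (\<kappa> x)"
  unfolding \<eta>_def by (subst D.der_letter_ten1[OF lm_\<eta>]) (simp_all add: letter_linear_letter)

lemma bd1_ten1: "x \<in> B \<Longrightarrow> x \<in> G n \<Longrightarrow> bd1 (ten1 x) = - ten1 (\<delta> x)"
  unfolding bd1_def by (subst D.der_letter_ten1[OF lm_bd1]) (simp_all add: letter_linear_letter)

lemma NN_ten1:
  assumes x: "x \<in> B" "x \<in> G n" shows "NN (ten1 x) = ten1 (x - p x)"
proof -
  have "NN (ten1 x) = ten1 (\<delta> (\<kappa> x)) + ten1 (\<kappa> (\<delta> x))"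
    unfolding NN_def \<eta>_ten1[OF x] bd1_ten1[OF x] \<eta>_linear bd1_linear \<eta>_ten1[OF d_G[OF x]] bd1_ten1[OF k_G[OF x]]
    by simp
  then show ?thesis unfolding ten1_linear(1)[symmetric] homotopy[OF x(1)] .
qed

text \<open>As a commutator of two odd derivations \<open>NN\<close> is an even derivation, so it is
  governed by its values on letters.\<close>

lemma NN_dcomm: "NN = D.dcomm (-1) (linear_letter (\<lambda>x. - \<delta> x)) 1 (linear_letter (\<lambda>x. - \<kappa> x))"
  by (simp add: fun_eq_iff NN_def D.dcomm_def bd1_def \<eta>_def tensor_apply)

lemma NN_tmult: "s \<in> Tc G B m \<Longrightarrow> t \<in> Tca G B \<Longrightarrow> NN (tmult s t) = tmult (NN s) t + tmult s (NN t)"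
  unfolding NN_dcomm using D.dcomm_tmult[OF lm_bd1 lm_\<eta>, of s m t] by simp

lemma \<eta>_tmult: "s \<in> Tc G B m \<Longrightarrow> t \<in> Tca G B \<Longrightarrow> \<eta> (tmult s t) = tmult (\<eta> s) t + ksgn m *\<^sub>Q tmult s (\<eta> t)"
  unfolding \<eta>_def using D.der_tmult[OF lm_\<eta>, of s m t] lin_supp_Tca[of t G B] by simp

lemma \<eta>_square: "t \<in> Tca G B \<Longrightarrow> \<eta> (\<eta> t) = 0"
proof -
  assume t: "t \<in> Tca G B"
  have c: "D.dcomm 1 (linear_letter (\<lambda>x. - \<kappa> x)) 1 (linear_letter (\<lambda>x. - \<kappa> x)) t = \<eta> (\<eta> t) + \<eta> (\<eta> t)" for t
    by (simp add: D.dcomm_def \<eta>_def)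
  have "D.dcomm 1 (linear_letter (\<lambda>x. - \<kappa> x)) 1 (linear_letter (\<lambda>x. - \<kappa> x)) t = 0"
    by (rule D.dcomm_eq_0[OF lm_\<eta> lm_\<eta> _ t])
      (simp only: c \<eta>_ten1 \<eta>_linear k_G, simp add: \<eta>_ten1[OF k_G] kk)
  then show ?thesis unfolding c by (rule qscale_double)
qed

text \<open>Both sides are \<eta> bd1 \<eta>, because \<eta> has square zero.\<close>

lemma NN_\<eta>: "t \<in> Tca G B \<Longrightarrow> NN (\<eta> t) = \<eta> (NN t)"
  by (simp add: NN_def \<eta>_square \<eta>_linear bd1_Tca bd1_linear)

lemma PP_lin: "qlinear (\<lambda>x. ten1 (p x))"
  by (rule qlinear_comp[OF qlinear_ten1 p_lin])

lemma PP_tmult: "s \<in> Tca G B \<Longrightarrow> PP (tmult s t) = tmult (PP s) (PP t)"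
  unfolding PP_def by (rule alg_tmult[OF PP_lin]) auto

lemma PP_ten1: "PP (ten1 x) = ten1 (p x)"
  unfolding PP_def by (rule alg_ten1[OF PP_lin]) simp

lemma PP_Nil: "PP (pure []) = pure []"
  unfolding PP_def by (rule alg_Nil)

lemma PP_Tca: "t \<in> Tca G B \<Longrightarrow> PP t \<in> Tca G H"
proof -
  have "ten1 (p x) \<in> Tc G H n" if "x \<in> B" "x \<in> G n" for x n
    by (rule ten1_in_Tc) (use p_G[OF that] in auto)
  then show "t \<in> Tca G B \<Longrightarrow> PP t \<in> Tca G H"
    unfolding PP_def by (intro alg_Tc(2)[OF PP_lin, of B G H]) auto
qed

lemma pure_Tca: "hword G V m xs \<Longrightarrow> pure xs \<in> Tca G V"
  using pure_in_Tc Tc_subset_Tca by blast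

lemma ten1_Tca: "x \<in> V \<Longrightarrow> x \<in> G n \<Longrightarrow> ten1 x \<in> Tca G V"
  using ten1_in_Tc[of x V G n] Tc_subset_Tca by blast

lemma H_Tca: "Tca G H \<subseteq> Tca G B"
  by (rule Tca_mono[OF H_sub])

lemma Tca_zero_on_H:
  assumes F: "filtered F" and nil: "F (pure []) = 0"
    and step: "\<And>x n m xs. x \<in> H \<Longrightarrow> x \<in> G n \<Longrightarrow> hword G H m xs \<Longrightarrow> F (pure xs) = 0 \<Longrightarrow> F (tmult (ten1 x) (pure xs)) = 0"
    and t: "t \<in> Tca G H"
  shows "F t = 0"
proof (rule filtered_Tca_eq[OF F filtered_zero _ t])
  fix m xs assume "hword G H m xs"
  then show "F (pure xs) = 0"
    by (induction rule: hword.induct) (simp_all add: nil pure_Cons step)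
qed

lemma \<eta>_H: "t \<in> Tca G H \<Longrightarrow> \<eta> t = 0"
proof (rule Tca_zero_on_H[OF filtered_\<eta>])
  fix x n m xs assume x: "x \<in> H" "x \<in> G n" and xs: "hword G H m xs" and IH: "\<eta> (pure xs) = 0"
  have xB: "x \<in> B" using x H_sub by blast
  have "\<eta> (tmult (ten1 x) (pure xs)) = tmult (\<eta> (ten1 x)) (pure xs) + ksgn n *\<^sub>Q tmult (ten1 x) (\<eta> (pure xs))"
    using x xB H_Tca pure_Tca[OF xs] by (intro \<eta>_tmult ten1_in_Tc) auto
  then show "\<eta> (tmult (ten1 x) (pure xs)) = 0"
    by (simp add: \<eta>_ten1[OF xB x(2)] k_H x(1) IH tmult_linear)
qed (simp_all add: \<eta>_def der_Nil)

lemma NN_H: "t \<in> Tca G H \<Longrightarrow> NN t = 0"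
proof (rule Tca_zero_on_H[OF filtered_NN])
  fix x n m xs assume x: "x \<in> H" "x \<in> G n" and xs: "hword G H m xs" and IH: "NN (pure xs) = 0"
  have xB: "x \<in> B" using x H_sub by blast
  have "NN (tmult (ten1 x) (pure xs)) = tmult (NN (ten1 x)) (pure xs) + tmult (ten1 x) (NN (pure xs))"
    using x xB H_Tca pure_Tca[OF xs] by (intro NN_tmult ten1_in_Tc) auto
  then show "NN (tmult (ten1 x) (pure xs)) = 0"
    by (simp add: NN_ten1[OF xB x(2)] p_H x(1) IH tmult_linear)
qed (simp_all add: NN_def \<eta>_def bd1_def der_Nil der_linear)

lemma PP_H: "t \<in> Tca G H \<Longrightarrow> PP t = t"
proof -
  assume t: "t \<in> Tca G H"
  have "PP t - t = 0"
  proof (rule Tca_zero_on_H[OF filtered_minus[OF filtered_PP filtered_id] _ _ t])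
    fix x n m xs assume x: "x \<in> H" "x \<in> G n" and IH: "PP (pure xs) - pure xs = 0"
    have "ten1 x \<in> Tca G B" using x H_sub by (intro ten1_Tca) auto
    then show "PP (tmult (ten1 x) (pure xs)) - tmult (ten1 x) (pure xs) = 0"
      using IH by (simp add: PP_tmult PP_ten1 p_H x)
  qed (simp add: PP_Nil)
  then show ?thesis by simp
qed

lemma NN_PP: "t \<in> Tca G B \<Longrightarrow> NN (PP t) = 0"
  by (rule NN_H[OF PP_Tca])

lemma p_p: "x \<in> B \<Longrightarrow> x \<in> G n \<Longrightarrow> p (p x) = p x"
  by (rule p_H[OF p_G(1)])

text \<open>\<open>PP\<close> is multiplicative, so once it annihilates the values of a derivation
  on letters it annihilates those on words. The factor c stands for the Koszul sign.\<close>

lemma PP_letterwise: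
  assumes F: "filtered F" and nil: "PP (F (pure [])) = 0"
    and tm: "\<And>x n t. x \<in> B \<Longrightarrow> x \<in> G n \<Longrightarrow> t \<in> Tca G B \<Longrightarrow>
      F (tmult (ten1 x) t) = tmult (F (ten1 x)) t + c n *\<^sub>Q tmult (ten1 x) (F t)"
    and Fx: "\<And>x n. x \<in> B \<Longrightarrow> x \<in> G n \<Longrightarrow> F (ten1 x) \<in> Tca G B \<and> PP (F (ten1 x)) = 0"
    and t: "t \<in> Tca G B"
  shows "PP (F t) = 0"
proof (rule filtered_Tca_eq[OF filtered_comp[OF filtered_PP F] filtered_zero _ t])
  fix m xs assume "hword G B m xs"
  then show "PP (F (pure xs)) = 0"
  proof (induction rule: hword.induct)
    case (Cons x n m xs)
    then show ?case
      using Fx[OF Cons(1,2)] ten1_Tca[OF Cons(1,2)] pure_Tca[OF Cons(3)]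
      by (simp add: pure_Cons tm[OF Cons(1,2)] PP_linear PP_tmult tmult_linear)
  qed (simp add: nil)
qed

lemma PP_NN: "t \<in> Tca G B \<Longrightarrow> PP (NN t) = 0"
proof (rule PP_letterwise[OF filtered_NN, where c = "\<lambda>_. 1"])
  show "NN (tmult (ten1 x) t) = tmult (NN (ten1 x)) t + 1 *\<^sub>Q tmult (ten1 x) (NN t)"
    if "x \<in> B" "x \<in> G n" "t \<in> Tca G B" for x n t
    using NN_tmult[OF ten1_in_Tc[of x B G n] that(3)] that by simp
  show "NN (ten1 x) \<in> Tca G B \<and> PP (NN (ten1 x)) = 0" if "x \<in> B" "x \<in> G n" for x n
    using NN_Tca[OF ten1_Tca[OF that]] p_p[OF that]
    by (simp add: NN_ten1[OF that] PP_ten1 PP_linear qlinear_diff[OF p_lin])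
qed (simp_all add: NN_def \<eta>_def bd1_def der_Nil der_linear PP_linear)

lemma PP_\<eta>: "t \<in> Tca G B \<Longrightarrow> PP (\<eta> t) = 0"
proof (rule PP_letterwise[OF filtered_\<eta>, where c = ksgn])
  show "\<eta> (tmult (ten1 x) t) = tmult (\<eta> (ten1 x)) t + ksgn n *\<^sub>Q tmult (ten1 x) (\<eta> t)"
    if "x \<in> B" "x \<in> G n" "t \<in> Tca G B" for x n t
    using \<eta>_tmult[OF ten1_in_Tc[of x B G n] that(3)] that by simp
  show "\<eta> (ten1 x) \<in> Tca G B \<and> PP (\<eta> (ten1 x)) = 0" if "x \<in> B" "x \<in> G n" for x n
    using \<eta>_Tca[OF ten1_Tca[OF that]] by (simp add: \<eta>_ten1[OF that] PP_ten1 PP_linear pk that)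
qed (simp_all add: \<eta>_def der_Nil PP_linear)

text \<open>\<open>NN\<close> multiplies a word by the number of its letters outside \<open>H\<close>. Hence on words of length \<open>n\<close> the
  product of the operators \<open>1 - NN / i\<close>, \<open>1 \<le> i \<le> n\<close>, is the projection \<open>PP\<close>, and \<open>NN\<close> can be inverted
  on the kernel of \<open>PP\<close> by a polynomial in \<open>NN\<close>. Being a polynomial in a derivation, the inverse
  preserves the free Lie algebra.\<close>

primrec RR :: "nat \<Rightarrow> 'c tensor \<Rightarrow> 'c tensor" where
  "RR 0 t = t"
| "RR (Suc j) t = RR j t - (1 / of_nat (Suc j)) *\<^sub>Q NN (RR j t)"

lemma filtered_RR: "filtered (RR j)"
  by (induction j) (simp_all add: filtered_id filtered_minus filtered_cmult filtered_comp[OF filtered_NN])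

lemmas RR_linear = qlinear_add[OF filtered_qlinear[OF filtered_RR]] qlinear_0[OF filtered_qlinear[OF filtered_RR]]

lemma RR_Tca: "t \<in> Tca G B \<Longrightarrow> RR j t \<in> Tca G B"
  by (induction j) (simp_all add: Q.subspace_diff[OF Tca_subspace] Q.subspace_scale[OF Tca_subspace] NN_Tca)

lemma RR_Lc: "t \<in> Lc G B m \<Longrightarrow> RR j t \<in> Lc G B m"
  by (induction j) (simp_all add: Q.subspace_diff[OF Lc_subspace] Q.subspace_scale[OF Lc_subspace] NN_Lc)

lemma \<eta>_RR: "t \<in> Tca G B \<Longrightarrow> \<eta> (RR j t) = RR j (\<eta> t)"
  by (induction j) (simp_all add: \<eta>_linear NN_\<eta>[symmetric] RR_Tca)

lemma PP_RR: "t \<in> Tca G B \<Longrightarrow> PP (RR j t) = PP t"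
  by (induction j) (simp_all add: PP_linear PP_NN RR_Tca)

lemma len_part_RR: "t \<in> Tca G B \<Longrightarrow> len_part k (RR j t) = RR j (len_part k t)"
  by (induction j) (simp_all add: len_part_linear len_part_NN RR_Tca)

text \<open>The derivation \<open>NN\<close> vanishes on letters of H and therefore acts behind
  them.\<close>

lemma RR_H:
  assumes x: "x \<in> H" "x \<in> G n" and t: "t \<in> Tca G B"
  shows "RR j (tmult (ten1 x) t) = tmult (ten1 x) (RR j t)"
proof (induction j)
  case (Suc j)
  have xB: "x \<in> B" using x H_sub by blast
  have "NN (tmult (ten1 x) (RR j t)) = tmult (ten1 x) (NN (RR j t))"
    using NN_tmult[OF ten1_in_Tc[of x B G n, OF xB x(2)] RR_Tca[OF t]]
    by (simp add: NN_ten1[OF xB x(2)] p_H x(1) tmult_linear)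
  then show ?case by (simp add: Suc tmult_linear)
qed simp

text \<open>A letter outside H counts once, so with N for \<open>NN\<close> on t, the operator acts
  as 1 + N behind x. The product of 1 - (1 + N) / i for i = 1, ..., j + 1 equals -N / (j + 1) times
  the product of 1 - N / i for i = 1, ..., j.\<close>

lemma RR_K:
  assumes x: "x \<in> B" "x \<in> G n" "p x = 0" and t: "t \<in> Tca G B"
  shows "RR (Suc j) (tmult (ten1 x) t) = - ((1 / of_nat (Suc j)) *\<^sub>Q tmult (ten1 x) (NN (RR j t)))"
proof (induction j)
  case 0
  show ?case
    using NN_tmult[OF ten1_in_Tc[of x B G n, OF x(1,2)] t]
    by (simp add: NN_ten1[OF x(1,2)] x(3))
next
  case (Suc j)
  let ?w = "tmult (ten1 x) (NN (RR j t))" and ?v = "tmult (ten1 x) (NN (NN (RR j t)))"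
  define a b :: rat where "a = 1 / of_nat (Suc j)" and "b = 1 / of_nat (Suc (Suc j))"
  have ab: "a - a * b = b"
  proof -
    define u :: rat where "u = of_nat (Suc j)"
    have "u > 0" "b = 1 / (u + 1)" by (simp_all add: u_def b_def add.commute)
    then show ?thesis by (simp add: a_def u_def[symmetric] field_simps del: of_nat_Suc)
  qed
  have N: "NN ?w = ?w + ?v"
    using NN_tmult[OF ten1_in_Tc[of x B G n, OF x(1,2)] NN_Tca[OF RR_Tca[OF t]]]
    by (simp add: NN_ten1[OF x(1,2)] x(3))
  have "RR (Suc (Suc j)) (tmult (ten1 x) t) = - (a *\<^sub>Q ?w) + (b * a) *\<^sub>Q (?w + ?v)"
    unfolding RR.simps(2)[of "Suc j"] Suc NN_linear N a_def[symmetric] b_def[symmetric]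
    by (simp add: Q.scale_right_distrib Q.scale_right_diff_distrib)
  also have "\<dots> = - ((a - a * b) *\<^sub>Q ?w) + (b * a) *\<^sub>Q ?v"
    by (simp add: Q.scale_right_distrib Q.scale_left_diff_distrib mult.commute)
  also have "\<dots> = - (b *\<^sub>Q tmult (ten1 x) (NN (RR (Suc j) t)))"
    unfolding ab by (simp add: NN_linear tmult_linear Q.scale_right_diff_distrib a_def)
  finally show ?case by (simp only: b_def)
qed

text \<open>Write the first letter as p x + (x - p x). Since \<open>NN\<close> kills the image of
  \<open>PP\<close>, the extra factor of the operator acts as the identity on the tail after p x,
  and by \<open>RR_K\<close> the second part gives 0.\<close>

lemma RR_PP_word: "hword G B m xs \<Longrightarrow> RR (length xs) (pure xs) = PP (pure xs)"
proof (induction rule: hword.induct)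
  case Nil
  then show ?case by (simp add: PP_Nil)
next
  case (Cons x n m xs)
  note x = Cons(1,2)
  note px = p_G[OF x]
  have t: "pure xs \<in> Tca G B" by (rule pure_Tca[OF Cons(3)])
  have k: "x - p x \<in> B" "x - p x \<in> G n" "p (x - p x) = 0"
    using x px H_sub p_p[OF x] by (auto simp: qlinear_diff[OF p_lin] intro: Q.subspace_diff[OF B_sub] Q.subspace_diff[OF D.sub])
  have 1: "RR (Suc (length xs)) (tmult (ten1 (p x)) (pure xs)) = tmult (ten1 (p x)) (PP (pure xs))"
    unfolding RR_H[OF px t] by (simp add: Cons.IH NN_PP t)
  have 2: "RR (Suc (length xs)) (tmult (ten1 (x - p x)) (pure xs)) = 0"
    unfolding RR_K[OF k t] by (simp add: Cons.IH NN_PP t tmult_linear)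
  have "pure (x # xs) = tmult (ten1 (p x)) (pure xs) + tmult (ten1 (x - p x)) (pure xs)"
    by (simp add: pure_Cons tmult_linear)
  then have "RR (Suc (length xs)) (pure (x # xs)) = tmult (ten1 (p x)) (PP (pure xs))"
    by (simp only: RR_linear 1 2 add_0_right)
  then show ?case using ten1_Tca[OF x] by (simp add: pure_Cons PP_tmult PP_ten1 del: RR.simps)
qed

lemma RR_PP: "t \<in> Tca G B \<Longrightarrow> RR n (len_part n t) = PP (len_part n t)"
proof (rule filtered_Tca_eq[of "\<lambda>t. RR n (len_part n t)" "\<lambda>t. PP (len_part n t)"])
  show "RR n (len_part n (pure xs)) = PP (len_part n (pure xs))" if "hword G B m xs" for m xs
    using RR_PP_word[OF that] by (simp add: len_part_pure RR_linear PP_linear)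
qed (intro filtered_comp[OF filtered_RR filtered_len_part] filtered_comp[OF filtered_PP filtered_len_part])+

lemma NN_inverse:
  assumes z: "z \<in> lie_family G B m n" and \<eta>z: "\<eta> z = 0" and PPz: "PP z = 0"
  obtains c where "c \<in> lie_family G B m n" "\<eta> c = 0" "PP c = 0" "NN c = z"
proof -
  have zL: "z \<in> Lc G B m" by (rule lprod_member[OF length_family_lie z])
  have zT: "z \<in> Tca G B" using zL Lc_subset_Tc Tc_subset_Tca by blast
  have zl: "len_part n z = z" using length_family_len[OF length_family_lie z, of n] by simp
  \<comment> \<open>As RR j - RR (Suc j) is 1 / (j + 1) times NN (RR j), applying \<open>NN\<close>
    to this sum telescopes to z - RR n z. That is z, because RR n z = PP z = 0.\<close>
  define c where "c = (\<Sum>j<n. (1 / of_nat (Suc j)) *\<^sub>Q RR j z)"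
  have "RR j z \<in> lie_family G B m n" for j
    using lprodD[OF RR_Lc[OF zL, of j], of n] by (simp add: len_part_RR[OF zT] zl)
  then have "c \<in> lie_family G B m n"
    unfolding c_def by (intro Q.subspace_sum[OF qsubspace_lie_family] Q.subspace_scale[OF qsubspace_lie_family])
  moreover have "\<eta> c = 0"
    by (simp add: c_def qlinear_sum[OF filtered_qlinear[OF filtered_\<eta>]] \<eta>_linear \<eta>_RR[OF zT] \<eta>z RR_linear)
  moreover have "PP c = 0"
    by (simp add: c_def qlinear_sum[OF filtered_qlinear[OF filtered_PP]] PP_linear PP_RR[OF zT] PPz)
  moreover have "NN c = z"
  proof -
    have "NN c = (\<Sum>j<n. RR j z - RR (Suc j) z)"
      by (simp add: c_def qlinear_sum[OF filtered_qlinear[OF filtered_NN]] NN_linear)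
    also have "\<dots> = RR 0 z - RR n z" by (rule sum_lessThan_telescope')
    finally show ?thesis using RR_PP[OF zT, of n] PPz zl by simp
  qed
  ultimately show ?thesis using that by blast
qed

end

context contraction
begin

interpretation T: coop C H \<Delta>'
  by unfold_locales (rule coop_transferred)

section \<open>Leading terms and lifting\<close>

lemma Lc_Tca: "t \<in> Lc G V m \<Longrightarrow> t \<in> Tca G V"
  using Lc_subset_Tc Tc_subset_Tca by blast

lemma length_part_Tca: "t \<in> Tca G B \<Longrightarrow> len_part n t \<in> Tca G B"
  by (rule lprod_trunc[OF length_family_tall])

text \<open>Only the replacement of a letter by its \<delta> keeps the length; \<open>s2\<close>
  raises it by one.\<close>

lemma bd_leading:
  assumes "t \<in> Tca G B" shows "len_part n (bd (len_part n t)) = bd1 (len_part n t)"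
proof (rule filtered_Tca_eq[of "\<lambda>t. len_part n (bd (len_part n t))" "\<lambda>t. bd1 (len_part n t)", OF _ _ _ assms])
  show "filtered (\<lambda>t. len_part n (bd (len_part n t)))"
    by (intro filtered_comp[OF filtered_len_part] filtered_comp[OF filtered_tensor_diff] filtered_len_part)
  show "filtered (\<lambda>t. bd1 (len_part n t))" by (rule filtered_comp[OF filtered_bd1 filtered_len_part])
  fix m xs assume xs: "hword G B m xs"
  have "len_part (length xs) (bd (pure xs)) = bd1 (pure xs)"
    using xs
  proof (induction rule: hword.induct)
    case Nil
    then show ?case by (simp add: tensor_diff_der bd1_def der_Nil len_part_linear)
  next
    case (Cons x q m xs)
    note x = Cons(1,2)
    have "bd (pure (x # xs)) = tmult (s2 x) (pure xs) - tmult (ten1 (\<delta> x)) (pure xs) +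
        ksgn q *\<^sub>Q tmult (ten1 x) (bd (pure xs))"
      unfolding pure_Cons partial_tmult[OF ten1_in_Tc[of x B G q, OF x] lin_supp_pure] partial_ten1[OF x]
      by (simp add: tmult_linear)
    moreover have "bd1 (pure (x # xs)) = - tmult (ten1 (\<delta> x)) (pure xs) + ksgn q *\<^sub>Q tmult (ten1 x) (bd1 (pure xs))"
      using D.der_letter_pure[OF lm_bd1 x, of xs] by (simp add: bd1_def letter_linear_letter tmult_linear)
    moreover have "len_part (length (x # xs)) (tmult (s2 x) (pure xs)) = 0"
      by (subst len_part_tmult_homog[of 2 _ "length xs"]) (simp_all add: s2_len[OF x] len_part_pure)
    moreover have "len_part (length (x # xs)) (tmult (ten1 y) (pure xs)) = tmult (ten1 y) (pure xs)" for y :: 'c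
      by (subst len_part_tmult_homog[of 1 _ "length xs"]) (simp_all add: len_part_ten1 len_part_pure)
    moreover have "len_part (length (x # xs)) (tmult (ten1 x) (bd (pure xs))) = tmult (ten1 x) (bd1 (pure xs))"
    proof -
      have "len_part (length (x # xs)) (tmult (ten1 x) (bd (pure xs))) =
        (\<Sum>i\<le>Suc (length xs). if i = 1 then tmult (ten1 x) (len_part (length xs) (bd (pure xs))) else 0)"
        unfolding len_part_tmult by (simp only: list.size) (intro sum.cong, auto simp: len_part_ten1 tmult_linear)
      then show ?thesis by (simp add: Cons.IH del: sum.atMost_Suc)
    qed
    ultimately show ?case by (simp add: len_part_linear del: list.size)
  qed
  then show "len_part n (bd (len_part n (pure xs))) = bd1 (len_part n (pure xs))"
    by (simp add: len_part_pure partial_linear bd1_linear len_part_linear)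
qed

text \<open>A letter goes to p x plus longer terms.\<close>

lemma \<Gamma>_leading:
  assumes "t \<in> Tca G B" shows "len_part n (\<Gamma> (len_part n t)) = PP (len_part n t)"
proof (rule filtered_Tca_eq[of "\<lambda>t. len_part n (\<Gamma> (len_part n t))" "\<lambda>t. PP (len_part n t)", OF _ _ _ assms])
  show "filtered (\<lambda>t. len_part n (\<Gamma> (len_part n t)))"
    by (intro filtered_comp[OF filtered_len_part] filtered_comp[OF filtered_\<Gamma>] filtered_len_part)
  show "filtered (\<lambda>t. PP (len_part n t))" by (rule filtered_comp[OF filtered_PP filtered_len_part])
  fix m xs assume xs: "hword G B m xs"
  \<comment> \<open>Vanishing below the length of the word is proved along, since the product
    formula needs it for the tail.\<close>
  have "(\<forall>k<length xs. len_part k (\<Gamma> (pure xs)) = 0) \<and> len_part (length xs) (\<Gamma> (pure xs)) = PP (pure xs)"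
    using xs
  proof (induction rule: hword.induct)
    case Nil
    then show ?case by (simp add: \<Gamma>_def PP_def alg_Nil len_part_pure)
  next
    case (Cons x q m xs)
    note x = Cons(1,2)
    have e: "\<Gamma> (pure (x # xs)) = tmult (letter \<gamma> x) (\<Gamma> (pure xs))" "PP (pure (x # xs)) = tmult (ten1 (p x)) (PP (pure xs))"
      using ten1_Tca[OF x] by (simp_all add: pure_Cons \<Gamma>_tmult PP_tmult \<Gamma>_ten1 PP_ten1)
    have l1: "len_part 1 (letter \<gamma> x) = ten1 (p x)"
      using \<gamma>_1[OF x] by (simp add: D.len_part_letter len_part_ten1)
    have "tmult (len_part i (letter \<gamma> x)) (len_part (k - i) (\<Gamma> (pure xs))) =
      (if i = 1 \<and> k = Suc (length xs) then tmult (ten1 (p x)) (PP (pure xs)) else 0)"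
      if "i \<le> k" "k \<le> Suc (length xs)" for i k
    proof (cases "i = 0")
      case True
      then show ?thesis by (simp add: D.len_part_0_letter tmult_linear)
    next
      case False
      show ?thesis
      proof (cases "k - i < length xs")
        case True
        then show ?thesis using Cons.IH that by (auto simp: tmult_linear)
      next
        case False
        then have "i = 1" "k = Suc (length xs)" using that \<open>i \<noteq> 0\<close> by auto
        then show ?thesis using Cons.IH l1 by simp
      qed
    qed
    then have "len_part k (\<Gamma> (pure (x # xs))) =
        (\<Sum>i\<le>k. if i = 1 \<and> k = Suc (length xs) then tmult (ten1 (p x)) (PP (pure xs)) else 0)"
      if "k \<le> Suc (length xs)" for k
      unfolding e len_part_tmult using that by (intro sum.cong) auto
    then show ?case unfolding e(2) by (auto simp del: sum.atMost_Suc)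
  qed
  then show "len_part n (\<Gamma> (len_part n (pure xs))) = PP (len_part n (pure xs))"
    by (simp add: len_part_pure \<Gamma>_linear PP_linear len_part_linear)
qed

lemma lie_family_Lc: "c \<in> lie_family G V m n \<Longrightarrow> c \<in> Lc G V m"
  by (rule lprod_member[OF length_family_lie])

lemma lie_family_mono: "lie_family G H m n \<subseteq> lie_family G B m n"
  by (auto simp: lie_family_def intro: lie_words_mono[OF _ H_sub])

text \<open>Two corrections in the new length: w over H repairs the image under
  \<open>\<Gamma>\<close>, and c0 repairs \<eta> bd. They do not interfere, because
  \<open>PP\<close> fixes w and kills c0, while \<open>NN\<close> kills w.\<close>

lemma lift_step:
  assumes X: "X \<in> Lc G B m" "\<eta> X = 0" and r: "r \<in> Lc G B m" "\<eta> r = 0" "PP r = 0" and y: "y \<in> Lc G H m"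
    and \<Gamma>X: "\<And>k. k \<le> i \<Longrightarrow> len_part k (\<Gamma> X) = len_part k y"
    and bX: "\<And>k. k \<le> i \<Longrightarrow> len_part k (\<eta> (bd X)) = len_part k r"
  shows "\<exists>c\<in>lie_family G B m (Suc i). \<eta> (X + c) = 0 \<and>
     (\<forall>k\<le>Suc i. len_part k (\<Gamma> (X + c)) = len_part k y \<and> len_part k (\<eta> (bd (X + c))) = len_part k r)"
proof -
  define n where "n = Suc i"
  define e where "e = len_part n (r - \<eta> (bd X))"
  define w where "w = len_part n (y - \<Gamma> X)"
  have bX': "bd X \<in> Tca G B" "\<eta> (bd X) \<in> Lc G B m"
    using bd_Lc[OF X(1)] \<eta>_Lc[OF bd_Lc[OF X(1)]] Lc_Tca by auto
  have rX: "r - \<eta> (bd X) \<in> Lc G B m" by (rule Q.subspace_diff[OF Lc_subspace r(1) bX'(2)])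
  have eL: "e \<in> lie_family G B m n" unfolding e_def by (rule lprodD[OF rX])
  have "\<eta> e = 0"
    unfolding e_def len_part_\<eta>[OF Lc_Tca[OF rX], symmetric]
    by (simp add: \<eta>_linear r \<eta>_square bX' len_part_linear)
  moreover have "PP e = 0"
  proof -
    have comm: "PP (len_part n t) = len_part n (PP t)" if "t \<in> Tca G B" for t
    proof (rule filtered_Tca_eq[of "\<lambda>t. PP (len_part n t)" "\<lambda>t. len_part n (PP t)", OF _ _ _ that])
      show "filtered (\<lambda>t. PP (len_part n t))" by (rule filtered_comp[OF filtered_PP filtered_len_part])
      show "filtered (\<lambda>t. len_part n (PP t))" by (rule filtered_comp[OF filtered_len_part filtered_PP])
      have 1: "len_part (length xs) (PP (pure xs)) = PP (pure xs)" if "hword G B m xs" for m xs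
        using RR_PP_word[OF that] len_part_RR[OF pure_Tca[OF that], of "length xs"]
        by (metis len_part_pure)
      show "PP (len_part n (pure xs)) = len_part n (PP (pure xs))" if "hword G B m xs" for m xs
        using 1[OF that] by (auto simp: len_part_pure PP_linear) (metis len_part_len_part)
    qed
    show ?thesis unfolding e_def comm[OF Lc_Tca[OF rX]]
      by (simp add: PP_linear r PP_\<eta> bX' len_part_linear)
  qed
  ultimately obtain c0 where c0: "c0 \<in> lie_family G B m n" "\<eta> c0 = 0" "PP c0 = 0" "NN c0 = e"
    using NN_inverse[OF eL] by blast
  have wH: "w \<in> lie_family G H m n"
    unfolding w_def by (rule lprodD[OF Q.subspace_diff[OF Lc_subspace y \<Gamma>_Lc[OF X(1)]]])
  then have wT: "w \<in> Tca G H" by (intro Lc_Tca[OF lie_family_Lc])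
  define c where "c = w + c0"
  have c: "c \<in> lie_family G B m n"
    unfolding c_def using wH lie_family_mono c0(1) by (intro Q.subspace_add[OF qsubspace_lie_family]) auto
  have cT: "c \<in> Tca G B" by (rule Lc_Tca[OF lie_family_Lc[OF c]])
  have cl: "len_part k c = (if k = n then c else 0)" for k by (rule length_family_len[OF length_family_lie c])
  have \<eta>c: "\<eta> c = 0" by (simp add: c_def \<eta>_linear \<eta>_H[OF wT] c0)
  have PPc: "PP c = w" by (simp add: c_def PP_linear PP_H[OF wT] c0)
  have NNc: "NN c = e" by (simp add: c_def NN_linear NN_H[OF wT] c0)
  have \<Gamma>c: "len_part k (\<Gamma> c) = (if k = n then w else 0)" if "k \<le> n" for k
  proof (cases "k = n")
    case True
    then show ?thesis using \<Gamma>_leading[OF cT, of n] cl PPc by simp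
  next
    case False
    then show ?thesis using \<Gamma>_vanish[of n c k] cl that by simp
  qed
  have bc: "len_part k (\<eta> (bd c)) = (if k = n then e else 0)" if "k \<le> n" for k
  proof (cases "k = n")
    case True
    have "len_part n (\<eta> (bd c)) = \<eta> (len_part n (bd c))" by (rule len_part_\<eta>[OF partial_Tca[OF cT]])
    also have "\<dots> = \<eta> (bd1 c)" using bd_leading[OF cT, of n] cl by simp
    \<comment> \<open>Since \<eta> c = 0, only one of the two terms of \<open>NN\<close>
      remains.\<close>
    also have "\<dots> = NN c" by (simp add: NN_def \<eta>c bd1_linear)
    finally show ?thesis using NNc True by simp
  next
    case False
    have "len_part k (bd c) = 0"
      by (rule filtered_len_part_vanish[OF filtered_tensor_diff, of k]) (use cl False that in auto)
    then show ?thesis using False len_part_\<eta>[OF partial_Tca[OF cT], of k] by (simp add: \<eta>_linear)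
  qed
  have "len_part k (\<Gamma> (X + c)) = len_part k y" if "k \<le> n" for k
    using \<Gamma>X[of k] \<Gamma>c[OF that] that by (auto simp: \<Gamma>_linear len_part_linear w_def n_def le_Suc_eq)
  moreover have "len_part k (\<eta> (bd (X + c))) = len_part k r" if "k \<le> n" for k
    using bX[of k] bc[OF that] that by (auto simp: partial_linear \<eta>_linear len_part_linear e_def n_def le_Suc_eq)
  ultimately show ?thesis
    using c X(2) \<eta>c by (intro bexI[of _ c]) (simp_all add: n_def \<eta>_linear)
qed

text \<open>The right-hand side r is kept general: for \<open>sec\<close> it is 0, while moving an
  element z into the kernel of \<eta> by a boundary requires solving \<eta> (bd c) = \<eta>
  z.\<close>

lemma lift_exists:
  assumes r: "r \<in> Lc G B m" "\<eta> r = 0" "PP r = 0" and y: "y \<in> Lc G H m"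
  obtains x where "x \<in> Lc G B m" "\<eta> x = 0" "\<Gamma> x = y" "\<eta> (bd x) = r"
proof -
  let ?Inv = "\<lambda>i X. \<eta> X = 0 \<and> (\<forall>k\<le>i. len_part k (\<Gamma> X) = len_part k y \<and> len_part k (\<eta> (bd X)) = len_part k r)"
  have "?Inv 0 0"
    using len_part_0_Lc[OF r(1)] len_part_0_Lc[OF y] by (simp add: \<eta>_linear \<Gamma>_linear partial_linear len_part_linear)
  moreover have "\<exists>c\<in>lie_family G B m (Suc i). ?Inv (Suc i) (X + c)" if "X \<in> Lc G B m" "?Inv i X" for i X
    using lift_step[OF that(1) _ r y, of i] that(2) by blast
  ultimately obtain x where x: "x \<in> Lc G B m"
    "\<forall>i. \<exists>X\<in>Lc G B m. ?Inv i X \<and> (\<forall>j\<le>i. len_part j X = len_part j x)"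
    by (rule lprod_recursion[OF length_family_lie, where Inv = ?Inv]) blast
  have "\<eta> x = 0"
  proof (rule len_part_eqI)
    fix i
    obtain X where X: "?Inv i X" "\<forall>j\<le>i. len_part j X = len_part j x" using x(2) by blast
    have "len_part i (\<eta> X) = len_part i (\<eta> x)" by (rule filtered_cong_le[OF filtered_\<eta> _ order_refl]) (use X(2) in simp)
    then show "len_part i (\<eta> x) = len_part i 0" using X(1) by simp
  qed
  moreover have "\<Gamma> x = y"
  proof (rule len_part_eqI)
    fix i
    obtain X where X: "?Inv i X" "\<forall>j\<le>i. len_part j X = len_part j x" using x(2) by blast
    have "len_part i (\<Gamma> X) = len_part i (\<Gamma> x)" by (rule filtered_cong_le[OF filtered_\<Gamma> _ order_refl]) (use X(2) in simp)
    then show "len_part i (\<Gamma> x) = len_part i y" using X(1) by simp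
  qed
  moreover have "\<eta> (bd x) = r"
  proof (rule len_part_eqI)
    fix i
    obtain X where X: "?Inv i X" "\<forall>j\<le>i. len_part j X = len_part j x" using x(2) by blast
    have "len_part i (\<eta> (bd X)) = len_part i (\<eta> (bd x))"
      by (rule filtered_cong_le[OF filtered_comp[OF filtered_\<eta> filtered_tensor_diff] _ order_refl]) (use X(2) in simp)
    then show "len_part i (\<eta> (bd x)) = len_part i r" using X(1) by simp
  qed
  ultimately show ?thesis using that x(1) by blast
qed

text \<open>Let c be the lowest part not yet known to vanish. It satisfies PP c = 0 and NN c = 0, so
  every factor of \<open>RR\<close> fixes it, while the full product is \<open>PP\<close>. Hence c =
  0.\<close>

lemma lift_unique:
  assumes y: "y \<in> Tca G B" "\<eta> y = 0" "\<Gamma> y = 0" "\<eta> (bd y) = 0" shows "y = 0"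
proof (rule len_part_eqI)
  fix n
  show "len_part n y = len_part n 0"
  proof (induction n rule: less_induct)
    case (less n)
    define c where "c = len_part n y"
    have low: "len_part j y = len_part j c" if "j \<le> n" for j
      using less[of j] that by (cases "j = n") (auto simp: c_def len_part_len_part len_part_linear)
    have cT: "c \<in> Tca G B" unfolding c_def by (rule length_part_Tca[OF y(1)])
    have cc: "len_part n c = c" by (simp add: c_def len_part_len_part)
    have "PP c = len_part n (\<Gamma> c)" using \<Gamma>_leading[OF cT, of n] cc by simp
    also have "\<dots> = len_part n (\<Gamma> y)" by (rule filtered_cong_le[OF filtered_\<Gamma>, of n, symmetric]) (use low in auto)
    finally have P: "PP c = 0" by (simp add: y len_part_linear)
    have e: "\<eta> c = 0" using len_part_\<eta>[OF y(1), of n] by (simp add: c_def y len_part_linear)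
    have "\<eta> (bd1 c) = \<eta> (len_part n (bd c))" using bd_leading[OF cT, of n] cc by simp
    also have "len_part n (bd c) = len_part n (bd y)"
      by (rule filtered_cong_le[OF filtered_tensor_diff, of n, symmetric]) (use low in auto)
    also have "\<eta> (len_part n (bd y)) = len_part n (\<eta> (bd y))" by (rule len_part_\<eta>[OF partial_Tca[OF y(1)], symmetric])
    finally have "NN c = 0" by (simp add: NN_def e y bd1_linear len_part_linear)
    then have "RR j c = c" for j by (induction j) simp_all
    then have "c = 0" using RR_PP[OF cT, of n] cc P by simp
    then show ?case by (simp add: c_def len_part_linear)
  qed
qed

text \<open>The elements \<open>x\<close> with \<open>\<eta> x = 0\<close> and \<open>\<eta> (bd x) = 0\<close> form a sub-dgl on which the projection
  \<open>\<Gamma>\<close> is an isomorphism; its inverse is the quasi-isomorphism.\<close>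

definition sec :: "'c tensor \<Rightarrow> 'c tensor" where
  "sec y = (THE x. x \<in> Tca G B \<and> \<eta> x = 0 \<and> \<eta> (bd x) = 0 \<and> \<Gamma> x = y)"

lemma sec_unique:
  assumes "x \<in> Tca G B" "\<eta> x = 0" "\<eta> (bd x) = 0" "\<Gamma> x = y" shows "sec y = x"
  unfolding sec_def
proof (rule the_equality)
  fix z assume z: "z \<in> Tca G B \<and> \<eta> z = 0 \<and> \<eta> (bd z) = 0 \<and> \<Gamma> z = y"
  have "z - x = 0"
    by (rule lift_unique) (use z assms in \<open>auto simp: \<eta>_linear \<Gamma>_linear partial_linear intro: Q.subspace_diff[OF Tca_subspace]\<close>)
  then show "z = x" by simp
qed (use assms in auto)

lemma sec:
  assumes "y \<in> Lc G H m"
  shows "sec y \<in> Lc G B m" "\<eta> (sec y) = 0" "\<eta> (bd (sec y)) = 0" "\<Gamma> (sec y) = y"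
proof -
  obtain x where x: "x \<in> Lc G B m" "\<eta> x = 0" "\<Gamma> x = y" "\<eta> (bd x) = 0"
    using lift_exists[of 0 m y] assms by (auto simp: \<eta>_linear PP_linear Q.subspace_0[OF Lc_subspace])
  then have "sec y = x" using sec_unique[OF Lc_Tca[OF x(1)]] by blast
  then show "sec y \<in> Lc G B m" "\<eta> (sec y) = 0" "\<eta> (bd (sec y)) = 0" "\<Gamma> (sec y) = y" using x by auto
qed

section \<open>The section as a quasi-isomorphism\<close>

lemma \<eta>_tbracket:
  assumes "s \<in> Lc G B m" "t \<in> Lc G B n" "\<eta> s = 0" "\<eta> t = 0" shows "\<eta> (tbracket m n s t) = 0"
  using D.der_tbracket[OF lm_\<eta>, of s m t n] assms Lc_subset_Tc[of G B]
  by (auto simp: \<eta>_def[symmetric] tbracket_linear)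

lemma bd_tbracket:
  assumes "s \<in> Lc G B m" "t \<in> Lc G B n"
  shows "bd (tbracket m n s t) = tbracket (m - 1) n (bd s) t + ksgn m *\<^sub>Q tbracket m (n - 1) s (bd t)"
  using D.der_tbracket[OF letter_map_desusp_op, of s m t n] assms Lc_subset_Tc[of G B]
  by (auto simp: tensor_diff_der)

text \<open>Each equation follows from uniqueness: the right-hand side meets the conditions that
  characterize \<open>sec\<close>.\<close>

lemma sec_morphism:
  "dgl_morphism \<lparr>part = Lc G H, bracket = tbracket, bdry = d'\<rparr> \<lparr>part = Lc G B, bracket = tbracket, bdry = bd\<rparr> sec"
  unfolding dgl_morphism_def dgl.simps
proof (intro conjI allI ballI)
  show "sec x \<in> Lc G B n" if "x \<in> Lc G H n" for n x using sec(1)[OF that] .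
  show "sec (a *\<^sub>Q x + b *\<^sub>Q y) = a *\<^sub>Q sec x + b *\<^sub>Q sec y" if "x \<in> Lc G H n" "y \<in> Lc G H n" for n x y a b
    using sec[OF that(1)] sec[OF that(2)] Lc_Tca
    by (intro sec_unique) (auto simp: \<eta>_linear partial_linear \<Gamma>_linear
        intro!: Q.subspace_add[OF Tca_subspace] Q.subspace_scale[OF Tca_subspace])
  show "sec (tbracket m n x y) = tbracket m n (sec x) (sec y)" if x: "x \<in> Lc G H m" and y: "y \<in> Lc G H n" for m n x y
  proof (rule sec_unique)
    note sx = sec[OF x] and sy = sec[OF y]
    show "tbracket m n (sec x) (sec y) \<in> Tca G B" by (rule Lc_Tca[OF tbracket_Lc[OF sx(1) sy(1)]])
    show "\<eta> (tbracket m n (sec x) (sec y)) = 0" by (rule \<eta>_tbracket[OF sx(1) sy(1) sx(2) sy(2)])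
    have "\<eta> (tbracket (m - 1) n (bd (sec x)) (sec y)) = 0" "\<eta> (tbracket m (n - 1) (sec x) (bd (sec y))) = 0"
      by (rule \<eta>_tbracket[OF bd_Lc[OF sx(1)] sy(1) sx(3) sy(2)], rule \<eta>_tbracket[OF sx(1) bd_Lc[OF sy(1)] sx(2) sy(3)])
    then show "\<eta> (bd (tbracket m n (sec x) (sec y))) = 0"
      by (simp add: bd_tbracket[OF sx(1) sy(1)] \<eta>_linear)
    have "\<Gamma> (tbracket m n (sec x) (sec y)) = tbracket m n (\<Gamma> (sec x)) (\<Gamma> (sec y))"
      unfolding \<Gamma>_def by (rule D.alg_tbracket[OF letter_\<gamma>_lin letter_nil Lc_Tca[OF sx(1)] Lc_Tca[OF sy(1)]])
    then show "\<Gamma> (tbracket m n (sec x) (sec y)) = tbracket m n x y" by (simp add: sx sy)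
  qed
  show "sec (d' x) = bd (sec x)" if x: "x \<in> Lc G H n" for n x
  proof (rule sec_unique)
    note sx = sec[OF x]
    show "bd (sec x) \<in> Tca G B" by (rule partial_Tca[OF Lc_Tca[OF sx(1)]])
    show "\<eta> (bd (sec x)) = 0" by (rule sx(3))
    show "\<eta> (bd (bd (sec x))) = 0" by (simp add: partial_square Lc_Tca[OF sx(1)] \<eta>_linear)
    show "\<Gamma> (bd (sec x)) = d' x" by (simp add: \<Gamma>_chain[symmetric] Lc_Tca[OF sx(1)] sx)
  qed
qed

text \<open>Every z differs by a boundary from an element of the kernel of \<eta>. For a cycle this
  element lies in the image of \<open>sec\<close>, whence surjectivity; for injectivity apply the
  chain map \<open>\<Gamma>\<close> to the equation that exhibits a boundary.\<close>

lemma sec_quasi_iso: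
  "quasi_iso \<lparr>part = Lc G H, bracket = tbracket, bdry = d'\<rparr> \<lparr>part = Lc G B, bracket = tbracket, bdry = bd\<rparr> sec"
proof (rule quasi_isoI[OF dgl_H dgl_B sec_morphism], unfold dgl.simps)
  have correct: "\<exists>c\<in>Lc G B (n + 1). \<eta> (z - bd c) = 0" if z: "z \<in> Lc G B n" for n z
  proof -
    have "PP (\<eta> z) = 0" "\<eta> (\<eta> z) = 0" using PP_\<eta> \<eta>_square Lc_Tca[OF z] by auto
    then obtain c where "c \<in> Lc G B (n + 1)" "\<eta> (bd c) = \<eta> z"
      using lift_exists[OF \<eta>_Lc[OF z], of 0] Q.subspace_0[OF Lc_subspace] by metis
    then show ?thesis by (intro bexI[of _ c]) (simp_all add: \<eta>_linear)
  qed
  show "\<exists>x'\<in>Lc G H (n + 1). x = d' x'"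
    if x: "x \<in> Lc G H n" "d' x = 0" and y: "y \<in> Lc G B (n + 1)" "sec x = bd y" for n x y
  proof -
    obtain c where c: "c \<in> Lc G B (n + 1 + 1)" "\<eta> (y - bd c) = 0" using correct[OF y(1)] by blast
    have "bd c \<in> Lc G B (n + 1)" using bd_Lc[OF c(1)] by (simp only: add_diff_cancel_right')
    then have yL: "y - bd c \<in> Lc G B (n + 1)" by (rule Q.subspace_diff[OF Lc_subspace y(1)])
    have "d' (\<Gamma> (y - bd c)) = \<Gamma> (bd (y - bd c))" by (rule \<Gamma>_chain[OF Lc_Tca[OF yL]])
    also have "\<dots> = x" using partial_square[OF Lc_Tca[OF c(1)]] y(2)[symmetric] sec(4)[OF x(1)] by (simp add: partial_linear)
    finally show ?thesis using \<Gamma>_Lc[OF yL] by (intro bexI[of _ "\<Gamma> (y - bd c)"]) auto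
  qed
  show "\<exists>x\<in>Lc G H n. d' x = 0 \<and> (\<exists>y\<in>Lc G B (n + 1). z = sec x + bd y)"
    if z: "z \<in> Lc G B n" "bd z = 0" for n z
  proof -
    obtain c where c: "c \<in> Lc G B (n + 1)" "\<eta> (z - bd c) = 0" using correct[OF z(1)] by blast
    define w where "w = z - bd c"
    have w: "w \<in> Lc G B n"
      unfolding w_def using bd_Lc[OF c(1)] z(1) by (intro Q.subspace_diff[OF Lc_subspace]) auto
    have bw: "bd w = 0" using partial_square[OF Lc_Tca[OF c(1)]] z(2) by (simp add: w_def partial_linear)
    have "sec (\<Gamma> w) = w" by (rule sec_unique) (use Lc_Tca[OF w] c(2) bw in \<open>auto simp: w_def \<eta>_linear\<close>)
    moreover have "d' (\<Gamma> w) = 0" using \<Gamma>_chain[OF Lc_Tca[OF w]] bw by (simp add: \<Gamma>_linear)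
    ultimately show ?thesis
      using \<Gamma>_Lc[OF w] c(1) by (intro bexI[of _ "\<Gamma> w"] conjI bexI[of _ c]) (auto simp: w_def)
  qed
qed

end

section \<open>The reduced coalgebra\<close>

text \<open>Letters of one degree already form a subspace, so their span contains nothing
  else.\<close>

lemma power_1E:
  assumes "t \<in> tensor_power G V 1 m" "qsubspace (G m)" "qsubspace V"
  obtains z where "z \<in> V" "z \<in> G m" "t = ten1 z"
proof -
  have "t \<in> ten1 ` (V \<inter> G m)"
    using assms(1) unfolding tensor_power_hword
  proof (rule qspan_qlinear_mem[OF qlinear_id, rotated -1])
    show "qsubspace (ten1 ` (V \<inter> G m))"
    proof (rule qsubspaceI)
      show "0 \<in> ten1 ` (V \<inter> G m)"
        using Q.subspace_0[OF assms(2)] Q.subspace_0[OF assms(3)] by (auto intro!: image_eqI[of _ _ 0])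
      fix x y a assume "x \<in> ten1 ` (V \<inter> G m)"
      then obtain x' where x': "x = ten1 x'" "x' \<in> V" "x' \<in> G m" by auto
      show "a *\<^sub>Q x \<in> ten1 ` (V \<inter> G m)"
        using x' Q.subspace_scale[OF assms(2)] Q.subspace_scale[OF assms(3)] by (auto intro!: image_eqI[of _ _ "a *\<^sub>Q x'"])
      assume "y \<in> ten1 ` (V \<inter> G m)"
      then obtain y' where y': "y = ten1 y'" "y' \<in> V" "y' \<in> G m" by auto
      show "x + y \<in> ten1 ` (V \<inter> G m)"
        using x' y' Q.subspace_add[OF assms(2)] Q.subspace_add[OF assms(3)] by (auto intro!: image_eqI[of _ _ "x' + y'"])
    qed
    fix s assume "s \<in> {pure xs |xs. length xs = 1 \<and> hword G V m xs}"
    then obtain x where x: "s = pure [x]" "hword G V m [x]" by (auto simp: length_Suc_conv)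
    from x(2) obtain d m' where "x \<in> V" "x \<in> G d" "m = d + m'" "hword G V m' []" by (rule hword_ConsE)
    moreover from this(4) have "m' = 0" by (rule hword_NilE)
    ultimately show "s \<in> ten1 ` (V \<inter> G m)" by (simp add: x(1) ten1_def)
  qed
  then show ?thesis using that by blast
qed

lemma pure_pair: "pure [x, y] = tmult (ten1 x) (ten1 y)"
  by (simp only: pure_Cons[of x "[y]"] ten1_def)

lemma dg_ops_simps: "dg_ops \<delta> \<Delta> 1 = (\<lambda>x. ten1 (\<delta> x))" "dg_ops \<delta> \<Delta> 2 = \<Delta>"
  "k \<ge> 3 \<Longrightarrow> dg_ops \<delta> \<Delta> k = (\<lambda>x. 0)"
  by (auto simp: dg_ops_def)

context grading
begin

section \<open>Tensors of length at most two\<close>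

lemma susp_ten1: "x \<in> G n \<Longrightarrow> susp G 1 (ten1 x) = ten1 x"
  using susp_Cons[of x n 0 "pure []"] by (simp add: susp_Nil)

lemma susp_pair: "x \<in> G m \<Longrightarrow> y \<in> G n \<Longrightarrow> susp G 2 (pure [x, y]) = ksgn m *\<^sub>Q pure [x, y]"
  using susp_Cons[of x m 1 "ten1 y"] susp_ten1[of y n]
  by (simp add: pure_pair numeral_2_eq_2)

lemma letter_dg_ops:
  assumes "\<delta> x \<in> G m" "len_part 2 (\<Delta> x) = \<Delta> x"
  shows "letter (desusp_op G (dg_ops \<delta> \<Delta>)) x = susp G 2 (\<Delta> x) - ten1 (\<delta> x)"
proof (rule len_part_eqI)
  fix j :: nat
  consider "j = 0" | "j = 1" | "j = 2" | "j \<ge> 3" by linarith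
  then show "len_part j (letter (desusp_op G (dg_ops \<delta> \<Delta>)) x) = len_part j (susp G 2 (\<Delta> x) - ten1 (\<delta> x))"
    by cases (simp_all add: len_part_0_letter len_part_letter desusp_op_susp dg_ops_def susp_ten1[OF assms(1), simplified]
        susp_linear len_part_linear len_part_susp len_part_ten1)
qed

lemma unshuffle_word_2:
  assumes x: "x \<in> G m" and y: "y \<in> G n" and f: "qlinear f" and g: "qlinear g"
  shows "unshuffle G (pure [x, y]) ([f], [g]) = f x * g y - ksgn (m * n) * g x * f y"
proof -
  have nil: "shsum [] [] 0 ([] :: ('c \<Rightarrow> rat) list) = 1"
  proof -
    have "shuffles_perm 0 0 = {id}" by (auto simp: shuffles_perm_def strict_mono_on_def)
    then show ?thesis by (simp add: shsum_def koszul_sign_def)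
  qed
  have y0: "shsum [n] [y] 0 [h] = h y" and y1: "shsum [n] [y] 1 [h] = h y" if "qlinear h" for h
    using shsum_Cons[of "[]" 0 "[]" 0 "[h]" n y] shsum_Cons[of "[]" 0 "[]" 1 "[h]" n y] that by (simp_all add: nil)
  have "graded_perm G \<sigma> (pure [x, y]) [f, g] = koszul_sign [m, n] \<sigma> * (\<Prod>p<2. ([f, g] ! p) ([x, y] ! \<sigma> p))"
    if "\<sigma> \<in> shuffles_perm 1 2" for \<sigma>
    by (rule graded_perm_pure) (use that x y f g in \<open>auto simp: shuffles_perm_def nth_Cons split: nat.split\<close>)
  then have "unshuffle G (pure [x, y]) ([f], [g]) = shsum [m, n] [x, y] 1 [f, g]"
    by (simp add: unshuffle_def shsum_def numeral_2_eq_2 mult_ac)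
  also have "\<dots> = f x * shsum [n] [y] 0 [g] - g x * shsum [n] [y] 1 [f \<circ> gsign G m]"
  proof -
    have "shsum [m, n] [x, y] 1 [f, g] =
      (if (1::nat) = 0 then 0 else ([f, g] ! 0) x * shsum [n] [y] (1 - 1) (tl [f, g])) +
      (if (1::nat) \<le> 1 then (-1) ^ 1 * ([f, g] ! 1) x *
        shsum [n] [y] 1 (map (\<lambda>f. f \<circ> gsign G m) (take 1 [f, g]) @ drop (Suc 1) [f, g]) else 0)"
      by (rule shsum_Cons) (use y f g in auto)
    then show ?thesis by simp
  qed
  finally show ?thesis
    using y0[OF g] y1[OF qlinear_compose[OF f qlinear_gsign], of m]
    by (simp add: gsign_homog[OF y] qlinear_scale[OF f])
qed

text \<open>For a tensor of length two only pairs of single functionals can give a nonzero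
  value.\<close>

lemma unshuffle_power_2_zero:
  assumes t: "t \<in> tensor_power G V 2 m" and z: "\<And>f g. qlinear f \<Longrightarrow> qlinear g \<Longrightarrow> unshuffle G t ([f], [g]) = 0"
  shows "unshuffle G t = 0"
proof
  fix \<phi>\<psi> :: "('c \<Rightarrow> rat) list \<times> ('c \<Rightarrow> rat) list"
  obtain \<phi>s \<psi>s where p: "\<phi>\<psi> = (\<phi>s, \<psi>s)" by fastforce
  consider "\<phi>s = [] \<or> \<psi>s = []" | "\<not> all_linear (\<phi>s @ \<psi>s)" | "length \<phi>s + length \<psi>s \<noteq> 2" |
    "\<phi>s \<noteq> []" "\<psi>s \<noteq> []" "all_linear \<phi>s" "all_linear \<psi>s" "length \<phi>s + length \<psi>s = 2" by auto
  then have "unshuffle G t (\<phi>s, \<psi>s) = 0"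
  proof cases
    case 3
    have "t fs = 0" if "length fs \<noteq> 2" for fs
      using fun_cong[OF length_family_len[OF length_family_tensor_power t, of 2], of fs] that
      by (auto simp: len_part_def)
    then have "graded_perm G \<sigma> t (\<phi>s @ \<psi>s) = 0" for \<sigma> using 3 by (intro graded_perm_vanish) simp
    then show ?thesis by (simp add: unshuffle_def)
  next
    case 4
    then obtain f g where "\<phi>s = [f]" "\<psi>s = [g]" "qlinear f" "qlinear g"
      by (cases \<phi>s; cases \<psi>s) (auto simp: numeral_2_eq_2)
    then show ?thesis using z by simp
  qed (auto simp: unshuffle_def graded_perm_def)
  then show "unshuffle G t \<phi>\<psi> = 0 \<phi>\<psi>" by (simp add: p tensor_apply)
qed

end

locale augmented_coalgebra =
  fixes C :: "int \<Rightarrow> 'c::rat_vector set" and \<delta> :: "'c \<Rightarrow> 'c" and \<Delta> :: "'c \<Rightarrow> 'c tensor"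
    and \<epsilon> :: "'c \<Rightarrow> rat" and u :: 'c
  assumes dg: "dg_coalgebra C \<delta> \<Delta>" and coc: "cocommutative C UNIV (dg_ops \<delta> \<Delta>)"
    and aug: "augmentation C \<delta> \<Delta> \<epsilon>" and coaug: "coaugmentation C \<delta> \<Delta> \<epsilon> u"
begin

section \<open>The axioms of the augmented coalgebra\<close>

lemma is_gr: "is_grading C" and d_lin: "qlinear \<delta>" and coop_C: "coop_family C UNIV (dg_ops \<delta> \<Delta>)"
  using dg by (auto simp: dg_coalgebra_def ainf_coalgebra_alt)

sublocale U: coop C UNIV "dg_ops \<delta> \<Delta>"
  by unfold_locales (rule is_gr, rule coop_C)

abbreviation "G \<equiv> desusp C"

abbreviation "B \<equiv> aug_ideal \<epsilon>"

abbreviation "D \<equiv> dg_ops \<delta> (reduced_comult \<Delta> u)"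

lemma graded_UNIV: "graded_subspace C UNIV"
  by (simp add: graded_subspace_def Q.subspace_UNIV)

lemma C_square: "x \<in> C n \<Longrightarrow> tensor_diff C (dg_ops \<delta> \<Delta>) (tensor_diff C (dg_ops \<delta> \<Delta>) (ten1 x)) = 0"
  using U.ainf_coalgebra_iff[OF graded_UNIV] dg by (auto simp: dg_coalgebra_def)

lemma d_deg: "x \<in> C n \<Longrightarrow> \<delta> x \<in> C (n - 1)"
proof -
  assume "x \<in> C n"
  then have "ten1 (\<delta> x) \<in> tensor_power C UNIV 1 (n - 1)"
    using U.coop_power[of 1 x n] unfolding dg_ops_simps by simp
  then obtain z where "z \<in> C (n - 1)" "ten1 (\<delta> x) = ten1 z"
    by (rule power_1E[OF _ U.sub Q.subspace_UNIV])
  then show ?thesis by (simp add: ten1_inject)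
qed

lemma comult_lin: "qlinear \<Delta>" and comult_power: "x \<in> C n \<Longrightarrow> \<Delta> x \<in> tensor_power C UNIV 2 n"
  using U.coop_lin[of 2] U.coop_power[of 2 x n] by (simp_all add: dg_ops_simps)

lemma eps_lin: "qlinear \<epsilon>" and eps_deg: "x \<in> C n \<Longrightarrow> n \<noteq> 0 \<Longrightarrow> \<epsilon> x = 0" and eps_d: "\<epsilon> (\<delta> x) = 0"
  using aug by (auto simp: augmentation_def)

lemma counit: "tensor_map C [(0, 0, \<lambda>v. \<epsilon> v *\<^sub>Q pure []), id_factor] (\<Delta> x) = ten1 x"
  "tensor_map C [id_factor, (0, 0, \<lambda>v. \<epsilon> v *\<^sub>Q pure [])] (\<Delta> x) = ten1 x"
  using aug by (auto simp: augmentation_def)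

lemma unit: "u \<in> C 0" "\<epsilon> u = 1" "\<delta> u = 0" "\<Delta> u = pure [u, u]"
  using coaug by (auto simp: coaugmentation_def)

text \<open>This is the structure relation of index 1, freed of tensor notation.\<close>

lemma dd: "\<delta> (\<delta> x) = 0"
proof (rule U.qlinear_homog_eq[OF qlinear_comp[OF d_lin d_lin] qlinear_zero])
  fix n x assume x: "x \<in> C n"
  have "ainf_relation C (dg_ops \<delta> \<Delta>) 1 x = 0"
    using dg by (simp add: dg_coalgebra_def ainf_coalgebra_alt)
  moreover have "tensor_map C [(- 1, 1, \<lambda>x. ten1 (\<delta> x))] (ten1 (\<delta> x)) = ten1 (\<delta> (\<delta> x))"
    using U.tensor_map_Cons[OF qlinear_comp[OF qlinear_ten1 d_lin] d_deg[OF x], of 1 "-1" "[]" "pure []"]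
    by (simp add: len_part_ten1 U.tensor_map_Nil lin_supp_def ten1_zero_off)
  ultimately have "ten1 (\<delta> (\<delta> x)) = 0"
    using dg_ops_simps(1)[of \<delta> \<Delta>] by (simp add: ainf_relation_def)
  then show "\<delta> (\<delta> x) = 0" using ten1_inject[of "\<delta> (\<delta> x)" 0] by simp
qed

lemma B_sub: "qsubspace B"
  by (rule qsubspaceI) (auto simp: aug_ideal_def qlinear_0[OF eps_lin] qlinear_add[OF eps_lin] qlinear_scale[OF eps_lin])

text \<open>The projection onto the augmentation ideal along u.\<close>

definition red :: "'c \<Rightarrow> 'c" where
  "red x = x - \<epsilon> x *\<^sub>Q u"

lemma red_lin: "qlinear red"
  by (rule qlinearI)
    (simp_all add: red_def qlinear_add[OF eps_lin] qlinear_scale[OF eps_lin] Q.scale_left_distrib Q.scale_right_diff_distrib)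

lemma red_mem: "red x \<in> B" "x \<in> C n \<Longrightarrow> red x \<in> C n"
proof -
  show "red x \<in> B"
    by (simp add: red_def aug_ideal_def qlinear_diff[OF eps_lin] qlinear_scale[OF eps_lin] unit)
  assume x: "x \<in> C n"
  have "\<epsilon> x *\<^sub>Q u \<in> C n"
    using eps_deg[OF x] unit(1) by (cases "n = 0") (auto simp: Q.subspace_scale[OF U.sub] Q.subspace_0[OF U.sub])
  then show "red x \<in> C n" unfolding red_def by (rule Q.subspace_diff[OF U.sub x])
qed

lemma red_B: "x \<in> B \<Longrightarrow> red x = x"
  by (simp add: red_def aug_ideal_def)

lemma eps_factor: "qlinear (\<lambda>v. \<epsilon> v *\<^sub>Q pure [])" "len_part 0 (\<epsilon> v *\<^sub>Q pure []) = \<epsilon> v *\<^sub>Q pure []" "lin_supp (\<epsilon> v *\<^sub>Q pure [])"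
proof -
  show "qlinear (\<lambda>v. \<epsilon> v *\<^sub>Q pure [])"
    by (rule qlinearI) (simp_all add: qlinear_add[OF eps_lin] qlinear_scale[OF eps_lin] Q.scale_left_distrib)
  show "len_part 0 (\<epsilon> v *\<^sub>Q pure []) = \<epsilon> v *\<^sub>Q pure []" by (simp add: len_part_linear len_part_pure)
  show "lin_supp (\<epsilon> v *\<^sub>Q pure [])" using lin_supp_pure[of "[]"] by (auto simp: lin_supp_def tensor_apply)
qed

lemma ten1_factor: "len_part 1 (ten1 x) = ten1 x" "lin_supp (ten1 x)"
  by (simp_all add: len_part_ten1 lin_supp_def ten1_zero_off)

lemma counit_pair:
  assumes "y \<in> C m" "z \<in> C n"
  shows "tensor_map C [(0, 0, \<lambda>v. \<epsilon> v *\<^sub>Q pure []), id_factor] (pure [y, z]) = \<epsilon> y *\<^sub>Q ten1 z"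
    and "tensor_map C [id_factor, (0, 0, \<lambda>v. \<epsilon> v *\<^sub>Q pure [])] (pure [y, z]) = \<epsilon> z *\<^sub>Q ten1 y"
  unfolding id_factor_def
  using U.tensor_map_pair[OF eps_factor(1-3) qlinear_ten1 ten1_factor assms, of 0 0]
    U.tensor_map_pair[OF qlinear_ten1 ten1_factor eps_factor(1-3) assms, of 0 0]
  by (simp_all add: tmult_linear)

lemma reduced_lin: "qlinear (reduced_comult \<Delta> u)"
  unfolding reduced_comult_def[abs_def] pure_pair
  by (rule qlinear_minus[OF qlinear_minus[OF comult_lin qlinear_comp[OF qlinear_tmult_left qlinear_ten1]]
        qlinear_comp[OF qlinear_tmult_right qlinear_ten1]])

lemma reduced_power_UNIV:
  assumes x: "x \<in> C n" shows "reduced_comult \<Delta> u x \<in> tensor_power C UNIV 2 n"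
proof -
  have "hword C UNIV (n + (0 + 0)) [x, u]" "hword C UNIV (0 + (n + 0)) [u, x]"
    by (intro hword.intros UNIV_I x unit)+
  then have "pure [x, u] \<in> tensor_power C UNIV 2 n" "pure [u, x] \<in> tensor_power C UNIV 2 n"
    using pure_in_power[of C UNIV n "[x, u]"] pure_in_power[of C UNIV n "[u, x]"] by (simp_all add: numeral_2_eq_2)
  then show ?thesis
    unfolding reduced_comult_def using comult_power[OF x] by (intro Q.subspace_diff[OF tensor_power_subspace])
qed

text \<open>On the augmentation ideal both partial counits annihilate the reduced comultiplication.
  It is therefore unchanged when each tensor factor is projected by \<open>red\<close>, and after
  that its entries lie in \<open>B\<close>.\<close>

lemma reduced_power:
  assumes x: "x \<in> B" "x \<in> C n" shows "reduced_comult \<Delta> u x \<in> tensor_power C B 2 n"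
proof -
  let ?t = "reduced_comult \<Delta> u x"
  let ?E1 = "tensor_map C [(0, 0, \<lambda>v. \<epsilon> v *\<^sub>Q pure []), id_factor]"
  let ?E2 = "tensor_map C [id_factor, (0, 0, \<lambda>v. \<epsilon> v *\<^sub>Q pure [])]"
  have ex: "\<epsilon> x = 0" using x by (simp add: aug_ideal_def)
  have E: "?E1 ?t = 0" "?E2 ?t = 0"
    unfolding reduced_comult_def
    by (simp_all add: qlinear_diff[OF qlinear_tensor_map] counit counit_pair[OF x(2) unit(1)]
        counit_pair[OF unit(1) x(2)] ex unit)
  note t = reduced_power_UNIV[OF x(2)]
  \<comment> \<open>On words \<open>R1\<close> and \<open>R2\<close> apply \<open>red\<close> to the
    first and to the second factor; on the given tensor they subtract 0.\<close>
  define R1 where "R1 t = t - tmult (ten1 u) (?E1 t)" for t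
  define R2 where "R2 t = t - tmult (?E2 t) (ten1 u)" for t
  have R1: "qlinear R1" unfolding R1_def[abs_def]
    by (rule qlinear_minus[OF qlinear_id qlinear_comp[OF qlinear_tmult_right qlinear_tensor_map]])
  have R2: "qlinear R2" unfolding R2_def[abs_def]
    by (rule qlinear_minus[OF qlinear_id qlinear_comp[OF qlinear_tmult_left qlinear_tensor_map]])
  have lin: "qlinear (\<lambda>t. R2 (R1 t))" by (rule qlinear_comp[OF R2 R1])
  have "R2 (R1 ?t) \<in> tensor_power C B 2 n"
  proof (rule tensor_power_2_induct[OF lin tensor_power_subspace t])
    fix y z m m' assume y: "y \<in> C m" and z: "z \<in> C m'" and n: "n = m + m'"
    have "R1 (pure [y, z]) = pure [red y, z]"
      unfolding R1_def counit_pair[OF y z] by (simp add: pure_pair red_def tmult_linear)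
    moreover have "R2 (pure [red y, z]) = pure [red y, red z]"
      unfolding R2_def counit_pair[OF red_mem(2)[OF y] z] by (simp add: pure_pair red_def[of z] tmult_linear)
    moreover have "hword C B (m + (m' + 0)) [red y, red z]"
      by (intro hword.intros red_mem y z)
    ultimately show "R2 (R1 (pure [y, z])) \<in> tensor_power C B 2 n"
      using pure_in_power[of C B n "[red y, red z]"] n by (simp add: numeral_2_eq_2)
  qed
  then show ?thesis by (simp add: R1_def R2_def E tmult_linear)
qed

lemma coop_B: "coop_family C B D"
  unfolding coop_family_def
proof (intro allI impI conjI ballI)
  fix k :: nat assume "k \<ge> 1"
  then consider "k = 1" | "k = 2" | "k \<ge> 3" by linarith
  note k = this
  from k show "qlinear (D k)"
    by cases (simp_all only: dg_ops_simps reduced_lin qlinear_zero qlinear_comp[OF qlinear_ten1 d_lin])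
  fix n x assume x: "x \<in> B \<inter> C n"
  from k show "D k x \<in> tensor_power C B k (n + int k - 2)"
  proof cases
    case 1
    have "hword C B (n - 1) [\<delta> x]"
      by (rule hword_single) (use x d_deg in \<open>auto simp: aug_ideal_def eps_d\<close>)
    then show ?thesis using pure_in_power[of C B "n - 1" "[\<delta> x]"] 1 by (simp add: dg_ops_def ten1_def)
  next
    case 2
    then show ?thesis using reduced_power[of x n] x by (simp add: dg_ops_def)
  qed (simp add: dg_ops_simps Q.subspace_0[OF tensor_power_subspace])
qed

sublocale R: coop C B D
  by unfold_locales (rule coop_B)

lemma u_G: "ten1 u \<in> Tc G UNIV (-1)"
  using ten1_in_Tc[of u UNIV G "-1"] unit(1) by (simp add: desusp_def)

abbreviation "dC \<equiv> tensor_diff C (dg_ops \<delta> \<Delta>)"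

abbreviation "dB \<equiv> tensor_diff C D"

text \<open>The two removed terms, with u on either side, desuspend to the graded bracket of s^-1 u
  with the letter.\<close>

lemma letter_reduced:
  assumes x: "x \<in> B" "x \<in> G n"
  shows "letter (desusp_op C D) x = letter (desusp_op C (dg_ops \<delta> \<Delta>)) x - tbracket (-1) n (ten1 u) (ten1 x)"
proof -
  have xC: "x \<in> C (n + 1)" using x by (simp add: desusp_def)
  note fam = length_family_len[OF length_family_tensor_power]
  have "letter (desusp_op C D) x = susp C 2 (reduced_comult \<Delta> u x) - ten1 (\<delta> x)"
    using fam[OF reduced_power_UNIV[OF xC], of 2] by (intro U.letter_dg_ops[where x = x and \<delta> = \<delta>, OF d_deg[OF xC]]) simp
  moreover have "letter (desusp_op C (dg_ops \<delta> \<Delta>)) x = susp C 2 (\<Delta> x) - ten1 (\<delta> x)"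
    using fam[OF comult_power[OF xC], of 2] by (intro U.letter_dg_ops[where x = x and \<delta> = \<delta>, OF d_deg[OF xC]]) simp
  ultimately show ?thesis
    by (simp add: reduced_comult_def susp_linear U.susp_pair[OF xC unit(1)] U.susp_pair[OF unit(1) xC])
      (simp add: tbracket_def pure_pair ksgn_add algebra_simps)
qed

text \<open>Passing to the reduced coalgebra twists the differential of the tensor algebra by the bracket
  with the Maurer-Cartan element \<open>s\<^sup>-\<^sup>1u\<close>.\<close>

lemma dB_twist:
  assumes t: "t \<in> Tc G B m" shows "dB t = dC t - tbracket (-1) m (ten1 u) t"
proof (rule filtered_Tc_eq[OF _ _ _ t])
  show "filtered dB" unfolding tensor_diff_der by (rule filtered_der)
  show "filtered (\<lambda>t. dC t - tbracket (-1) m (ten1 u) t)"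
    unfolding tensor_diff_der by (intro filtered_minus filtered_der filtered_tbracket_right)
  show "dB (pure xs) = dC (pure xs) - tbracket (-1) m (ten1 u) (pure xs)" if "hword G B m xs" for xs
    using that
  proof (induction rule: hword.induct)
    case Nil
    then show ?case by (simp add: tensor_diff_der der_Nil tbracket_def)
  next
    case (Cons x n m xs)
    note x = Cons(1,2)
    have a: "dB (pure (x # xs)) = tmult (letter (desusp_op C D) x) (pure xs) + ksgn n *\<^sub>Q tmult (ten1 x) (dB (pure xs))"
      using U.D.der_letter_pure[OF R.letter_map_desusp_op x, of xs] by (simp add: tensor_diff_der)
    have b: "dC (pure (x # xs)) = tmult (letter (desusp_op C (dg_ops \<delta> \<Delta>)) x) (pure xs) + ksgn n *\<^sub>Q tmult (ten1 x) (dC (pure xs))"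
      using U.D.der_letter_pure[OF U.letter_map_desusp_op UNIV_I x(2), of xs] by (simp add: tensor_diff_der)
    have c: "tbracket (-1) (n + m) (ten1 u) (pure (x # xs)) =
       tmult (tbracket (-1) n (ten1 u) (ten1 x)) (pure xs) + ksgn n *\<^sub>Q tmult (ten1 x) (tbracket (-1) m (ten1 u) (pure xs))"
      by (simp add: tbracket_def pure_Cons tmult_linear tmult_assoc Q.scale_right_diff_distrib ksgn_diff)
    show ?case unfolding a b c letter_reduced[OF x] Cons.IH
      by (simp add: tmult_linear Q.scale_right_diff_distrib algebra_simps)
  qed
qed

text \<open>The Maurer-Cartan equation is dC u = u u, half the bracket of the odd element u with
  itself. It makes the correction terms in the square of the twisted differential cancel.\<close>

lemma dB_square:
  assumes x: "x \<in> B" "x \<in> C n" shows "dB (dB (ten1 x)) = 0"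
proof -
  define m where "m = n - 1"
  have xG: "x \<in> G m" using x by (simp add: desusp_def m_def)
  let ?u = "ten1 u" and ?x = "ten1 x"
  have xB: "?x \<in> Tc G B m" and xU: "?x \<in> Tc G UNIV m"
    using ten1_in_Tc[of x B G m] ten1_in_Tc[of x UNIV G m] x xG by auto
  have t: "dB ?x \<in> Tc G B (m - 1)"
    using U.D.der_Tc[OF R.letter_map_desusp_op xB] by (simp add: tensor_diff_der)
  have dCu: "dC ?u = tmult ?u ?u"
  proof -
    have "u \<in> G (-1)" using unit by (simp add: desusp_def)
    then have "dC ?u = letter (desusp_op C (dg_ops \<delta> \<Delta>)) u"
      unfolding tensor_diff_der by (rule U.D.der_letter_ten1[OF U.letter_map_desusp_op UNIV_I])
    also have "\<dots> = susp C 2 (\<Delta> u) - ten1 (\<delta> u)"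
      by (rule U.letter_dg_ops[where m = 0 and x = u]) (simp_all add: unit Q.subspace_0[OF U.sub] len_part_pure)
    finally have "dC ?u = susp C 2 (pure [u, u])" by (simp add: unit)
    then show ?thesis unfolding U.susp_pair[OF unit(1) unit(1)] by (simp add: pure_pair)
  qed
  have "dC (dB ?x) = dC (dC ?x) - dC (tbracket (-1) m ?u ?x)"
    unfolding dB_twist[OF xB] by (simp add: tensor_diff_der der_linear)
  also have "dC (tbracket (-1) m ?u ?x) = tbracket (-2) m (dC ?u) ?x - tbracket (-1) (m - 1) ?u (dC ?x)"
    using U.D.der_tbracket[OF U.letter_map_desusp_op u_G xU] by (simp add: tensor_diff_der)
  finally have 1: "dC (dB ?x) = tbracket (-1) (m - 1) ?u (dC ?x) - tbracket (-2) m (tmult ?u ?u) ?x"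
    using C_square[OF x(2)] by (simp add: dCu)
  have 2: "tbracket (-1) (m - 1) ?u (dB ?x) = tbracket (-1) (m - 1) ?u (dC ?x) -
      tbracket (-1) (m - 1) ?u (tbracket (-1) m ?u ?x)"
    unfolding dB_twist[OF xB] by (rule qlinear_diff[OF filtered_qlinear[OF filtered_tbracket_right]])
  \<comment> \<open>Bracketing twice with an odd element is bracketing once with its square.\<close>
  have "tbracket (-1) (m - 1) ?u (tbracket (-1) m ?u ?x) = tbracket (-2) m (tmult ?u ?u) ?x"
    by (simp add: tbracket_def tmult_linear tmult_assoc Q.scale_right_diff_distrib ksgn_diff)
      (simp add: ksgn_def)
  then show ?thesis unfolding dB_twist[OF t] 1 2 by simp
qed

text \<open>Since u has degree 0, the unshufflings of the two words with u cancel, so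
  cocommutativity passes from C to the reduced comultiplication.\<close>

lemma reduced_lie:
  assumes x: "x \<in> B" "x \<in> C n" shows "(2, n - 2, susp C 2 (D 2 x)) \<in> lie_words G B"
  unfolding dg_ops_simps
proof (rule U.lie_words_of_unshuffle_2[OF reduced_power[OF x] U.unshuffle_power_2_zero[OF reduced_power[OF x]]])
  fix f g :: "'c \<Rightarrow> rat" assume f: "qlinear f" and g: "qlinear g"
  have lin: "qlinear (\<lambda>t. unshuffle C t ([f], [g]))"
    by (rule qlinearI) (simp_all add: unshuffle_def graded_perm_add graded_perm_scale tensor_apply algebra_simps
        sum.distrib sum_distrib_left)
  have "unshuffle C (dg_ops \<delta> \<Delta> 2 x) = 0" using coc by (simp add: cocommutative_def)
  then have "unshuffle C (\<Delta> x) ([f], [g]) = 0" by (simp add: dg_ops_simps tensor_apply)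
  then show "unshuffle C (reduced_comult \<Delta> u x) ([f], [g]) = 0"
    unfolding reduced_comult_def qlinear_diff[OF lin]
    by (simp add: U.unshuffle_word_2[OF x(2) unit(1) f g] U.unshuffle_word_2[OF unit(1) x(2) f g])
qed

end

section \<open>The contraction\<close>

locale split_coalgebra = augmented_coalgebra +
  fixes A H
  assumes split: "dg_splitting C (aug_ideal \<epsilon>) \<delta> A H"
begin

abbreviation "p \<equiv> retract_p \<delta> \<epsilon> u A H"

abbreviation "k \<equiv> retract_k \<delta> \<epsilon> u A H"

lemma split_ex1: "x \<in> B \<Longrightarrow> \<exists>!(a, b, h). a \<in> A \<and> b \<in> \<delta> ` A \<and> h \<in> H \<and> x = a + b + h"
proof -
  have "\<forall>x\<in>B. \<exists>!(a, b, h). a \<in> A \<and> b \<in> \<delta> ` A \<and> h \<in> H \<and> x = a + b + h"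
    using split unfolding dg_splitting_def by (elim conjE)
  then show "x \<in> B \<Longrightarrow> \<exists>!(a, b, h). a \<in> A \<and> b \<in> \<delta> ` A \<and> h \<in> H \<and> x = a + b + h" by (rule bspec)
qed

lemma A_gr: "graded_subspace C A" and H_gr: "graded_subspace C H" and A_B: "A \<subseteq> B" and H_B: "H \<subseteq> B"
  and d_H: "h \<in> H \<Longrightarrow> \<delta> h = 0" and d_inj: "inj_on \<delta> A"
  using split unfolding dg_splitting_def by (elim conjE; simp)+

lemma A_sub: "qsubspace A" and H_sub: "qsubspace H"
  using A_gr H_gr by (auto simp: graded_subspace_def)

lemma decomp:
  obtains a a' h where "a \<in> A" "a' \<in> A" "h \<in> H" "red x = a + \<delta> a' + h"
proof -
  have "\<exists>!(a, b, h). a \<in> A \<and> b \<in> \<delta> ` A \<and> h \<in> H \<and> red x = a + b + h"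
    by (rule split_ex1[OF red_mem(1)])
  then obtain abh where "case abh of (a, b, h) \<Rightarrow> a \<in> A \<and> b \<in> \<delta> ` A \<and> h \<in> H \<and> red x = a + b + h"
    by (rule ex1E)
  then show ?thesis using that by (cases abh) auto
qed

text \<open>Uniqueness of the triple gives \<delta> a' = \<delta> c', and \<delta> is injective on
  A.\<close>

lemma decomp_unique:
  assumes "a \<in> A" "a' \<in> A" "h \<in> H" "c \<in> A" "c' \<in> A" "g \<in> H" "a + \<delta> a' + h = c + \<delta> c' + g"
  shows "a = c \<and> a' = c' \<and> h = g"
proof -
  have dA: "\<delta> a' \<in> B" by (simp add: aug_ideal_def eps_d)
  have "a \<in> B" "h \<in> B" using assms A_B H_B by auto
  then have "a + \<delta> a' + h \<in> B" using dA by (intro Q.subspace_add[OF B_sub])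
  then have "\<exists>!(x, y, z). x \<in> A \<and> y \<in> \<delta> ` A \<and> z \<in> H \<and> a + \<delta> a' + h = x + y + z"
    by (rule split_ex1)
  then obtain t where t: "\<And>s. (case s of (x, y, z) \<Rightarrow>
      x \<in> A \<and> y \<in> \<delta> ` A \<and> z \<in> H \<and> a + \<delta> a' + h = x + y + z) \<Longrightarrow> s = t"
    by (elim ex1E) blast
  have "(a, \<delta> a', h) = t" "(c, \<delta> c', g) = t"
    by (rule t; use assms in simp)+
  then have "(a, \<delta> a', h) = (c, \<delta> c', g)" by simp
  then show ?thesis using d_inj assms by (auto dest: inj_onD)
qed

lemma retract_eq:
  assumes "a \<in> A" "a' \<in> A" "h \<in> H" "red x = a + \<delta> a' + h"
  shows "p x = h" "k x = a'"
proof -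
  show "p x = h"
    unfolding retract_p_def red_def[symmetric]
  proof (rule the_equality)
    show "h \<in> H \<and> (\<exists>a\<in>A. \<exists>b\<in>\<delta> ` A. red x = a + b + h)" using assms by blast
    fix g assume "g \<in> H \<and> (\<exists>a\<in>A. \<exists>b\<in>\<delta> ` A. red x = a + b + g)"
    then obtain c c' where "g \<in> H" "c \<in> A" "c' \<in> A" "red x = c + \<delta> c' + g" by blast
    then show "g = h" using decomp_unique[OF assms(1-3), of c c' g] assms(4) by auto
  qed
  show "k x = a'"
    unfolding retract_k_def red_def[symmetric]
  proof (rule the_equality)
    show "a' \<in> A \<and> (\<exists>a\<in>A. \<exists>h\<in>H. red x = a + \<delta> a' + h)" using assms by blast
    fix c' assume "c' \<in> A \<and> (\<exists>a\<in>A. \<exists>h\<in>H. red x = a + \<delta> c' + h)"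
    then obtain c g where "g \<in> H" "c \<in> A" "c' \<in> A" "red x = c + \<delta> c' + g" by blast
    then show "c' = a'" using decomp_unique[OF assms(1-3), of c c' g] assms(4) by auto
  qed
qed

section \<open>Properties of the retract\<close>

lemma retract_lin: "qlinear p" "qlinear k"
proof -
  have add: "p (x + y) = p x + p y \<and> k (x + y) = k x + k y" for x y
  proof -
    obtain a a' h where x: "a \<in> A" "a' \<in> A" "h \<in> H" "red x = a + \<delta> a' + h" by (rule decomp)
    obtain c c' g where y: "c \<in> A" "c' \<in> A" "g \<in> H" "red y = c + \<delta> c' + g" by (rule decomp)
    have "red (x + y) = (a + c) + \<delta> (a' + c') + (h + g)"
      by (simp add: qlinear_add[OF red_lin] qlinear_add[OF d_lin] x y)
    then show ?thesis
      using retract_eq[OF x] retract_eq[OF y]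
        retract_eq[OF Q.subspace_add[OF A_sub x(1) y(1)] Q.subspace_add[OF A_sub x(2) y(2)]
          Q.subspace_add[OF H_sub x(3) y(3)], of "x + y"] by simp
  qed
  have scale: "p (r *\<^sub>Q x) = r *\<^sub>Q p x \<and> k (r *\<^sub>Q x) = r *\<^sub>Q k x" for r x
  proof -
    obtain a a' h where x: "a \<in> A" "a' \<in> A" "h \<in> H" "red x = a + \<delta> a' + h" by (rule decomp)
    have "red (r *\<^sub>Q x) = r *\<^sub>Q a + \<delta> (r *\<^sub>Q a') + r *\<^sub>Q h"
      by (simp add: qlinear_scale[OF red_lin] qlinear_scale[OF d_lin] x Q.scale_right_distrib)
    then show ?thesis
      using retract_eq[OF x] retract_eq[OF Q.subspace_scale[OF A_sub x(1)] Q.subspace_scale[OF A_sub x(2)]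
          Q.subspace_scale[OF H_sub x(3)], of "r *\<^sub>Q x"] by simp
  qed
  show "qlinear p" "qlinear k" using add scale by (auto intro: qlinearI)
qed

lemma hpart_d: "hpart C (\<delta> x) n = \<delta> (hpart C x (n + 1))"
proof (rule U.qlinear_homog_eq[OF qlinear_comp[OF U.qlinear_hpart d_lin] qlinear_comp[OF d_lin U.qlinear_hpart]])
  show "hpart C (\<delta> x) n = \<delta> (hpart C x (n + 1))" if "x \<in> C m" for m x
    by (auto simp: U.hpart_homog[OF that] U.hpart_homog[OF d_deg[OF that]] qlinear_0[OF d_lin])
qed

text \<open>Taking components in the right degrees of any decomposition gives another one, since A
  and H are graded and \<delta> has degree -1.\<close>

lemma homog_decomp:
  assumes x: "x \<in> B" "x \<in> C n"
  obtains a a' h where "a \<in> A" "a' \<in> A" "h \<in> H" "x = a + \<delta> a' + h" "a' \<in> C (n + 1)" "h \<in> C n"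
proof -
  obtain a a' h where d: "a \<in> A" "a' \<in> A" "h \<in> H" "red x = a + \<delta> a' + h" by (rule decomp)
  have "hpart C x n = hpart C (a + \<delta> a' + h) n" using d(4) red_B[OF x(1)] by simp
  then have "x = hpart C a n + \<delta> (hpart C a' (n + 1)) + hpart C h n"
    by (simp add: U.hpart_homog[OF x(2)] U.hpart_add hpart_d)
  moreover have "hpart C a n \<in> A" "hpart C a' (n + 1) \<in> A" "hpart C h n \<in> H"
    using d A_gr H_gr by (auto simp: graded_subspace_def)
  ultimately show ?thesis using that U.hpart_mem by blast
qed

lemma retract_A: "a \<in> A \<Longrightarrow> p a = 0 \<and> k a = 0"
  using retract_eq[of a 0 0 a] A_B red_B Q.subspace_0[OF A_sub] Q.subspace_0[OF H_sub]
  by (auto simp: qlinear_0[OF d_lin])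

lemma retract_H: "h \<in> H \<Longrightarrow> p h = h \<and> k h = 0"
  using retract_eq[of 0 0 h h] H_B red_B Q.subspace_0[OF A_sub] by (auto simp: qlinear_0[OF d_lin])

lemma retract_d: "a \<in> A \<Longrightarrow> p (\<delta> a) = 0 \<and> k (\<delta> a) = a"
  using retract_eq[of 0 a 0 "\<delta> a"] red_B[of "\<delta> a"] Q.subspace_0[OF A_sub] Q.subspace_0[OF H_sub] eps_d
  by (auto simp: aug_ideal_def)

text \<open>For x = a + \<delta> a' + h one has k x = a' and \<delta> x = \<delta> a, so the two
  homotopy terms return \<delta> a' and a.\<close>

lemma d_retract:
  assumes "x \<in> B" shows "k x \<in> A" "p (\<delta> x) = 0" "\<delta> (k x) + k (\<delta> x) = x - p x"
proof -
  obtain a a' h where d: "a \<in> A" "a' \<in> A" "h \<in> H" "red x = a + \<delta> a' + h" by (rule decomp)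
  have x: "x = a + \<delta> a' + h" using d red_B[OF assms] by simp
  have px: "p x = h" "k x = a'" using retract_eq[OF d] by auto
  have "\<delta> x = \<delta> a" by (simp add: x qlinear_add[OF d_lin] dd d_H[OF d(3)])
  then show "k x \<in> A" "p (\<delta> x) = 0" "\<delta> (k x) + k (\<delta> x) = x - p x"
    using retract_d[OF d(1)] d px by (auto simp: x)
qed

sublocale K: contraction C B D p k H \<delta>
proof unfold_locales
  show "D j = (\<lambda>x. 0)" if "j \<ge> 3" for j using that by (rule dg_ops_simps)
  show "p (x + y) = p x + p y" "k (x + y) = k x + k y" "\<delta> (x + y) = \<delta> x + \<delta> y" for x y
    by (rule qlinear_add, rule retract_lin d_lin)+
  show "p (r *\<^sub>Q x) = r *\<^sub>Q p x" "k (r *\<^sub>Q x) = r *\<^sub>Q k x" "\<delta> (r *\<^sub>Q x) = r *\<^sub>Q \<delta> x" for r x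
    by (rule qlinear_scale, rule retract_lin d_lin)+
  show "p x \<in> H \<inter> C n" "k x \<in> B \<inter> C (n + 1)" if x: "x \<in> B" "x \<in> C n" for x n
  proof -
    obtain a a' h where d: "a \<in> A" "a' \<in> A" "h \<in> H" "x = a + \<delta> a' + h" "a' \<in> C (n + 1)" "h \<in> C n"
      by (rule homog_decomp[OF x])
    then have "p x = h" "k x = a'" using retract_eq[OF d(1-3)] red_B[OF x(1)] by auto
    then show "p x \<in> H \<inter> C n" "k x \<in> B \<inter> C (n + 1)" using d A_B by auto
  qed
  show "D 1 = (\<lambda>x. ten1 (\<delta> x))" by (rule dg_ops_simps)
  show "\<delta> x \<in> B \<inter> C (n - 1)" if "x \<in> B" "x \<in> C n" for x n
    using d_deg[OF that(2)] by (simp add: aug_ideal_def eps_d)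
qed (use retract_H retract_A d_retract d_H in \<open>auto intro: B_sub H_B[THEN subsetD] dB_square reduced_lie\<close>)

lemma transferred: "transferred_ops C D p k = K.\<Delta>'"
  by (simp add: fun_eq_iff transferred_ops_def K.\<Delta>'_def K.top_sum_def tensor_apply)

text \<open>F is left open so that one argument serves the completed and the ordinary free Lie
  algebra.\<close>

lemma minimal_model:
  assumes F: "\<And>V r m. V = B \<or> V = H \<Longrightarrow> F G V r m = complete_free_lie G V r m"
  shows "quillen_minimal_model F G H (tensor_diff C K.\<Delta>') (quillen_L F C B D)"
proof -
  have e: "F G B 1 = Lc G B" "F G H 1 = Lc G H"
    by (rule ext, simp add: F complete_free_lie_1[unfolded One_nat_def])+
  show ?thesis
    unfolding quillen_minimal_model_def quillen_L_def Let_def e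
    using U.D.is_grading graded_subspace_desusp[OF is_gr H_gr] K.dgl_H K.dgl_B K.sec_quasi_iso
      K.d'_decomposable F by auto
qed

end

theorem theorem3p1:
  fixes C :: "int \<Rightarrow> 'c::rat_vector set"
    and \<delta> :: "'c \<Rightarrow> 'c" and \<Delta> :: "'c \<Rightarrow> 'c tensor"
    and \<epsilon> :: "'c \<Rightarrow> rat" and u :: 'c and A H Cbar :: "'c set"
    and D \<Delta>' :: "nat \<Rightarrow> 'c \<Rightarrow> 'c tensor"
  assumes "dg_coalgebra C \<delta> \<Delta>"
    and "cocommutative C UNIV (dg_ops \<delta> \<Delta>)"
    and "augmentation C \<delta> \<Delta> \<epsilon>"
    and "coaugmentation C \<delta> \<Delta> \<epsilon> u"
    and Cbar: "Cbar = aug_ideal \<epsilon>"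
    and D: "D = dg_ops \<delta> (reduced_comult \<Delta> u)"
    and "dg_splitting C Cbar \<delta> A H"
    and \<Delta>': "\<Delta>' = transferred_ops C D (retract_p \<delta> \<epsilon> u A H) (retract_k \<delta> \<epsilon> u A H)"
  shows "ainf_coalgebra C H \<Delta>' \<and> cocommutative C H \<Delta>' \<and>
    quillen_minimal_model complete_free_lie (desusp C) H (tensor_diff C \<Delta>')
      (quillen_L complete_free_lie C Cbar D) \<and>
    ((\<forall>n\<le>1. Cbar \<inter> C n = {0}) \<or> (\<forall>n\<ge>1. Cbar \<inter> C n = {0}) \<longrightarrow>
      quillen_minimal_model free_lie (desusp C) H (tensor_diff C \<Delta>')
        (quillen_L free_lie C Cbar D))"
proof -
  interpret split_coalgebra C \<delta> \<Delta> \<epsilon> u A H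
    using assms by unfold_locales auto
  have eq: "\<Delta>' = K.\<Delta>'" unfolding \<Delta>' D by (rule transferred)
  have "free_lie (desusp C) V r m = complete_free_lie (desusp C) V r m"
    if bounded: "(\<forall>n\<le>1. Cbar \<inter> C n = {0}) \<or> (\<forall>n\<ge>1. Cbar \<inter> C n = {0})" and V: "V = Cbar \<or> V = H" for V r m
  proof -
    have VB: "V \<subseteq> Cbar" using V H_B Cbar by auto
    from bounded show ?thesis
    proof
      assume "\<forall>n\<le>1. Cbar \<inter> C n = {0}"
      \<comment> \<open>Degree n of the desuspension is degree n + 1 of C, which turns the bound 1
        of the hypothesis into the bound 0 of \<open>free_lie_eq_complete\<close>.\<close>
      then have "Cbar \<inter> C (n + 1) = {0}" if "1 * n \<le> 0" for n using that by simp
      then have "V \<inter> desusp C n \<subseteq> {0}" if "1 * n \<le> 0" for n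
        using that VB unfolding desusp_def by blast
      then show ?thesis by (intro free_lie_eq_complete[OF U.D.is_grading, of 1]) auto
    next
      assume "\<forall>n\<ge>1. Cbar \<inter> C n = {0}"
      then have "Cbar \<inter> C (n + 1) = {0}" if "-1 * n \<le> 0" for n using that by simp
      then have "V \<inter> desusp C n \<subseteq> {0}" if "-1 * n \<le> 0" for n
        using that VB unfolding desusp_def by blast
      then show ?thesis by (intro free_lie_eq_complete[OF U.D.is_grading, of "-1"]) auto
    qed
  qed
  then show ?thesis
    unfolding eq D Cbar
    using K.ainf_transferred[OF H_gr] K.cocommutative_transferred[OF H_gr]
      minimal_model[of complete_free_lie] minimal_model[of free_lie] by blast
qed

end
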